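(* Let $d$ be a positive integer and $\lambda$ a partition of weight $d$. The canonical morphism $\Gamma^\lambda\to\Delta(\lambda)$ induces isomorphisms \[W_\lambda\xrightarrow{\ \sim\ }\Delta(\lambda)\quad\text{and}\quad \operatorname{Hom}_{\Gamma^d_k}(\Delta(\lambda),\Delta(\lambda))\xrightarrow{\ \sim\ }\operatorname{Hom}_{\Gamma^d_k}(\Gamma^\lambda,\Delta(\lambda))\xrightarrow{\ \sim\ }k,\] where the first isomorphism is compatible with the canonical epimorphisms $\Gamma^\lambda\to W_\lambda$ and $\Gamma^\lambda\to\Delta(\lambda)$.
   Context: $k$ is a commutative ring, $\mathcal P_k$ the category of finitely generated projective $k$-modules, $\otimes=\otimes_k$. For $V\in\mathcal P_k$, $\Gamma^dV=(V^{\otimes d})^{\mathfrak S_d}$ is the module of symmetric tensors (divided powers), and $\Lambda^dV$ is the exterior power. The category $\Gamma^d\mathcal P_k$ has as objects the finitely generated projective $k$-modules and $\operatorname{Hom}_{\Gamma^d\mathcal P_k}(V,W)=\Gamma^d\operatorname{Hom}(V,W)$, identified with $\operatorname{Hom}(V^{\otimes d},W^{\otimes d})^{\mathfrak S_d}$ (this defines composition). $\operatorname{Rep}\Gamma^d_k$ is the abelian category of $k$-linear functors from $\Gamma^d\mathcal P_k$ to $k$-modules; its Hom sets are written $\operatorname{Hom}_{\Gamma^d_k}(X,Y)$. For $X\in\operatorname{Rep}\Gamma^d_k$, $Y\in\operatorname{Rep}\Gamma^e_k$, the tensor product $X\otimes Y\in\operatorname{Rep}\Gamma^{d+e}_k$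 is $V\mapsto X(V)\otimes Y(V)$, acting on morphisms via the natural map $\Gamma^{d+e}\operatorname{Hom}(V,W)\to\Gamma^d\operatorname{Hom}(V,W)\otimes\Gamma^e\operatorname{Hom}(V,W)$ (inclusion of $\mathfrak S_{d+e}$-invariants into $\mathfrak S_d\times\mathfrak S_e$-invariants). The functors $\Gamma^d,\Lambda^d$ belong to $\operatorname{Rep}\Gamma^d_k$, and for a sequence $\lambda=(\lambda_1,\ldots,\lambda_n)$ of non-negative integers with sum $d$, $\Gamma^\lambda=\Gamma^{\lambda_1}\otimes\cdots\otimes\Gamma^{\lambda_n}$. A partition of weight $d$ is a weakly decreasing sequence of non-negative integers with sum $d$; $\lambda'$ is the conjugate partition. Dominance order: $\mu\le\lambda$ iff $\sum_{i=1}^r\mu_i\le\sum_{i=1}^r\lambda_i$ for all $r\ge1$. Each $r\in\{1,\ldots,d\}$ is uniquely $r=\lambda_1+\cdots+\lambda_{i-1}+j$ with $1\le j\le\lambda_i$; define $\sigma_\lambda\in\mathfrak S_d$ by $\sigma_\lambda(r)=\lambda'_1+\cdots+\lambda'_{j-1}+i$, and $s_\lambda\colon V^{\otimes d}\to V^{\otimes d}$ by $s_\lambda(v_1\otimes\cdots\otimes v_d)=v_{\sigma_\lambda(1)}\otimes\cdots\otimes v_{\sigma_\lambda(d)}$. Weyl functor: if $\lambda_1+\cdots+\lambda_n=d=\lambda_1'+\cdots+\lambda_m'$, then $W_\lambda V$ is the image of the composite \[\Gamma^{\lambda_1}V\otimes\cdots\otimes\Gamma^{\lambda_n}V\to V^{\otimes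 d}\xrightarrow{s_{\lambda'}}V^{\otimes d}\to\Lambda^{\lambda_1'}V\otimes\cdots\otimes\Lambda^{\lambda_m'}V,\] with first map the tensor product of the inclusions $\Gamma^{\lambda_i}V\subseteq V^{\otimes\lambda_i}$ and last map the tensor product of the canonical projections $V^{\otimes r}\to\Lambda^rV$. This defines $W_\lambda\in\operatorname{Rep}\Gamma^d_k$ with a canonical epimorphism $\Gamma^\lambda\to W_\lambda$. Standard object: for $X\in\operatorname{Rep}\Gamma^d_k$ and a partition $\mu$ of $d$ put $\operatorname{tr}_\mu X=\sum_{\phi\colon\Gamma^\mu\to X}\operatorname{Im}\phi$, and \[\Delta(\lambda)=\Gamma^\lambda\big/\Big(\sum_{\mu\not\le\lambda}\operatorname{tr}_\mu\Gamma^\lambda\Big),\] where $\mu$ runs through all partitions of weight $d$ with $\mu\not\le\lambda$ in the dominance order. The canonical morphism $\Gamma^\lambda\to\Delta(\lambda)$ is the quotient map. *)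

theory Defs
  imports "HOL-Algebra.Module" "HOL-Algebra.AbelCoset" "HOL-Combinatorics.Permutations"
begin

section \<open>Modules over a commutative ring\<close>

text \<open>
  Modules are HOL-Algebra modules; the ring multiplication and unit fields of a module record
  carry no information. Linear maps, functors and natural transformations are made
  extensional, so that equality of functions is equality of the morphisms they represent.
\<close>

definition mod_hom ::
    "('a, 'm) ring_scheme \<Rightarrow> ('a, 'b) module \<Rightarrow> ('a, 'c) module \<Rightarrow> ('b \<Rightarrow> 'c) set" where
  "mod_hom R M N = {f \<in> carrier M \<rightarrow>\<^sub>E carrier N.
     (\<forall>x\<in>carrier M. \<forall>y\<in>carrier M. f (x \<oplus>\<^bsub>M\<^esub> y) = f x \<oplus>\<^bsub>N\<^esub> f y) \<and>
     (\<forall>c\<in>carrier R. \<forall>x\<in>carrier M. f (c \<odot>\<^bsub>M\<^esub> x) = c \<odot>\<^bsub>N\<^esub> f x)}"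

definition mod_iso ::
    "('a, 'm) ring_scheme \<Rightarrow> ('a, 'b) module \<Rightarrow> ('a, 'c) module \<Rightarrow> ('b \<Rightarrow> 'c) set" where
  "mod_iso R M N = {f \<in> mod_hom R M N. bij_betw f (carrier M) (carrier N)}"

definition hom_mod ::
    "('a, 'm) ring_scheme \<Rightarrow> ('a, 'b) module \<Rightarrow> ('a, 'c) module \<Rightarrow> ('a, 'b \<Rightarrow> 'c) module" where
  "hom_mod R M N = \<lparr>carrier = mod_hom R M N, monoid.mult = undefined, one = undefined,
     zero = (\<lambda>x\<in>carrier M. \<zero>\<^bsub>N\<^esub>),
     add = (\<lambda>f g. \<lambda>x\<in>carrier M. f x \<oplus>\<^bsub>N\<^esub> g x),
     smult = (\<lambda>c f. \<lambda>x\<in>carrier M. c \<odot>\<^bsub>N\<^esub> f x)\<rparr>"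

definition ring_as_mod :: "('a, 'm) ring_scheme \<Rightarrow> ('a, 'a) module" where
  "ring_as_mod R = \<lparr>carrier = carrier R, monoid.mult = monoid.mult R, one = one R,
     zero = zero R, add = add R, smult = monoid.mult R\<rparr>"

definition mod_span :: "('a, 'm) ring_scheme \<Rightarrow> ('a, 'b) module \<Rightarrow> 'b set \<Rightarrow> 'b set" where
  "mod_span R M S = \<Inter>{N. submodule N R M \<and> S \<subseteq> N}"

definition quot_mod :: "('a, 'b) module \<Rightarrow> 'b set \<Rightarrow> ('a, 'b set) module" where
  "quot_mod M N = \<lparr>carrier = a_rcosets\<^bsub>M\<^esub> N, monoid.mult = undefined, one = undefined,
     zero = N, add = set_add M,
     smult = (\<lambda>c A. \<Union>a\<in>A. N +>\<^bsub>M\<^esub> (c \<odot>\<^bsub>M\<^esub> a))\<rparr>"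

definition quot_proj :: "('a, 'b) module \<Rightarrow> 'b set \<Rightarrow> 'b \<Rightarrow> 'b set" where
  "quot_proj M N = (\<lambda>x\<in>carrier M. N +>\<^bsub>M\<^esub> x)"

definition free_mod :: "('a, 'm) ring_scheme \<Rightarrow> 'i set \<Rightarrow> ('a, 'i \<Rightarrow> 'a) module" where
  "free_mod R B = \<lparr>
     carrier = {f. (\<forall>x. f x \<in> carrier R) \<and> (\<forall>x. x \<notin> B \<longrightarrow> f x = \<zero>\<^bsub>R\<^esub>) \<and> finite {x. f x \<noteq> \<zero>\<^bsub>R\<^esub>}},
     monoid.mult = undefined, one = undefined,
     zero = (\<lambda>x. \<zero>\<^bsub>R\<^esub>),
     add = (\<lambda>f g x. f x \<oplus>\<^bsub>R\<^esub> g x),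
     smult = (\<lambda>c f x. c \<otimes>\<^bsub>R\<^esub> f x)\<rparr>"

definition free_basis :: "('a, 'm) ring_scheme \<Rightarrow> 'i \<Rightarrow> 'i \<Rightarrow> 'a" where
  "free_basis R b = (\<lambda>x. if x = b then \<one>\<^bsub>R\<^esub> else \<zero>\<^bsub>R\<^esub>)"

text \<open>
  A finitely generated projective module is a direct summand of a free module of finite rank.
  The type \<open>'u\<close> of module elements plays the role of the universe.
\<close>

definition fg_projective :: "('a, 'm) ring_scheme \<Rightarrow> ('a, 'u) module \<Rightarrow> bool" where
  "fg_projective R V \<longleftrightarrow> module R V \<and>
     (\<exists>(n::nat) i p. i \<in> mod_hom R V (free_mod R {..<n}) \<and> p \<in> mod_hom R (free_mod R {..<n}) V \<and>
        (\<forall>x\<in>carrier V. p (i x) = x))"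

definition fg_proj_mods :: "('a, 'm) ring_scheme \<Rightarrow> ('a, 'u) module set" where
  "fg_proj_mods R = {V. fg_projective R V}"


section \<open>Tensor products\<close>

text \<open>
  The tensor product \<open>M 0 \<otimes> \<dots> \<otimes> M (n - 1)\<close> is the free module on the product of
  the carriers modulo the relations of multilinearity. For \<open>n = 0\<close> it is the ring itself.
\<close>

type_synonym ('a, 'b) tensor = "((nat \<Rightarrow> 'b) \<Rightarrow> 'a) set"

definition tensor_base :: "nat \<Rightarrow> (nat \<Rightarrow> ('a, 'b) module) \<Rightarrow> (nat \<Rightarrow> 'b) set" where
  "tensor_base n M = (\<Pi>\<^sub>E i\<in>{..<n}. carrier (M i))"

definition tensor_rels ::
    "('a, 'm) ring_scheme \<Rightarrow> nat \<Rightarrow> (nat \<Rightarrow> ('a, 'b) module) \<Rightarrow> ((nat \<Rightarrow> 'b) \<Rightarrow> 'a) set" where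
  "tensor_rels R n M = (let F = free_mod R (tensor_base n M); e = free_basis R in
     mod_span R F
      ({e (v(i := x \<oplus>\<^bsub>M i\<^esub> y)) \<ominus>\<^bsub>F\<^esub> (e (v(i := x)) \<oplus>\<^bsub>F\<^esub> e (v(i := y))) | v i x y.
          v \<in> tensor_base n M \<and> i < n \<and> x \<in> carrier (M i) \<and> y \<in> carrier (M i)} \<union>
       {e (v(i := c \<odot>\<^bsub>M i\<^esub> x)) \<ominus>\<^bsub>F\<^esub> (c \<odot>\<^bsub>F\<^esub> e (v(i := x))) | v i c x.
          v \<in> tensor_base n M \<and> i < n \<and> c \<in> carrier R \<and> x \<in> carrier (M i)}))"

definition tensor ::
    "('a, 'm) ring_scheme \<Rightarrow> nat \<Rightarrow> (nat \<Rightarrow> ('a, 'b) module) \<Rightarrow> ('a, ('a, 'b) tensor) module" where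
  "tensor R n M = quot_mod (free_mod R (tensor_base n M)) (tensor_rels R n M)"

definition pure_tensor ::
    "('a, 'm) ring_scheme \<Rightarrow> nat \<Rightarrow> (nat \<Rightarrow> ('a, 'b) module) \<Rightarrow> (nat \<Rightarrow> 'b) \<Rightarrow> ('a, 'b) tensor" where
  "pure_tensor R n M v = quot_proj (free_mod R (tensor_base n M)) (tensor_rels R n M) (free_basis R v)"

text \<open>
  The linear map out of the tensor product that takes the value \<open>m v\<close> on the pure tensor of
  \<open>v\<close>; it exists (uniquely) when \<open>m\<close> is multilinear, and is only used for such \<open>m\<close>.
\<close>

definition tensor_lift ::
    "('a, 'm) ring_scheme \<Rightarrow> nat \<Rightarrow> (nat \<Rightarrow> ('a, 'b) module) \<Rightarrow> ('a, 'c) module \<Rightarrow>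
     ((nat \<Rightarrow> 'b) \<Rightarrow> 'c) \<Rightarrow> ('a, 'b) tensor \<Rightarrow> 'c" where
  "tensor_lift R n M N m = (THE f. f \<in> mod_hom R (tensor R n M) N \<and>
     (\<forall>v\<in>tensor_base n M. f (pure_tensor R n M v) = m v))"

definition tensor_map ::
    "('a, 'm) ring_scheme \<Rightarrow> nat \<Rightarrow> (nat \<Rightarrow> ('a, 'b) module) \<Rightarrow> (nat \<Rightarrow> ('a, 'c) module) \<Rightarrow>
     (nat \<Rightarrow> 'b \<Rightarrow> 'c) \<Rightarrow> ('a, 'b) tensor \<Rightarrow> ('a, 'c) tensor" where
  "tensor_map R n M N f =
     tensor_lift R n M (tensor R n N) (\<lambda>v. pure_tensor R n N (\<lambda>i\<in>{..<n}. f i (v i)))"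

definition tpow ::
    "('a, 'm) ring_scheme \<Rightarrow> nat \<Rightarrow> ('a, 'u) module \<Rightarrow> ('a, ('a, 'u) tensor) module" where
  "tpow R d V = tensor R d (\<lambda>_. V)"

definition tpure ::
    "('a, 'm) ring_scheme \<Rightarrow> nat \<Rightarrow> ('a, 'u) module \<Rightarrow> (nat \<Rightarrow> 'u) \<Rightarrow> ('a, 'u) tensor" where
  "tpure R d V = pure_tensor R d (\<lambda>_. V)"

text \<open>\<open>tperm R d V \<sigma>\<close> sends \<open>v\<^sub>1 \<otimes> \<dots> \<otimes> v\<^sub>d\<close> to the pure tensor with entry \<open>v\<close> at \<open>\<sigma> r\<close> in position \<open>r\<close>.\<close>

definition tperm ::
    "('a, 'm) ring_scheme \<Rightarrow> nat \<Rightarrow> ('a, 'u) module \<Rightarrow> (nat \<Rightarrow> nat) \<Rightarrow>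
     ('a, 'u) tensor \<Rightarrow> ('a, 'u) tensor" where
  "tperm R d V \<sigma> =
     tensor_lift R d (\<lambda>_. V) (tpow R d V) (\<lambda>v. tpure R d V (\<lambda>r\<in>{..<d}. v (\<sigma> r)))"

text \<open>
  The canonical isomorphism from the tensor power of degree \<open>sum_list l\<close> to the tensor product
  of the tensor powers of degrees \<open>l ! i\<close>, and its inverse.
\<close>

definition tsplit ::
    "('a, 'm) ring_scheme \<Rightarrow> nat list \<Rightarrow> ('a, 'u) module \<Rightarrow>
     ('a, 'u) tensor \<Rightarrow> ('a, ('a, 'u) tensor) tensor" where
  "tsplit R l V = tensor_lift R (sum_list l) (\<lambda>_. V) (tensor R (length l) (\<lambda>i. tpow R (l ! i) V))
     (\<lambda>v. pure_tensor R (length l) (\<lambda>i. tpow R (l ! i) V)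
        (\<lambda>i\<in>{..<length l}. tpure R (l ! i) V (\<lambda>j\<in>{..<l ! i}. v (sum_list (take i l) + j))))"

definition tjoin ::
    "('a, 'm) ring_scheme \<Rightarrow> nat list \<Rightarrow> ('a, 'u) module \<Rightarrow>
     ('a, ('a, 'u) tensor) tensor \<Rightarrow> ('a, 'u) tensor" where
  "tjoin R l V = (\<lambda>t\<in>carrier (tensor R (length l) (\<lambda>i. tpow R (l ! i) V)).
     inv_into (carrier (tpow R (sum_list l) V)) (tsplit R l V) t)"


section \<open>The category of divided powers and its representations\<close>

text \<open>
  The Hom modules of the category \<open>\<Gamma>\<^sup>d P\<^sub>k\<close>, in the form of the equivariant maps
  between tensor powers; composition is composition of maps.
\<close>

definition sp_hom ::
    "('a, 'm) ring_scheme \<Rightarrow> nat \<Rightarrow> ('a, 'u) module \<Rightarrow> ('a, 'u) module \<Rightarrow>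
     ('a, ('a, 'u) tensor \<Rightarrow> ('a, 'u) tensor) module" where
  "sp_hom R d V W = (hom_mod R (tpow R d V) (tpow R d W))
     \<lparr>carrier := {f \<in> mod_hom R (tpow R d V) (tpow R d W).
        \<forall>\<sigma>. \<sigma> permutes {..<d} \<longrightarrow>
          (\<forall>t\<in>carrier (tpow R d V). f (tperm R d V \<sigma> t) = tperm R d W \<sigma> (f t))}\<rparr>"

record ('a, 'u, 'x) sp_functor =
  on_obj :: "('a, 'u) module \<Rightarrow> ('a, 'x) module"
  on_mor :: "('a, 'u) module \<Rightarrow> ('a, 'u) module \<Rightarrow>
             (('a, 'u) tensor \<Rightarrow> ('a, 'u) tensor) \<Rightarrow> 'x \<Rightarrow> 'x"

definition is_rep ::
    "('a, 'm) ring_scheme \<Rightarrow> nat \<Rightarrow> ('a, 'u, 'x) sp_functor \<Rightarrow> bool" where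
  "is_rep R d X \<longleftrightarrow>
     (\<forall>V\<in>fg_proj_mods R. module R (on_obj X V)) \<and>
     (\<forall>V\<in>fg_proj_mods R. \<forall>W\<in>fg_proj_mods R.
        restrict (on_mor X V W) (carrier (sp_hom R d V W))
          \<in> mod_hom R (sp_hom R d V W) (hom_mod R (on_obj X V) (on_obj X W))) \<and>
     (\<forall>V\<in>fg_proj_mods R.
        on_mor X V V (\<lambda>t\<in>carrier (tpow R d V). t) = (\<lambda>x\<in>carrier (on_obj X V). x)) \<and>
     (\<forall>U\<in>fg_proj_mods R. \<forall>V\<in>fg_proj_mods R. \<forall>W\<in>fg_proj_mods R.
        \<forall>\<phi>\<in>carrier (sp_hom R d U V). \<forall>\<psi>\<in>carrier (sp_hom R d V W).
        on_mor X U W (compose (carrier (tpow R d U)) \<psi> \<phi>) =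
        compose (carrier (on_obj X U)) (on_mor X V W \<psi>) (on_mor X U V \<phi>))"

definition nat_trans ::
    "('a, 'm) ring_scheme \<Rightarrow> nat \<Rightarrow> ('a, 'u, 'x) sp_functor \<Rightarrow> ('a, 'u, 'y) sp_functor \<Rightarrow>
     (('a, 'u) module \<Rightarrow> 'x \<Rightarrow> 'y) set" where
  "nat_trans R d X Y = {\<eta> \<in> (\<Pi>\<^sub>E V\<in>fg_proj_mods R. mod_hom R (on_obj X V) (on_obj Y V)).
     \<forall>V\<in>fg_proj_mods R. \<forall>W\<in>fg_proj_mods R. \<forall>\<phi>\<in>carrier (sp_hom R d V W).
       \<forall>x\<in>carrier (on_obj X V). \<eta> W (on_mor X V W \<phi> x) = on_mor Y V W \<phi> (\<eta> V x)}"

definition rep_hom ::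
    "('a, 'm) ring_scheme \<Rightarrow> nat \<Rightarrow> ('a, 'u, 'x) sp_functor \<Rightarrow> ('a, 'u, 'y) sp_functor \<Rightarrow>
     ('a, ('a, 'u) module \<Rightarrow> 'x \<Rightarrow> 'y) module" where
  "rep_hom R d X Y = \<lparr>carrier = nat_trans R d X Y, monoid.mult = undefined, one = undefined,
     zero = (\<lambda>V\<in>fg_proj_mods R. \<lambda>x\<in>carrier (on_obj X V). \<zero>\<^bsub>on_obj Y V\<^esub>),
     add = (\<lambda>\<eta> \<theta>. \<lambda>V\<in>fg_proj_mods R. \<lambda>x\<in>carrier (on_obj X V). \<eta> V x \<oplus>\<^bsub>on_obj Y V\<^esub> \<theta> V x),
     smult = (\<lambda>c \<eta>. \<lambda>V\<in>fg_proj_mods R. \<lambda>x\<in>carrier (on_obj X V). c \<odot>\<^bsub>on_obj Y V\<^esub> \<eta> V x)\<rparr>"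

definition rep_id ::
    "('a, 'm) ring_scheme \<Rightarrow> ('a, 'u, 'x) sp_functor \<Rightarrow> ('a, 'u) module \<Rightarrow> 'x \<Rightarrow> 'x" where
  "rep_id R X = (\<lambda>V\<in>fg_proj_mods R. \<lambda>x\<in>carrier (on_obj X V). x)"

text \<open>The composite \<open>\<theta> \<circ> \<eta>\<close> of \<open>\<eta> : X \<rightarrow> Y\<close> and \<open>\<theta> : Y \<rightarrow> Z\<close>.\<close>

definition rep_comp ::
    "('a, 'm) ring_scheme \<Rightarrow> ('a, 'u, 'x) sp_functor \<Rightarrow>
     (('a, 'u) module \<Rightarrow> 'y \<Rightarrow> 'z) \<Rightarrow> (('a, 'u) module \<Rightarrow> 'x \<Rightarrow> 'y) \<Rightarrow>
     ('a, 'u) module \<Rightarrow> 'x \<Rightarrow> 'z" where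
  "rep_comp R X \<theta> \<eta> = (\<lambda>V\<in>fg_proj_mods R. compose (carrier (on_obj X V)) (\<theta> V) (\<eta> V))"

definition rep_iso ::
    "('a, 'm) ring_scheme \<Rightarrow> nat \<Rightarrow> ('a, 'u, 'x) sp_functor \<Rightarrow> ('a, 'u, 'y) sp_functor \<Rightarrow>
     (('a, 'u) module \<Rightarrow> 'x \<Rightarrow> 'y) \<Rightarrow> bool" where
  "rep_iso R d X Y \<theta> \<longleftrightarrow> is_rep R d X \<and> is_rep R d Y \<and> \<theta> \<in> nat_trans R d X Y \<and>
     (\<exists>\<theta>'\<in>nat_trans R d Y X. rep_comp R X \<theta>' \<theta> = rep_id R X \<and> rep_comp R Y \<theta> \<theta>' = rep_id R Y)"

definition sub_functor ::
    "('a, 'u, 'x) sp_functor \<Rightarrow> (('a, 'u) module \<Rightarrow> 'x set) \<Rightarrow> ('a, 'u, 'x) sp_functor" where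
  "sub_functor X U = \<lparr>on_obj = (\<lambda>V. (on_obj X V)\<lparr>carrier := U V\<rparr>),
     on_mor = (\<lambda>V W \<phi>. restrict (on_mor X V W \<phi>) (U V))\<rparr>"

definition quot_functor ::
    "('a, 'u, 'x) sp_functor \<Rightarrow> (('a, 'u) module \<Rightarrow> 'x set) \<Rightarrow> ('a, 'u, 'x set) sp_functor" where
  "quot_functor X U = \<lparr>on_obj = (\<lambda>V. quot_mod (on_obj X V) (U V)),
     on_mor = (\<lambda>V W \<phi>. \<lambda>A\<in>carrier (quot_mod (on_obj X V) (U V)).
        \<Union>a\<in>A. U W +>\<^bsub>on_obj X W\<^esub> on_mor X V W \<phi> a)\<rparr>"

text \<open>
  The tensor product of representations \<open>X i\<close> of degrees \<open>l ! i\<close>. Both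
  maps below have as source the tensor product over \<open>i\<close> of the modules
  \<open>\<Gamma>\<^sup>e Hom(V, W)\<close> with \<open>e = l ! i\<close>. The first is the canonical injective map to
  \<open>Hom(V\<^sup>\<otimes>\<^sup>d, W\<^sup>\<otimes>\<^sup>d)\<close> with \<open>d = sum_list l\<close>, whose image consists of the maps that are
  equivariant for the Young subgroup of \<open>l\<close>; the second one lets it act on
  the tensor product of the \<open>X i\<close>. A morphism in \<open>\<Gamma>\<^sup>d Hom(V, W)\<close> is, in
  particular, equivariant for the Young subgroup, and acts through its preimage under the first map.
\<close>

definition young_incl ::
    "('a, 'm) ring_scheme \<Rightarrow> nat list \<Rightarrow> ('a, 'u) module \<Rightarrow> ('a, 'u) module \<Rightarrow>
     ('a, ('a, 'u) tensor \<Rightarrow> ('a, 'u) tensor) tensor \<Rightarrow> ('a, 'u) tensor \<Rightarrow> ('a, 'u) tensor" where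
  "young_incl R l V W = tensor_lift R (length l) (\<lambda>i. sp_hom R (l ! i) V W)
     (hom_mod R (tpow R (sum_list l) V) (tpow R (sum_list l) W))
     (\<lambda>\<psi>. \<lambda>t\<in>carrier (tpow R (sum_list l) V). tjoin R l W
        (tensor_map R (length l) (\<lambda>i. tpow R (l ! i) V) (\<lambda>i. tpow R (l ! i) W) \<psi> (tsplit R l V t)))"

definition young_act ::
    "('a, 'm) ring_scheme \<Rightarrow> nat list \<Rightarrow> (nat \<Rightarrow> ('a, 'u, 'x) sp_functor) \<Rightarrow>
     ('a, 'u) module \<Rightarrow> ('a, 'u) module \<Rightarrow>
     ('a, ('a, 'u) tensor \<Rightarrow> ('a, 'u) tensor) tensor \<Rightarrow> ('a, 'x) tensor \<Rightarrow> ('a, 'x) tensor" where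
  "young_act R l X V W = tensor_lift R (length l) (\<lambda>i. sp_hom R (l ! i) V W)
     (hom_mod R (tensor R (length l) (\<lambda>i. on_obj (X i) V)) (tensor R (length l) (\<lambda>i. on_obj (X i) W)))
     (\<lambda>\<psi>. tensor_map R (length l) (\<lambda>i. on_obj (X i) V) (\<lambda>i. on_obj (X i) W)
        (\<lambda>i. on_mor (X i) V W (\<psi> i)))"

definition tensor_functor ::
    "('a, 'm) ring_scheme \<Rightarrow> nat list \<Rightarrow> (nat \<Rightarrow> ('a, 'u, 'x) sp_functor) \<Rightarrow>
     ('a, 'u, ('a, 'x) tensor) sp_functor" where
  "tensor_functor R l X = \<lparr>on_obj = (\<lambda>V. tensor R (length l) (\<lambda>i. on_obj (X i) V)),
     on_mor = (\<lambda>V W \<phi>. young_act R l X V W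
       (inv_into (carrier (tensor R (length l) (\<lambda>i. sp_hom R (l ! i) V W))) (young_incl R l V W) \<phi>))\<rparr>"


section \<open>Divided and exterior powers\<close>

definition tpow_functor ::
    "('a, 'm) ring_scheme \<Rightarrow> nat \<Rightarrow> ('a, 'u, ('a, 'u) tensor) sp_functor" where
  "tpow_functor R d = \<lparr>on_obj = tpow R d, on_mor = (\<lambda>V W \<phi>. \<phi>)\<rparr>"

definition sym_tensors ::
    "('a, 'm) ring_scheme \<Rightarrow> nat \<Rightarrow> ('a, 'u) module \<Rightarrow> ('a, 'u) tensor set" where
  "sym_tensors R d V =
     {t \<in> carrier (tpow R d V). \<forall>\<sigma>. \<sigma> permutes {..<d} \<longrightarrow> tperm R d V \<sigma> t = t}"

definition div_power ::
    "('a, 'm) ring_scheme \<Rightarrow> nat \<Rightarrow> ('a, 'u, ('a, 'u) tensor) sp_functor" where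
  "div_power R d = sub_functor (tpow_functor R d) (sym_tensors R d)"

definition alt_rels ::
    "('a, 'm) ring_scheme \<Rightarrow> nat \<Rightarrow> ('a, 'u) module \<Rightarrow> ('a, 'u) tensor set" where
  "alt_rels R d V = mod_span R (tpow R d V)
     {tpure R d V v | v. v \<in> tensor_base d (\<lambda>_. V) \<and> (\<exists>i j. i < j \<and> j < d \<and> v i = v j)}"

definition ext_power ::
    "('a, 'm) ring_scheme \<Rightarrow> nat \<Rightarrow> ('a, 'u, ('a, 'u) tensor set) sp_functor" where
  "ext_power R d = quot_functor (tpow_functor R d) (alt_rels R d)"

definition div_powers ::
    "('a, 'm) ring_scheme \<Rightarrow> nat list \<Rightarrow> ('a, 'u, ('a, ('a, 'u) tensor) tensor) sp_functor" where
  "div_powers R l = tensor_functor R l (\<lambda>i. div_power R (l ! i))"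

definition ext_powers ::
    "('a, 'm) ring_scheme \<Rightarrow> nat list \<Rightarrow> ('a, 'u, ('a, ('a, 'u) tensor set) tensor) sp_functor" where
  "ext_powers R l = tensor_functor R l (\<lambda>i. ext_power R (l ! i))"


section \<open>Partitions\<close>

text \<open>Trailing zeros are allowed. Positions are counted from 0.\<close>

definition is_partition :: "nat \<Rightarrow> nat list \<Rightarrow> bool" where
  "is_partition d l \<longleftrightarrow> sorted_wrt (\<ge>) l \<and> sum_list l = d"

definition conj_part :: "nat list \<Rightarrow> nat list" where
  "conj_part l = map (\<lambda>j. card {i. i < length l \<and> j < l ! i}) [0..<(case l of [] \<Rightarrow> 0 | a # _ \<Rightarrow> a)]"

definition dominated :: "nat list \<Rightarrow> nat list \<Rightarrow> bool" where
  "dominated m l \<longleftrightarrow> (\<forall>r\<ge>1. sum_list (take r m) \<le> sum_list (take r l))"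

definition part_perm :: "nat list \<Rightarrow> nat \<Rightarrow> nat" where
  "part_perm l r = (THE s. \<exists>i j. i < length l \<and> j < l ! i \<and>
     r = sum_list (take i l) + j \<and> s = sum_list (take j (conj_part l)) + i)"


section \<open>Weyl functors\<close>

definition div_incl ::
    "('a, 'm) ring_scheme \<Rightarrow> nat list \<Rightarrow> ('a, 'u) module \<Rightarrow>
     ('a, ('a, 'u) tensor) tensor \<Rightarrow> ('a, 'u) tensor" where
  "div_incl R l V x = tjoin R l V
     (tensor_map R (length l) (\<lambda>i. on_obj (div_power R (l ! i)) V) (\<lambda>i. tpow R (l ! i) V) (\<lambda>i t. t) x)"

definition ext_proj ::
    "('a, 'm) ring_scheme \<Rightarrow> nat list \<Rightarrow> ('a, 'u) module \<Rightarrow>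
     ('a, 'u) tensor \<Rightarrow> ('a, ('a, 'u) tensor set) tensor" where
  "ext_proj R l V t =
     tensor_map R (length l) (\<lambda>i. tpow R (l ! i) V) (\<lambda>i. on_obj (ext_power R (l ! i)) V)
       (\<lambda>i. quot_proj (tpow R (l ! i) V) (alt_rels R (l ! i) V)) (tsplit R l V t)"

definition weyl_map ::
    "('a, 'm) ring_scheme \<Rightarrow> nat list \<Rightarrow> ('a, 'u) module \<Rightarrow>
     ('a, ('a, 'u) tensor) tensor \<Rightarrow> ('a, ('a, 'u) tensor set) tensor" where
  "weyl_map R l V x = ext_proj R (conj_part l) V
     (tperm R (sum_list l) V (part_perm (conj_part l)) (div_incl R l V x))"

definition weyl ::
    "('a, 'm) ring_scheme \<Rightarrow> nat list \<Rightarrow> ('a, 'u, ('a, ('a, 'u) tensor set) tensor) sp_functor" where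
  "weyl R l = sub_functor (ext_powers R (conj_part l))
     (\<lambda>V. weyl_map R l V ` carrier (on_obj (div_powers R l) V))"

definition weyl_epi ::
    "('a, 'm) ring_scheme \<Rightarrow> nat list \<Rightarrow> ('a, 'u) module \<Rightarrow>
     ('a, ('a, 'u) tensor) tensor \<Rightarrow> ('a, ('a, 'u) tensor set) tensor" where
  "weyl_epi R l = (\<lambda>V\<in>fg_proj_mods R. restrict (weyl_map R l V) (carrier (on_obj (div_powers R l) V)))"


section \<open>Standard objects\<close>

definition trace_sub ::
    "('a, 'm) ring_scheme \<Rightarrow> nat list \<Rightarrow> ('a, 'u, 'x) sp_functor \<Rightarrow> ('a, 'u) module \<Rightarrow> 'x set" where
  "trace_sub R m X V = mod_span R (on_obj X V)
     (\<Union>\<phi>\<in>nat_trans R (sum_list m) (div_powers R m) X. \<phi> V ` carrier (on_obj (div_powers R m) V))"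

definition std_rels ::
    "('a, 'm) ring_scheme \<Rightarrow> nat list \<Rightarrow> ('a, 'u) module \<Rightarrow> ('a, ('a, 'u) tensor) tensor set" where
  "std_rels R l V = mod_span R (on_obj (div_powers R l) V)
     (\<Union>m\<in>{m. is_partition (sum_list l) m \<and> \<not> dominated m l}. trace_sub R m (div_powers R l) V)"

definition std_obj ::
    "('a, 'm) ring_scheme \<Rightarrow> nat list \<Rightarrow>
     ('a, 'u, ('a, ('a, 'u) tensor) tensor set) sp_functor" where
  "std_obj R l = quot_functor (div_powers R l) (std_rels R l)"

definition std_epi ::
    "('a, 'm) ring_scheme \<Rightarrow> nat list \<Rightarrow> ('a, 'u) module \<Rightarrow>
     ('a, ('a, 'u) tensor) tensor \<Rightarrow> ('a, ('a, 'u) tensor) tensor set" where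
  "std_epi R l = (\<lambda>V\<in>fg_proj_mods R. quot_proj (on_obj (div_powers R l) V) (std_rels R l V))"

end

theory Submission
  imports Defs
begin

text \<open>
  Write \<open>D\<close> for the kernel of the Weyl map \<open>\<Gamma>\<^sup>\<lambda> \<rightarrow> \<Lambda>\<^sup>\<lambda>\<^sup>'\<close>, where \<open>\<lambda>'\<close> is the conjugate
  partition, and \<open>N\<close> for the sum of the traces that defines \<open>\<Delta>(\<lambda>)\<close>. The theorem amounts to
  \<open>N = D\<close> together with a computation of the vectors of weight \<open>\<lambda>\<close> in \<open>\<Lambda>\<^sup>\<lambda>\<^sup>'\<close>.

  The functor \<open>\<Gamma>\<^sup>\<mu>\<close> is generated by one element \<open>e\<close> of its value at a free module with basis
  \<open>x\<^sub>0, x\<^sub>1, \<dots>\<close>, the tensor product of the powers \<open>x\<^sub>i \<otimes> \<dots> \<otimes> x\<^sub>i\<close> (\<open>gen_generates\<close>). A morphism out of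
  \<open>\<Gamma>\<^sup>\<mu>\<close> is determined by the image of \<open>e\<close>, which is a vector of weight \<open>\<mu>\<close>
  (\<open>nat_trans_gen_eqI\<close>, \<open>weight_span\<close>). In \<open>\<Lambda>\<^sup>\<lambda>\<^sup>'\<close> such vectors are spanned by products of wedges whose
  entries have content \<open>\<mu>\<close>. A wedge with a repeated entry vanishes, so by the easy half of the theorem
  of Gale and Ryser there is no nonzero one unless \<open>\<mu>\<close> is dominated by \<open>\<lambda>\<close>, and for \<open>\<mu> = \<lambda>\<close> there is
  only one up to scalars, the image of \<open>e\<close>. The first fact gives \<open>N \<subseteq> D\<close> (\<open>weyl_map_std_rels\<close>), the
  second one that all morphisms \<open>\<Gamma>\<^sup>\<lambda> \<rightarrow> \<Delta>(\<lambda>)\<close> are multiples of the canonical one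
  (\<open>hom_to_std\<close>).

  For \<open>D \<subseteq> N\<close> it suffices to consider free modules, because every object is a retract of one. There
  \<open>\<Gamma>\<^sup>\<lambda>\<close> has a basis of monomials indexed by tableaux, that is, by the contents of the rows of
  fillings of \<open>\<lambda>\<close>. Conversely to the above, an element of \<open>\<Gamma>\<^sup>\<lambda>\<close> of weight \<open>\<mu>\<close> defines a morphism
  from \<open>\<Gamma>\<^sup>\<mu>\<close> (\<open>trace_mem\<close>); this produces explicit elements of \<open>N\<close>. When a tableau is not
  semistandard, one of them expresses its monomial by monomials of tableaux of larger weight,
  where the weight \<open>\<Sum> i v\<close> over all entries \<open>v\<close> in row \<open>i\<close> measures how far large
  entries are at the bottom (\<open>straightening_step\<close>). Hence semistandard monomials span modulo \<open>N\<close>. Their images under the Weyl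
  map are linearly independent: products of minors of the columns form a triangular system of
  functionals on them, by the rearrangement inequality (\<open>weyl_functional\<close>). So \<open>D \<subseteq> N\<close>
  (\<open>weyl_kernel\<close>).

  The representations involved are tensor products of functors, on which a morphism acts through the
  invariants of a Young subgroup. For this action one needs that these invariants are the
  image of the tensor product of the smaller invariants (\<open>young_incl_surj\<close>), which holds
  because orbit sums span. Finitely generated projective modules enter through dual bases only, that is,
  finite families \<open>x\<^sub>j\<close> and functionals \<open>\<xi>\<^sub>j\<close> with \<open>v = \<Sum> \<xi>\<^sub>j(v) x\<^sub>j\<close>.
\<close>

section \<open>Notation\<close>

abbreviation (input) module_add ("(_ +[_] _)" [65, 0, 66] 65) where
  "x +[M] y \<equiv> add M x y"

abbreviation (input) module_smult ("(_ *[_] _)" [70, 0, 71] 70) where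
  "c *[M] x \<equiv> smult M c x"

abbreviation (input) module_zero ("\<zero>[_]" [0] 1000) where
  "\<zero>[M] \<equiv> zero M"

abbreviation Idx :: "nat \<Rightarrow> 'i set \<Rightarrow> (nat \<Rightarrow> 'i) set" where
  "Idx d B \<equiv> PiE {..<d} (\<lambda>_. B)"

abbreviation tup :: "nat \<Rightarrow> (nat \<Rightarrow> 'i) \<Rightarrow> nat \<Rightarrow> 'i" where
  "tup d f \<equiv> restrict f {..<d}"

context cring
begin

abbreviation Tens :: "nat \<Rightarrow> ('a, 'u) module \<Rightarrow> ('a, 'u) tensor set" where
  "Tens d V \<equiv> carrier (tpow R d V)"

abbreviation Homs :: "nat \<Rightarrow> ('a, 'u) module \<Rightarrow> ('a, 'u) module \<Rightarrow> (('a, 'u) tensor \<Rightarrow> ('a, 'u) tensor) set" where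
  "Homs d V W \<equiv> carrier (sp_hom R d V W)"

end

section \<open>Linear maps, spans and quotients\<close>

text \<open>Linearity without the extensionality that \<^const>\<open>mod_hom\<close> asks for; the maps that occur in
 proofs, such as inclusions written as \<open>\<lambda>t. t\<close>, are linear in this sense only.\<close>

definition lin ::
 "('a, 'm) ring_scheme => ('a, 'b) module => ('a, 'c) module => ('b => 'c) => bool" where
 "lin R M N f \<longleftrightarrow> (ALL x:carrier M. f x:carrier N) &
 (ALL x:carrier M. ALL y:carrier M. f (x +[M] y) = f x +[N] f y) &
 (ALL c:carrier R. ALL x:carrier M. f (c *[M] x) = c *[N] f x)"

lemma linI:
 assumes "!!x. x:carrier M ==> f x:carrier N"
 and "!!x y. x:carrier M ==> y:carrier M ==> f (x +[M] y) = f x +[N] f y"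
 and "!!c x. c:carrier R ==> x:carrier M ==> f (c *[M] x) = c *[N] f x"
 shows "lin R M N f"
 using assms by (auto simp: lin_def)

lemma lin_closed: "lin R M N f ==> x:carrier M ==> f x:carrier N"
 and lin_add: "lin R M N f ==> x:carrier M ==> y:carrier M ==> f (x +[M] y) = f x +[N] f y"
 and lin_smult: "lin R M N f ==> c:carrier R ==> x:carrier M ==> f (c *[M] x) = c *[N] f x"
 by (auto simp: lin_def)

lemma mod_hom_iff: "f:mod_hom R M N \<longleftrightarrow> lin R M N f & f:extensional (carrier M)"
 by (auto simp: mod_hom_def lin_def PiE_def)

lemma mod_hom_lin: "f:mod_hom R M N ==> lin R M N f"
 by (simp add: mod_hom_iff)

lemma mod_hom_eqI:
 "f:mod_hom R M N ==> g:mod_hom R M N ==> (!!x. x:carrier M ==> f x = g x) ==> f = g"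
 by (auto simp: mod_hom_iff intro: extensionalityI)

lemma lin_comp: "lin R M N f ==> lin R N P g ==> lin R M P (%x. g (f x))"
 by (auto simp: lin_def)

lemma lin_id: "lin R M M (%x. x)"
 by (auto simp: lin_def)

lemma lin_cong:
 assumes "lin R M N f" "!!x. x:carrier M ==> g x = f x" "module R M"
 shows "lin R M N g"
proof -
 interpret M: module R M by fact
 show ?thesis using assms(1,2) by (auto simp: lin_def)
qed

context cring
begin

lemma lin_restrict:
 assumes "module R M" "lin R M N f"
 shows "restrict f (carrier M):mod_hom R M N"
 using lin_cong[OF assms(2) _ assms(1)] by (auto simp: mod_hom_iff)

lemma lin_zero:
 assumes "module R M" "module R N" "lin R M N f"
 shows "f \<zero>[M] = \<zero>[N]"
proof -
 interpret M: module R M by fact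
 interpret N: module R N by fact
 have "f (\<zero> *[M] \<zero>[M]) = \<zero> *[N] f \<zero>[M]"
 using lin_smult[OF assms(3)] by blast
 thus ?thesis using lin_closed[OF assms(3)] by simp
qed

lemma lin_finsum:
 assumes "module R M" "module R N" "lin R M N f" "g:A \<rightarrow> carrier M"
 shows "f (finsum M g A) = finsum N (%x. f (g x)) A"
proof -
 interpret M: module R M by fact
 interpret N: module R N by fact
 show ?thesis
 proof (cases "finite A")
 case True
 thus ?thesis using assms(4)
 proof induction
 case empty thus ?case using lin_zero[OF assms(1-3)] by simp
 next
 case (insert a A)
 have gA: "g:A \<rightarrow> carrier M" and ga: "g a:carrier M" using insert.prems by auto
 have fA: "(%x. f (g x)):A \<rightarrow> carrier N" and fa: "f (g a):carrier N"
 using gA ga lin_closed[OF assms(3)] by auto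
 have "f (finsum M g (insert a A)) = f (g a +[M] finsum M g A)"
 using insert.hyps gA ga by simp
 also have "... = f (g a) +[N] f (finsum M g A)"
 using lin_add[OF assms(3)] ga gA by simp
 also have "... = f (g a) +[N] finsum N (%x. f (g x)) A"
 using insert.IH gA by simp
 finally show ?case using insert.hyps fA fa by simp
 qed
 next
 case False thus ?thesis using lin_zero[OF assms(1-3)] by simp
 qed
qed

text \<open>The base ring as a target, so that linear functionals are linear maps.\<close>

lemma ring_as_mod_simps [simp]:
 "carrier (ring_as_mod R) = carrier R" "zero (ring_as_mod R) = \<zero>"
 "add (ring_as_mod R) = add R" "smult (ring_as_mod R) = monoid.mult R"
 "one (ring_as_mod R) = \<one>" "monoid.mult (ring_as_mod R) = monoid.mult R"
 by (simp_all add: ring_as_mod_def)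

lemma module_ring: "module R (ring_as_mod R)"
proof (rule moduleI)
 show "abelian_group (ring_as_mod R)"
 by (rule abelian_groupI) (auto simp: a_ac intro: l_neg)
qed (auto simp: l_distr r_distr m_assoc intro: is_cring)

lemma finsum_ring [simp]: "finsum (ring_as_mod R) f A = finsum R f A"
 by (simp add: finsum_def finprod_def ring_as_mod_def)

lemma module_image:
 assumes "module R M" "carrier Q = h ` carrier M" "zero Q = h (zero M)"
 "!!x y. x:carrier M ==> y:carrier M ==> h x +[Q] h y = h (x +[M] y)"
 "!!c x. c:carrier R ==> x:carrier M ==> c *[Q] h x = h (c *[M] x)"
 shows "module R Q"
proof -
 interpret M: module R M by fact
 note [simp] = assms(2-5)
 show ?thesis
 proof (rule moduleI)
 show "abelian_group Q"
 proof (rule abelian_groupI)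
 fix x assume "x:carrier Q"
 then obtain a where a: "x = h a" "a:carrier M" by auto
 have "h (\<ominus>\<^bsub>M\<^esub> a) +[Q] x = \<zero>[Q]" using a by (simp add: M.l_neg)
 thus "EX y:carrier Q. y +[Q] x = \<zero>[Q]" using a by auto
 qed (auto simp: M.a_ac)
 qed (auto simp: M.smult_l_distr M.smult_r_distr M.smult_assoc1 intro: is_cring)
qed

lemma submoduleI':
 assumes "module R M" "H<=carrier M" "\<zero>[M]:H"
 "!!a b. a:H ==> b:H ==> a +[M] b:H"
 "!!c a. c:carrier R ==> a:H ==> c *[M] a:H"
 shows "submodule H R M"
proof -
 interpret M: module R M by fact
 show ?thesis
 proof (rule M.submoduleI)
 fix a assume "a:H"
 hence "\<ominus>\<^bsub>M\<^esub> a = (\<ominus> \<one>) *[M] a" using assms(2) by (auto simp: M.smult_l_minus)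
 thus "\<ominus>\<^bsub>M\<^esub> a:H" using assms(5) \<open>a:H\<close> by simp
 qed (use assms in auto)
qed

lemma submoduleD:
 assumes "submodule H R M" "module R M"
 shows "H<=carrier M" "\<zero>[M]:H"
 "!!a b. a:H ==> b:H ==> a +[M] b:H"
 "!!c a. c:carrier R ==> a:H ==> c *[M] a:H"
 "!!a. a:H ==> \<ominus>\<^bsub>M\<^esub> a:H"
proof -
 interpret M: module R M by fact
 note * = M.submoduleE[OF assms(1)]
 obtain a where "a:H" using *(2) by auto
 hence "a +[M] \<ominus>\<^bsub>M\<^esub> a:H" "a:carrier M" using *(1,3,5) by auto
 thus "\<zero>[M]:H" by (simp add: M.r_neg)
qed (use module.submoduleE[OF assms(2,1)] in auto)

lemma submodule_finsum:
 assumes "submodule H R M" "module R M" "g:A \<rightarrow> H"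
 shows "finsum M g A:H"
proof -
 interpret M: module R M by fact
 note H = submoduleD[OF assms(1,2)]
 show ?thesis
 proof (cases "finite A")
 case True thus ?thesis using assms(3)
 proof induction
 case (insert a A)
 have "g:A \<rightarrow> carrier M" "g a:carrier M" using insert.prems H(1) by auto
 thus ?case using insert H(3) by simp
 qed (simp add: H)
 qed (simp add: H)
qed

lemma submodule_mod_span:
 assumes "module R M" "S<=carrier M"
 shows "submodule (mod_span R M S) R M"
proof -
 interpret M: module R M by fact
 have car: "carrier M:{N. submodule N R M & S<=N}" using M.carrier_is_submodule assms by auto
 show ?thesis
 proof (rule submoduleI'[OF assms(1)])
 show "mod_span R M S<=carrier M" using car unfolding mod_span_def by (rule Inter_lower)
 qed (auto simp: mod_span_def submoduleD(2-4)[OF _ assms(1)])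
qed

lemma mod_span_superset: "x:S ==> x:mod_span R M S"
 by (auto simp: mod_span_def)

lemma mod_span_least: "submodule N R M ==> S<=N ==> mod_span R M S<=N"
 by (auto simp: mod_span_def)

lemma mod_span_carrier: "module R M ==> S<=carrier M ==> mod_span R M S<=carrier M"
 using mod_span_least[OF module.carrier_is_submodule] .

lemma submodule_preimage:
 assumes "module R M" "module R N" "lin R M N f" "submodule H R N"
 shows "submodule {x\<in>carrier M. f x:H} R M"
proof -
 interpret M: module R M by fact
 note H = submoduleD[OF assms(4,2)]
 show ?thesis
 by (rule submoduleI')
 (auto simp: H lin_add[OF assms(3)] lin_smult[OF assms(3)] lin_zero[OF assms(1-3)] assms(1))
qed

lemma submodule_image:
 assumes "module R M" "module R N" "lin R M N f"
 shows "submodule (f ` carrier M) R N"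
proof -
 interpret M: module R M by fact
 show ?thesis
 proof (rule submoduleI'[OF assms(2)])
 show "\<zero>[N]:f ` carrier M" using lin_zero[OF assms] M.zero_closed by (metis imageI)
 qed (auto simp: lin_closed[OF assms(3)] lin_add[OF assms(3), symmetric]
 lin_smult[OF assms(3), symmetric])
qed

lemma submodule_zero: "module R M ==> submodule {\<zero>[M]} R M"
proof -
 assume a: "module R M"
 interpret M: module R M by fact
 show ?thesis by (rule submoduleI') (auto intro: a)
qed

lemma submodule_equalizer:
 assumes "module R M" "module R N" "lin R M N f" "lin R M N g"
 shows "submodule {x\<in>carrier M. f x = g x} R M"
proof -
 interpret M: module R M by fact
 interpret N: module R N by fact
 show ?thesis
 by (rule submoduleI') (auto simp: assms(1) lin_add[OF assms(3)] lin_smult[OF assms(3)]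
 lin_add[OF assms(4)] lin_smult[OF assms(4)] lin_zero[OF assms(1-3)] lin_zero[OF assms(1,2,4)])
qed

lemma lin_eq_on_span:
 assumes "module R M" "module R N" "lin R M N f" "lin R M N g" "S<=carrier M"
 "!!x. x:S ==> f x = g x" "x:mod_span R M S"
 shows "f x = g x"
 using mod_span_least[OF submodule_equalizer[OF assms(1-4)], of S] assms(5-7) by auto

lemma module_submodule: "module R M ==> submodule H R M ==> module R (M\<lparr>carrier := H\<rparr>)"
 by (rule submodule.submodule_is_module)

lemma quot_proj_eq: "x:carrier M ==> quot_proj M N x = N +>\<^bsub>M\<^esub> x"
 by (simp add: quot_proj_def)

lemma quot_carrier: "carrier (quot_mod M N) = quot_proj M N ` carrier M"
 by (auto simp: quot_mod_def quot_proj_def A_RCOSETS_def')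

lemma abelian_subgroup_submodule:
 assumes "module R M" "submodule N R M"
 shows "abelian_subgroup N M"
proof -
 interpret M: module R M by fact
 show ?thesis
 using assms(2) M.abelian_group_axioms
 by (intro abelian_subgroupI3) (auto simp: submodule_def additive_subgroup_def)
qed

lemma quot_proj_eq_iff:
 assumes "module R M" "submodule N R M" "x:carrier M" "y:carrier M"
 shows "quot_proj M N x = quot_proj M N y \<longleftrightarrow> x \<ominus>\<^bsub>M\<^esub> y:N"
proof -
 interpret M: module R M by fact
 interpret N: abelian_subgroup N M by (rule abelian_subgroup_submodule) fact+
 have "x:N +>\<^bsub>M\<^esub> y \<longleftrightarrow> N +>\<^bsub>M\<^esub> x = N +>\<^bsub>M\<^esub> y"
 using N.a_repr_independence'[of x y] N.a_rcos_self[of x] assms(3,4) by auto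
 moreover have "x \<ominus>\<^bsub>M\<^esub> y:N \<longleftrightarrow> x:N +>\<^bsub>M\<^esub> y"
 using N.a_rcos_module[of y x] assms(3,4) by (simp add: M.minus_eq)
 ultimately show ?thesis using assms(3,4) by (simp add: quot_proj_eq)
qed

lemma quot_ops:
 assumes "module R M" "submodule N R M" "x:carrier M"
 shows "y:carrier M ==>
 quot_proj M N x +[quot_mod M N] quot_proj M N y = quot_proj M N (x +[M] y)"
 and "c:carrier R ==> c *[quot_mod M N] quot_proj M N x = quot_proj M N (c *[M] x)"
 and "zero (quot_mod M N) = quot_proj M N \<zero>[M]"
proof -
 interpret M: module R M by fact
 interpret N: abelian_subgroup N M by (rule abelian_subgroup_submodule) fact+
 note H = submoduleD[OF assms(2,1)]
 show "quot_proj M N x +[quot_mod M N] quot_proj M N y = quot_proj M N (x +[M] y)"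
 if "y:carrier M" using that N.a_rcos_sum[of x y] assms by (simp add: quot_proj_eq quot_mod_def)
 show "zero (quot_mod M N) = quot_proj M N \<zero>[M]"
 using H(1) by (simp add: quot_proj_eq quot_mod_def)
 assume c: "c:carrier R"
 have eq: "N +>\<^bsub>M\<^esub> (c *[M] a) = N +>\<^bsub>M\<^esub> (c *[M] x)" if "a:N +>\<^bsub>M\<^esub> x" for a
 proof -
 have a: "a:carrier M" using that assms(3) H(1) by (auto simp: a_r_coset_def' )
 have "a \<ominus>\<^bsub>M\<^esub> x:N"
 using that quot_proj_eq_iff[OF assms(1,2) a assms(3)] N.a_repr_independence'[OF that] assms(3) a
 by (simp add: quot_proj_eq)
 hence "c *[M] (a \<ominus>\<^bsub>M\<^esub> x):N" using H c by simp
 hence "(c *[M] a) \<ominus>\<^bsub>M\<^esub> (c *[M] x):N"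
 using a assms c by (simp add: M.minus_eq M.smult_r_distr M.smult_r_minus)
 thus ?thesis using quot_proj_eq_iff[OF assms(1,2)] a assms c by (simp add: quot_proj_eq)
 qed
 have "(\<Union>a\<in>N +>\<^bsub>M\<^esub> x. N +>\<^bsub>M\<^esub> (c *[M] a)) = N +>\<^bsub>M\<^esub> (c *[M] x)"
 by (rule UN_constant_eq[OF N.a_rcos_self[OF assms(3)]]) (rule ballI, rule eq)
 thus "c *[quot_mod M N] quot_proj M N x = quot_proj M N (c *[M] x)"
 using assms c by (simp add: quot_proj_eq quot_mod_def)
qed

lemma module_quot: "module R M ==> submodule N R M ==> module R (quot_mod M N)"
 by (rule module_image[of M _ "quot_proj M N"]) (auto simp: quot_carrier quot_ops(1,2)
 quot_ops(3)[OF _ _ subsetD[OF submoduleD(1,2)]])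

lemma lin_quot_proj: "module R M ==> submodule N R M ==> lin R M (quot_mod M N) (quot_proj M N)"
 by (rule linI) (auto simp: quot_carrier quot_ops)

lemma quot_proj_zero_iff:
 assumes "module R M" "submodule N R M" "x:carrier M"
 shows "quot_proj M N x = \<zero>[quot_mod M N] \<longleftrightarrow> x:N"
proof -
 interpret M: module R M by fact
 have "x \<ominus>\<^bsub>M\<^esub> \<zero>[M] = x"
 by (metis M.minus_eq M.r_neg M.l_zero M.r_zero M.zero_closed M.a_inv_closed assms(3))
 thus ?thesis
 using quot_proj_eq_iff[OF assms(1-3), of "\<zero>[M]"] quot_ops(3)[OF assms(1-3)] assms(3)
 by simp
qed

lemma lin_minus:
 assumes "module R M" "module R N" "lin R M N f" "x:carrier M" "y:carrier M"
 shows "f (x \<ominus>\<^bsub>M\<^esub> y) = f x \<ominus>\<^bsub>N\<^esub> f y"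
proof -
 interpret M: module R M by fact
 interpret N: module R N by fact
 have "\<ominus>\<^bsub>M\<^esub> y = (\<ominus> \<one>) *[M] y" using assms by (simp add: M.smult_l_minus)
 hence "f (\<ominus>\<^bsub>M\<^esub> y) = \<ominus>\<^bsub>N\<^esub> f y"
 using lin_smult[OF assms(3), of "\<ominus> \<one>" y] lin_closed[OF assms(3)] assms
 by (simp add: N.smult_l_minus)
 thus ?thesis using lin_add[OF assms(3)] assms by (simp add: M.minus_eq N.minus_eq)
qed

lemma quot_lift:
 assumes "module R M" "submodule N R M" "module R P" "lin R M P h" "!!x. x:N ==> h x = \<zero>[P]"
 obtains g where "lin R (quot_mod M N) P g" "!!x. x:carrier M ==> g (quot_proj M N x) = h x"
proof
 interpret M: module R M by fact
 interpret P: module R P by fact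
 define g where "g = (%A. h (SOME x. x:carrier M & A = quot_proj M N x))"
 show *: "g (quot_proj M N x) = h x" if x: "x:carrier M" for x
 proof -
 define y where "y = (SOME y. y:carrier M & quot_proj M N x = quot_proj M N y)"
 have y: "y:carrier M & quot_proj M N x = quot_proj M N y"
 unfolding y_def by (rule someI) (use x in auto)
 hence "x \<ominus>\<^bsub>M\<^esub> y:N" using quot_proj_eq_iff[OF assms(1,2)] x by blast
 hence "h x \<ominus>\<^bsub>P\<^esub> h y = \<zero>[P]"
 using assms(5) lin_minus[OF assms(1,3,4)] x y by force
 moreover have hxy: "h x:carrier P" "h y:carrier P" using x y lin_closed[OF assms(4)] by auto
 ultimately have "(h x +[P] \<ominus>\<^bsub>P\<^esub> h y) +[P] h y = h y" by (simp add: P.minus_eq)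
 hence "h x = h y" using hxy by (simp add: P.a_assoc P.l_neg)
 thus ?thesis by (simp add: g_def y_def)
 qed
 show "lin R (quot_mod M N) P g"
 by (rule linI) (auto simp: quot_carrier quot_ops assms * lin_add[OF assms(4)] lin_smult[OF assms(4)]
 lin_closed[OF assms(4)])
qed

lemma lin_sum:
 assumes M: "module R M" and N: "module R N" and c: "!!a. a:A ==> lin R M (ring_as_mod R) (c a)"
 and y: "y:A \<rightarrow> carrier N"
 shows "lin R M N (%t. finsum N (%a. c a t *[N] y a) A)"
proof -
 interpret M: module R M by (rule M)
 interpret N: module R N by (rule N)
 have yc: "y a:carrier N" if "a:A" for a using y that by (rule funcset_mem)
 have cc: "c a t:carrier R" if "a:A" "t:carrier M" for a t using lin_closed[OF c[OF that(1)] that(2)] by simp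
 have ca: "c a (u +[M] v) = c a u \<oplus> c a v" if "a:A" "u:carrier M" "v:carrier M" for a u v
 using lin_add[OF c[OF that(1)] that(2,3)] by simp
 have cs: "c a (k *[M] v) = k\<otimes>c a v" if "a:A" "k:carrier R" "v:carrier M" for a k v
 using lin_smult[OF c[OF that(1)] that(2,3)] by simp
 show ?thesis
 proof (cases "finite A")
 case True
 show ?thesis
 proof (rule linI)
 fix u v assume u: "u:carrier M" and v: "v:carrier M"
 have "finsum N (%a. c a (u +[M] v) *[N] y a) A = finsum N (%a. c a u *[N] y a +[N] c a v *[N] y a) A"
 by (rule N.finsum_cong'[OF refl]) (simp_all add: ca u v cc yc N.smult_l_distr)
 also have "... = finsum N (%a. c a u *[N] y a) A +[N] finsum N (%a. c a v *[N] y a) A"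
 by (rule N.finsum_addf) (simp_all add: u v cc yc)
 finally show "finsum N (%a. c a (u +[M] v) *[N] y a) A =
 finsum N (%a. c a u *[N] y a) A +[N] finsum N (%a. c a v *[N] y a) A" .
 next
 fix k v assume k: "k:carrier R" and v: "v:carrier M"
 have "finsum N (%a. c a (k *[M] v) *[N] y a) A = finsum N (%a. k *[N] (c a v *[N] y a)) A"
 by (rule N.finsum_cong'[OF refl]) (simp_all add: cs k v cc yc N.smult_assoc1)
 also have "... = k *[N] finsum N (%a. c a v *[N] y a) A"
 by (rule N.finsum_smult_ldistr[symmetric]) (simp_all add: True k v cc yc)
 finally show "finsum N (%a. c a (k *[M] v) *[N] y a) A = k *[N] finsum N (%a. c a v *[N] y a) A" .
 next
 fix v assume "v:carrier M"
 thus "finsum N (%a. c a v *[N] y a) A:carrier N" by (intro N.finsum_closed) (simp add: cc yc)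
 qed
 next
 case False thus ?thesis by (intro linI) simp_all
 qed
qed

section \<open>Free modules\<close>

lemma module_free: "module R (free_mod R B)"
proof (rule moduleI)
 have fin: "finite {x. f x \<oplus> g x ~= \<zero>}" if "finite {x. f x ~= \<zero>}" "finite {x. g x ~= \<zero>}" for f g :: "'c => 'a"
 by (rule finite_subset[of _ "{x. f x ~= \<zero>}\<union>{x. g x ~= \<zero>}"]) (use that in auto)
 have fin2: "finite {x. c\<otimes>f x ~= \<zero>}" if "finite {x. f x ~= \<zero>}" "c:carrier R" for c and f :: "'c => 'a"
 by (rule finite_subset[of _ "{x. f x ~= \<zero>}"]) (use that in auto)
 show "abelian_group (free_mod R B)"
 proof (rule abelian_groupI)
 fix f assume f: "f:carrier (free_mod R B)"
 have fin3: "finite {x. \<ominus> f x ~= \<zero>}"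
 by (rule finite_subset[of _ "{x. f x ~= \<zero>}"]) (use f in "auto simp: free_mod_def")
 show "EX g:carrier (free_mod R B). g +[free_mod R B] f = \<zero>[free_mod R B]"
 by (rule bexI[of _ "%x. \<ominus> f x"]) (use f fin3 in "auto simp: free_mod_def l_neg")
 qed (auto simp: free_mod_def a_ac fin)
 fix c x assume "c:carrier R" "x:carrier (free_mod R B)"
 thus "c *[free_mod R B] x:carrier (free_mod R B)" by (auto simp: free_mod_def fin2)
qed (auto simp: free_mod_def l_distr r_distr m_assoc intro: is_cring)

lemma free_basis_carrier: "b:B ==> free_basis R b:carrier (free_mod R B)"
 by (auto simp: free_mod_def free_basis_def)

lemma free_mod_span:
 assumes "f:carrier (free_mod R B)"
 shows "f:mod_span R (free_mod R B) (free_basis R ` B)"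
proof -
 let ?F = "free_mod R B"
 note H = submoduleD[OF submodule_mod_span[OF module_free, of "free_basis R ` B" B] module_free]
 have sub: "free_basis R ` B<=carrier ?F" using free_basis_carrier by auto
 have "ALL f:carrier ?F. {x. f x ~= \<zero>}<=S --> f:mod_span R ?F (free_basis R ` B)" if "finite S" for S
 using that
 proof induction
 case empty
 have "f = \<zero>[?F]" if "{x. f x ~= \<zero>}<={}" for f using that by (auto simp: free_mod_def)
 thus ?case using H(2)[OF sub] by auto
 next
 case (insert b S)
 show ?case
 proof (intro ballI impI)
 fix f assume f: "f:carrier ?F" "{x. f x ~= \<zero>}<=insert b S"
 show "f:mod_span R ?F (free_basis R ` B)"
 proof (cases "b:B")
 case True
 let ?g = "f(b := \<zero>)"
 have g: "?g:carrier ?F"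
 proof -
 have "finite {x. ?g x ~= \<zero>}"
 by (rule finite_subset[of _ "{x. f x ~= \<zero>}"]) (use f in "auto simp: free_mod_def")
 thus ?thesis using f by (auto simp: free_mod_def)
 qed
 have "{x. ?g x ~= \<zero>}<=S" using f(2) by auto
 hence 1: "?g:mod_span R ?F (free_basis R ` B)" using insert.IH g by blast
 have 2: "free_basis R b:mod_span R ?F (free_basis R ` B)"
 using True by (intro mod_span_superset) auto
 have fx: "f x:carrier R" for x using f by (auto simp: free_mod_def)
 have "f = f b *[?F] free_basis R b +[?F] ?g"
 using fx by (auto simp: free_mod_def free_basis_def fun_eq_iff)
 moreover have "...:mod_span R ?F (free_basis R ` B)"
 using H(3)[OF sub H(4)[OF sub fx[of b] 2] 1] .
 ultimately show ?thesis by simp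
 next
 case False
 hence "{x. f x ~= \<zero>}<=S" using f by (auto simp: free_mod_def)
 thus ?thesis using insert.IH f by auto
 qed
 qed
 qed
 thus ?thesis using assms by (auto simp: free_mod_def)
qed

lemma free_lift:
 assumes N: "module R N" and g: "!!b. b:B ==> g b:carrier N"
 obtains L where "lin R (free_mod R B) N L" "!!b. b:B ==> L (free_basis R b) = g b"
proof
 interpret N: module R N by fact
 let ?F = "free_mod R B"
 define L where "L = (%f. finsum N (%b. f b *[N] g b) {b. f b ~= \<zero>})"
 have Fr: "f x:carrier R" "f x ~= \<zero> ==> x:B" "finite {x. f x ~= \<zero>}" if "f:carrier ?F" for f x
 using that by (auto simp: free_mod_def)
 have cl: "f b *[N] g b:carrier N" if "f:carrier ?F" "b:B" for f b
 using Fr[OF that(1)] g that by auto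
 \<comment> \<open>the support may be replaced by any larger finite set, so that sums for different elements
 can be compared\<close>
 have L_eq: "L f = finsum N (%b. f b *[N] g b) S"
 if "f:carrier ?F" "finite S" "{b. f b ~= \<zero>}<=S" "S<=B" for f S
 unfolding L_def by (rule N.add.finprod_mono_neutral_cong_left)
 (use that cl g in "auto")
 show "lin R ?F N L"
 proof (rule linI)
 fix f assume f: "f:carrier ?F"
 show "L f:carrier N" unfolding L_def using cl[OF f] Fr(2)[OF f] by (intro N.finsum_closed) auto
 next
 fix f h assume f: "f:carrier ?F" and h: "h:carrier ?F"
 let ?S = "{b. f b ~= \<zero>}\<union>{b. h b ~= \<zero>}"
 have S: "finite ?S" "?S<=B" using Fr[OF f] Fr[OF h] by auto
 interpret F: module R ?F by (rule module_free)
 have fh: "f +[?F] h:carrier ?F" using f h by simp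
 have "L (f +[?F] h) = finsum N (%b. (f b \<oplus> h b) *[N] g b) ?S"
 by (subst L_eq[OF fh S(1) _ S(2)]) (auto simp: free_mod_def)
 also have "... = finsum N (%b. f b *[N] g b +[N] h b *[N] g b) ?S"
 by (rule N.finsum_cong') (use S g cl[OF f] cl[OF h] Fr[OF f] Fr[OF h] in "auto simp: N.smult_l_distr")
 also have "... = L f +[N] L h"
 by (subst (1 2) L_eq[OF _ S(1) _ S(2)], use f h in \<open>auto\<close>, rule N.finsum_addf)
 (use S cl[OF f] cl[OF h] Fr[OF f] Fr[OF h] in auto)
 finally show "L (f +[?F] h) = L f +[N] L h" .
 next
 fix c f assume c: "c:carrier R" and f: "f:carrier ?F"
 let ?S = "{b. f b ~= \<zero>}"
 have S: "finite ?S" "?S<=B" using Fr[OF f] by auto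
 interpret F: module R ?F by (rule module_free)
 have cf: "c *[?F] f:carrier ?F" using f c by simp
 have "L (c *[?F] f) = finsum N (%b. (c\<otimes>f b) *[N] g b) ?S"
 by (subst L_eq[OF cf S(1) _ S(2)]) (auto simp: free_mod_def c)
 also have "... = finsum N (%b. c *[N] (f b *[N] g b)) ?S"
 by (rule N.finsum_cong') (use S g cl[OF f] Fr[OF f] c in "auto simp: N.smult_assoc1")
 also have "... = c *[N] L f"
 unfolding L_def using S cl[OF f] c by (subst N.finsum_smult_ldistr) auto
 finally show "L (c *[?F] f) = c *[N] L f" .
 qed
 fix b assume b: "b:B"
 show "L (free_basis R b) = g b"
 proof -
 have "{x. free_basis R b x ~= \<zero>}<={b}" by (auto simp: free_basis_def)
 hence "L (free_basis R b) = finsum N (%x. free_basis R b x *[N] g x) {b}"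
 using L_eq[OF free_basis_carrier[OF b], of "{b}"] b by blast
 thus ?thesis using b g by (simp add: free_basis_def)
 qed
qed

end

section \<open>Sums over families of indices\<close>

lemma (in comm_monoid) finprod_Sigma:
 assumes "finite A" "!!a. a:A ==> finite (B a)" "!!a b. a:A ==> b:B a ==> f (a, b):carrier G"
 shows "finprod G f (Sigma A B) = finprod G (%a. finprod G (%b. f (a, b)) (B a)) A"
proof -
 have "Sigma A B = (\<Union>a\<in>A. Pair a ` B a)" by auto
 hence "finprod G f (Sigma A B) = finprod G f (\<Union>a\<in>A. Pair a ` B a)" by simp
 also have "... = finprod G (%a. finprod G f (Pair a ` B a)) A"
 by (rule finprod_UN_disjoint) (use assms in "auto simp: pairwise_def disjnt_def")
 also have "... = finprod G (%a. finprod G (%b. f (a, b)) (B a)) A"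
 proof (rule finprod_cong')
 fix a assume a: "a:A"
 show "finprod G f (Pair a ` B a) = finprod G (%b. f (a, b)) (B a)"
 by (rule finprod_reindex) (use assms a in "auto simp: inj_on_def")
 qed (use assms in auto)
 finally show ?thesis .
qed

lemma (in comm_monoid) finprod_fibers:
 assumes "finite A" "f:A \<rightarrow> carrier G"
 shows "finprod G f A = finprod G (%y. finprod G f {x\<in>A. g x = y}) (g ` A)"
proof -
 have "A = (\<Union>y\<in>g ` A. {x\<in>A. g x = y})" by auto
 hence "finprod G f A = finprod G f (\<Union>y\<in>g ` A. {x\<in>A. g x = y})" by simp
 also have "... = finprod G (%y. finprod G f {x\<in>A. g x = y}) (g ` A)"
 by (rule finprod_UN_disjoint) (use assms in "auto simp: pairwise_def disjnt_def")
 finally show ?thesis .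
qed

lemma (in comm_monoid) finprod_PiE_Suc:
 assumes "!!i. i <= k ==> finite (B i)" "!!J. J:PiE {..<Suc k} B ==> f J:carrier G"
 shows "finprod G f (PiE {..<Suc k} B) =
 finprod G (%J. finprod G (%j. f (J(k := j))) (B k)) (PiE {..<k} B)"
proof -
 let ?h = "%(J, j). J(k := j)"
 have eq: "PiE {..<Suc k} B = ?h ` (PiE {..<k} B\<times>B k)"
 by (auto simp: lessThan_Suc PiE_insert_eq image_iff)
 have inj: "inj_on ?h (PiE {..<k} B\<times>B k)"
 proof (rule inj_onI, clarify)
 fix J j J' j' assume *: "J:PiE {..<k} B" "J':PiE {..<k} B" "J(k := j) = J'(k := j')"
 have "J x = J' x" if "x < k" for x using fun_cong[OF *(3), of x] that by simp
 hence "J = J'" using *(1,2) by (intro PiE_ext[of _ "{..<k}" B]) auto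
 thus "J = J' & j = j'" using fun_cong[OF *(3), of k] by simp
 qed
 have cl: "f (J(k := j)):carrier G" if "J:PiE {..<k} B" "j:B k" for J j
 using that eq by (intro assms(2)) (auto intro!: image_eqI[of _ _ "(J, j)"])
 have "finprod G f (PiE {..<Suc k} B) = finprod G (%p. f (?h p)) (PiE {..<k} B\<times>B k)"
 unfolding eq by (rule finprod_reindex) (use cl inj in auto)
 also have "... = finprod G (%J. finprod G (%j. f (J(k := j))) (B k)) (PiE {..<k} B)"
 using assms(1) cl by (subst finprod_Sigma) (auto intro: finite_PiE)
 finally show ?thesis .
qed

text \<open>Terms cancel in pairs. The fixed points of \<open>h\<close> are treated separately, so that \<open>2\<close> need not be invertible.\<close>

lemma (in comm_monoid) finprod_involution:
 assumes "finite A" "f:A \<rightarrow> carrier G" "!!a. a:A ==> h a:A" "!!a. a:A ==> h (h a) = a"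
 "!!a. a:A ==> f a\<otimes>f (h a) = \<one>" "!!a. a:A ==> h a = a ==> f a = \<one>"
 shows "finprod G f A = \<one>"
 using assms
proof (induction A rule: finite_psubset_induct)
 case (psubset A)
 show ?case
 proof (cases "A = {}")
 case False
 then obtain a where a: "a:A" by blast
 let ?B = "A - {a, h a}"
 note hh = psubset.prems(3)
 have fB: "f:?B \<rightarrow> carrier G" using psubset.prems(1) by auto
 have "h b:?B" if b: "b:?B" for b
 proof -
 have bA: "b:A" "b ~= a" "b ~= h a" using b by blast+
 have "h b ~= a" using hh[OF bA(1)] bA(3) by auto
 moreover have "h b ~= h a" using hh[OF bA(1)] hh[OF a] bA(2) by metis
 ultimately show ?thesis using psubset.prems(2)[OF bA(1)] by blast
 qed
 hence IH: "finprod G f ?B = \<one>" using psubset.prems(3-5) a fB by (intro psubset.IH) blast+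
 have fa: "f a:carrier G" "f (h a):carrier G" using psubset.prems(1,2) a by auto
 show ?thesis
 proof (cases "h a = a")
 case True
 have "finprod G f (insert a ?B) = f a\<otimes>finprod G f ?B"
 by (rule finprod_insert) (use psubset.hyps fa fB in auto)
 moreover have "insert a ?B = A" using a True by auto
 ultimately show ?thesis using IH psubset.prems(5)[OF a True] by simp
 next
 case False
 have "finprod G f (insert a (insert (h a) ?B)) = f a\<otimes>finprod G f (insert (h a) ?B)"
 by (rule finprod_insert) (use psubset.hyps fa fB False in auto)
 moreover have "finprod G f (insert (h a) ?B) = f (h a)\<otimes>finprod G f ?B"
 by (rule finprod_insert) (use psubset.hyps fa fB in auto)
 moreover have "insert a (insert (h a) ?B) = A" using a psubset.prems(2)[OF a] by auto
 ultimately show ?thesis using IH psubset.prems(4)[OF a] fa by simp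
 qed
 qed simp
qed

section \<open>Tensor products\<close>

definition modules ::
 "('a, 'm) ring_scheme => nat => (nat => ('a, 'b) module) => bool" where
 "modules R n M \<longleftrightarrow> (ALL i<n. module R (M i))"

definition lins ::
 "('a, 'm) ring_scheme => nat => (nat => ('a, 'b) module) => (nat => ('a, 'c) module) =>
 (nat => 'b => 'c) => bool" where
 "lins R n M N f \<longleftrightarrow> (ALL i<n. lin R (M i) (N i) (f i))"

lemma modulesI: "(!!i. i < n ==> module R (M i)) ==> modules R n M"
 and modulesD: "modules R n M ==> i < n ==> module R (M i)"
 by (simp_all add: modules_def)

lemma linsI: "(!!i. i < n ==> lin R (M i) (N i) (f i)) ==> lins R n M N f"
 and linsD: "lins R n M N f ==> i < n ==> lin R (M i) (N i) (f i)"
 by (simp_all add: lins_def)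

lemma modules_const: "module R V ==> modules R n (%_. V)"
 by (simp add: modules_def)

definition multilin ::
 "('a, 'm) ring_scheme => nat => (nat => ('a, 'b) module) => ('a, 'c) module =>
 ((nat => 'b) => 'c) => bool" where
 "multilin R n M N m \<longleftrightarrow> (ALL v:tensor_base n M. m v:carrier N) &
 (ALL v:tensor_base n M. ALL i<n. lin R (M i) N (%x. m (v(i := x))))"

lemma tensor_base_upd:
 "v:tensor_base n M ==> i < n ==> x:carrier (M i) ==> v(i := x):tensor_base n M"
 by (auto simp: tensor_base_def PiE_def Pi_def extensional_def)

lemma tensor_base_restrict:
 "(!!i. i < n ==> v i:carrier (M i)) ==> (tup n (%i. v i)):tensor_base n M"
 by (auto simp: tensor_base_def)

lemma tensor_baseD: "v:tensor_base n M ==> i < n ==> v i:carrier (M i)"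
 by (auto simp: tensor_base_def)

lemma tensor_base_eqI:
 "v:tensor_base n M ==> w:tensor_base n M ==> (!!i. i < n ==> v i = w i) ==> v = w"
 unfolding tensor_base_def by (rule PiE_ext) auto

lemma multilin_closed: "multilin R n M N m ==> v:tensor_base n M ==> m v:carrier N"
 by (simp add: multilin_def)

lemma multilin_slice:
 "multilin R n M N m ==> v:tensor_base n M ==> i < n ==> lin R (M i) N (%x. m (v(i := x)))"
 by (simp add: multilin_def)

lemma multilin_lin:
 "multilin R n M N m ==> lin R N P f ==> multilin R n M P (%v. f (m v))"
 by (simp add: multilin_def lin_closed lin_comp[of R _ N _ P f])

lemma multilin_map:
 assumes "multilin R n N P m" "lins R n M N f" "modules R n M"
 shows "multilin R n M P (%v. m (tup n (%i. f i (v i))))"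
 unfolding multilin_def
proof (intro conjI ballI allI impI)
 fix v assume v: "v:tensor_base n M"
 have b: "(tup n (%i. f i (v i))):tensor_base n N"
 using tensor_baseD[OF v] by (intro tensor_base_restrict lin_closed[OF linsD[OF assms(2)]])
 thus "m (tup n (%i. f i (v i))):carrier P" using assms(1) by (simp add: multilin_closed)
 fix i assume i: "i < n"
 have "(tup n (%j. f j ((v(i := x)) j))) = (tup n (%j. f j (v j)))(i := f i x)" for x
 using i by auto
 thus "lin R (M i) P (%x. m (tup n (%j. f j ((v(i := x)) j))))"
 using lin_comp[OF linsD[OF assms(2) i] multilin_slice[OF assms(1) b i]] by simp
qed

context cring
begin

lemma tensor_rels_submodule:
 assumes "modules R n M"
 shows "submodule (tensor_rels R n M) R (free_mod R (tensor_base n M))"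
proof -
 let ?F = "free_mod R (tensor_base n M)"
 interpret F: module R ?F by (rule module_free)
 have e: "free_basis R (v(i := x)):carrier ?F"
 if "v:tensor_base n M" "i < n" "x:carrier (M i)" for v i x
 using that by (intro free_basis_carrier tensor_base_upd)
 have cl: "x +[M i] y:carrier (M i)" "c:carrier R ==> c *[M i] x:carrier (M i)"
 if "i < n" "x:carrier (M i)" "y:carrier (M i)" for i x y c
 proof -
 interpret M: module R "M i" using modulesD[OF assms that(1)] .
 show "x +[M i] y:carrier (M i)" "c:carrier R ==> c *[M i] x:carrier (M i)"
 using that by auto
 qed
 show ?thesis
 unfolding tensor_rels_def Let_def by (rule submodule_mod_span[OF module_free]) (auto intro!: e cl)
qed

lemma module_tensor: "modules R n M ==> module R (tensor R n M)"
 unfolding tensor_def by (intro module_quot module_free tensor_rels_submodule)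

lemma multilin_pure:
 assumes M: "modules R n M"
 shows "multilin R n M (tensor R n M) (pure_tensor R n M)"
 unfolding multilin_def
proof (intro conjI ballI allI impI)
 let ?F = "free_mod R (tensor_base n M)" and ?N = "tensor_rels R n M" and ?e = "free_basis R"
 interpret F: module R ?F by (rule module_free)
 note sub = tensor_rels_submodule[OF M]
 have e: "?e v:carrier ?F" if "v:tensor_base n M" for v
 using that by (intro free_basis_carrier)
 show cl: "pure_tensor R n M v:carrier (tensor R n M)" if "v:tensor_base n M" for v
 using e[OF that] by (auto simp: pure_tensor_def tensor_def quot_carrier)
 fix v i assume v: "v:tensor_base n M" and i: "i < n"
 interpret Mi: module R "M i" using modulesD[OF M i] .
 note up = tensor_base_upd[OF v i]
 show "lin R (M i) (tensor R n M) (%x. pure_tensor R n M (v(i := x)))"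
 proof (rule linI)
 fix x assume x: "x:carrier (M i)"
 show "pure_tensor R n M (v(i := x)):carrier (tensor R n M)" by (rule cl[OF up[OF x]])
 {
 fix y assume y: "y:carrier (M i)"
 have "?e (v(i := x +[M i] y)) \<ominus>\<^bsub>?F\<^esub> (?e (v(i := x)) +[?F] ?e (v(i := y))):?N"
 unfolding tensor_rels_def Let_def using v i x y by (intro mod_span_superset UnI1) blast
 thus "pure_tensor R n M (v(i := x +[M i] y)) =
 pure_tensor R n M (v(i := x)) +[tensor R n M] pure_tensor R n M (v(i := y))"
 unfolding pure_tensor_def tensor_def
 using e[OF up] x y
 by (subst quot_ops(1)[OF module_free sub]) (auto simp: quot_proj_eq_iff[OF module_free sub])
 }
 fix c assume c: "c:carrier R"
 have "?e (v(i := c *[M i] x)) \<ominus>\<^bsub>?F\<^esub> (c *[?F] ?e (v(i := x))):?N"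
 unfolding tensor_rels_def Let_def using v i x c by (intro mod_span_superset UnI2) blast
 thus "pure_tensor R n M (v(i := c *[M i] x)) =
 c *[tensor R n M] pure_tensor R n M (v(i := x))"
 unfolding pure_tensor_def tensor_def
 using e[OF up] x c
 by (subst quot_ops(2)[OF module_free sub]) (auto simp: quot_proj_eq_iff[OF module_free sub])
 qed
qed

lemmas pure_closed = multilin_closed[OF multilin_pure]

lemma tensor_span:
 assumes M: "modules R n M" and t: "t:carrier (tensor R n M)"
 shows "t:mod_span R (tensor R n M) (pure_tensor R n M ` tensor_base n M)"
proof -
 let ?F = "free_mod R (tensor_base n M)"
 let ?H = "mod_span R (tensor R n M) (pure_tensor R n M ` tensor_base n M)"
 have H: "submodule ?H R (tensor R n M)"
 by (rule submodule_mod_span[OF module_tensor[OF M]]) (auto intro!: pure_closed[OF M])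
 have pr: "lin R ?F (tensor R n M) (quot_proj ?F (tensor_rels R n M))"
 unfolding tensor_def by (intro lin_quot_proj module_free tensor_rels_submodule M)
 have "mod_span R ?F (free_basis R ` tensor_base n M)<={f\<in>carrier ?F. quot_proj ?F (tensor_rels R n M) f:?H}"
 by (rule mod_span_least[OF submodule_preimage[OF module_free module_tensor[OF M] pr H]])
 (auto intro!: mod_span_superset free_basis_carrier simp: pure_tensor_def)
 moreover obtain f where "t = quot_proj ?F (tensor_rels R n M) f" "f:carrier ?F"
 using t by (auto simp: tensor_def quot_carrier)
 ultimately show ?thesis using free_mod_span by blast
qed

lemma tensor_lin_eqI:
 assumes M: "modules R n M" and "module R N"
 and "lin R (tensor R n M) N f" "lin R (tensor R n M) N g"
 and "!!v. v:tensor_base n M ==> f (pure_tensor R n M v) = g (pure_tensor R n M v)"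
 and "t:carrier (tensor R n M)"
 shows "f t = g t"
 by (rule lin_eq_on_span[OF module_tensor[OF M] assms(2-4) _ _ tensor_span[OF M assms(6)]])
 (auto intro!: pure_closed[OF M] assms(5))

lemma tensor_lift:
 assumes M: "modules R n M" and N: "module R N" and m: "multilin R n M N m"
 shows "tensor_lift R n M N m:mod_hom R (tensor R n M) N"
 and "!!v. v:tensor_base n M ==> tensor_lift R n M N m (pure_tensor R n M v) = m v"
proof -
 let ?F = "free_mod R (tensor_base n M)" and ?N = "tensor_rels R n M"
 interpret F: module R ?F by (rule module_free)
 interpret N: module R N by fact
 note sub = tensor_rels_submodule[OF M]
 obtain L where L: "lin R ?F N L" "!!v. v:tensor_base n M ==> L (free_basis R v) = m v"
 by (rule free_lift[OF N, of "tensor_base n M" m]) (use multilin_closed[OF m] in auto)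
 have "?N<={f\<in>carrier ?F. L f:{\<zero>[N]}}"
 unfolding tensor_rels_def Let_def
 proof (rule mod_span_least[OF submodule_preimage[OF module_free N L(1) submodule_zero[OF N]]],
 intro Un_least subsetI)
 have e: "free_basis R (v(i := x)):carrier ?F"
 if "v:tensor_base n M" "i < n" "x:carrier (M i)" for v i x
 using that by (intro free_basis_carrier tensor_base_upd)
 {
 fix f assume "f:{free_basis R (v(i := x +[M i] y)) \<ominus>\<^bsub>?F\<^esub>
 (free_basis R (v(i := x)) +[?F] free_basis R (v(i := y))) |v i x y.
 v:tensor_base n M & i < n & x:carrier (M i) & y:carrier (M i)}"
 then obtain v i x y where f: "f = free_basis R (v(i := x +[M i] y)) \<ominus>\<^bsub>?F\<^esub>
 (free_basis R (v(i := x)) +[?F] free_basis R (v(i := y)))"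
 and v: "v:tensor_base n M" "i < n" "x:carrier (M i)" "y:carrier (M i)" by blast
 interpret Mi: module R "M i" using modulesD[OF M v(2)] .
 note ee = e[OF v(1,2) v(3)] e[OF v(1,2) v(4)] e[OF v(1,2) Mi.add.m_closed[OF v(3,4)]]
 have "L f = \<zero>[N]" unfolding f
 using ee lin_add[OF multilin_slice[OF m v(1,2)] v(3,4)] v
 by (simp add: lin_minus[OF module_free N L(1)] lin_add[OF L(1)] L(2) tensor_base_upd
 N.minus_eq N.r_neg multilin_closed[OF m])
 thus "f:{f\<in>carrier ?F. L f:{\<zero>[N]}}" using f ee by simp
 }
 {
 fix f assume "f:{free_basis R (v(i := c *[M i] x)) \<ominus>\<^bsub>?F\<^esub>
 (c *[?F] free_basis R (v(i := x))) |v i c x.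
 v:tensor_base n M & i < n & c:carrier R & x:carrier (M i)}"
 then obtain v i c x where f: "f = free_basis R (v(i := c *[M i] x)) \<ominus>\<^bsub>?F\<^esub>
 (c *[?F] free_basis R (v(i := x)))"
 and v: "v:tensor_base n M" "i < n" "c:carrier R" "x:carrier (M i)" by blast
 interpret Mi: module R "M i" using modulesD[OF M v(2)] .
 note ee = e[OF v(1,2) v(4)] e[OF v(1,2) Mi.smult_closed[OF v(3,4)]]
 have "L f = \<zero>[N]" unfolding f
 using ee lin_smult[OF multilin_slice[OF m v(1,2)] v(3,4)] v
 by (simp add: lin_minus[OF module_free N L(1)] lin_smult[OF L(1)] L(2) tensor_base_upd
 N.minus_eq N.r_neg multilin_closed[OF m])
 thus "f:{f\<in>carrier ?F. L f:{\<zero>[N]}}" using f ee v by simp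
 }
 qed
 then obtain g where g: "lin R (tensor R n M) N g" "!!x. x:carrier ?F ==> g (quot_proj ?F ?N x) = L x"
 using quot_lift[OF module_free sub N L(1)] unfolding tensor_def by blast
 define h where "h = restrict g (carrier (tensor R n M))"
 have h: "h:mod_hom R (tensor R n M) N" "!!v. v:tensor_base n M ==> h (pure_tensor R n M v) = m v"
 proof -
 show "h:mod_hom R (tensor R n M) N"
 unfolding h_def by (intro lin_restrict module_tensor M g)
 fix v assume v: "v:tensor_base n M"
 show "h (pure_tensor R n M v) = m v"
 using g(2)[OF free_basis_carrier[OF v]] pure_closed[OF M v] L(2)[OF v]
 by (simp add: h_def pure_tensor_def)
 qed
 have "tensor_lift R n M N m:mod_hom R (tensor R n M) N &
 (ALL v:tensor_base n M. tensor_lift R n M N m (pure_tensor R n M v) = m v)"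
 unfolding tensor_lift_def
 proof (rule theI[where a = h])
 fix k assume k: "k:mod_hom R (tensor R n M) N &
 (ALL v:tensor_base n M. k (pure_tensor R n M v) = m v)"
 show "k = h"
 proof (rule mod_hom_eqI[where R = R and N = N])
 show "k x = h x" if "x:carrier (tensor R n M)" for x
 by (rule tensor_lin_eqI[OF M N mod_hom_lin mod_hom_lin _ that]) (simp_all add: k h)
 qed (simp_all add: k h)
 qed (use h in auto)
 thus "tensor_lift R n M N m:mod_hom R (tensor R n M) N"
 and "!!v. v:tensor_base n M ==> tensor_lift R n M N m (pure_tensor R n M v) = m v" by auto
qed

lemma tensor_map:
 assumes M: "modules R n M" and N: "modules R n N"
 and f: "lins R n M N f"
 shows "tensor_map R n M N f:mod_hom R (tensor R n M) (tensor R n N)"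
 and "!!v. v:tensor_base n M ==>
 tensor_map R n M N f (pure_tensor R n M v) = pure_tensor R n N (tup n (%i. f i (v i)))"
proof -
 note * = tensor_lift[OF M module_tensor[OF N] multilin_map[OF multilin_pure[OF N] f M]]
 show "tensor_map R n M N f:mod_hom R (tensor R n M) (tensor R n N)"
 unfolding tensor_map_def by (rule *(1))
 show "tensor_map R n M N f (pure_tensor R n M v) = pure_tensor R n N (tup n (%i. f i (v i)))"
 if "v:tensor_base n M" for v
 unfolding tensor_map_def by (rule *(2)[OF that])
qed

lemma multilin_zero_slot:
 assumes "module R (M i)" "module R N" "multilin R n M N m" "v:tensor_base n M" "i < n" "v i = \<zero>[M i]"
 shows "m v = \<zero>[N]"
proof -
 have "v(i := \<zero>[M i]) = v" using assms(6) by auto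
 thus ?thesis using lin_zero[OF assms(1,2) multilin_slice[OF assms(3-5)]] by simp
qed

lemma multilin_in_submodule:
 assumes M: "modules R n M" and N: "module R N" and m: "multilin R n M N m"
 and H: "submodule H R N" and G: "!!i. i < n ==> G i<=carrier (M i)"
 and gen: "!!u. u:PiE {..<n} G ==> m u:H"
 and v: "v:tensor_base n M" "!!i. i < n ==> v i:mod_span R (M i) (G i)"
 shows "m v:H"
proof -
 have "m v:H" if "k <= n" "v:tensor_base n M" "!!i. i < k ==> v i:mod_span R (M i) (G i)"
 "!!i. k <= i ==> i < n ==> v i:G i" for k v
 using that
 proof (induction k arbitrary: v)
 case 0
 have "v:PiE {..<n} G"
 using 0(2) 0(4) by (simp add: tensor_base_def PiE_iff)
 thus ?case by (rule gen)
 next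
 case (Suc k)
 have k: "k < n" using Suc.prems by simp
 let ?S = "{x\<in>carrier (M k). m (v(k := x)):H}"
 have "mod_span R (M k) (G k)<=?S"
 proof (rule mod_span_least)
 show "submodule ?S R (M k)"
 by (rule submodule_preimage[OF modulesD[OF M k] N multilin_slice[OF m Suc.prems(2) k] H])
 show "G k<=?S"
 using G[OF k] k Suc.prems by (auto intro!: Suc.IH tensor_base_upd)
 qed
 thus ?case using Suc.prems(3)[of k] by auto
 qed
 from this[of n v] v show ?thesis by auto
qed

lemma pure_in_span:
 assumes M: "modules R n M" and G: "!!i. i < n ==> G i<=carrier (M i)"
 and v: "v:tensor_base n M" "!!i. i < n ==> v i:mod_span R (M i) (G i)"
 shows "pure_tensor R n M v:mod_span R (tensor R n M) (pure_tensor R n M ` PiE {..<n} G)"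
proof (rule multilin_in_submodule[OF M module_tensor[OF M] multilin_pure[OF M] _ G _ v])
 have "u:tensor_base n M" if "u:PiE {..<n} G" for u
 unfolding tensor_base_def using PiE_mono[of "{..<n}" G "%i. carrier (M i)"] G that by blast
 thus "submodule (mod_span R (tensor R n M) (pure_tensor R n M ` PiE {..<n} G)) R (tensor R n M)"
 by (intro submodule_mod_span module_tensor M image_subsetI pure_closed)
qed (assumption | rule mod_span_superset imageI)+

text \<open>The expansion of a multilinear map whose arguments are given as linear combinations,
 obtained by expanding one argument after the other.\<close>

lemma multilin_expand:
 assumes M: "modules R n M" and N: "module R N" and m: "multilin R n M N m"
 and B: "!!i. i < n ==> finite (B i)"
 and b: "!!i j. i < n ==> j:B i ==> b i j:carrier (M i)"
 and c: "!!i j. i < n ==> j:B i ==> c i j:carrier R"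
 and v: "v:tensor_base n M" "!!i. i < n ==> v i = finsum (M i) (%j. c i j *[M i] b i j) (B i)"
 shows "m v = finsum N (%J. (\<Otimes>i\<in>{..<n}. c i (J i)) *[N] m (tup n (%i. b i (J i)))) (PiE {..<n} B)"
proof -
 interpret N: module R N by fact
 define w where "w k J = (tup n (%i. if i < k then b i (J i) else v i))" for k J
 have w_base: "w k J:tensor_base n M" if "J:PiE {..<k} B" "k <= n" for k J
 unfolding w_def using that b tensor_baseD[OF v(1)] by (intro tensor_base_restrict) auto
 have pc: "(\<Otimes>i\<in>{..<k}. c i (J i)):carrier R" if "J:PiE {..<k} B" "k <= n" for k J
 proof (intro finprod_closed Pi_I)
 fix i assume i: "i:{..<k}"
 show "c i (J i):carrier R" using i that(2) by (intro c PiE_mem[OF that(1) i]) simp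
 qed
 have "m v = finsum N (%J. (\<Otimes>i\<in>{..<k}. c i (J i)) *[N] m (w k J)) (PiE {..<k} B)" if "k <= n" for k
 using that
 proof (induction k)
 case 0
 have "w 0 J = v" for J
 proof -
 have "w 0 J = restrict v {..<n}" by (simp add: w_def)
 also have "... = v" using v(1) unfolding tensor_base_def by (rule PiE_restrict)
 finally show ?thesis .
 qed
 thus ?case using multilin_closed[OF m v(1)] by simp
 next
 case (Suc k)
 hence k: "k < n" by simp
 interpret Mk: module R "M k" using modulesD[OF M k] .
 have step: "(\<Otimes>i\<in>{..<k}. c i (J i)) *[N] m (w k J) =
 finsum N (%j. (\<Otimes>i\<in>{..<Suc k}. c i ((J(k := j)) i)) *[N] m (w (Suc k) (J(k := j)))) (B k)"
 if J: "J:PiE {..<k} B" for J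
 proof -
 have wk: "w k J:tensor_base n M" using w_base J k by simp
 have ws: "w (Suc k) (J(k := j)) = (w k J)(k := b k j)" for j
 using k by (auto simp: w_def fun_eq_iff less_Suc_eq)
 have "m (w k J) = m ((w k J)(k := finsum (M k) (%j. c k j *[M k] b k j) (B k)))"
 using v(2)[OF k] k by (intro arg_cong[where f = m]) (auto simp: w_def fun_eq_iff)
 also have "... = finsum N (%j. m ((w k J)(k := c k j *[M k] b k j))) (B k)"
 using b[OF k] c[OF k] by (intro lin_finsum[OF modulesD[OF M k] N multilin_slice[OF m wk k]]) auto
 also have "... = finsum N (%j. c k j *[N] m (w (Suc k) (J(k := j)))) (B k)"
 unfolding ws
 using b[OF k] c[OF k] lin_smult[OF multilin_slice[OF m wk k]] multilin_closed[OF m tensor_base_upd[OF wk k]]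
 by (intro N.finsum_cong') auto
 finally have 1: "m (w k J) = finsum N (%j. c k j *[N] m (w (Suc k) (J(k := j)))) (B k)" .
 have cJ: "c i (J i):carrier R" if "i < k" for i
 using that k by (intro c PiE_mem[OF J]) auto
 have cl: "m (w (Suc k) (J(k := j))):carrier N" if "j:B k" for j
 unfolding ws using that by (intro multilin_closed[OF m tensor_base_upd[OF wk k]] b k)
 have fp: "(\<Otimes>i\<in>{..<Suc k}. c i ((J(k := j)) i)) = (\<Otimes>i\<in>{..<k}. c i (J i))\<otimes>c k j" if "j:B k" for j
 proof -
 have "(\<Otimes>i\<in>{..<Suc k}. c i ((J(k := j)) i)) = c k j\<otimes>(\<Otimes>i\<in>{..<k}. c i ((J(k := j)) i))"
 unfolding lessThan_Suc using cJ c k that by (subst finprod_insert) auto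
 also have "(\<Otimes>i\<in>{..<k}. c i ((J(k := j)) i)) = (\<Otimes>i\<in>{..<k}. c i (J i))"
 using cJ by (intro finprod_cong') auto
 finally show ?thesis using pc[OF J] k c that by (simp add: m_comm)
 qed
 have "(\<Otimes>i\<in>{..<k}. c i (J i)) *[N] m (w k J) =
 finsum N (%j. (\<Otimes>i\<in>{..<k}. c i (J i)) *[N] (c k j *[N] m (w (Suc k) (J(k := j))))) (B k)"
 unfolding 1 using pc[OF J] k c cl B by (intro N.finsum_smult_ldistr) auto
 also have "... = finsum N (%j. (\<Otimes>i\<in>{..<Suc k}. c i ((J(k := j)) i)) *[N] m (w (Suc k) (J(k := j)))) (B k)"
 proof (intro N.finsum_cong' refl)
 fix j assume j: "j:B k"
 show "(\<Otimes>i\<in>{..<k}. c i (J i)) *[N] (c k j *[N] m (w (Suc k) (J(k := j)))) =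
 (\<Otimes>i\<in>{..<Suc k}. c i ((J(k := j)) i)) *[N] m (w (Suc k) (J(k := j)))"
 unfolding fp[OF j] using pc[OF J] k c[OF k j] cl[OF j] by (simp add: N.smult_assoc1)
 next
 show "(%j. (\<Otimes>i\<in>{..<Suc k}. c i ((J(k := j)) i)) *[N] m (w (Suc k) (J(k := j)))):B k \<rightarrow> carrier N"
 using pc[OF J] k c[OF k] cl by (auto simp: fp simp del: fun_upd_apply)
 qed
 finally show ?thesis .
 qed
 have "m v = finsum N (%J. finsum N (%j. (\<Otimes>i\<in>{..<Suc k}. c i ((J(k := j)) i)) *[N]
 m (w (Suc k) (J(k := j)))) (B k)) (PiE {..<k} B)"
 unfolding Suc.IH[OF less_imp_le[OF k]]
 proof (rule N.finsum_cong')
 show "(%J. finsum N (%j. (\<Otimes>i\<in>{..<Suc k}. c i ((J(k := j)) i)) *[N]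
 m (w (Suc k) (J(k := j)))) (B k)):PiE {..<k} B \<rightarrow> carrier N"
 using step pc w_base k multilin_closed[OF m] by (auto simp: step[symmetric] simp del: fun_upd_apply)
 qed (use step in auto)
 also have "... = finsum N (%J. (\<Otimes>i\<in>{..<Suc k}. c i (J i)) *[N] m (w (Suc k) J)) (PiE {..<Suc k} B)"
 using k B pc w_base multilin_closed[OF m] Suc.prems
 by (subst N.add.finprod_PiE_Suc) auto
 finally show ?case .
 qed
 from this[of n] have "m v = finsum N (%J. (\<Otimes>i\<in>{..<n}. c i (J i)) *[N] m (w n J)) (PiE {..<n} B)" by simp
 moreover have "w n = (%J. \<lambda>i\<in>{..<n}. b i (J i))"
 by (intro ext) (simp add: w_def restrict_def)
 ultimately show ?thesis by simp
qed

lemma multilin_prod: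
 assumes M: "modules R n M" and f: "lins R n M (%_. ring_as_mod R) f"
 shows "multilin R n M (ring_as_mod R) (%v. \<Otimes>i\<in>{..<n}. f i (v i))"
 unfolding multilin_def
proof (intro conjI ballI allI impI)
 have cl: "f i (v i):carrier R" if "v:tensor_base n M" "i < n" for v i
 using lin_closed[OF linsD[OF f that(2)] tensor_baseD[OF that]] by simp
 fix v assume v: "v:tensor_base n M"
 show "(\<Otimes>i\<in>{..<n}. f i (v i)):carrier (ring_as_mod R)"
 using cl[OF v] by (auto intro: finprod_closed)
 fix k assume k: "k < n"
 interpret Mk: module R "M k" using modulesD[OF M k] .
 define p where "p = (\<Otimes>i\<in>{..<n} - {k}. f i (v i))"
 have p: "p:carrier R" unfolding p_def using cl[OF v] by (auto intro: finprod_closed)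
 have fk: "f k x:carrier R" if "x:carrier (M k)" for x
 using lin_closed[OF linsD[OF f k] that] by simp
 have "(\<Otimes>i\<in>{..<n}. f i ((v(k := x)) i)) = f k x\<otimes>p" if x: "x:carrier (M k)" for x
 proof -
 have "(\<Otimes>i\<in>insert k ({..<n} - {k}). f i ((v(k := x)) i)) = f k x\<otimes>(\<Otimes>i\<in>{..<n} - {k}. f i ((v(k := x)) i))"
 using cl[OF v] fk[OF x] by (subst finprod_insert) auto
 also have "(\<Otimes>i\<in>{..<n} - {k}. f i ((v(k := x)) i)) = p"
 unfolding p_def using cl[OF v] by (intro finprod_cong') auto
 also have "insert k ({..<n} - {k}) = {..<n}" using k by auto
 finally show ?thesis .
 qed
 thus "lin R (M k) (ring_as_mod R) (%x. \<Otimes>i\<in>{..<n}. f i ((v(k := x)) i))"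
 using p fk by (intro linI)
 (auto simp: lin_add[OF linsD[OF f k]] lin_smult[OF linsD[OF f k]] l_distr m_assoc simp del: fun_upd_apply)
qed

section \<open>Dual bases\<close>

text \<open>A finitely generated projective module has a dual basis, and so has a tensor product of
 modules with dual bases. Through its coordinate functionals one computes in such modules as in free
 ones; only linear independence is lost.\<close>

definition dual_basis ::
 "('a, 'v) module => 'i set => ('i => 'v) => ('i => 'v => 'a) => bool" where
 "dual_basis M B b c \<longleftrightarrow> finite B & (ALL j:B. b j:carrier M) &
 (ALL j:B. lin R M (ring_as_mod R) (c j)) &
 (ALL x:carrier M. x = finsum M (%j. c j x *[M] b j) B)"

lemma dual_basisD:
 assumes "dual_basis M B b c"
 shows "finite B" "!!j. j:B ==> b j:carrier M" "!!j. j:B ==> lin R M (ring_as_mod R) (c j)"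
 "!!x. x:carrier M ==> finsum M (%j. c j x *[M] b j) B = x"
 "!!j x. j:B ==> x:carrier M ==> c j x:carrier R"
proof -
 show 3: "!!j. j:B ==> lin R M (ring_as_mod R) (c j)" using assms unfolding dual_basis_def by blast
 show "!!j x. j:B ==> x:carrier M ==> c j x:carrier R" using lin_closed[OF 3] by simp
 show "!!x. x:carrier M ==> finsum M (%j. c j x *[M] b j) B = x"
 using assms unfolding dual_basis_def by metis
 show "finite B" "!!j. j:B ==> b j:carrier M" using assms unfolding dual_basis_def by blast+
qed

lemma dual_basis_eqI:
 assumes "dual_basis M B b c" "module R M" "x:carrier M" "y:carrier M" "!!j. j:B ==> c j x = c j y"
 shows "x = y"
proof -
 interpret M: module R M by fact
 note D = dual_basisD[OF assms(1)]
 have "finsum M (%j. c j x *[M] b j) B = finsum M (%j. c j y *[M] b j) B"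
 using assms D by (intro M.finsum_cong') auto
 thus ?thesis using D(4) assms by simp
qed

lemma dual_basis_span:
 assumes "dual_basis M B b c" "module R M" "submodule H R M" "b ` B<=H" "x:carrier M"
 shows "x:H"
proof -
 interpret M: module R M by fact
 note D = dual_basisD[OF assms(1)]
 have "finsum M (%j. c j x *[M] b j) B:H"
 using assms D submoduleD[OF assms(3,2)] by (intro submodule_finsum[OF assms(3,2)]) auto
 thus ?thesis using D(4) assms by simp
qed

definition tcoef ::
 "nat => (nat => ('a, 'v) module) => (nat => 'i => 'v => 'a) => (nat => 'i) => ('a, 'v) tensor => 'a" where
 "tcoef n M c J = tensor_lift R n M (ring_as_mod R) (%v. \<Otimes>i\<in>{..<n}. c i (J i) (v i))"

lemma tcoef:
 assumes M: "modules R n M" and f: "lins R n M (%_. ring_as_mod R) (%i. c i (J i))"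
 shows "lin R (tensor R n M) (ring_as_mod R) (tcoef n M c J)"
 and "!!v. v:tensor_base n M ==> tcoef n M c J (pure_tensor R n M v) = (\<Otimes>i\<in>{..<n}. c i (J i) (v i))"
 unfolding tcoef_def
proof -
 note * = tensor_lift[OF M module_ring multilin_prod[OF M f]]
 show "lin R (tensor R n M) (ring_as_mod R)
 (tensor_lift R n M (ring_as_mod R) (%v. \<Otimes>i\<in>{..<n}. c i (J i) (v i)))"
 by (rule mod_hom_lin[OF *(1)])
 show "tensor_lift R n M (ring_as_mod R) (%v. \<Otimes>i\<in>{..<n}. c i (J i) (v i)) (pure_tensor R n M v) =
 (\<Otimes>i\<in>{..<n}. c i (J i) (v i))" if "v:tensor_base n M" for v
 by (rule *(2)[OF that])
qed

lemma dual_basis_tensor: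
 assumes M: "modules R n M" and D: "!!i. i < n ==> dual_basis (M i) (B i) (b i) (c i)"
 shows "dual_basis (tensor R n M) (PiE {..<n} B)
 (%J. pure_tensor R n M (tup n (%i. b i (J i)))) (tcoef n M c)"
proof -
 interpret T: module R "tensor R n M" by (rule module_tensor[OF M])
 have fin: "finite (PiE {..<n} B)" using dual_basisD(1)[OF D] by (intro finite_PiE) auto
 have cl: "lins R n M (%_. ring_as_mod R) (%i. c i (J i))" if "J:PiE {..<n} B" for J
 by (intro linsI dual_basisD(3)[OF D]) (use that in auto)
 have b: "(tup n (%i. b i (J i))):tensor_base n M" if "J:PiE {..<n} B" for J
 using that dual_basisD(2)[OF D] by (intro tensor_base_restrict) auto
 have tc: "lin R (tensor R n M) (ring_as_mod R) (tcoef n M c J)"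
 "!!v. v:tensor_base n M ==> tcoef n M c J (pure_tensor R n M v) = (\<Otimes>i\<in>{..<n}. c i (J i) (v i))"
 if "J:PiE {..<n} B" for J
 using tcoef[where c = c and J = J, OF M cl[OF that]] by blast+
 let ?e = "%J. pure_tensor R n M (tup n (%i. b i (J i)))"
 let ?h = "%t. finsum (tensor R n M) (%J. tcoef n M c J t *[tensor R n M]
 pure_tensor R n M (tup n (%i. b i (J i)))) (PiE {..<n} B)"
 have tcc: "tcoef n M c J t:carrier R" if "J:PiE {..<n} B" "t:carrier (tensor R n M)" for J t
 using lin_closed[OF tc(1)[OF that(1)] that(2)] by simp
 have h: "lin R (tensor R n M) (tensor R n M) ?h"
 by (rule lin_sum[OF T.module_axioms T.module_axioms]) (rule tc(1), assumption, rule Pi_I, rule pure_closed[OF M b])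
 have main: "t = ?h t" if "t:carrier (tensor R n M)" for t
 proof (rule tensor_lin_eqI[OF M T.module_axioms lin_id h _ that])
 fix v assume v: "v:tensor_base n M"
 have "pure_tensor R n M v = finsum (tensor R n M) (%J. (\<Otimes>i\<in>{..<n}. c i (J i) (v i)) *[tensor R n M]
 pure_tensor R n M (tup n (%i. b i (J i)))) (PiE {..<n} B)"
 by (rule multilin_expand[OF M T.module_axioms multilin_pure[OF M], where c = "%i j. c i j (v i)"])
 (simp_all add: v dual_basisD(1,2,5)[OF D] dual_basisD(4)[OF D] tensor_baseD[OF v])
 also have "... = ?h (pure_tensor R n M v)"
 using tc(2)[OF _ v] tcc[OF _ pure_closed[OF M v]] pure_closed[OF M b]
 by (intro T.finsum_cong' refl) simp_all
 finally show "pure_tensor R n M v = ?h (pure_tensor R n M v)" .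
 qed
 show ?thesis unfolding dual_basis_def
 proof (intro conjI ballI)
 show "t = ?h t" if "t:carrier (tensor R n M)" for t by (rule main[OF that])
 show "finite (PiE {..<n} B)" by (rule fin)
 fix J assume J: "J:PiE {..<n} B"
 show "lin R (tensor R n M) (ring_as_mod R) (tcoef n M c J)" by (rule tc(1)[OF J])
 show "?e J:carrier (tensor R n M)" by (rule pure_closed[OF M b[OF J]])
 qed
qed

lemma fgp_module: "V:fg_proj_mods R ==> module R V"
 unfolding fg_proj_mods_def fg_projective_def by blast

lemma dual_basis_retract:
 assumes V: "module R V" and i: "i:mod_hom R V (free_mod R {..<n::nat})"
 and p: "p:mod_hom R (free_mod R {..<n}) V" and pi: "!!x. x:carrier V ==> p (i x) = x"
 shows "dual_basis V {..<n} (%j. p (free_basis R j)) (%j x. i x j)"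
proof -
 interpret V: module R V by fact
 let ?F = "free_mod R {..<n}"
 interpret F: module R ?F by (rule module_free)
 note p = mod_hom_lin[OF p] and i = mod_hom_lin[OF i]
 have e: "free_basis R j:carrier ?F" if "j < n" for j
 using that by (intro free_basis_carrier) auto
 have fs: "finsum ?F (%j. f j *[?F] free_basis R j) {..<n} = f" if f: "f:carrier ?F" for f
 proof -
 have coord: "lin R ?F (ring_as_mod R) (%f. f k)" for k
 by (rule linI) (auto simp: free_mod_def)
 have fj: "f j:carrier R" for j using f by (auto simp: free_mod_def)
 have "finsum ?F (%j. f j *[?F] free_basis R j) {..<n} k = f k" for k
 proof -
 have "finsum ?F (%j. f j *[?F] free_basis R j) {..<n} k =
 finsum R (%j. (f j *[?F] free_basis R j) k) {..<n}"
 using lin_finsum[OF module_free module_ring coord] e fj by (subst lin_finsum[OF module_free module_ring coord]) auto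
 also have "... = finsum R (%j. if k = j then f j else \<zero>) {..<n}"
 by (intro finsum_cong') (auto simp: free_mod_def free_basis_def fj)
 also have "... = f k"
 proof (cases "k < n")
 case True thus ?thesis using fj by (subst finsum_singleton) auto
 next
 case False
 hence "f k = \<zero>" using f by (auto simp: free_mod_def)
 moreover have "finsum R (%j. if k = j then f j else \<zero>) {..<n} = finsum R (%j. \<zero>) {..<n}"
 using False by (intro finsum_cong') auto
 ultimately show ?thesis by (simp add: finsum_zero)
 qed
 finally show ?thesis .
 qed
 thus ?thesis by auto
 qed
 have ij: "i x j:carrier R" if "x:carrier V" for x j
 using lin_closed[OF i that] by (auto simp: free_mod_def)
 show ?thesis
 unfolding dual_basis_def
 proof (intro conjI ballI)
 fix j assume "j:{..<n}"
 thus "p (free_basis R j):carrier V" using lin_closed[OF p e] by auto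
 show "lin R V (ring_as_mod R) (%x. i x j)"
 by (rule linI) (auto simp: ij lin_add[OF i] lin_smult[OF i], auto simp: free_mod_def)
 next
 fix x assume x: "x:carrier V"
 have "x = p (finsum ?F (%j. i x j *[?F] free_basis R j) {..<n})"
 using fs[OF lin_closed[OF i x]] pi[OF x] by simp
 also have "... = finsum V (%j. p (i x j *[?F] free_basis R j)) {..<n}"
 by (rule lin_finsum[OF module_free V p]) (use e ij[OF x] in auto)
 also have "... = finsum V (%j. i x j *[V] p (free_basis R j)) {..<n}"
 using e ij[OF x] lin_closed[OF p e] by (intro V.finsum_cong') (auto simp: lin_smult[OF p])
 finally show "x = finsum V (%j. i x j *[V] p (free_basis R j)) {..<n}" .
 qed simp
qed

lemma fg_projective_dual_basis:
 assumes "V:fg_proj_mods R"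
 obtains n :: nat and x \<xi> where "dual_basis V {..<n} x \<xi>"
proof -
 obtain n i p where V: "module R V" and i: "i:mod_hom R V (free_mod R {..<n::nat})"
 and p: "p:mod_hom R (free_mod R {..<n}) V" and pi: "ALL x:carrier V. p (i x) = x"
 using assms unfolding fg_proj_mods_def fg_projective_def mem_Collect_eq by (elim conjE exE) (rule that)
 show thesis by (rule that, rule dual_basis_retract[OF V i p]) (use pi in blast)
qed

end

section \<open>Blocks of positions\<close>

text \<open>The positions \<open>0, \<dots>, sum_list l - 1\<close> are cut into consecutive blocks of lengths \<open>l ! i\<close>;
 \<open>pos l i j\<close> is the \<open>j\<close>-th position of the \<open>i\<close>-th block.\<close>

definition pos :: "nat list => nat => nat => nat" where
 "pos l i j = sum_list (take i l) + j"

lemma bij_pos: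
 "bij_betw (%(i, j). pos l i j) (SIGMA i:{..<length l}. {..<l ! i}) {..<sum_list l}"
proof (induction l rule: rev_induct)
 case Nil
 show ?case by (simp add: bij_betw_def)
next
 case (snoc a l)
 let ?S = "SIGMA i:{..<length l}. {..<l ! i}"
 have S: "(SIGMA i:{..<length (l @ [a])}. {..<(l @ [a]) ! i}) = ?S\<union>{length l}\<times>{..<a}"
 by (auto simp: nth_append less_Suc_eq split: if_splits)
 have T: "{..<sum_list (l @ [a])} = {..<sum_list l}\<union>{sum_list l..<sum_list l + a}" by auto
 have "bij_betw (%(i, j). pos (l @ [a]) i j) ?S {..<sum_list l} \<longleftrightarrow>
 bij_betw (%(i, j). pos l i j) ?S {..<sum_list l}"
 by (rule bij_betw_cong) (auto simp: pos_def)
 hence 1: "bij_betw (%(i, j). pos (l @ [a]) i j) ?S {..<sum_list l}" using snoc.IH by blast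
 have 2: "bij_betw (%(i, j). pos (l @ [a]) i j) ({length l}\<times>{..<a}) {sum_list l..<sum_list l + a}"
 by (rule bij_betw_byWitness[where f' = "%r. (length l, r - sum_list l)"]) (auto simp: pos_def)
 show ?case unfolding S T by (rule bij_betw_combine[OF 1 2]) auto
qed

lemma pos_less: "i < length l ==> j < l ! i ==> pos l i j < sum_list l"
 using bij_betwE[OF bij_pos[of l]] by auto

lemma pos_inj:
 assumes "i < length l" "j < l ! i" "i' < length l" "j' < l ! i'" "pos l i j = pos l i' j'"
 shows "i = i'" "j = j'"
 using inj_onD[OF bij_betw_imp_inj_on[OF bij_pos[of l]], of "(i, j)" "(i', j')"] assms by auto

lemma pos_cases:
 assumes "r < sum_list l"
 obtains i j where "i < length l" "j < l ! i" "r = pos l i j"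
proof -
 have "r:(%(i, j). pos l i j) ` (SIGMA i:{..<length l}. {..<l ! i})"
 using bij_betw_imp_surj_on[OF bij_pos[of l]] assms by auto
 thus thesis using that by auto
qed

lemma (in comm_monoid) finprod_blocks:
 assumes "!!r. r < sum_list l ==> f r:carrier G"
 shows "finprod G f {..<sum_list l} =
 finprod G (%i. finprod G (%j. f (pos l i j)) {..<l ! i}) {..<length l}"
proof -
 have "finprod G f {..<sum_list l} =
 finprod G (%p. f (case p of (i, j) => pos l i j)) (SIGMA i:{..<length l}. {..<l ! i})"
 using bij_pos[of l] assms
 by (subst bij_betw_imp_surj_on[OF bij_pos[of l], symmetric], subst finprod_reindex)
 (auto simp: bij_betw_def pos_less)
 also have "... = finprod G (%i. finprod G (%j. f (pos l i j)) {..<l ! i}) {..<length l}"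
 using assms by (subst finprod_Sigma) (auto simp: pos_less)
 finally show ?thesis .
qed

lemma sum_blocks:
 fixes f :: "nat => 'b::comm_monoid_add"
 shows "sum f {..<sum_list l} = (\<Sum>i<length l. \<Sum>j<l ! i. f (pos l i j))"
proof -
 have "sum f {..<sum_list l} = (\<Sum>(i, j)\<in>(SIGMA i:{..<length l}. {..<l ! i}). f (pos l i j))"
 using sum.reindex_bij_betw[OF bij_pos[of l], of f] by (simp add: case_prod_unfold)
 thus ?thesis by (simp add: sum.Sigma)
qed

lemma idxI: "(!!r. r < d ==> f r:A r) ==> (tup d (%r. f r)):PiE {..<d} A"
 by (simp add: restrict_PiE_iff)

lemma idxD: "J:PiE {..<d} A ==> r < d ==> J r:A r"
 by (simp add: PiE_iff)

definition blk :: "nat list => (nat => 'b) => nat => nat => 'b" where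
 "blk l J i = (tup (l ! i) (%j. J (pos l i j)))"

definition glue :: "nat list => (nat => nat => 'b) => nat => 'b" where
 "glue l K = (\<lambda>r\<in>{..<sum_list l}.
 (%(i, j). K i j) (inv_into (SIGMA i:{..<length l}. {..<l ! i}) (%(i, j). pos l i j) r))"

lemma blk_PiE: "J:Idx (sum_list l) A ==> i < length l ==> blk l J i:Idx (l ! i) A"
 unfolding blk_def by (rule idxI) (rule idxD, assumption, rule pos_less)

lemma glue_pos: "i < length l ==> j < l ! i ==> glue l K (pos l i j) = K i j"
 using bij_betw_inv_into_left[OF bij_pos[of l], of "(i, j)"] by (simp add: glue_def pos_less)

lemma glue_PiE:
 assumes "!!i. i < length l ==> K i:Idx (l ! i) A"
 shows "glue l K:Idx (sum_list l) A"
proof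
 fix r assume "r:{..<sum_list l}"
 then obtain i j where r: "i < length l" "j < l ! i" "r = pos l i j" using pos_cases by blast
 thus "glue l K r:A" using idxD[OF assms[OF r(1)] r(2)] glue_pos[OF r(1,2), of K] by simp
qed (simp add: glue_def)

lemma blk_glue: "i < length l ==> K i:Idx (l ! i) A ==> blk l (glue l K) i = K i"
 by (simp add: blk_def glue_pos fun_eq_iff PiE_iff extensional_def)

lemma blk_eqI:
 assumes "J:Idx (sum_list l) A" "J':Idx (sum_list l) A'"
 "!!i. i < length l ==> blk l J i = blk l J' i"
 shows "J = J'"
proof
 fix r
 show "J r = J' r"
 proof (cases "r < sum_list l")
 case True
 then obtain i j where r: "i < length l" "j < l ! i" "r = pos l i j" using pos_cases by blast
 thus ?thesis using fun_cong[OF assms(3)[OF r(1)], of j] by (simp add: blk_def)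
 next
 case False thus ?thesis using assms(1,2) by (simp add: PiE_iff extensional_def)
 qed
qed

section \<open>Tensor powers\<close>

context cring
begin

abbreviation tb :: "nat => ('a, 'u) module => ('i => 'u) => (nat => 'i) => ('a, 'u) tensor" where
 "tb d V x J \<equiv> tpure R d V (tup d (%r. x (J r)))"

abbreviation tc :: "nat => ('a, 'u) module => ('i => 'u => 'a) => (nat => 'i) => ('a, 'u) tensor => 'a" where
 "tc d V \<xi> \<equiv> tcoef d (%_. V) (%_. \<xi>)"

lemma module_tpow: "module R V ==> module R (tpow R d V)"
 unfolding tpow_def by (rule module_tensor[OF modules_const])

lemma modules_tpow: "module R V ==> modules R n (%i. tpow R (l ! i) V)"
 by (simp add: modules_def module_tpow)

lemma multilin_tpure: "module R V ==> multilin R d (%_. V) (tpow R d V) (tpure R d V)"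
 unfolding tpow_def tpure_def by (rule multilin_pure[OF modules_const])

lemmas tpure_closed = multilin_closed[OF multilin_tpure]

lemma tpow_lin_eqI:
 assumes "module R V" "module R N" "lin R (tpow R d V) N f" "lin R (tpow R d V) N g"
 and "!!v. v:tensor_base d (%_. V) ==> f (tpure R d V v) = g (tpure R d V v)"
 and "t:Tens d V"
 shows "f t = g t"
 by (rule tensor_lin_eqI[OF modules_const[OF assms(1)] assms(2) assms(3,4)[unfolded tpow_def] assms(5)[unfolded tpure_def]
 assms(6)[unfolded tpow_def]])

lemma tpow_lift:
 assumes "module R V" "module R N" "multilin R d (%_. V) N m"
 shows "tensor_lift R d (%_. V) N m:mod_hom R (tpow R d V) N"
 and "!!v. v:tensor_base d (%_. V) ==> tensor_lift R d (%_. V) N m (tpure R d V v) = m v"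
 unfolding tpow_def tpure_def using tensor_lift[OF modules_const[OF assms(1)] assms(2,3)] by auto

lemma dual_basis_tpow:
 assumes "module R V" "dual_basis V B x \<xi>"
 shows "dual_basis (tpow R d V) (Idx d B) (tb d V x) (tc d V \<xi>)"
 unfolding tpow_def tpure_def
 by (rule dual_basis_tensor[OF modules_const[OF assms(1)]]) (rule assms(2))

lemma tc_pure:
 assumes "module R V" "dual_basis V B x \<xi>" "J:Idx d B" "v:tensor_base d (%_. V)"
 shows "tc d V \<xi> J (tpure R d V v) = (\<Otimes>r\<in>{..<d}. \<xi> (J r) (v r))"
 unfolding tpure_def
proof (rule tcoef(2)[OF modules_const[OF assms(1)] linsI assms(4)])
 show "lin R V (ring_as_mod R) (\<xi> (J i))" if "i < d" for i
 using that by (intro dual_basisD(3)[OF assms(2)] idxD[OF assms(3)])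
qed

lemma multilin_perm:
 assumes V: "module R V" and s: "bij_betw \<sigma> {..<d} {..<d}"
 shows "multilin R d (%_. V) (tpow R d V) (%v. tpure R d V (tup d (%r. v (\<sigma> r))))"
 unfolding multilin_def
proof (intro conjI ballI allI impI)
 have s': "\<sigma> r < d" if "r < d" for r using bij_betwE[OF s] that by auto
 fix v assume v: "v:tensor_base d (%_. V)"
 have b: "(tup d (%r. v (\<sigma> r))):tensor_base d (%_. V)"
 using s' by (intro tensor_base_restrict tensor_baseD[OF v])
 thus "tpure R d V (tup d (%r. v (\<sigma> r))):Tens d V" using V by (rule tpure_closed[rotated])
 fix i assume i: "i < d"
 obtain k where k: "k < d" "\<sigma> k = i" using bij_betw_imp_surj_on[OF s] i by (metis imageE lessThan_iff)
 have "\<sigma> r = i \<longleftrightarrow> r = k" if "r < d" for r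
 using k that inj_onD[OF bij_betw_imp_inj_on[OF s], of r k] by auto
 hence "(tup d (%r. (v(i := y)) (\<sigma> r))) = (tup d (%r. v (\<sigma> r)))(k := y)" for y
 using k by (auto simp: fun_eq_iff)
 thus "lin R V (tpow R d V) (%y. tpure R d V (tup d (%r. (v(i := y)) (\<sigma> r))))"
 using multilin_slice[OF multilin_tpure[OF V] b k(1)] by simp
qed

lemma tperm:
 assumes "module R V" "bij_betw \<sigma> {..<d} {..<d}"
 shows "tperm R d V \<sigma>:mod_hom R (tpow R d V) (tpow R d V)"
 and "!!v. v:tensor_base d (%_. V) ==>
 tperm R d V \<sigma> (tpure R d V v) = tpure R d V (tup d (%r. v (\<sigma> r)))"
 unfolding tperm_def using tpow_lift[OF assms(1) module_tpow[OF assms(1)] multilin_perm[OF assms]] by auto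

lemma tperm_cong: "(!!r. r < d ==> \<sigma> r = \<tau> r) ==> tperm R d V \<sigma> = tperm R d V \<tau>"
proof -
 assume "!!r. r < d ==> \<sigma> r = \<tau> r"
 hence "(tup d (%r. v (\<sigma> r))) = (tup d (%r. v (\<tau> r)))" for v :: "nat => 'c" by auto
 thus ?thesis unfolding tperm_def by presburger
qed

lemmas tperm_lin = mod_hom_lin[OF tperm(1)]

lemma tperm_base:
 assumes "bij_betw \<sigma> {..<d} {..<d}" "v:tensor_base d M"
 shows "(!!i j. M i = M j) ==> (tup d (%r. v (\<sigma> r))):tensor_base d M"
proof -
 assume M: "!!i j. M i = M j"
 show ?thesis
 proof (rule tensor_base_restrict)
 fix r assume "r < d"
 hence "\<sigma> r < d" using bij_betwE[OF assms(1)] by auto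
 thus "v (\<sigma> r):carrier (M r)" using tensor_baseD[OF assms(2)] M by metis
 qed
qed

lemma tc_tperm:
 assumes V: "module R V" and D: "dual_basis V B x \<xi>" and s: "bij_betw \<sigma> {..<d} {..<d}"
 and J: "J:Idx d B" and t: "t:Tens d V"
 shows "tc d V \<xi> (tup d (%r. J (\<sigma> r))) (tperm R d V \<sigma> t) = tc d V \<xi> J t"
proof -
 have s': "\<sigma> r < d" if "r < d" for r using bij_betwE[OF s] that by auto
 have J': "(tup d (%r. J (\<sigma> r))):Idx d B" using s' by (intro idxI idxD[OF J])
 note dT = dual_basisD(3)[OF dual_basis_tpow[OF V D]]
 show ?thesis
 proof (rule tpow_lin_eqI[OF V module_ring lin_comp[OF tperm_lin[OF V s] dT[OF J']] dT[OF J] _ t])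
 fix v assume v: "v:tensor_base d (%_. V)"
 have cl: "\<xi> (J r) (v r):carrier R" if "r < d" for r
 using that by (intro dual_basisD(5)[OF D] idxD[OF J] tensor_baseD[OF v])
 have "tc d V \<xi> (tup d (%r. J (\<sigma> r))) (tperm R d V \<sigma> (tpure R d V v)) =
 (\<Otimes>r\<in>{..<d}. \<xi> (J (\<sigma> r)) (v (\<sigma> r)))"
 unfolding tperm(2)[OF V s v]
 using cl s' by (subst tc_pure[OF V D J' tperm_base[OF s v]]) (auto intro!: finprod_cong')
 also have "... = (\<Otimes>r\<in>\<sigma> ` {..<d}. \<xi> (J r) (v r))"
 using cl s' bij_betw_imp_inj_on[OF s] by (subst finprod_reindex) auto
 also have "... = tc d V \<xi> J (tpure R d V v)"
 unfolding bij_betw_imp_surj_on[OF s] tc_pure[OF V D J v] ..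
 finally show "tc d V \<xi> (tup d (%r. J (\<sigma> r))) (tperm R d V \<sigma> (tpure R d V v)) = tc d V \<xi> J (tpure R d V v)" .
 qed
qed

section \<open>Splitting tensor powers into blocks\<close>

lemma blk_base: "v:tensor_base (sum_list l) (%_. V) ==> i < length l ==> blk l v i:tensor_base (l ! i) (%_. V)"
 unfolding tensor_base_def by (rule blk_PiE)

lemma multilin_split:
 assumes V: "module R V"
 shows "multilin R (sum_list l) (%_. V) (tensor R (length l) (%i. tpow R (l ! i) V))
 (%v. pure_tensor R (length l) (%i. tpow R (l ! i) V) (tup (length l) (%i. tpure R (l ! i) V (blk l v i))))"
 unfolding multilin_def
proof (intro conjI ballI allI impI)
 let ?T = "%i. tpow R (l ! i) V"
 have mp: "multilin R (length l) ?T (tensor R (length l) ?T) (pure_tensor R (length l) ?T)"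
 by (rule multilin_pure[OF modules_tpow[OF V]])
 fix v assume v: "v:tensor_base (sum_list l) (%_. V)"
 have b: "(tup (length l) (%i. tpure R (l ! i) V (blk l v i))):tensor_base (length l) ?T"
 using v V by (intro tensor_base_restrict tpure_closed blk_base)
 thus "pure_tensor R (length l) ?T (tup (length l) (%i. tpure R (l ! i) V (blk l v i))) :
 carrier (tensor R (length l) ?T)"
 by (rule multilin_closed[OF mp])
 fix r assume "r < sum_list l"
 then obtain i j where r: "i < length l" "j < l ! i" "r = pos l i j" using pos_cases by blast
 have blk_upd: "blk l (v(r := y)) i' = (if i' = i then (blk l v i)(j := y) else blk l v i')" if "i' < length l" for i' y
 proof -
 have "pos l i' j' = pos l i j \<longleftrightarrow> i' = i & j' = j" if "j' < l ! i'" for j'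
 using pos_inj[OF \<open>i' < length l\<close> that r(1,2)] by auto
 thus ?thesis using r by (auto simp: blk_def fun_eq_iff)
 qed
 have "(tup (length l) (%i. tpure R (l ! i) V (blk l (v(r := y)) i))) =
 (tup (length l) (%i. tpure R (l ! i) V (blk l v i)))(i := tpure R (l ! i) V ((blk l v i)(j := y)))" for y
 proof
 fix i'
 show "(tup (length l) (%i. tpure R (l ! i) V (blk l (v(r := y)) i))) i' =
 ((tup (length l) (%i. tpure R (l ! i) V (blk l v i)))(i := tpure R (l ! i) V ((blk l v i)(j := y)))) i'"
 using r(1) by (cases "i' < length l") (simp_all add: blk_upd)
 qed
 thus "lin R V (tensor R (length l) ?T) (%y. pure_tensor R (length l) ?T
 (tup (length l) (%i. tpure R (l ! i) V (blk l (v(r := y)) i))))"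
 using lin_comp[OF multilin_slice[OF multilin_tpure[OF V] blk_base[OF v r(1)] r(2)]
 multilin_slice[OF mp b r(1)]] by simp
qed

lemma tsplit:
 assumes V: "module R V"
 shows "tsplit R l V:mod_hom R (tpow R (sum_list l) V) (tensor R (length l) (%i. tpow R (l ! i) V))"
 and "!!v. v:tensor_base (sum_list l) (%_. V) ==> tsplit R l V (tpure R (sum_list l) V v) =
 pure_tensor R (length l) (%i. tpow R (l ! i) V) (tup (length l) (%i. tpure R (l ! i) V (blk l v i)))"
 unfolding tsplit_def pos_def[symmetric] blk_def[symmetric]
 using tpow_lift[OF V module_tensor[OF modules_tpow[OF V]] multilin_split[OF V]] by auto

lemmas tsplit_lin = mod_hom_lin[OF tsplit(1)]

abbreviation tcc :: "nat list => ('a, 'u) module => ('i => 'u => 'a) => (nat => nat => 'i) =>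
 ('a, ('a, 'u) tensor) tensor => 'a" where
 "tcc l V \<xi> \<equiv> tcoef (length l) (%i. tpow R (l ! i) V) (%i. tc (l ! i) V \<xi>)"

lemma tcc_lin:
 assumes "module R V" "dual_basis V B x \<xi>" "!!i. i < length l ==> K i:Idx (l ! i) B"
 shows "lin R (tensor R (length l) (%i. tpow R (l ! i) V)) (ring_as_mod R) (tcc l V \<xi> K)"
 using assms by (intro tcoef(1) modules_tpow linsI dual_basisD(3)[OF dual_basis_tpow])

lemma tcc_tsplit:
 assumes V: "module R V" and D: "dual_basis V B x \<xi>" and J: "J:Idx (sum_list l) B"
 and t: "t:Tens (sum_list l) V"
 shows "tcc l V \<xi> (blk l J) (tsplit R l V t) = tc (sum_list l) V \<xi> J t"
proof (rule tpow_lin_eqI[OF V module_ring lin_comp[OF tsplit_lin[OF V]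
 tcc_lin[OF V D blk_PiE[OF J]]] dual_basisD(3)[OF dual_basis_tpow[OF V D] J] _ t])
 fix v assume v: "v:tensor_base (sum_list l) (%_. V)"
 have cl: "\<xi> (J r) (v r):carrier R" if "r < sum_list l" for r
 using that by (intro dual_basisD(5)[OF D] idxD[OF J] tensor_baseD[OF v])
 have base: "(tup (length l) (%i. tpure R (l ! i) V (blk l v i))):tensor_base (length l) (%i. tpow R (l ! i) V)"
 using v V by (intro tensor_base_restrict tpure_closed blk_base)
 have lins: "lins R (length l) (%i. tpow R (l ! i) V) (%_. ring_as_mod R) (%i. tc (l ! i) V \<xi> (blk l J i))"
 by (intro linsI dual_basisD(3)[OF dual_basis_tpow[OF V D]] blk_PiE[OF J])
 have "tcc l V \<xi> (blk l J) (tsplit R l V (tpure R (sum_list l) V v)) =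
 (\<Otimes>i\<in>{..<length l}. tc (l ! i) V \<xi> (blk l J i) ((tup (length l) (%i. tpure R (l ! i) V (blk l v i))) i))"
 unfolding tsplit(2)[OF V v] by (rule tcoef(2)[where J = "blk l J" and c = "%i. tc (l ! i) V \<xi>", OF modules_tpow[OF V] lins base])
 also have "... = (\<Otimes>i\<in>{..<length l}. \<Otimes>j\<in>{..<l ! i}. \<xi> (J (pos l i j)) (v (pos l i j)))"
 proof (rule finprod_cong')
 fix i assume i: "i:{..<length l}"
 thus "tc (l ! i) V \<xi> (blk l J i) ((tup (length l) (%i. tpure R (l ! i) V (blk l v i))) i) =
 (\<Otimes>j\<in>{..<l ! i}. \<xi> (J (pos l i j)) (v (pos l i j)))"
 using tc_pure[OF V D blk_PiE[OF J] blk_base[OF v]] cl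
 by (auto intro!: finprod_cong' simp: blk_def pos_less)
 qed (auto intro!: finprod_closed simp: cl pos_less)
 also have "... = tc (sum_list l) V \<xi> J (tpure R (sum_list l) V v)"
 unfolding tc_pure[OF V D J v] using cl by (subst finprod_blocks) auto
 finally show "tcc l V \<xi> (blk l J) (tsplit R l V (tpure R (sum_list l) V v)) =
 tc (sum_list l) V \<xi> J (tpure R (sum_list l) V v)" .
qed

lemma tsplit_inj:
 assumes V: "V:fg_proj_mods R"
 shows "inj_on (tsplit R l V) (Tens (sum_list l) V)"
proof (rule inj_onI)
 have M: "module R V" by (rule fgp_module[OF V])
 obtain n :: nat and x \<xi> where D: "dual_basis V {..<n} x \<xi>" using fg_projective_dual_basis[OF V] .
 fix s t assume s: "s:Tens (sum_list l) V" and t: "t:Tens (sum_list l) V"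
 and eq: "tsplit R l V s = tsplit R l V t"
 show "s = t"
 proof (rule dual_basis_eqI[OF dual_basis_tpow[OF M D] module_tpow[OF M] s t])
 fix J assume "J:Idx (sum_list l) {..<n}"
 thus "tc (sum_list l) V \<xi> J s = tc (sum_list l) V \<xi> J t"
 using tcc_tsplit[OF M D _ s] tcc_tsplit[OF M D _ t] eq by metis
 qed
qed

lemma tsplit_surj:
 assumes V: "module R V"
 shows "tsplit R l V ` Tens (sum_list l) V = carrier (tensor R (length l) (%i. tpow R (l ! i) V))"
 (is "?I = carrier ?T")
proof
 let ?M = "%i. tpow R (l ! i) V"
 let ?G = "%i. tpure R (l ! i) V ` tensor_base (l ! i) (%_. V)"
 have M: "modules R (length l) ?M" by (rule modules_tpow[OF V])
 have sub: "submodule ?I R ?T"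
 by (intro submodule_image module_tpow[OF V] module_tensor M tsplit_lin[OF V])
 have G: "?G i<=carrier (?M i)" for i using V by (auto intro: tpure_closed)
 have "pure_tensor R (length l) ?M ` tensor_base (length l) ?M<=?I"
 proof (rule image_subsetI)
 fix u assume u: "u:tensor_base (length l) ?M"
 show "pure_tensor R (length l) ?M u:?I"
 proof (rule multilin_in_submodule[OF M module_tensor[OF M] multilin_pure[OF M] sub G _ u])
 fix w assume w: "w:PiE {..<length l} ?G"
 have "ALL i:{..<length l}. EX v. v:tensor_base (l ! i) (%_. V) & w i = tpure R (l ! i) V v"
 proof
 fix i assume "i:{..<length l}"
 hence "w i:?G i" using idxD[OF w] by blast
 thus "EX v. v:tensor_base (l ! i) (%_. V) & w i = tpure R (l ! i) V v" by blast
 qed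
 then obtain K where K: "!!i. i < length l ==> K i:tensor_base (l ! i) (%_. V)"
 "!!i. i < length l ==> w i = tpure R (l ! i) V (K i)" by (metis lessThan_iff)
 have g: "glue l K:tensor_base (sum_list l) (%_. V)"
 using glue_PiE[of l K "carrier V"] K(1) by (auto simp: tensor_base_def)
 have "w = (tup (length l) (%i. tpure R (l ! i) V (blk l (glue l K) i)))"
 proof
 fix i
 show "w i = (tup (length l) (%i. tpure R (l ! i) V (blk l (glue l K) i))) i"
 using w K blk_glue[of i l K "carrier V"]
 by (cases "i < length l") (simp_all add: tensor_base_def PiE_iff extensional_def)
 qed
 hence "pure_tensor R (length l) ?M w = tsplit R l V (tpure R (sum_list l) V (glue l K))"
 using tsplit(2)[OF V g] by simp
 thus "pure_tensor R (length l) ?M w:?I" using tpure_closed[OF V g] by blast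
 next
 fix i assume "i < length l"
 thus "u i:mod_span R (?M i) (?G i)"
 using tensor_span[OF modules_const[OF V], of _ "l ! i"] tensor_baseD[OF u]
 by (auto simp: tpow_def tpure_def)
 qed
 qed
 thus "carrier ?T<=?I"
 using tensor_span[OF M] mod_span_least[OF sub] by blast
qed (use lin_closed[OF tsplit_lin[OF V]] in auto)

lemma tjoin:
 assumes V: "V:fg_proj_mods R"
 shows "tjoin R l V:mod_hom R (tensor R (length l) (%i. tpow R (l ! i) V)) (tpow R (sum_list l) V)"
 and "!!t. t:Tens (sum_list l) V ==> tjoin R l V (tsplit R l V t) = t"
 and "!!u. u:carrier (tensor R (length l) (%i. tpow R (l ! i) V)) ==> tsplit R l V (tjoin R l V u) = u"
proof -
 let ?T = "tensor R (length l) (%i. tpow R (l ! i) V)" and ?P = "tpow R (sum_list l) V"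
 have M: "module R V" by (rule fgp_module[OF V])
 interpret P: module R ?P by (rule module_tpow[OF M])
 note S = tsplit_lin[OF M, of l]
 show 1: "tjoin R l V (tsplit R l V t) = t" if "t:carrier ?P" for t
 using inv_into_f_f[OF tsplit_inj[OF V] that] lin_closed[OF S that] by (simp add: tjoin_def)
 have ex: "EX t:carrier ?P. u = tsplit R l V t" if "u:carrier ?T" for u
 using tsplit_surj[OF M, of l] that by blast
 show "tsplit R l V (tjoin R l V u) = u" if "u:carrier ?T" for u
 using ex[OF that] 1 by auto
 show "tjoin R l V:mod_hom R ?T ?P"
 unfolding mod_hom_iff
 proof (intro conjI linI)
 fix u w assume "u:carrier ?T" "w:carrier ?T"
 then obtain s t where "s:carrier ?P" "t:carrier ?P" "u = tsplit R l V s" "w = tsplit R l V t"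
 using ex by metis
 thus "tjoin R l V (u +[?T] w) = tjoin R l V u +[?P] tjoin R l V w"
 using lin_add[OF S, symmetric] 1 by simp
 next
 fix c u assume c: "c:carrier R" and "u:carrier ?T"
 then obtain s where "s:carrier ?P" "u = tsplit R l V s" using ex by metis
 thus "tjoin R l V (c *[?T] u) = c *[?P] tjoin R l V u"
 using lin_smult[OF S c, symmetric] 1 c by simp
 next
 fix u assume "u:carrier ?T"
 then obtain s where "s:carrier ?P" "u = tsplit R l V s" using ex by metis
 thus "tjoin R l V u:carrier ?P" using 1 by simp
 qed (simp add: tjoin_def)
qed

lemmas tjoin_lin = mod_hom_lin[OF tjoin(1)]

end

section \<open>Representations of the category of divided powers\<close>

context cring
begin

lemma module_hom_mod:
 assumes M: "module R M" and N: "module R N"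
 shows "module R (hom_mod R M N)"
proof -
 interpret M: module R M by fact
 interpret N: module R N by fact
 let ?H = "hom_mod R M N"
 have car: "carrier ?H = mod_hom R M N" by (simp add: hom_mod_def)
 have cl: "f x:carrier N" if "f:mod_hom R M N" "x:carrier M" for f x
 using lin_closed[OF mod_hom_lin[OF that(1)] that(2)] .
 have add: "f +[?H] g = restrict (%x. f x +[N] g x) (carrier M)" for f g
 by (simp add: hom_mod_def)
 have sm: "c *[?H] f = restrict (%x. c *[N] f x) (carrier M)" for c f
 by (simp add: hom_mod_def)
 have ze: "\<zero>[?H] = restrict (%x. \<zero>[N]) (carrier M)" by (simp add: hom_mod_def)
 have add_cl: "f +[?H] g:mod_hom R M N" if "f:mod_hom R M N" "g:mod_hom R M N" for f g
 unfolding add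
 proof (rule lin_restrict[OF M], rule linI)
 note f = mod_hom_lin[OF that(1)] and g = mod_hom_lin[OF that(2)]
 fix x y assume xy: "x:carrier M" "y:carrier M"
 show "f (x +[M] y) +[N] g (x +[M] y) = f x +[N] g x +[N] (f y +[N] g y)"
 using xy lin_closed[OF f] lin_closed[OF g] by (simp add: lin_add[OF f] lin_add[OF g] N.a_ac)
 next
 note f = mod_hom_lin[OF that(1)] and g = mod_hom_lin[OF that(2)]
 fix c x assume "c:carrier R" "x:carrier M"
 thus "f (c *[M] x) +[N] g (c *[M] x) = c *[N] (f x +[N] g x)"
 using lin_closed[OF f] lin_closed[OF g] by (simp add: lin_smult[OF f] lin_smult[OF g] N.smult_r_distr)
 qed (simp add: cl that)
 have sm_cl: "c *[?H] f:mod_hom R M N" if "c:carrier R" "f:mod_hom R M N" for c f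
 unfolding sm
 proof (rule lin_restrict[OF M], rule linI)
 note f = mod_hom_lin[OF that(2)]
 fix x y assume "x:carrier M" "y:carrier M"
 thus "c *[N] f (x +[M] y) = c *[N] f x +[N] c *[N] f y"
 using lin_closed[OF f] that(1) by (simp add: lin_add[OF f] N.smult_r_distr)
 next
 note f = mod_hom_lin[OF that(2)]
 fix b x assume "b:carrier R" "x:carrier M"
 thus "c *[N] f (b *[M] x) = b *[N] (c *[N] f x)"
 using lin_closed[OF f] that(1) by (simp add: lin_smult[OF f] N.smult_assoc1[symmetric] m_comm)
 qed (simp add: cl that)
 have ze_cl: "\<zero>[?H]:mod_hom R M N"
 unfolding ze by (rule lin_restrict[OF M], rule linI) simp_all
 have ext: "restrict f (carrier M) = f" if "f:mod_hom R M N" for f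
 using that by (simp add: mod_hom_iff extensional_restrict)
 have eqI: "f = g" if "f:mod_hom R M N" "g:mod_hom R M N" "!!x. x:carrier M ==> f x = g x" for f g
 by (rule mod_hom_eqI[OF that])
 show ?thesis
 proof (rule moduleI)
 show "abelian_group ?H"
 proof (rule abelian_groupI, unfold car)
 fix f assume f: "f:mod_hom R M N"
 show "\<zero>[?H] +[?H] f = f"
 by (rule eqI[OF add_cl[OF ze_cl f] f]) (simp add: add ze cl[OF f])
 show "EX g:mod_hom R M N. g +[?H] f = \<zero>[?H]"
 proof
 have m: "\<ominus> \<one>:carrier R" by simp
 show 1: "(\<ominus> \<one>) *[?H] f:mod_hom R M N" by (rule sm_cl[OF m f])
 show "(\<ominus> \<one>) *[?H] f +[?H] f = \<zero>[?H]"
 by (rule eqI[OF add_cl[OF 1 f] ze_cl]) (simp add: add sm ze cl[OF f] N.smult_l_minus N.l_neg)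
 qed
 next
 fix f g assume f: "f:mod_hom R M N" and g: "g:mod_hom R M N"
 show "f +[?H] g = g +[?H] f"
 by (rule eqI[OF add_cl[OF f g] add_cl[OF g f]]) (simp add: add cl[OF f] cl[OF g] N.a_comm)
 fix h assume h: "h:mod_hom R M N"
 show "f +[?H] g +[?H] h = f +[?H] (g +[?H] h)"
 by (rule eqI[OF add_cl[OF add_cl[OF f g] h] add_cl[OF f add_cl[OF g h]]])
 (simp add: add cl[OF f] cl[OF g] cl[OF h] N.a_assoc)
 qed (simp_all add: add_cl ze_cl)
 next
 fix a b f assume a: "a:carrier R" and b: "b:carrier R" and "f:carrier ?H"
 hence f: "f:mod_hom R M N" by (simp add: car)
 show "(a \<oplus> b) *[?H] f = a *[?H] f +[?H] b *[?H] f"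
 by (rule eqI) (simp_all add: add_cl sm_cl a b f, simp add: add sm a b cl[OF f] N.smult_l_distr)
 show "(a\<otimes>b) *[?H] f = a *[?H] (b *[?H] f)"
 by (rule eqI) (simp_all add: sm_cl a b f, simp add: sm a b cl[OF f] N.smult_assoc1)
 next
 fix a f g assume a: "a:carrier R" and "f:carrier ?H" "g:carrier ?H"
 hence f: "f:mod_hom R M N" and g: "g:mod_hom R M N" by (simp_all add: car)
 show "a *[?H] (f +[?H] g) = a *[?H] f +[?H] a *[?H] g"
 by (rule eqI) (simp_all add: add_cl sm_cl a f g, simp add: add sm a cl[OF f] cl[OF g] N.smult_r_distr)
 next
 fix f assume "f:carrier ?H"
 hence f: "f:mod_hom R M N" by (simp add: car)
 show "\<one> *[?H] f = f" by (rule eqI) (simp_all add: sm_cl f, simp add: sm cl[OF f])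
 qed (simp_all add: car sm_cl is_cring)
qed

text \<open>Linearity into a module of linear maps is checked pointwise.\<close>

lemma lin_hom_modI:
 assumes "!!x. x:carrier P ==> f x:mod_hom R M N" "module R M" "module R N" "module R P"
 and "!!y. y:carrier M ==> lin R P N (%x. f x y)"
 shows "lin R P (hom_mod R M N) f"
proof (rule linI)
 interpret P: module R P by fact
 interpret H: module R "hom_mod R M N" by (rule module_hom_mod) fact+
 have car: "carrier (hom_mod R M N) = mod_hom R M N" by (simp add: hom_mod_def)
 show "f x:carrier (hom_mod R M N)" if "x:carrier P" for x using assms(1)[OF that] by (simp add: car)
 fix x y assume x: "x:carrier P" and y: "y:carrier P"
 show "f (x +[P] y) = f x +[hom_mod R M N] f y"
 proof (rule mod_hom_eqI[OF assms(1)])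
 show "f x +[hom_mod R M N] f y:mod_hom R M N"
 using H.add.m_closed[of "f x" "f y"] assms(1) x y by (simp add: car)
 qed (use x y in "simp_all add: hom_mod_def lin_add[OF assms(5)]")
next
 interpret P: module R P by fact
 interpret H: module R "hom_mod R M N" by (rule module_hom_mod) fact+
 have car: "carrier (hom_mod R M N) = mod_hom R M N" by (simp add: hom_mod_def)
 fix c x assume c: "c:carrier R" and x: "x:carrier P"
 show "f (c *[P] x) = c *[hom_mod R M N] f x"
 proof (rule mod_hom_eqI[OF assms(1)])
 show "c *[hom_mod R M N] f x:mod_hom R M N"
 using H.smult_closed[of c "f x"] assms(1) x c by (simp add: car)
 qed (use x c in "simp_all add: hom_mod_def lin_smult[OF assms(5)]")
qed

lemma lin_hom_mod_apply:
 assumes "lin R P (hom_mod R M N) f" "y:carrier M"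
 shows "lin R P N (%x. f x y)"
proof (rule linI)
 fix x assume "x:carrier P"
 hence "f x:mod_hom R M N" using lin_closed[OF assms(1)] by (simp add: hom_mod_def)
 thus "f x y:carrier N" using lin_closed[OF mod_hom_lin assms(2)] by blast
qed (simp_all add: lin_add[OF assms(1)] lin_smult[OF assms(1)], simp_all add: hom_mod_def assms(2))

lemma lin_hom_mod_closed: "lin R P (hom_mod R M N) f ==> x:carrier P ==> f x:mod_hom R M N"
 using lin_closed by (fastforce simp: hom_mod_def)

lemma sp_hom_iff:
 "\<phi>:Homs d V W \<longleftrightarrow> \<phi>:mod_hom R (tpow R d V) (tpow R d W) &
 (ALL \<sigma>. \<sigma> permutes {..<d} -->
 (ALL t:Tens d V. \<phi> (tperm R d V \<sigma> t) = tperm R d W \<sigma> (\<phi> t)))"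
 by (simp add: sp_hom_def)

lemma sp_hom_lin: "\<phi>:Homs d V W ==> lin R (tpow R d V) (tpow R d W) \<phi>"
 and sp_hom_mod_hom: "\<phi>:Homs d V W ==> \<phi>:mod_hom R (tpow R d V) (tpow R d W)"
 and sp_hom_perm: "\<phi>:Homs d V W ==> \<sigma> permutes {..<d} ==> t:Tens d V ==>
 \<phi> (tperm R d V \<sigma> t) = tperm R d W \<sigma> (\<phi> t)"
 by (auto simp: sp_hom_iff mod_hom_lin)

lemma submodule_sp_hom:
 assumes V: "module R V" and W: "module R W"
 shows "submodule (Homs d V W) R (hom_mod R (tpow R d V) (tpow R d W))"
proof -
 let ?V = "tpow R d V" and ?W = "tpow R d W"
 let ?H = "hom_mod R ?V ?W"
 interpret V: module R ?V by (rule module_tpow[OF V])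
 interpret W: module R ?W by (rule module_tpow[OF W])
 interpret H: module R ?H by (rule module_hom_mod[OF V.module_axioms W.module_axioms])
 have car: "carrier ?H = mod_hom R ?V ?W" by (simp add: hom_mod_def)
 have pV: "lin R ?V ?V (tperm R d V \<sigma>)" and pW: "lin R ?W ?W (tperm R d W \<sigma>)"
 if "\<sigma> permutes {..<d}" for \<sigma>
 using permutes_imp_bij[OF that] by (intro tperm_lin V W; assumption)+
 show ?thesis
 proof (rule submoduleI'[OF H.module_axioms])
 show "Homs d V W<=carrier ?H" by (auto simp: sp_hom_iff car)
 show "\<zero>[?H]:Homs d V W"
 unfolding sp_hom_iff
 proof (intro conjI allI impI ballI)
 show "\<zero>[?H]:mod_hom R ?V ?W" using H.zero_closed car by simp
 fix \<sigma> t assume s: "\<sigma> permutes {..<d}" and t: "t:carrier ?V"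
 show "\<zero>[?H] (tperm R d V \<sigma> t) = tperm R d W \<sigma> (\<zero>[?H] t)"
 using t lin_closed[OF pV[OF s] t] lin_zero[OF W.module_axioms W.module_axioms pW[OF s]]
 by (simp add: hom_mod_def)
 qed
 next
 fix f g assume f: "f:Homs d V W" and g: "g:Homs d V W"
 show "f +[?H] g:Homs d V W"
 unfolding sp_hom_iff
 proof (intro conjI allI impI ballI)
 show "f +[?H] g:mod_hom R ?V ?W"
 using H.add.m_closed[of f g] sp_hom_mod_hom[OF f] sp_hom_mod_hom[OF g] car by simp
 fix \<sigma> t assume s: "\<sigma> permutes {..<d}" and t: "t:carrier ?V"
 have "f t:carrier ?W" "g t:carrier ?W"
 using lin_closed[OF sp_hom_lin[OF f] t] lin_closed[OF sp_hom_lin[OF g] t] by auto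
 thus "(f +[?H] g) (tperm R d V \<sigma> t) = tperm R d W \<sigma> ((f +[?H] g) t)"
 using t lin_closed[OF pV[OF s] t] sp_hom_perm[OF f s t] sp_hom_perm[OF g s t]
 by (simp add: hom_mod_def lin_add[OF pW[OF s]])
 qed
 next
 fix c f assume c: "c:carrier R" and f: "f:Homs d V W"
 show "c *[?H] f:Homs d V W"
 unfolding sp_hom_iff
 proof (intro conjI allI impI ballI)
 show "c *[?H] f:mod_hom R ?V ?W"
 using H.smult_closed[of c f] sp_hom_mod_hom[OF f] c car by simp
 fix \<sigma> t assume s: "\<sigma> permutes {..<d}" and t: "t:carrier ?V"
 have "f t:carrier ?W" using lin_closed[OF sp_hom_lin[OF f] t] by auto
 thus "(c *[?H] f) (tperm R d V \<sigma> t) = tperm R d W \<sigma> ((c *[?H] f) t)"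
 using t c lin_closed[OF pV[OF s] t] sp_hom_perm[OF f s t]
 by (simp add: hom_mod_def lin_smult[OF pW[OF s]])
 qed
 qed
qed

lemma sp_hom_eq: "sp_hom R d V W = (hom_mod R (tpow R d V) (tpow R d W))\<lparr>carrier := Homs d V W\<rparr>"
 by (simp add: sp_hom_def)

lemma module_sp_hom: "module R V ==> module R W ==> module R (sp_hom R d V W)"
 by (subst sp_hom_eq, rule module_submodule[OF module_hom_mod[OF module_tpow module_tpow] submodule_sp_hom])

lemma lin_sp_hom_incl: "lin R (sp_hom R d V W) (hom_mod R (tpow R d V) (tpow R d W)) (%\<phi>. \<phi>)"
 by (rule linI) (simp_all add: sp_hom_def hom_mod_def)

lemma lin_sp_hom_apply: "t:Tens d V ==> lin R (sp_hom R d V W) (tpow R d W) (%\<phi>. \<phi> t)"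
 by (rule lin_hom_mod_apply[OF lin_sp_hom_incl])

lemma sp_hom_eqI:
 "\<phi>:Homs d V W ==> \<psi>:Homs d V W ==>
 (!!t. t:Tens d V ==> \<phi> t = \<psi> t) ==> \<phi> = \<psi>"
 by (rule mod_hom_eqI[OF sp_hom_mod_hom sp_hom_mod_hom])

lemma sp_hom_id: "module R V ==> (\<lambda>t\<in>Tens d V. t):Homs d V V"
 unfolding sp_hom_iff
 by (auto intro!: lin_restrict module_tpow lin_id dest: lin_closed[OF tperm_lin[OF _ permutes_imp_bij]])

lemma sp_hom_comp:
 assumes "\<phi>:Homs d U V" "\<psi>:Homs d V W" "module R U"
 shows "compose (Tens d U) \<psi> \<phi>:Homs d U W"
 unfolding sp_hom_iff
proof (intro conjI allI impI ballI)
 show "compose (Tens d U) \<psi> \<phi>:mod_hom R (tpow R d U) (tpow R d W)"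
 unfolding compose_def
 by (rule lin_restrict[OF module_tpow[OF assms(3)] lin_comp[OF sp_hom_lin[OF assms(1)] sp_hom_lin[OF assms(2)]]])
 fix \<sigma> t assume s: "\<sigma> permutes {..<d}" and t: "t:Tens d U"
 show "compose (Tens d U) \<psi> \<phi> (tperm R d U \<sigma> t) =
 tperm R d W \<sigma> (compose (Tens d U) \<psi> \<phi> t)"
 using t lin_closed[OF tperm_lin[OF assms(3) permutes_imp_bij[OF s]] t]
 sp_hom_perm[OF assms(1) s t] sp_hom_perm[OF assms(2) s lin_closed[OF sp_hom_lin[OF assms(1)] t]]
 by (simp add: compose_def)
qed

text \<open>Linear maps induce morphisms of the category of divided powers.\<close>

lemma sp_hom_of_lin:
 assumes V: "module R V" and W: "module R W" and f: "lin R V W f"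
 shows "tensor_map R d (%_. V) (%_. W) (%_. f):Homs d V W"
 and "!!v. v:tensor_base d (%_. V) ==>
 tensor_map R d (%_. V) (%_. W) (%_. f) (tpure R d V v) = tpure R d W (tup d (%r. f (v r)))"
proof -
 let ?F = "tensor_map R d (%_. V) (%_. W) (%_. f)"
 have lins: "lins R d (%_. V) (%_. W) (%_. f)" using f by (simp add: lins_def)
 note F = tensor_map[OF modules_const[OF V] modules_const[OF W] lins]
 show 2: "?F (tpure R d V v) = tpure R d W (tup d (%r. f (v r)))" if "v:tensor_base d (%_. V)" for v
 unfolding tpure_def by (rule F(2)[OF that])
 have 1: "?F:mod_hom R (tpow R d V) (tpow R d W)" unfolding tpow_def by (rule F(1))
 show "?F:Homs d V W"
 unfolding sp_hom_iff
 proof (intro conjI allI impI ballI 1)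
 fix \<sigma> t assume s: "\<sigma> permutes {..<d}" and t: "t:Tens d V"
 note b = permutes_imp_bij[OF s]
 show "?F (tperm R d V \<sigma> t) = tperm R d W \<sigma> (?F t)"
 proof (rule tpow_lin_eqI[OF V module_tpow[OF W] lin_comp[OF tperm_lin[OF V b] mod_hom_lin[OF 1]]
 lin_comp[OF mod_hom_lin[OF 1] tperm_lin[OF W b]] _ t])
 fix v assume v: "v:tensor_base d (%_. V)"
 have w: "(tup d (%r. f (v r))):tensor_base d (%_. W)"
 by (intro tensor_base_restrict lin_closed[OF f] tensor_baseD[OF v])
 have "(tup d (%r. f ((tup d (%r. v (\<sigma> r))) r))) = (tup d (%r. (tup d (%r. f (v r))) (\<sigma> r)))"
 using permutes_in_image[OF s] by (auto simp: fun_eq_iff)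
 thus "?F (tperm R d V \<sigma> (tpure R d V v)) = tperm R d W \<sigma> (?F (tpure R d V v))"
 using 2[OF v] 2[OF tperm_base[OF b v]] tperm(2)[OF V b v] tperm(2)[OF W b w] by simp
 qed
 qed
qed

abbreviation "fgp \<equiv> fg_proj_mods R"

lemma is_repI:
 fixes X :: "('a, 'u, 'x) sp_functor"
 assumes mod: "!!V. V:fgp ==> module R (on_obj X V)"
 and mor: "!!V W \<phi>. V:fgp ==> W:fgp ==> \<phi>:Homs d V W ==>
 on_mor X V W \<phi>:mod_hom R (on_obj X V) (on_obj X W)"
 and lin: "!!V W x. V:fgp ==> W:fgp ==> x:carrier (on_obj X V) ==>
 lin R (sp_hom R d V W) (on_obj X W) (%\<phi>. on_mor X V W \<phi> x)"
 and id: "!!V x. V:fgp ==> x:carrier (on_obj X V) ==>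
 on_mor X V V (\<lambda>t\<in>Tens d V. t) x = x"
 and comp: "!!U V W \<phi> \<psi> x. U:fgp ==> V:fgp ==> W:fgp ==> \<phi>:Homs d U V ==>
 \<psi>:Homs d V W ==> x:carrier (on_obj X U) ==>
 on_mor X U W (compose (Tens d U) \<psi> \<phi>) x = on_mor X V W \<psi> (on_mor X U V \<phi> x)"
 shows "is_rep R d X"
 unfolding is_rep_def
proof (intro conjI ballI)
 fix V :: "('a, 'u) module" assume V: "V:fgp"
 show "module R (on_obj X V)" by (rule mod[OF V])
 have "on_mor X V V (\<lambda>t\<in>Tens d V. t):mod_hom R (on_obj X V) (on_obj X V)"
 by (intro mor V sp_hom_id fgp_module)
 thus "on_mor X V V (\<lambda>t\<in>Tens d V. t) = (\<lambda>x\<in>carrier (on_obj X V). x)"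
 by (rule mod_hom_eqI[OF _ lin_restrict[OF mod[OF V] lin_id]]) (simp add: id[OF V])
next
 fix V W :: "('a, 'u) module" assume V: "V:fgp" and W: "W:fgp"
 note s = module_sp_hom[OF fgp_module[OF V] fgp_module[OF W]]
 show "restrict (on_mor X V W) (Homs d V W) :
 mod_hom R (sp_hom R d V W) (hom_mod R (on_obj X V) (on_obj X W))"
 by (rule lin_restrict[OF s lin_hom_modI[OF mor[OF V W] mod[OF V] mod[OF W] s lin[OF V W]]])
next
 fix U V W :: "('a, 'u) module" and \<phi> \<psi> assume U: "U:fgp" and V: "V:fgp" and W: "W:fgp"
 and f: "\<phi>:Homs d U V" and g: "\<psi>:Homs d V W"
 have fg: "compose (carrier (on_obj X U)) (on_mor X V W \<psi>) (on_mor X U V \<phi>):mod_hom R (on_obj X U) (on_obj X W)"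
 unfolding compose_def
 by (rule lin_restrict[OF mod[OF U] lin_comp[OF mod_hom_lin[OF mor[OF U V f]] mod_hom_lin[OF mor[OF V W g]]]])
 show "on_mor X U W (compose (Tens d U) \<psi> \<phi>) =
 compose (carrier (on_obj X U)) (on_mor X V W \<psi>) (on_mor X U V \<phi>)"
 by (rule mod_hom_eqI[OF mor[OF U W sp_hom_comp[OF f g fgp_module[OF U]]] fg])
 (subst comp[OF U V W f g], assumption, simp add: compose_eq)
qed

lemma is_repD:
 fixes X :: "('a, 'u, 'x) sp_functor"
 assumes X: "is_rep R d X"
 shows rep_module: "!!V. V:fgp ==> module R (on_obj X V)"
 and rep_mor: "!!V W \<phi>. V:fgp ==> W:fgp ==> \<phi>:Homs d V W ==>
 on_mor X V W \<phi>:mod_hom R (on_obj X V) (on_obj X W)"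
 and rep_lin: "!!V W x. V:fgp ==> W:fgp ==> x:carrier (on_obj X V) ==>
 lin R (sp_hom R d V W) (on_obj X W) (%\<phi>. on_mor X V W \<phi> x)"
 and rep_id_mor: "!!V x. V:fgp ==> x:carrier (on_obj X V) ==>
 on_mor X V V (\<lambda>t\<in>Tens d V. t) x = x"
 and rep_comp_mor: "!!U V W \<phi> \<psi> x. U:fgp ==> V:fgp ==> W:fgp ==> \<phi>:Homs d U V ==>
 \<psi>:Homs d V W ==> x:carrier (on_obj X U) ==>
 on_mor X U W (compose (Tens d U) \<psi> \<phi>) x = on_mor X V W \<psi> (on_mor X U V \<phi> x)"
proof -
 fix V :: "('a, 'u) module" assume V: "V:fgp"
 show "module R (on_obj X V)" using X V unfolding is_rep_def by blast
 show "on_mor X V V (\<lambda>t\<in>Tens d V. t) x = x" if "x:carrier (on_obj X V)" for x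
 using X V that unfolding is_rep_def by simp
 fix W :: "('a, 'u) module" assume W: "W:fgp"
 note s = module_sp_hom[OF fgp_module[OF V] fgp_module[OF W], of d]
 have "restrict (on_mor X V W) (Homs d V W) :
 mod_hom R (sp_hom R d V W) (hom_mod R (on_obj X V) (on_obj X W))"
 using X V W unfolding is_rep_def by blast
 hence L: "lin R (sp_hom R d V W) (hom_mod R (on_obj X V) (on_obj X W)) (on_mor X V W)"
 by (rule lin_cong[OF mod_hom_lin _ s]) simp
 show "on_mor X V W \<phi>:mod_hom R (on_obj X V) (on_obj X W)" if "\<phi>:Homs d V W" for \<phi>
 by (rule lin_hom_mod_closed[OF L that])
 show "lin R (sp_hom R d V W) (on_obj X W) (%\<phi>. on_mor X V W \<phi> x)" if "x:carrier (on_obj X V)" for x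
 by (rule lin_hom_mod_apply[OF L that])
next
 fix U V W :: "('a, 'u) module" and \<phi> \<psi> x
 assume a: "U:fgp" "V:fgp" "W:fgp" "\<phi>:Homs d U V" "\<psi>:Homs d V W"
 "x:carrier (on_obj X U)"
 hence "on_mor X U W (compose (Tens d U) \<psi> \<phi>) =
 compose (carrier (on_obj X U)) (on_mor X V W \<psi>) (on_mor X U V \<phi>)"
 using X unfolding is_rep_def by blast
 thus "on_mor X U W (compose (Tens d U) \<psi> \<phi>) x = on_mor X V W \<psi> (on_mor X U V \<phi> x)"
 using a(6) by (simp add: compose_def)
qed

lemmas rep_mor_lin = mod_hom_lin[OF rep_mor]
lemmas rep_mor_closed = lin_closed[OF rep_mor_lin]

lemma is_rep_tpow: "is_rep R d (tpow_functor R d)"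
 by (rule is_repI)
 (simp_all add: tpow_functor_def fgp_module module_tpow sp_hom_mod_hom lin_sp_hom_apply compose_def)

definition subrep :: "nat => ('a, 'u, 'x) sp_functor => (('a, 'u) module => 'x set) => bool" where
 "subrep d X U \<longleftrightarrow> (ALL V:fgp. submodule (U V) R (on_obj X V)) &
 (ALL V:fgp. ALL W:fgp. ALL \<phi>:Homs d V W. ALL x:U V. on_mor X V W \<phi> x:U W)"

lemma subrepI:
 "(!!V. V:fgp ==> submodule (U V) R (on_obj X V)) ==>
 (!!V W \<phi> x. V:fgp ==> W:fgp ==> \<phi>:Homs d V W ==> x:U V ==>
 on_mor X V W \<phi> x:U W) ==> subrep d X U"
 by (simp add: subrep_def)

lemma subrep_submodule: "subrep d X U ==> V:fgp ==> submodule (U V) R (on_obj X V)"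
 and subrep_mor: "subrep d X U ==> V:fgp ==> W:fgp ==> \<phi>:Homs d V W ==> x:U V ==>
 on_mor X V W \<phi> x:U W"
 by (simp_all add: subrep_def)

lemma is_rep_sub:
 fixes X :: "('a, 'u, 'x) sp_functor"
 assumes X: "is_rep R d X" and sr: "subrep d X U"
 shows "is_rep R d (sub_functor X U)"
proof -
 have sub: "x:carrier (on_obj X V)" if "V:fgp" "x:U V" for x V
 using submoduleD(1)[OF subrep_submodule[OF sr that(1)] rep_module[OF X that(1)]] that(2) by blast
 show ?thesis
 proof (rule is_repI)
 fix V :: "('a, 'u) module" assume V: "V:fgp"
 show m: "module R (on_obj (sub_functor X U) V)"
 using module_submodule[OF rep_module[OF X V] subrep_submodule[OF sr V]] by (simp add: sub_functor_def)
 note idc = sp_hom_id[OF fgp_module[OF V], of d]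
 show "on_mor (sub_functor X U) V V (\<lambda>t\<in>Tens d V. t) x = x"
 if "x:carrier (on_obj (sub_functor X U) V)" for x
 using that rep_id_mor[OF X V] sub[OF V] by (simp add: sub_functor_def)
 fix W :: "('a, 'u) module" assume W: "W:fgp"
 show "on_mor (sub_functor X U) V W \<phi>:mod_hom R (on_obj (sub_functor X U) V) (on_obj (sub_functor X U) W)"
 if f: "\<phi>:Homs d V W" for \<phi>
 proof -
 note L = rep_mor_lin[OF X V W f]
 have "lin R (on_obj (sub_functor X U) V) (on_obj (sub_functor X U) W) (on_mor X V W \<phi>)"
 by (rule linI)
 (simp_all add: sub_functor_def subrep_mor[OF sr V W f] lin_add[OF L] lin_smult[OF L] sub[OF V])
 from lin_restrict[OF m this] show ?thesis by (simp add: sub_functor_def)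
 qed
 show "lin R (sp_hom R d V W) (on_obj (sub_functor X U) W) (%\<phi>. on_mor (sub_functor X U) V W \<phi> x)"
 if x: "x:carrier (on_obj (sub_functor X U) V)" for x
 proof -
 have xU: "x:U V" using x by (simp add: sub_functor_def)
 note L = rep_lin[OF X V W sub[OF V xU]]
 show ?thesis
 by (rule linI) (simp_all add: sub_functor_def xU subrep_mor[OF sr V W] lin_add[OF L] lin_smult[OF L])
 qed
 next
 fix U' V W :: "('a, 'u) module" and \<phi> \<psi> x
assume a: "U':fgp" "V:fgp" "W:fgp" "\<phi>:Homs d U' V" "\<psi>:Homs d V W"
 and x: "x:carrier (on_obj (sub_functor X U) U')"
 have "x:U U'" using x by (simp add: sub_functor_def)
 thus "on_mor (sub_functor X U) U' W (compose (Tens d U') \<psi> \<phi>) x =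
 on_mor (sub_functor X U) V W \<psi> (on_mor (sub_functor X U) U' V \<phi> x)"
 using rep_comp_mor[OF X a sub[OF a(1)]] subrep_mor[OF sr a(1,2,4)] by (simp add: sub_functor_def)
 qed
qed

lemma quot_functor_mor:
 fixes X :: "('a, 'u, 'x) sp_functor"
 assumes X: "is_rep R d X" and sr: "subrep d X U"
 and V: "V:fgp" and W: "W:fgp" and f: "\<phi>:Homs d V W" and x: "x:carrier (on_obj X V)"
 shows "on_mor (quot_functor X U) V W \<phi> (quot_proj (on_obj X V) (U V) x) =
 quot_proj (on_obj X W) (U W) (on_mor X V W \<phi> x)"
proof -
 note MV = rep_module[OF X V] and MW = rep_module[OF X W]
 interpret V: module R "on_obj X V" by (rule MV)
 interpret W: module R "on_obj X W" by (rule MW)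
 interpret N: abelian_subgroup "U V" "on_obj X V" by (rule abelian_subgroup_submodule[OF MV subrep_submodule[OF sr V]])
 note L = rep_mor_lin[OF X V W f]
 have eq: "U W +>\<^bsub>on_obj X W\<^esub> on_mor X V W \<phi> a = quot_proj (on_obj X W) (U W) (on_mor X V W \<phi> x)"
 if "a:U V +>\<^bsub>on_obj X V\<^esub> x" for a
 proof -
 have a: "a:carrier (on_obj X V)"
 using that x submoduleD(1)[OF subrep_submodule[OF sr V] MV] by (auto simp: a_r_coset_def')
 have "a \<ominus>\<^bsub>on_obj X V\<^esub> x:U V"
 using quot_proj_eq_iff[OF MV subrep_submodule[OF sr V] a x] N.a_repr_independence'[OF that x] x a by (simp add: quot_proj_eq)
 hence "on_mor X V W \<phi> a \<ominus>\<^bsub>on_obj X W\<^esub> on_mor X V W \<phi> x:U W"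
 using subrep_mor[OF sr V W f] lin_minus[OF MV MW L a x] by metis
 thus ?thesis
 using quot_proj_eq_iff[OF MW subrep_submodule[OF sr W] lin_closed[OF L a] lin_closed[OF L x]] lin_closed[OF L a]
 by (simp add: quot_proj_eq)
 qed
 have "(\<Union>a\<in>U V +>\<^bsub>on_obj X V\<^esub> x. U W +>\<^bsub>on_obj X W\<^esub> on_mor X V W \<phi> a) =
 quot_proj (on_obj X W) (U W) (on_mor X V W \<phi> x)"
 by (rule UN_constant_eq[OF N.a_rcos_self[OF x]]) (rule ballI, rule eq)
 moreover have "quot_proj (on_obj X V) (U V) x:carrier (quot_mod (on_obj X V) (U V))"
 using x by (simp add: quot_carrier)
 ultimately show ?thesis using x by (simp add: quot_functor_def quot_proj_eq)
qed

lemma is_rep_quot: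
 fixes X :: "('a, 'u, 'x) sp_functor"
 assumes X: "is_rep R d X" and sr: "subrep d X U"
 shows "is_rep R d (quot_functor X U)"
proof -
 let ?Q = "quot_functor X U" and ?q = "%V. quot_proj (on_obj X V) (U V)"
 have obj: "on_obj ?Q V = quot_mod (on_obj X V) (U V)" for V by (simp add: quot_functor_def)
 have mod: "module R (on_obj ?Q V)" if "V:fgp" for V
 unfolding obj by (rule module_quot[OF rep_module[OF X that] subrep_submodule[OF sr that]])
 have q: "lin R (on_obj X V) (on_obj ?Q V) (?q V)" if "V:fgp" for V
 unfolding obj by (rule lin_quot_proj[OF rep_module[OF X that] subrep_submodule[OF sr that]])
 note mor = quot_functor_mor[OF X sr]
 show ?thesis
 proof (rule is_repI)
 fix V :: "('a, 'u) module" assume V: "V:fgp"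
 have surj: "EX a:carrier (on_obj X V). x = ?q V a" if "x:carrier (on_obj ?Q V)" for x
 using that unfolding obj quot_carrier by blast
 show "module R (on_obj ?Q V)" by (rule mod[OF V])
 show "on_mor ?Q V V (\<lambda>t\<in>Tens d V. t) x = x" if "x:carrier (on_obj ?Q V)" for x
 using surj[OF that] rep_id_mor[OF X V] mor[OF V V sp_hom_id[OF fgp_module[OF V]]] by auto
 fix W :: "('a, 'u) module" assume W: "W:fgp"
 show "on_mor ?Q V W \<phi>:mod_hom R (on_obj ?Q V) (on_obj ?Q W)" if f: "\<phi>:Homs d V W" for \<phi>
 proof -
 note L = rep_mor_lin[OF X V W f] and m = mor[OF V W f]
 interpret V: module R "on_obj X V" by (rule rep_module[OF X V])
 have "lin R (on_obj ?Q V) (on_obj ?Q W) (on_mor ?Q V W \<phi>)"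
 proof (rule linI)
 fix x y assume "x:carrier (on_obj ?Q V)" "y:carrier (on_obj ?Q V)"
 then obtain a b where ab: "a:carrier (on_obj X V)" "b:carrier (on_obj X V)" "x = ?q V a" "y = ?q V b"
 using surj by blast
 show "on_mor ?Q V W \<phi> (x +[on_obj ?Q V] y) = on_mor ?Q V W \<phi> x +[on_obj ?Q W] on_mor ?Q V W \<phi> y"
 using ab lin_add[OF q[OF V], symmetric] lin_add[OF q[OF W], symmetric] lin_closed[OF L]
 by (simp add: m lin_add[OF L])
 next
 fix c x assume c: "c:carrier R" and "x:carrier (on_obj ?Q V)"
 then obtain a where a: "a:carrier (on_obj X V)" "x = ?q V a" using surj by blast
 show "on_mor ?Q V W \<phi> (c *[on_obj ?Q V] x) = c *[on_obj ?Q W] on_mor ?Q V W \<phi> x"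
 using c a lin_smult[OF q[OF V], symmetric] lin_smult[OF q[OF W], symmetric] lin_closed[OF L]
 by (simp add: m lin_smult[OF L])
 next
 fix x assume "x:carrier (on_obj ?Q V)"
 then obtain a where a: "a:carrier (on_obj X V)" "x = ?q V a" using surj by blast
 show "on_mor ?Q V W \<phi> x:carrier (on_obj ?Q W)"
 using a lin_closed[OF q[OF W] lin_closed[OF L a(1)]] by (simp add: m)
 qed
 thus ?thesis by (simp add: mod_hom_iff) (simp add: quot_functor_def)
 qed
 show "lin R (sp_hom R d V W) (on_obj ?Q W) (%\<phi>. on_mor ?Q V W \<phi> x)"
 if "x:carrier (on_obj ?Q V)" for x
 proof -
 obtain a where a: "a:carrier (on_obj X V)" "x = ?q V a" using surj \<open>x:carrier (on_obj ?Q V)\<close> by blast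
 have L: "lin R (sp_hom R d V W) (on_obj ?Q W) (%\<phi>. ?q W (on_mor X V W \<phi> a))"
 by (rule lin_comp[OF rep_lin[OF X V W a(1)] q[OF W]])
 show ?thesis
 proof (rule lin_cong[OF L])
 show "module R (sp_hom R d V W)"
 by (rule module_sp_hom[OF fgp_module[OF V] fgp_module[OF W]])
 show "on_mor ?Q V W \<phi> x = ?q W (on_mor X V W \<phi> a)" if "\<phi>:Homs d V W" for \<phi>
 unfolding a(2) by (rule mor[OF V W that a(1)])
 qed
 qed
 next
 fix U' V W :: "('a, 'u) module" and \<phi> \<psi> x
assume a: "U':fgp" "V:fgp" "W:fgp" "\<phi>:Homs d U' V" "\<psi>:Homs d V W"
 and x: "x:carrier (on_obj ?Q U')"
 then obtain b where b: "b:carrier (on_obj X U')" "x = ?q U' b" unfolding obj quot_carrier by blast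
 show "on_mor ?Q U' W (compose (Tens d U') \<psi> \<phi>) x = on_mor ?Q V W \<psi> (on_mor ?Q U' V \<phi> x)"
 unfolding b(2) mor[OF a(1,2,4) b(1)] mor[OF a(2,3,5) rep_mor_closed[OF X a(1,2,4) b(1)]]
 mor[OF a(1,3) sp_hom_comp[OF a(4,5) fgp_module[OF a(1)]] b(1)]
 rep_comp_mor[OF X a b(1)] ..
 qed
qed

end

section \<open>Contents of index functions\<close>

text \<open>The content of \<open>J\<close> is the multiset of its values; two index functions lie in the same
 orbit of the symmetric group if and only if they have the same content.\<close>

definition ct :: "nat => (nat => 'i) => 'i multiset" where
 "ct d J = image_mset J (mset_set {..<d})"

lemma ct_sum: "ct d J = (\<Sum>r<d. {#J r#})"
 unfolding ct_def by (induction d) (simp_all add: lessThan_Suc)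

lemma ct_cong: "(!!r. r < d ==> J r = J' r) ==> ct d J = ct d J'"
 by (simp add: ct_sum)

lemma size_ct [simp]: "size (ct d J) = d"
 by (simp add: ct_def)

lemma ct_comp: "ct d (%r. f (J r)) = image_mset f (ct d J)"
 by (simp add: ct_def multiset.map_comp comp_def)

lemma ct_perm:
 assumes "\<sigma> permutes {..<d}"
 shows "ct d (tup d (%r. J (\<sigma> r))) = ct d J"
proof -
 have "ct d (tup d (%r. J (\<sigma> r))) = ct d (%r. J (\<sigma> r))" by (rule ct_cong) simp
 also have "... = (\<Sum>r<d. {#J (\<sigma> r)#})" by (simp add: ct_sum)
 also have "... = (\<Sum>r<d. {#J r#})" using sum.permute[OF assms, of "%r. {#J r#}"] by (simp add: comp_def)
 finally show ?thesis by (simp add: ct_sum)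
qed

lemma ct_eq_perm:
 assumes "ct d J = ct d J'" "J:PiE {..<d} A"
 obtains \<sigma> where "\<sigma> permutes {..<d}" "J = (tup d (%r. J' (\<sigma> r)))"
proof -
 obtain p where p: "p permutes {..<d}" "ALL x:{..<d}. J x = J' (p x)"
 using image_mset_eq_implies_permutes[of "{..<d}" J J'] assms(1) by (auto simp: ct_def)
 have "J = (tup d (%r. J' (p r)))"
 using p(2) assms(2) by (auto simp: fun_eq_iff PiE_iff extensional_def)
 with p(1) show thesis by (rule that)
qed

lemma ct_blocks: "ct (sum_list l) J = (\<Sum>i<length l. ct (l ! i) (blk l J i))"
proof -
 have "ct (l ! i) (blk l J i) = (\<Sum>j<l ! i. {#J (pos l i j)#})" for i
 by (simp add: ct_sum blk_def)
 thus ?thesis by (simp add: ct_sum sum_blocks)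
qed

lemma idx_fst:
 assumes "L:Idx d (B\<times>C)"
 shows "(tup d (%r. fst (L r))):Idx d B"
proof (rule idxI)
 fix r assume "r < d"
 from idxD[OF assms this] show "fst (L r):B" by (simp add: mem_Times_iff)
qed

lemma idx_snd:
 assumes "L:Idx d (B\<times>C)"
 shows "(tup d (%r. snd (L r))):Idx d C"
proof (rule idxI)
 fix r assume "r < d"
 from idxD[OF assms this] show "snd (L r):C" by (simp add: mem_Times_iff)
qed

lemma permutes_less: "\<sigma> permutes {..<d} ==> r < d ==> \<sigma> r < d"
 using permutes_in_image[of \<sigma> "{..<d}" r] by simp

lemma idx_perm: "\<sigma> permutes {..<d} ==> J:Idx d B ==> (tup d (%r. J (\<sigma> r))):Idx d B"
 by (rule idxI, erule idxD, rule permutes_less)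

text \<open>Permuting the arguments is a bijection on every set of index functions that is closed under it.\<close>

lemma perm_bij:
 assumes SP: "S<=Idx d A" and s: "\<sigma> permutes {..<d}"
 and inv: "!!L \<sigma>. L:S ==> \<sigma> permutes {..<d} ==> (tup d (%r. L (\<sigma> r))):S"
 shows "inj_on (%L. \<lambda>r\<in>{..<d}. L (\<sigma> r)) S" and "(%L. \<lambda>r\<in>{..<d}. L (\<sigma> r)) ` S = S"
proof -
 let ?f = "%L. \<lambda>r\<in>{..<d}. L (\<sigma> r)"
 have SL: "L:Idx d A" if "L:S" for L using SP that by blast
 show "inj_on ?f S"
 proof (rule inj_onI)
 fix L L' assume L: "L:S" "L':S" and eq: "?f L = ?f L'"
 show "L = L'"
 proof (rule PiE_ext[OF SL[OF L(1)] SL[OF L(2)]])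
 fix r assume "r:{..<d}"
 then obtain k where "k < d" "\<sigma> k = r" using permutes_image[OF s] by (metis imageE lessThan_iff)
 thus "L r = L' r" using fun_cong[OF eq, of k] by simp
 qed
 qed
 show "?f ` S = S"
 proof
 show "?f ` S<=S" using inv s by blast
 show "S<=?f ` S"
 proof
 fix L assume L: "L:S"
 have eq: "?f (tup d (%r. L (inv_into UNIV \<sigma> r))) = L"
 proof
 fix r show "?f (tup d (%r. L (inv_into UNIV \<sigma> r))) r = L r"
 using SL[OF L] permutes_in_image[OF s, of r] permutes_inverses(2)[OF s]
 by (cases "r < d") (simp_all add: PiE_iff extensional_def)
 qed
 show "L:?f ` S"
 by (rule image_eqI[OF _ inv[OF L permutes_inv[OF s]]]) (rule eq[symmetric])
 qed
 qed
qed

section \<open>Splitting sums of basis tensors\<close>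

context cring
begin

text \<open>Distributing a tensor product of sums over the blocks: a choice of one index function for
 each block is the same as one index function for all positions.\<close>

lemma tsplit_sum:
 assumes W: "module R W" and y: "y:A \<rightarrow> carrier W" and A: "finite A"
 and S: "!!i. i < length l ==> S i<=Idx (l ! i) A"
 and c: "!!i L. i < length l ==> L:S i ==> c i L:carrier R"
 shows "pure_tensor R (length l) (%i. tpow R (l ! i) W)
 (tup (length l) (%i. finsum (tpow R (l ! i) W) (%L. c i L *[tpow R (l ! i) W] tb (l ! i) W y L) (S i))) =
 tsplit R l W (finsum (tpow R (sum_list l) W)
 (%L. (\<Otimes>i\<in>{..<length l}. c i (blk l L i)) *[tpow R (sum_list l) W] tb (sum_list l) W y L)
 {L\<in>Idx (sum_list l) A. ALL i<length l. blk l L i:S i})"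
proof -
 let ?n = "length l" and ?M = "%i. tpow R (l ! i) W" and ?d = "sum_list l"
 let ?T = "tensor R ?n ?M" and ?P = "tpow R ?d W"
 let ?S = "{L\<in>Idx ?d A. ALL i<?n. blk l L i:S i}"
 let ?v = "\<lambda>i\<in>{..<?n}. finsum (?M i) (%L. c i L *[?M i] tb (l ! i) W y L) (S i)"
 have M: "modules R ?n ?M" by (rule modules_tpow[OF W])
 interpret T: module R ?T by (rule module_tensor[OF M])
 interpret P: module R ?P by (rule module_tpow[OF W])
 have tbb: "(tup e (%r. y (L r))):tensor_base e (%_. W)" if "L:Idx e A" for e L
 by (intro tensor_base_restrict funcset_mem[OF y] idxD[OF that])
 have tbc: "tb e W y L:Tens e W" if "L:Idx e A" for e L
 by (rule tpure_closed[OF W tbb[OF that]])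
 have tbS: "tb (l ! i) W y L:carrier (?M i)" if "i < ?n" "L:S i" for i L
 using S that by (intro tbc) blast
 have finS: "finite (S i)" if "i < ?n" for i
 by (rule finite_subset[OF S[OF that]]) (rule finite_PiE, use A in auto)
 have v: "?v:tensor_base ?n ?M"
 proof (rule tensor_base_restrict)
 fix i assume i: "i < ?n"
 interpret Mi: module R "?M i" by (rule module_tpow[OF W])
 show "finsum (?M i) (%L. c i L *[?M i] tb (l ! i) W y L) (S i):carrier (?M i)"
 by (rule Mi.finsum_closed) (simp add: c[OF i] tbS[OF i])
 qed
 have "pure_tensor R ?n ?M ?v = finsum ?T (%K. (\<Otimes>i\<in>{..<?n}. c i (K i)) *[?T]
 pure_tensor R ?n ?M (tup ?n (%i. tb (l ! i) W y (K i)))) (PiE {..<?n} S)"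
 proof (rule multilin_expand[OF M T.module_axioms multilin_pure[OF M], where b = "%i L. tb (l ! i) W y L"])
 show "?v:tensor_base ?n ?M" by (rule v)
 qed (simp_all add: finS tbS c)
 also have "PiE {..<?n} S = (%L. \<lambda>i\<in>{..<?n}. blk l L i) ` ?S"
 proof (intro equalityI subsetI)
 fix K assume K: "K:PiE {..<?n} S"
 have Ki: "K i:Idx (l ! i) A" if "i < ?n" for i using idxD[OF K that] S[OF that] by blast
 have g: "glue l K:Idx ?d A" by (rule glue_PiE) (rule Ki)
 have bg: "blk l (glue l K) i = K i" if "i < ?n" for i by (rule blk_glue[where K = K, OF that Ki[OF that]])
 have "K = (tup ?n (%i. blk l (glue l K) i))"
 proof
 fix i show "K i = (tup ?n (%i. blk l (glue l K) i)) i"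
 using K bg by (cases "i < ?n") (simp_all add: PiE_iff extensional_def)
 qed
 moreover have "glue l K:?S" using g idxD[OF K] bg by simp
 ultimately show "K:(%L. \<lambda>i\<in>{..<?n}. blk l L i) ` ?S" by blast
 next
 fix K assume "K:(%L. \<lambda>i\<in>{..<?n}. blk l L i) ` ?S"
 then obtain L where "L:?S" "K = (tup ?n (%i. blk l L i))" by blast
 thus "K:PiE {..<?n} S" by (simp add: restrict_PiE_iff)
 qed
 also have "finsum ?T (%K. (\<Otimes>i\<in>{..<?n}. c i (K i)) *[?T]
 pure_tensor R ?n ?M (tup ?n (%i. tb (l ! i) W y (K i)))) ((%L. \<lambda>i\<in>{..<?n}. blk l L i) ` ?S) =
 finsum ?T (%L. tsplit R l W ((\<Otimes>i\<in>{..<?n}. c i (blk l L i)) *[?P] tb ?d W y L)) ?S"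
 proof (subst T.finsum_reindex)
 have inj: "L = L'" if "L:?S" "L':?S" "(tup ?n (%i. blk l L i)) = (tup ?n (%i. blk l L' i))" for L L'
 proof (rule blk_eqI)
 show "L:Idx ?d A" "L':Idx ?d A" using that by auto
 show "blk l L i = blk l L' i" if "i < ?n" for i
 using fun_cong[OF \<open>(tup ?n (%i. blk l L i)) = (tup ?n (%i. blk l L' i))\<close>, of i] that by simp
 qed
 thus "inj_on (%L. \<lambda>i\<in>{..<?n}. blk l L i) ?S" by (intro inj_onI)
 have pc: "(\<Otimes>i\<in>{..<?n}. c i (blk l L i)):carrier R" if "L:?S" for L
 using that c by (intro finprod_closed) auto
 have eq: "tsplit R l W ((\<Otimes>i\<in>{..<?n}. c i (blk l L i)) *[?P] tb ?d W y L) =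
 (\<Otimes>i\<in>{..<?n}. c i ((tup ?n (%i. blk l L i)) i)) *[?T]
 pure_tensor R ?n ?M (tup ?n (%i. tb (l ! i) W y ((tup ?n (%i. blk l L i)) i)))" if L: "L:?S" for L
 proof -
 have LA: "L:Idx ?d A" using L by simp
 have p: "(\<Otimes>i\<in>{..<?n}. c i ((tup ?n (%i. blk l L i)) i)) = (\<Otimes>i\<in>{..<?n}. c i (blk l L i))"
 using L c by (intro finprod_cong') auto
 have "(tup ?n (%i. tpure R (l ! i) W (blk l (tup ?d (%r. y (L r))) i))) =
 (tup ?n (%i. tb (l ! i) W y ((tup ?n (%i. blk l L i)) i)))"
 by (intro ext) (simp add: blk_def restrict_def pos_less cong: if_cong)
 thus ?thesis
 unfolding p lin_smult[OF tsplit_lin[OF W] pc[OF L] tbc[OF LA]] tsplit(2)[OF W tbb[OF LA]] by simp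
 qed
 have clo: "(\<Otimes>i\<in>{..<?n}. c i ((tup ?n (%i. blk l L i)) i)) *[?T]
 pure_tensor R ?n ?M (tup ?n (%i. tb (l ! i) W y ((tup ?n (%i. blk l L i)) i))):carrier ?T" if L: "L:?S" for L
 unfolding eq[OF L, symmetric]
 using L pc[OF L] by (intro lin_closed[OF tsplit_lin[OF W]] P.smult_closed tbc) auto
 thus "(%K. (\<Otimes>i\<in>{..<?n}. c i (K i)) *[?T] pure_tensor R ?n ?M (tup ?n (%i. tb (l ! i) W y (K i))))
:(%L. \<lambda>i\<in>{..<?n}. blk l L i) ` ?S \<rightarrow> carrier ?T" by blast
 show "finsum ?T (%L. (\<Otimes>i\<in>{..<?n}. c i ((tup ?n (%i. blk l L i)) i)) *[?T]
 pure_tensor R ?n ?M (tup ?n (%i. tb (l ! i) W y ((tup ?n (%i. blk l L i)) i)))) ?S =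
 finsum ?T (%L. tsplit R l W ((\<Otimes>i\<in>{..<?n}. c i (blk l L i)) *[?P] tb ?d W y L)) ?S"
 by (rule T.finsum_cong'[OF refl]) (use eq clo in auto)
 qed
 also have "... = tsplit R l W (finsum ?P (%L. (\<Otimes>i\<in>{..<?n}. c i (blk l L i)) *[?P] tb ?d W y L) ?S)"
 proof (rule lin_finsum[OF P.module_axioms T.module_axioms tsplit_lin[OF W], symmetric])
 show "(%L. (\<Otimes>i\<in>{..<?n}. c i (blk l L i)) *[?P] tb ?d W y L):?S \<rightarrow> carrier ?P"
 using c tbc by (auto intro!: finprod_closed)
 qed
 finally show ?thesis .
qed

section \<open>Multilinearity of tensor products of maps\<close>

lemma multilin_tensor_map:
 assumes M: "modules R n M" and N: "modules R n N" and P: "modules R n P"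
 and h: "lins R n P (%i. hom_mod R (M i) (N i)) h"
 shows "multilin R n P (hom_mod R (tensor R n M) (tensor R n N)) (%\<psi>. tensor_map R n M N (%i. h i (\<psi> i)))"
proof -
 let ?H = "hom_mod R (tensor R n M) (tensor R n N)"
 interpret H: module R ?H by (intro module_hom_mod module_tensor M N)
 have car: "carrier ?H = mod_hom R (tensor R n M) (tensor R n N)" by (simp add: hom_mod_def)
 have lins: "lins R n M N (%i. h i (\<psi> i))" if "\<psi>:tensor_base n P" for \<psi>
 by (intro linsI mod_hom_lin lin_hom_mod_closed[OF linsD[OF h]] tensor_baseD[OF that])
 have tm: "tensor_map R n M N (%i. h i (\<psi> i)):mod_hom R (tensor R n M) (tensor R n N)"
 if "\<psi>:tensor_base n P" for \<psi>
 by (rule tensor_map(1)[OF M N lins[OF that]])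
 note eqI = tensor_lin_eqI[OF M module_tensor[OF N] mod_hom_lin mod_hom_lin]
 show ?thesis unfolding multilin_def
 proof (intro conjI ballI allI impI)
 fix \<psi> assume p: "\<psi>:tensor_base n P"
 show "tensor_map R n M N (%i. h i (\<psi> i)):carrier ?H" using tm[OF p] by (simp add: car)
 fix i assume i: "i < n"
 interpret Pi: module R "P i" by (rule modulesD[OF P i])
 note up = tensor_base_upd[where M = P, OF p i]
 let ?t = "%x. tensor_map R n M N (%j. h j ((\<psi>(i := x)) j))"
 have val: "?t x (pure_tensor R n M v) = pure_tensor R n N ((tup n (%j. h j (\<psi> j) (v j)))(i := h i x (v i)))"
 if "x:carrier (P i)" "v:tensor_base n M" for x v
 proof -
 have "(tup n (%j. h j ((\<psi>(i := x)) j) (v j))) = (tup n (%j. h j (\<psi> j) (v j)))(i := h i x (v i))"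
 using i by (intro ext) simp
 thus ?thesis using tensor_map(2)[OF M N lins[OF up[OF that(1)]] that(2)] by simp
 qed
 have sl: "lin R (P i) (tensor R n N) (%x. pure_tensor R n N ((tup n (%j. h j (\<psi> j) (v j)))(i := h i x (v i))))"
 if "v:tensor_base n M" for v
 proof -
 have "(tup n (%j. h j (\<psi> j) (v j))):tensor_base n N"
 by (intro tensor_base_restrict lin_closed[OF linsD[OF lins[OF p]]] tensor_baseD[OF that])
 from lin_comp[OF lin_hom_mod_apply[OF linsD[OF h i] tensor_baseD[OF that i]]
 multilin_slice[OF multilin_pure[OF N] this i]] show ?thesis .
 qed
 show "lin R (P i) ?H ?t"
 proof (rule linI)
 fix x assume x: "x:carrier (P i)"
 show "?t x:carrier ?H" using tm[OF up[OF x]] by (simp add: car)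
 {
 fix y assume y: "y:carrier (P i)"
 have xy: "?t x +[?H] ?t y:mod_hom R (tensor R n M) (tensor R n N)"
 using H.add.m_closed[of "?t x" "?t y"] tm[OF up[OF x]] tm[OF up[OF y]] car by simp
 note s = tm[OF up[OF Pi.add.m_closed[OF x y]]]
 show "?t (x +[P i] y) = ?t x +[?H] ?t y"
 proof (rule mod_hom_eqI[OF s xy], rule eqI[OF s xy])
 fix v assume v: "v:tensor_base n M"
 show "?t (x +[P i] y) (pure_tensor R n M v) = (?t x +[?H] ?t y) (pure_tensor R n M v)"
 unfolding val[OF Pi.add.m_closed[OF x y] v] lin_add[OF sl[OF v] x y]
 using pure_closed[OF M v] val[OF x v] val[OF y v] by (simp add: hom_mod_def)
 qed
 }
 fix c assume c: "c:carrier R"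
 have cx: "c *[?H] ?t x:mod_hom R (tensor R n M) (tensor R n N)"
 using H.smult_closed[of c "?t x"] tm[OF up[OF x]] c car by simp
 note s = tm[OF up[OF Pi.smult_closed[OF c x]]]
 show "?t (c *[P i] x) = c *[?H] ?t x"
 proof (rule mod_hom_eqI[OF s cx], rule eqI[OF s cx])
 fix v assume v: "v:tensor_base n M"
 show "?t (c *[P i] x) (pure_tensor R n M v) = (c *[?H] ?t x) (pure_tensor R n M v)"
 unfolding val[OF Pi.smult_closed[OF c x] v] lin_smult[OF sl[OF v] c x]
 using pure_closed[OF M v] val[OF x v] by (simp add: hom_mod_def)
 qed
 qed
 qed
qed

lemma lin_hom_mod_conj:
 assumes "module R A" "module R A'" "module R B" "module R B'" "lin R A' A f" "lin R B B' g"
 shows "lin R (hom_mod R A B) (hom_mod R A' B') (%\<phi>. \<lambda>t\<in>carrier A'. g (\<phi> (f t)))"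
proof (rule lin_hom_modI)
 fix \<phi> assume "\<phi>:carrier (hom_mod R A B)"
 hence p: "lin R A B \<phi>" by (simp add: hom_mod_def mod_hom_lin)
 show "(\<lambda>t\<in>carrier A'. g (\<phi> (f t))):mod_hom R A' B'"
 by (rule lin_restrict[OF assms(2) lin_comp[OF lin_comp[OF assms(5) p] assms(6)]])
next
 fix t assume t: "t:carrier A'"
 have "lin R (hom_mod R A B) B' (%\<phi>. g (\<phi> (f t)))"
 by (rule lin_comp[OF lin_hom_mod_apply[OF lin_id lin_closed[OF assms(5) t]] assms(6)])
 thus "lin R (hom_mod R A B) B' (%\<phi>. (\<lambda>t\<in>carrier A'. g (\<phi> (f t))) t)" using t by simp
qed (intro module_hom_mod assms)+

section \<open>The inclusion for a Young subgroup is onto the equivariant maps\<close>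

lemma modules_sp_hom: "V:fgp ==> W:fgp ==> modules R n (%i. sp_hom R (l ! i) V W)"
 by (simp add: modules_def module_sp_hom fgp_module)

lemma multilin_young_incl:
 assumes V: "V:fgp" and W: "W:fgp"
 shows "multilin R (length l) (%i. sp_hom R (l ! i) V W)
 (hom_mod R (tpow R (sum_list l) V) (tpow R (sum_list l) W))
 (%\<psi>. \<lambda>t\<in>Tens (sum_list l) V. tjoin R l W
 (tensor_map R (length l) (%i. tpow R (l ! i) V) (%i. tpow R (l ! i) W) \<psi> (tsplit R l V t)))"
proof -
 note MV = fgp_module[OF V] and MW = fgp_module[OF W]
 have h: "lins R (length l) (%i. sp_hom R (l ! i) V W) (%i. hom_mod R (tpow R (l ! i) V) (tpow R (l ! i) W)) (%i \<phi>. \<phi>)"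
 by (intro linsI lin_sp_hom_incl)
 note m = multilin_tensor_map[OF modules_tpow[OF MV] modules_tpow[OF MW] modules_sp_hom[OF V W] h]
 show ?thesis
 by (rule multilin_lin[OF m lin_hom_mod_conj[OF module_tensor[OF modules_tpow[OF MV]] module_tpow[OF MV]
 module_tensor[OF modules_tpow[OF MW]] module_tpow[OF MW] tsplit_lin[OF MV] tjoin_lin[OF W]]])
qed

lemma young_incl:
 assumes V: "V:fgp" and W: "W:fgp"
 shows "lin R (tensor R (length l) (%i. sp_hom R (l ! i) V W))
 (hom_mod R (tpow R (sum_list l) V) (tpow R (sum_list l) W)) (young_incl R l V W)"
 and "!!\<psi> t. \<psi>:tensor_base (length l) (%i. sp_hom R (l ! i) V W) ==> t:Tens (sum_list l) V ==>
 tsplit R l W (young_incl R l V W (pure_tensor R (length l) (%i. sp_hom R (l ! i) V W) \<psi>) t) =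
 tensor_map R (length l) (%i. tpow R (l ! i) V) (%i. tpow R (l ! i) W) \<psi> (tsplit R l V t)"
proof -
 note MV = fgp_module[OF V] and MW = fgp_module[OF W]
 note L = tensor_lift[OF modules_sp_hom[OF V W] module_hom_mod[OF module_tpow[OF MV] module_tpow[OF MW]]
 multilin_young_incl[OF V W]]
 show "lin R (tensor R (length l) (%i. sp_hom R (l ! i) V W))
 (hom_mod R (tpow R (sum_list l) V) (tpow R (sum_list l) W)) (young_incl R l V W)"
 unfolding young_incl_def by (rule mod_hom_lin[OF L(1)])
 fix \<psi> t assume p: "\<psi>:tensor_base (length l) (%i. sp_hom R (l ! i) V W)"
 and t: "t:Tens (sum_list l) V"
 have lins: "lins R (length l) (%i. tpow R (l ! i) V) (%i. tpow R (l ! i) W) \<psi>"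
 by (intro linsI sp_hom_lin tensor_baseD[OF p])
 have "tensor_map R (length l) (%i. tpow R (l ! i) V) (%i. tpow R (l ! i) W) \<psi> (tsplit R l V t) :
 carrier (tensor R (length l) (%i. tpow R (l ! i) W))"
 by (rule lin_closed[OF mod_hom_lin[OF tensor_map(1)[OF modules_tpow[OF MV] modules_tpow[OF MW] lins]]
 lin_closed[OF tsplit_lin[OF MV] t]])
 thus "tsplit R l W (young_incl R l V W (pure_tensor R (length l) (%i. sp_hom R (l ! i) V W) \<psi>) t) =
 tensor_map R (length l) (%i. tpow R (l ! i) V) (%i. tpow R (l ! i) W) \<psi> (tsplit R l V t)"
 unfolding young_incl_def L(2)[OF p] using t by (simp add: tjoin(3)[OF W])
qed

text \<open>Sums of elementary maps: the pair \<open>L r = (p, q)\<close> sends the \<open>p\<close>-th basis vector in the tensor factor \<open>r\<close>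
 to the \<open>q\<close>-th one. For \<open>S\<close> the orbit of one \<open>L\<close> these are the standard basis elements of the Schur algebra.\<close>

definition esum :: "nat => ('a, 'u) module => ('a, 'u) module => ('i => 'u => 'a) => ('j => 'u) =>
 (nat => 'i\<times>'j) set => ('a, 'u) tensor => ('a, 'u) tensor" where
 "esum d V W \<xi> y S = (\<lambda>t\<in>Tens d V. finsum (tpow R d W)
 (%L. tc d V \<xi> (tup d (%r. fst (L r))) t *[tpow R d W] tb d W (%p. y (snd p)) L) S)"

lemma tb_closed:
 assumes "module R W" "y:C \<rightarrow> carrier W" "J:Idx d C"
 shows "(tup d (%r. y (J r))):tensor_base d (%_. W)" "tb d W y J:Tens d W"
proof -
 show "(tup d (%r. y (J r))):tensor_base d (%_. W)"
 by (intro tensor_base_restrict funcset_mem[OF assms(2)] idxD[OF assms(3)])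
 thus "tb d W y J:Tens d W" by (rule tpure_closed[OF assms(1)])
qed

lemma tperm_tb:
 assumes "module R W" "y:C \<rightarrow> carrier W" "J:Idx d C" "\<sigma> permutes {..<d}"
 shows "tperm R d W \<sigma> (tb d W y J) = tb d W y (tup d (%r. J (\<sigma> r)))"
proof -
 have "(tup d (%r. (tup d (%r. y (J r))) (\<sigma> r))) = (tup d (%r. y ((tup d (%r. J (\<sigma> r))) r)))"
 using permutes_in_image[OF assms(4)] by (intro ext) auto
 thus ?thesis using tperm(2)[OF assms(1) permutes_imp_bij[OF assms(4)] tb_closed(1)[OF assms(1-3)]] by simp
qed

lemma esum_lin:
 assumes V: "module R V" and DV: "dual_basis V B x \<xi>" and W: "module R W"
 and y: "y:C \<rightarrow> carrier W" and S: "S<=Idx d (B\<times>C)"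
 shows "esum d V W \<xi> y S:mod_hom R (tpow R d V) (tpow R d W)"
proof -
 interpret PW: module R "tpow R d W" by (rule module_tpow[OF W])
 have f: "(tup d (%r. fst (L r))):Idx d B" if "L:S" for L using S that by (intro idx_fst) blast
 note tl = dual_basisD(3)[OF dual_basis_tpow[OF V DV] f]
 have y': "(%p. y (snd p)):B\<times>C \<rightarrow> carrier W" using y by auto
 have tbb: "tb d W (%p. y (snd p)) L:Tens d W" if "L:S" for L
 using tb_closed(2)[OF W y', of L d] S that by blast
 have "lin R (tpow R d V) (tpow R d W) (%t. finsum (tpow R d W)
 (%L. tc d V \<xi> (tup d (%r. fst (L r))) t *[tpow R d W] tb d W (%p. y (snd p)) L) S)"
 by (rule lin_sum[OF module_tpow[OF V] module_tpow[OF W]]) (rule tl, assumption, rule Pi_I, rule tbb)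
 from lin_restrict[OF module_tpow[OF V] this] show ?thesis by (simp add: esum_def)
qed

lemma esum_sp_hom:
 assumes V: "module R V" and DV: "dual_basis V B x \<xi>" and W: "module R W"
 and y: "y:C \<rightarrow> carrier W" and S: "S<=Idx d (B\<times>C)"
 and inv: "!!L \<sigma>. L:S ==> \<sigma> permutes {..<d} ==> (tup d (%r. L (\<sigma> r))):S"
 shows "esum d V W \<xi> y S:Homs d V W"
 unfolding sp_hom_iff
proof (intro conjI allI impI ballI esum_lin[OF V DV W y S])
 interpret PW: module R "tpow R d W" by (rule module_tpow[OF W])
 have SL: "L:Idx d (B\<times>C)" if "L:S" for L using S that by blast
 have y': "(%p. y (snd p)):B\<times>C \<rightarrow> carrier W" using y by auto
 note tl = dual_basisD(3)[OF dual_basis_tpow[OF V DV] idx_fst[OF SL]]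
 have tcc: "tc d V \<xi> (tup d (%r. fst (L r))) t:carrier R" if "L:S" "t:Tens d V" for L t
 using lin_closed[OF tl[OF that(1)] that(2)] by simp
 note tbb = tb_closed(2)[OF W y' SL]
 let ?a = "%t L. tc d V \<xi> (tup d (%r. fst (L r))) t *[tpow R d W] tb d W (%p. y (snd p)) L"
 fix \<sigma> t assume s: "\<sigma> permutes {..<d}" and t: "t:Tens d V"
 note b = permutes_imp_bij[OF s]
 note st = lin_closed[OF tperm_lin[OF V b] t]
 let ?f = "%L. \<lambda>r\<in>{..<d}. L (\<sigma> r)"
 have inj: "inj_on ?f S" by (rule perm_bij(1)[OF S s]) (rule inv)
 have im: "?f ` S = S" by (rule perm_bij(2)[OF S s]) (rule inv)
 have "esum d V W \<xi> y S (tperm R d V \<sigma> t) = finsum (tpow R d W) (?a (tperm R d V \<sigma> t)) (?f ` S)"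
 using st by (simp add: esum_def im)
 also have "... = finsum (tpow R d W) (%L. ?a (tperm R d V \<sigma> t) (?f L)) S"
 by (rule PW.finsum_reindex[OF _ inj]) (simp add: im tcc[OF _ st] tbb)
 also have "... = finsum (tpow R d W) (%L. tperm R d W \<sigma> (?a t L)) S"
 proof (rule PW.finsum_cong'[OF refl])
 fix L assume L: "L:S"
 have "(tup d (%r. fst (?f L r))) = (tup d (%r. (tup d (%r. fst (L r))) (\<sigma> r)))"
 using permutes_in_image[OF s] by (intro ext) auto
 thus "?a (tperm R d V \<sigma> t) (?f L) = tperm R d W \<sigma> (?a t L)"
 using tc_tperm[OF V DV b idx_fst[OF SL[OF L]] t] tperm_tb[OF W y' SL[OF L] s]
 lin_smult[OF tperm_lin[OF W b] tcc[OF L t] tbb[OF L]] by simp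
 qed (simp add: lin_closed[OF tperm_lin[OF W b]] tcc[OF _ t] tbb)
 also have "... = tperm R d W \<sigma> (esum d V W \<xi> y S t)"
 using t by (simp add: esum_def lin_finsum[OF PW.module_axioms PW.module_axioms tperm_lin[OF W b]] tcc tbb)
 finally show "esum d V W \<xi> y S (tperm R d V \<sigma> t) = tperm R d W \<sigma> (esum d V W \<xi> y S t)" .
qed

end

lemma (in comm_monoid) finprod_idx_pairs:
 assumes "finite B" "finite C"
 and "!!J K. J:Idx d B ==> K:Idx d C ==> f J K:carrier G"
 shows "finprod G (%J. finprod G (f J) (Idx (d::nat) C)) (Idx d B) =
 finprod G (%L. f (tup d (%r. fst (L r))) (tup d (%r. snd (L r)))) (Idx d (B\<times>C))"
proof -
 let ?B = "Idx d B" and ?C = "Idx d C" and ?P = "Idx d (B\<times>C)"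
 let ?h = "%L. (\<lambda>r\<in>{..<d}. fst (L r), \<lambda>r\<in>{..<d}. snd (L r))"
 have fin: "finite ?B" "finite ?C" using assms(1,2) by (simp_all add: finite_PiE)
 have inj: "inj_on ?h ?P"
 proof (rule inj_onI)
 fix L L' assume L: "L:?P" "L':?P" and eq: "?h L = ?h L'"
 show "L = L'"
 proof (rule PiE_ext[OF L])
 have 1: "(tup d (%r. fst (L r))) = (tup d (%r. fst (L' r)))"
 and 2: "(tup d (%r. snd (L r))) = (tup d (%r. snd (L' r)))" using eq by blast+
 fix r assume "r:{..<d}"
 thus "L r = L' r" using fun_cong[OF 1, of r] fun_cong[OF 2, of r] by (simp add: prod_eq_iff)
 qed
 qed
 have im: "?h ` ?P = ?B\<times>?C"
 proof (intro equalityI subsetI)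
 fix p assume "p:?h ` ?P"
 thus "p:?B\<times>?C" using idx_fst[of _ d B C] idx_snd[of _ d B C] by blast
 next
 fix p assume p: "p:?B\<times>?C"
 obtain J K where JK: "p = (J, K)" "J:?B" "K:?C" using p by blast
 have m1: "(tup d (%r. (J r, K r))):?P"
 by (rule idxI) (simp add: idxD[OF JK(2)] idxD[OF JK(3)])
 have m2: "?h (tup d (%r. (J r, K r))) = p"
 proof -
 have "(tup d (%r. fst ((tup d (%r. (J r, K r))) r))) = J"
 by (rule PiE_ext[OF _ JK(2)]) (use JK(2) in "simp_all add: PiE_iff")
 moreover have "(tup d (%r. snd ((tup d (%r. (J r, K r))) r))) = K"
 by (rule PiE_ext[OF _ JK(3)]) (use JK(3) in "simp_all add: PiE_iff")
 ultimately show ?thesis unfolding JK(1) by (rule arg_cong2)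
 qed
 show "p:?h ` ?P" by (rule image_eqI[where f = ?h, OF m2[symmetric] m1])
 qed
 have "finprod G (%J. finprod G (f J) ?C) ?B = finprod G (%p. f (fst p) (snd p)) (?B\<times>?C)"
 using finprod_Sigma[of ?B "%_. ?C" "%p. f (fst p) (snd p)"] fin assms(3) by simp
 also have "... = finprod G (%L. f (fst (?h L)) (snd (?h L))) ?P"
 unfolding im[symmetric]
 proof (rule finprod_reindex[OF _ inj])
 show "(%p. f (fst p) (snd p)):?h ` ?P \<rightarrow> carrier G" unfolding im using assms(3) by force
 qed
 finally show ?thesis by simp
qed

context cring
begin

definition mat_coef :: "nat => ('a, 'u) module => ('a, 'u) module => ('i => 'u) => ('j => 'u => 'a) =>
 (('a, 'u) tensor => ('a, 'u) tensor) => (nat => 'i\<times>'j) => 'a" where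
 "mat_coef d V W x \<eta> \<phi> L = tc d W \<eta> (tup d (%r. snd (L r))) (\<phi> (tb d V x (tup d (%r. fst (L r)))))"

lemma dual_basis_mem: "dual_basis V B x \<xi> ==> x:B \<rightarrow> carrier V"
 by (rule Pi_I, rule dual_basisD(2))

lemma mat_coef_closed:
 assumes V: "module R V" and DV: "dual_basis V B x \<xi>" and W: "module R W" and DW: "dual_basis W C y \<eta>"
 and f: "lin R (tpow R d V) (tpow R d W) \<phi>" and L: "L:Idx d (B\<times>C)"
 shows "mat_coef d V W x \<eta> \<phi> L:carrier R"
 unfolding mat_coef_def
 by (rule dual_basisD(5)[OF dual_basis_tpow[OF W DW] idx_snd[OF L]
 lin_closed[OF f tb_closed(2)[OF V dual_basis_mem[OF DV] idx_fst[OF L]]]])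

text \<open>The matrix of an equivariant map is constant on orbits.\<close>

lemma mat_coef_perm:
 assumes V: "module R V" and DV: "dual_basis V B x \<xi>" and W: "module R W" and DW: "dual_basis W C y \<eta>"
 and f: "\<phi>:Homs d V W" and L: "L:Idx d (B\<times>C)" and s: "\<sigma> permutes {..<d}"
 shows "mat_coef d V W x \<eta> \<phi> (tup d (%r. L (\<sigma> r))) = mat_coef d V W x \<eta> \<phi> L"
proof -
 let ?J = "\<lambda>r\<in>{..<d}. fst (L r)" and ?K = "\<lambda>r\<in>{..<d}. snd (L r)"
 note b = permutes_imp_bij[OF s] and J = idx_fst[OF L] and K = idx_snd[OF L]
 have J': "(tup d (%r. fst ((tup d (%r. L (\<sigma> r))) r))) = (tup d (%r. ?J (\<sigma> r)))"
 and K': "(tup d (%r. snd ((tup d (%r. L (\<sigma> r))) r))) = (tup d (%r. ?K (\<sigma> r)))"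
 using permutes_less[OF s] by (auto simp: fun_eq_iff)
 note tbJ = tb_closed(2)[OF V dual_basis_mem[OF DV] J]
 show ?thesis
 unfolding mat_coef_def J' K' tperm_tb[OF V dual_basis_mem[OF DV] J s, symmetric] sp_hom_perm[OF f s tbJ]
 by (rule tc_tperm[OF W DW b K lin_closed[OF sp_hom_lin[OF f] tbJ]])
qed

lemma mat_coef_ct:
 assumes V: "module R V" and DV: "dual_basis V B x \<xi>" and W: "module R W" and DW: "dual_basis W C y \<eta>"
 and f: "\<phi>:Homs d V W" and L: "L:Idx d (B\<times>C)"
 and L': "L':Idx d (B\<times>C)" and ct: "ct d L = ct d L'"
 shows "mat_coef d V W x \<eta> \<phi> L = mat_coef d V W x \<eta> \<phi> L'"
proof -
 obtain \<sigma> where s: "\<sigma> permutes {..<d}" "L = (tup d (%r. L' (\<sigma> r)))" using ct_eq_perm[OF ct L] .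
 show ?thesis unfolding s(2) by (rule mat_coef_perm[OF V DV W DW f L' s(1)])
qed

lemma lin_expand:
 assumes V: "module R V" and DV: "dual_basis V B x \<xi>" and W: "module R W" and DW: "dual_basis W C y \<eta>"
 and f: "lin R (tpow R d V) (tpow R d W) \<phi>" and t: "t:Tens d V"
 shows "\<phi> t = finsum (tpow R d W) (%L. mat_coef d V W x \<eta> \<phi> L *[tpow R d W]
 (tc d V \<xi> (tup d (%r. fst (L r))) t *[tpow R d W] tb d W (%p. y (snd p)) L)) (Idx d (B\<times>C))"
proof -
 let ?B = "Idx d B" and ?C = "Idx d C"
 let ?V = "tpow R d V" and ?W = "tpow R d W"
 interpret PW: module R ?W by (rule module_tpow[OF W])
 note PV = module_tpow[OF V, of d]
 note DV' = dual_basisD[OF dual_basis_tpow[OF V DV, of d]] and DW' = dual_basisD[OF dual_basis_tpow[OF W DW, of d]]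
 have fb: "\<phi> (tb d V x J):carrier ?W" if "J:?B" for J by (rule lin_closed[OF f DV'(2)[OF that]])
 have c1: "tc d V \<xi> J t:carrier R" if "J:?B" for J by (rule DV'(5)[OF that t])
 have c2: "tc d W \<eta> K (\<phi> (tb d V x J)):carrier R" if "J:?B" "K:?C" for J K
 by (rule DW'(5)[OF that(2) fb[OF that(1)]])
 have "\<phi> t = \<phi> (finsum ?V (%J. tc d V \<xi> J t *[?V] tb d V x J) ?B)" by (simp only: DV'(4)[OF t])
 also have "... = finsum ?W (%J. \<phi> (tc d V \<xi> J t *[?V] tb d V x J)) ?B"
 by (rule lin_finsum[OF PV PW.module_axioms f])
 (intro Pi_I module.smult_closed[OF PV] c1 DV'(2); assumption)
 also have "... = finsum ?W (%J. finsum ?W (%K. tc d W \<eta> K (\<phi> (tb d V x J)) *[?W]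
 (tc d V \<xi> J t *[?W] tb d W y K)) ?C) ?B"
 proof (rule PW.finsum_cong'[OF refl])
 show "(%J. finsum ?W (%K. tc d W \<eta> K (\<phi> (tb d V x J)) *[?W] (tc d V \<xi> J t *[?W] tb d W y K)) ?C):?B \<rightarrow> carrier ?W"
 by (intro Pi_I PW.finsum_closed PW.smult_closed c1 c2 DW'(2); assumption)
 fix J assume J: "J:?B"
 have "\<phi> (tc d V \<xi> J t *[?V] tb d V x J) = tc d V \<xi> J t *[?W] \<phi> (tb d V x J)"
 by (rule lin_smult[OF f c1[OF J] DV'(2)[OF J]])
 also have "... = tc d V \<xi> J t *[?W] finsum ?W (%K. tc d W \<eta> K (\<phi> (tb d V x J)) *[?W] tb d W y K) ?C"
 by (simp only: DW'(4)[OF fb[OF J]])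
 also have "... = finsum ?W (%K. tc d V \<xi> J t *[?W] (tc d W \<eta> K (\<phi> (tb d V x J)) *[?W] tb d W y K)) ?C"
 by (rule PW.finsum_smult_ldistr[OF DW'(1) c1[OF J]])
 (intro Pi_I PW.smult_closed c2[OF J] DW'(2); assumption)
 also have "... = finsum ?W (%K. tc d W \<eta> K (\<phi> (tb d V x J)) *[?W] (tc d V \<xi> J t *[?W] tb d W y K)) ?C"
 proof (rule PW.finsum_cong'[OF refl])
 fix K assume K: "K:?C"
 show "tc d V \<xi> J t *[?W] (tc d W \<eta> K (\<phi> (tb d V x J)) *[?W] tb d W y K) =
 tc d W \<eta> K (\<phi> (tb d V x J)) *[?W] (tc d V \<xi> J t *[?W] tb d W y K)"
 using c1[OF J] c2[OF J K] DW'(2)[OF K] by (simp add: PW.smult_assoc1[symmetric] m_comm)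
 qed (intro Pi_I PW.smult_closed c1[OF J] c2[OF J] DW'(2); assumption)
 finally show "\<phi> (tc d V \<xi> J t *[?V] tb d V x J) =
 finsum ?W (%K. tc d W \<eta> K (\<phi> (tb d V x J)) *[?W] (tc d V \<xi> J t *[?W] tb d W y K)) ?C" .
 qed
 also have "... = finsum ?W (%L. tc d W \<eta> (tup d (%r. snd (L r))) (\<phi> (tb d V x (tup d (%r. fst (L r))))) *[?W]
 (tc d V \<xi> (tup d (%r. fst (L r))) t *[?W] tb d W y (tup d (%r. snd (L r))))) (Idx d (B\<times>C))"
 by (rule PW.add.finprod_idx_pairs[OF dual_basisD(1)[OF DV] dual_basisD(1)[OF DW]])
 (simp add: c1 c2 DW'(2))
 also have "(%L. tb d W y (tup d (%r. snd (L r)))) = tb d W (%p. y (snd p))"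
 by (intro ext arg_cong[where f = "tpure R d W"]) simp
 finally show ?thesis by (simp add: mat_coef_def restrict_def cong: if_cong)
qed

text \<open>An equivariant map is a linear combination of orbit sums. The orbits may be refined: below they are
 those of a Young subgroup.\<close>

lemma sp_hom_in_span:
 assumes V: "module R V" and DV: "dual_basis V B x \<xi>" and W: "module R W" and DW: "dual_basis W C y \<eta>"
 and f: "\<phi>:Homs d V W"
 and g: "!!L L'. L:Idx d (B\<times>C) ==> L':Idx d (B\<times>C) ==> g L = g L' ==> ct d L = ct d L'"
 and H: "submodule H R (hom_mod R (tpow R d V) (tpow R d W))"
 and E: "!!L. L:Idx d (B\<times>C) ==>
 esum d V W \<xi> y {L'\<in>Idx d (B\<times>C). g L' = g L}:H"
 shows "\<phi>:H"
proof -
 let ?P = "Idx d (B\<times>C)" and ?V = "tpow R d V" and ?W = "tpow R d W"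
 let ?H = "hom_mod R ?V ?W"
 interpret PW: module R ?W by (rule module_tpow[OF W])
 note PV = module_tpow[OF V, of d]
 interpret HM: module R ?H by (rule module_hom_mod[OF PV PW.module_axioms])
 note HD = submoduleD[OF H HM.module_axioms]
 have y: "y:C \<rightarrow> carrier W" by (rule dual_basis_mem[OF DW])
 have y': "(%p. y (snd p)):B\<times>C \<rightarrow> carrier W" using y by auto
 have finP: "finite ?P" using dual_basisD(1)[OF DV] dual_basisD(1)[OF DW] by (simp add: finite_PiE)
 define A where "A k = mat_coef d V W x \<eta> \<phi> (SOME L. L:?P & g L = k)" for k
 have A: "A (g L) = mat_coef d V W x \<eta> \<phi> L" if L: "L:?P" for L
 proof -
 have *: "(SOME L'. L':?P & g L' = g L):?P & g (SOME L'. L':?P & g L' = g L) = g L"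
 by (rule someI[of _ L]) (simp add: L)
 show ?thesis unfolding A_def
 using mat_coef_ct[OF V DV W DW f _ L] g[OF _ L] * by simp
 qed
 have mc: "mat_coef d V W x \<eta> \<phi> L:carrier R" if "L:?P" for L
 by (rule mat_coef_closed[OF V DV W DW sp_hom_lin[OF f] that])
 have AR: "A k:carrier R" if "k:g ` ?P" for k using that A mc by auto
 let ?E = "%k. esum d V W \<xi> y {L'\<in>?P. g L' = k}"
 have Ek: "?E k:H" if "k:g ` ?P" for k using that E by blast
 define S where "S = finsum ?H (%k. A k *[?H] ?E k) (g ` ?P)"
 have SH: "S:H" unfolding S_def
 by (rule submodule_finsum[OF H HM.module_axioms]) (use Ek AR HD(4) in blast)
 have "\<phi> = S"
 proof (rule mod_hom_eqI[OF sp_hom_mod_hom[OF f]])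
 show "S:mod_hom R ?V ?W" using SH HD(1) by (auto simp: hom_mod_def)
 fix t assume t: "t:carrier ?V"
 let ?e = "%L. tc d V \<xi> (tup d (%r. fst (L r))) t *[?W] tb d W (%p. y (snd p)) L"
 have e: "?e L:carrier ?W" if "L:?P" for L
 by (rule PW.smult_closed[OF dual_basisD(5)[OF dual_basis_tpow[OF V DV] idx_fst[OF that] t] tb_closed(2)[OF W y' that]])
 have ev: "lin R ?H ?W (%\<phi>. \<phi> t)" by (rule lin_hom_mod_apply[OF lin_id t])
 have Ec: "?E k:carrier ?H" if "k:g ` ?P" for k using Ek[OF that] HD(1) by blast
 have "S t = finsum ?W (%k. (A k *[?H] ?E k) t) (g ` ?P)"
 unfolding S_def by (rule lin_finsum[OF HM.module_axioms PW.module_axioms ev])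
 (intro Pi_I HM.smult_closed AR Ec; assumption)
 also have "... = finsum ?W (%k. finsum ?W (%L. mat_coef d V W x \<eta> \<phi> L *[?W] ?e L) {L\<in>?P. g L = k}) (g ` ?P)"
 proof (rule PW.finsum_cong'[OF refl])
 show "(%k. finsum ?W (%L. mat_coef d V W x \<eta> \<phi> L *[?W] ?e L) {L\<in>?P. g L = k}):g ` ?P \<rightarrow> carrier ?W"
 by (intro Pi_I PW.finsum_closed PW.smult_closed mc e; simp)
 fix k assume k: "k:g ` ?P"
 have "(A k *[?H] ?E k) t = A k *[?W] finsum ?W ?e {L\<in>?P. g L = k}"
 using t by (simp add: hom_mod_def esum_def)
 also have "... = finsum ?W (%L. A k *[?W] ?e L) {L\<in>?P. g L = k}"
 by (rule PW.finsum_smult_ldistr[OF _ AR[OF k]]) (use finP e in auto)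
 also have "... = finsum ?W (%L. mat_coef d V W x \<eta> \<phi> L *[?W] ?e L) {L\<in>?P. g L = k}"
 proof (rule PW.finsum_cong'[OF refl])
 show "(%L. mat_coef d V W x \<eta> \<phi> L *[?W] ?e L):{L\<in>?P. g L = k} \<rightarrow> carrier ?W"
 by (intro Pi_I PW.smult_closed mc e; simp)
 show "A k *[?W] ?e L = mat_coef d V W x \<eta> \<phi> L *[?W] ?e L" if "L:{L\<in>?P. g L = k}" for L
 using that A[of L] by simp
 qed
 finally show "(A k *[?H] ?E k) t = finsum ?W (%L. mat_coef d V W x \<eta> \<phi> L *[?W] ?e L) {L\<in>?P. g L = k}" .
 qed
 also have "... = finsum ?W (%L. mat_coef d V W x \<eta> \<phi> L *[?W] ?e L) ?P"
 by (rule PW.add.finprod_fibers[OF finP, symmetric]) (intro Pi_I PW.smult_closed mc e; assumption)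
 also have "... = \<phi> t" by (rule lin_expand[OF V DV W DW sp_hom_lin[OF f] t, symmetric])
 finally show "\<phi> t = S t" by simp
 qed
 thus ?thesis using SH by simp
qed

lemma blk_restrict_comp:
 "i < length l ==> blk l (tup (sum_list l) (%r. f (L r))) i = (tup (l ! i) (%j. f (blk l L i j)))"
 by (intro ext) (simp add: blk_def restrict_def pos_less)

lemma tc_blocks:
 assumes V: "module R V" and D: "dual_basis V B x \<xi>" and J: "J:Idx (sum_list l) B"
 and v: "v:tensor_base (sum_list l) (%_. V)"
 shows "(\<Otimes>i\<in>{..<length l}. tc (l ! i) V \<xi> (blk l J i) (tpure R (l ! i) V (blk l v i))) =
 tc (sum_list l) V \<xi> J (tpure R (sum_list l) V v)"
proof -
 have base: "(tup (length l) (%i. tpure R (l ! i) V (blk l v i))):tensor_base (length l) (%i. tpow R (l ! i) V)"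
 by (intro tensor_base_restrict tpure_closed[OF V] blk_base[OF v])
 have lins: "lins R (length l) (%i. tpow R (l ! i) V) (%_. ring_as_mod R) (%i. tc (l ! i) V \<xi> (blk l J i))"
 by (intro linsI dual_basisD(3)[OF dual_basis_tpow[OF V D]] blk_PiE[OF J])
 have "tc (sum_list l) V \<xi> J (tpure R (sum_list l) V v) = tcc l V \<xi> (blk l J) (tsplit R l V (tpure R (sum_list l) V v))"
 by (rule tcc_tsplit[OF V D J tpure_closed[OF V v], symmetric])
 also have "... = (\<Otimes>i\<in>{..<length l}. tc (l ! i) V \<xi> (blk l J i) ((tup (length l) (%i. tpure R (l ! i) V (blk l v i))) i))"
 unfolding tsplit(2)[OF V v]
 by (rule tcoef(2)[where J = "blk l J" and c = "%i. tc (l ! i) V \<xi>", OF modules_tpow[OF V] lins base])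
 also have "... = (\<Otimes>i\<in>{..<length l}. tc (l ! i) V \<xi> (blk l J i) (tpure R (l ! i) V (blk l v i)))"
 proof (rule finprod_cong'[OF refl])
 show "(%i. tc (l ! i) V \<xi> (blk l J i) (tpure R (l ! i) V (blk l v i))):{..<length l} \<rightarrow> carrier R"
 proof
 fix i assume "i:{..<length l}"
 hence i: "i < length l" by simp
 show "tc (l ! i) V \<xi> (blk l J i) (tpure R (l ! i) V (blk l v i)):carrier R"
 by (rule dual_basisD(5)[OF dual_basis_tpow[OF V D] blk_PiE[OF J i] tpure_closed[OF V blk_base[OF v i]]])
 qed
 qed simp
 finally show ?thesis by simp
qed

lemma young_incl_esum:
 assumes V: "V:fgp" and DV: "dual_basis V B x \<xi>" and W: "W:fgp" and DW: "dual_basis W C y \<eta>"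
 and S: "!!i. i < length l ==> S i<=Idx (l ! i) (B\<times>C)"
 and inv: "!!i. i < length l ==> esum (l ! i) V W \<xi> y (S i):Homs (l ! i) V W"
 shows "young_incl R l V W (pure_tensor R (length l) (%i. sp_hom R (l ! i) V W)
 (tup (length l) (%i. esum (l ! i) V W \<xi> y (S i)))) =
 esum (sum_list l) V W \<xi> y {L\<in>Idx (sum_list l) (B\<times>C). ALL i<length l. blk l L i:S i}"
 (is "young_incl R l V W ?\<psi> = esum ?d V W \<xi> y ?S")
proof -
 note MV = fgp_module[OF V] and MW = fgp_module[OF W]
 let ?n = "length l" and ?e = "\<lambda>i\<in>{..<length l}. esum (l ! i) V W \<xi> y (S i)"
 have psi: "?e:tensor_base ?n (%i. sp_hom R (l ! i) V W)"
 by (intro tensor_base_restrict inv)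
 have y: "y:C \<rightarrow> carrier W" by (rule dual_basis_mem[OF DW])
 have y': "(%p. y (snd p)):B\<times>C \<rightarrow> carrier W" using y by auto
 have finBC: "finite (B\<times>C)" using dual_basisD(1)[OF DV] dual_basisD(1)[OF DW] by simp
 have 1: "young_incl R l V W ?\<psi>:mod_hom R (tpow R ?d V) (tpow R ?d W)"
 by (rule lin_hom_mod_closed[OF young_incl(1)[OF V W] pure_closed[OF modules_sp_hom[OF V W] psi]])
 have 2: "esum ?d V W \<xi> y ?S:mod_hom R (tpow R ?d V) (tpow R ?d W)"
 by (rule esum_lin[OF MV DV MW y]) blast
 show ?thesis
 proof (rule mod_hom_eqI[OF 1 2], rule tpow_lin_eqI[OF MV module_tpow[OF MW] mod_hom_lin[OF 1] mod_hom_lin[OF 2]])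
 fix v assume v: "v:tensor_base ?d (%_. V)"
 note tv = tpure_closed[OF MV v]
 have lins: "lins R ?n (%i. tpow R (l ! i) V) (%i. tpow R (l ! i) W) ?e"
 by (intro linsI sp_hom_lin tensor_baseD[OF psi])
 have base: "(tup ?n (%i. tpure R (l ! i) V (blk l v i))):tensor_base ?n (%i. tpow R (l ! i) V)"
 by (intro tensor_base_restrict tpure_closed[OF MV] blk_base[OF v])
 let ?c = "%i L. tc (l ! i) V \<xi> (tup (l ! i) (%r. fst (L r))) (tpure R (l ! i) V (blk l v i))"
 have c: "?c i L:carrier R" if i: "i < ?n" and L: "L:S i" for i L
 proof -
 have "L:Idx (l ! i) (B\<times>C)" using S[OF i] L by blast
 from dual_basisD(5)[OF dual_basis_tpow[OF MV DV] idx_fst[OF this] tpure_closed[OF MV blk_base[OF v i]]]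
 show ?thesis .
 qed
 have "tsplit R l W (young_incl R l V W ?\<psi> (tpure R ?d V v)) =
 pure_tensor R ?n (%i. tpow R (l ! i) W) (tup ?n (%i. ?e i ((tup ?n (%i. tpure R (l ! i) V (blk l v i))) i)))"
 unfolding young_incl(2)[OF V W psi tv] tsplit(2)[OF MV v]
 by (rule tensor_map(2)[OF modules_tpow[OF MV] modules_tpow[OF MW] lins base])
 also have "(tup ?n (%i. ?e i ((tup ?n (%i. tpure R (l ! i) V (blk l v i))) i))) =
 (tup ?n (%i. finsum (tpow R (l ! i) W) (%L. ?c i L *[tpow R (l ! i) W] tb (l ! i) W (%p. y (snd p)) L) (S i)))"
 by (intro restrict_ext) (simp add: esum_def tpure_closed[OF MV blk_base[OF v]])
 also have "pure_tensor R ?n (%i. tpow R (l ! i) W) ... = tsplit R l W (finsum (tpow R ?d W)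
 (%L. (\<Otimes>i\<in>{..<?n}. ?c i (blk l L i)) *[tpow R ?d W] tb ?d W (%p. y (snd p)) L) ?S)"
 by (rule tsplit_sum[OF MW y' finBC S c])
 also have "finsum (tpow R ?d W) (%L. (\<Otimes>i\<in>{..<?n}. ?c i (blk l L i)) *[tpow R ?d W] tb ?d W (%p. y (snd p)) L) ?S =
 esum ?d V W \<xi> y ?S (tpure R ?d V v)"
 proof -
 interpret PW: module R "tpow R ?d W" by (rule module_tpow[OF MW])
 have "(\<Otimes>i\<in>{..<?n}. ?c i (blk l L i)) = tc ?d V \<xi> (tup ?d (%r. fst (L r))) (tpure R ?d V v)" if "L:?S" for L
 proof -
 have L: "L:Idx ?d (B\<times>C)" using that by blast
 have "(\<Otimes>i\<in>{..<?n}. ?c i (blk l L i)) =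
 (\<Otimes>i\<in>{..<?n}. tc (l ! i) V \<xi> (blk l (tup ?d (%r. fst (L r))) i) (tpure R (l ! i) V (blk l v i)))"
 proof (rule finprod_cong'[OF refl])
 show "(%i. tc (l ! i) V \<xi> (blk l (tup ?d (%r. fst (L r))) i) (tpure R (l ! i) V (blk l v i))):{..<?n} \<rightarrow> carrier R"
 using that c by (simp add: blk_restrict_comp Pi_iff)
 qed (simp add: blk_restrict_comp)
 thus ?thesis using tc_blocks[OF MV DV idx_fst[OF L] v] by simp
 qed
 moreover have "tc ?d V \<xi> (tup ?d (%r. fst (L r))) (tpure R ?d V v) *[tpow R ?d W] tb ?d W (%p. y (snd p)) L :
 Tens ?d W" if "L:?S" for L
 proof -
 have L: "L:Idx ?d (B\<times>C)" using that by blast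
 show ?thesis by (rule PW.smult_closed[OF dual_basisD(5)[OF dual_basis_tpow[OF MV DV] idx_fst[OF L] tv]
 tb_closed(2)[OF MW y' L]])
 qed
 ultimately show ?thesis using tv unfolding esum_def restrict_apply'[OF tv]
 by (intro PW.finsum_cong'[OF refl] Pi_I) simp_all
 qed
 finally show "young_incl R l V W ?\<psi> (tpure R ?d V v) = esum ?d V W \<xi> y ?S (tpure R ?d V v)"
 using inj_onD[OF tsplit_inj[OF W]] lin_closed[OF mod_hom_lin[OF 1] tv] lin_closed[OF mod_hom_lin[OF 2] tv] by blast
 qed
qed

text \<open>Restricting the equivariance from the symmetric group to a Young subgroup refines the orbits, and the
 orbit sums of the Young subgroup are tensor products of orbit sums of its factors.\<close>

lemma young_incl_surj:
 assumes V: "V:fgp" and W: "W:fgp" and f: "\<phi>:Homs (sum_list l) V W"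
 shows "\<phi>:young_incl R l V W ` carrier (tensor R (length l) (%i. sp_hom R (l ! i) V W))"
proof -
 note MV = fgp_module[OF V] and MW = fgp_module[OF W]
 obtain n :: nat and x \<xi> where DV: "dual_basis V {..<n} x \<xi>" using fg_projective_dual_basis[OF V] .
 obtain m :: nat and y \<eta> where DW: "dual_basis W {..<m} y \<eta>" using fg_projective_dual_basis[OF W] .
 let ?BC = "{..<n}\<times>{..<m}"
 let ?T = "tensor R (length l) (%i. sp_hom R (l ! i) V W)" and ?d = "sum_list l"
 let ?H = "young_incl R l V W ` carrier ?T"
 have H: "submodule ?H R (hom_mod R (tpow R ?d V) (tpow R ?d W))"
 by (rule submodule_image[OF module_tensor[OF modules_sp_hom[OF V W]]
 module_hom_mod[OF module_tpow[OF MV] module_tpow[OF MW]] young_incl(1)[OF V W]])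
 let ?g = "%L. \<lambda>i\<in>{..<length l}. ct (l ! i) (blk l L i)"
 have gi: "ct (l ! i) (blk l L i) = ct (l ! i) (blk l L' i)" if "?g L = ?g L'" "i < length l" for L L' :: "nat => nat\<times>nat" and i
 using fun_cong[OF that(1), of i] that(2) by simp
 have g: "ct ?d L = ct ?d L'" if "?g L = ?g L'" for L L' :: "nat => nat\<times>nat"
 unfolding ct_blocks using gi[OF that] by simp
 show ?thesis
 proof (rule sp_hom_in_span[OF MV DV MW DW f g H])
 fix L assume L: "L:Idx ?d ?BC"
 let ?S = "%i. {L'\<in>Idx (l ! i) ?BC. ct (l ! i) L' = ct (l ! i) (blk l L i)}"
 have S: "?S i<=Idx (l ! i) ?BC" for i by blast
 have inv: "esum (l ! i) V W \<xi> y (?S i):Homs (l ! i) V W" for i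
 proof (rule esum_sp_hom[OF MV DV MW dual_basis_mem[OF DW] S])
 fix L' \<sigma> assume L': "L':?S i" and s: "\<sigma> permutes {..<l ! i}"
 have "L':Idx (l ! i) ?BC" using L' by blast
 from idx_perm[OF s this] show "(tup (l ! i) (%r. L' (\<sigma> r))):?S i" using L' ct_perm[OF s, of L'] by simp
 qed
 have "{L'\<in>Idx ?d ?BC. ALL i<length l. blk l L' i:?S i} = {L'\<in>Idx ?d ?BC. ?g L' = ?g L}"
 proof (intro Collect_cong conj_cong refl iffI)
 fix L' assume L': "L':Idx ?d ?BC"
 show "?g L' = ?g L" if "ALL i<length l. blk l L' i:?S i"
 using that by (intro restrict_ext) simp
 show "ALL i<length l. blk l L' i:?S i" if "?g L' = ?g L"
 using gi[OF that] blk_PiE[OF L'] by simp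
 qed
 hence "esum ?d V W \<xi> y {L'\<in>Idx ?d ?BC. ?g L' = ?g L} =
 young_incl R l V W (pure_tensor R (length l) (%i. sp_hom R (l ! i) V W)
 (tup (length l) (%i. esum (l ! i) V W \<xi> y (?S i))))"
 using young_incl_esum[OF V DV W DW S inv] by simp
 also have "...:?H"
 by (intro imageI pure_closed modules_sp_hom V W tensor_base_restrict inv)
 finally show "esum ?d V W \<xi> y {L'\<in>Idx ?d ?BC. ?g L' = ?g L}:?H" .
 qed
qed

section \<open>Tensor products of representations\<close>

definition reps :: "nat list => (nat => ('a, 'u, 'x) sp_functor) => bool" where
 "reps l X \<longleftrightarrow> (ALL i<length l. is_rep R (l ! i) (X i))"

lemma repsD: "reps l X ==> i < length l ==> is_rep R (l ! i) (X i)"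
 by (simp add: reps_def)

lemma modules_reps: "reps l X ==> V:fgp ==> modules R (length l) (%i. on_obj (X i) V)"
 by (intro modulesI rep_module[OF repsD])

lemma reps_lins:
 assumes X: "reps l X" and V: "V:fgp" and W: "W:fgp"
 and p: "\<psi>:tensor_base (length l) (%i. sp_hom R (l ! i) V W)"
 shows "lins R (length l) (%i. on_obj (X i) V) (%i. on_obj (X i) W) (%i. on_mor (X i) V W (\<psi> i))"
 by (intro linsI rep_mor_lin[OF repsD[OF X] V W] tensor_baseD[OF p])

lemma young_act:
 assumes X: "reps l X" and V: "V:fgp" and W: "W:fgp"
 shows "lin R (tensor R (length l) (%i. sp_hom R (l ! i) V W))
 (hom_mod R (tensor R (length l) (%i. on_obj (X i) V)) (tensor R (length l) (%i. on_obj (X i) W)))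
 (young_act R l X V W)"
 and "!!\<psi>. \<psi>:tensor_base (length l) (%i. sp_hom R (l ! i) V W) ==>
 young_act R l X V W (pure_tensor R (length l) (%i. sp_hom R (l ! i) V W) \<psi>) =
 tensor_map R (length l) (%i. on_obj (X i) V) (%i. on_obj (X i) W) (%i. on_mor (X i) V W (\<psi> i))"
proof -
 let ?S = "%i. sp_hom R (l ! i) V W"
 have h: "lins R (length l) ?S (%i. hom_mod R (on_obj (X i) V) (on_obj (X i) W)) (%i. on_mor (X i) V W)"
 proof (rule linsI)
 fix i assume i: "i < length l"
 note Xi = repsD[OF X i]
 show "lin R (?S i) (hom_mod R (on_obj (X i) V) (on_obj (X i) W)) (on_mor (X i) V W)"
 proof (rule lin_hom_modI)
 show "module R (?S i)" by (rule modulesD[OF modules_sp_hom[OF V W] i])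
 qed (rule rep_mor[OF Xi V W] rep_module[OF Xi V] rep_module[OF Xi W] rep_lin[OF Xi V W]; assumption?)+
 qed
 note m = multilin_tensor_map[OF modules_reps[OF X V] modules_reps[OF X W] modules_sp_hom[OF V W] h]
 note L = tensor_lift[OF modules_sp_hom[OF V W] module_hom_mod[OF module_tensor[OF modules_reps[OF X V]]
 module_tensor[OF modules_reps[OF X W]]] m]
 show "lin R (tensor R (length l) ?S) (hom_mod R (tensor R (length l) (%i. on_obj (X i) V))
 (tensor R (length l) (%i. on_obj (X i) W))) (young_act R l X V W)"
 unfolding young_act_def by (rule mod_hom_lin[OF L(1)])
 show "young_act R l X V W (pure_tensor R (length l) ?S \<psi>) =
 tensor_map R (length l) (%i. on_obj (X i) V) (%i. on_obj (X i) W) (%i. on_mor (X i) V W (\<psi> i))"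
 if "\<psi>:tensor_base (length l) ?S" for \<psi>
 unfolding young_act_def by (rule L(2)[OF that])
qed

lemma young_act_nat:
 assumes X: "reps l X" and Y: "reps l Y" and V: "V:fgp" and W: "W:fgp"
 and aV: "lins R (length l) (%i. on_obj (X i) V) (%i. on_obj (Y i) V) \<alpha>"
 and aW: "lins R (length l) (%i. on_obj (X i) W) (%i. on_obj (Y i) W) \<beta>"
 and nat: "!!i \<phi> x. i < length l ==> \<phi>:Homs (l ! i) V W ==> x:carrier (on_obj (X i) V) ==>
 \<beta> i (on_mor (X i) V W \<phi> x) = on_mor (Y i) V W \<phi> (\<alpha> i x)"
 and xi: "\<xi>:carrier (tensor R (length l) (%i. sp_hom R (l ! i) V W))"
 and z: "z:carrier (tensor R (length l) (%i. on_obj (X i) V))"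
 shows "tensor_map R (length l) (%i. on_obj (X i) W) (%i. on_obj (Y i) W) \<beta> (young_act R l X V W \<xi> z) =
 young_act R l Y V W \<xi> (tensor_map R (length l) (%i. on_obj (X i) V) (%i. on_obj (Y i) V) \<alpha> z)"
proof -
 let ?n = "length l" and ?S = "%i. sp_hom R (l ! i) V W"
 let ?XV = "%i. on_obj (X i) V" and ?XW = "%i. on_obj (X i) W"
 let ?YV = "%i. on_obj (Y i) V" and ?YW = "%i. on_obj (Y i) W"
 note XV = modules_reps[OF X V] and XW = modules_reps[OF X W]
 note YV = modules_reps[OF Y V] and YW = modules_reps[OF Y W]
 note A = tensor_map[OF XV YV aV] and B = tensor_map[OF XW YW aW]
 note AX = young_act[OF X V W] and AY = young_act[OF Y V W]
 show ?thesis
 proof (rule tensor_lin_eqI[OF modules_sp_hom[OF V W] module_tensor[OF YW] _ _ _ xi])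
 show "lin R (tensor R ?n ?S) (tensor R ?n ?YW) (%\<xi>. tensor_map R ?n ?XW ?YW \<beta> (young_act R l X V W \<xi> z))"
 by (rule lin_comp[OF lin_hom_mod_apply[OF AX(1) z] mod_hom_lin[OF B(1)]])
 show "lin R (tensor R ?n ?S) (tensor R ?n ?YW) (%\<xi>. young_act R l Y V W \<xi> (tensor_map R ?n ?XV ?YV \<alpha> z))"
 by (rule lin_hom_mod_apply[OF AY(1) lin_closed[OF mod_hom_lin[OF A(1)] z]])
 fix \<psi> assume p: "\<psi>:tensor_base ?n ?S"
 note lX = reps_lins[OF X V W p] and lY = reps_lins[OF Y V W p]
 note TX = tensor_map[OF XV XW lX] and TY = tensor_map[OF YV YW lY]
 show "tensor_map R ?n ?XW ?YW \<beta> (young_act R l X V W (pure_tensor R ?n ?S \<psi>) z) =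
 young_act R l Y V W (pure_tensor R ?n ?S \<psi>) (tensor_map R ?n ?XV ?YV \<alpha> z)"
 unfolding AX(2)[OF p] AY(2)[OF p]
 proof (rule tensor_lin_eqI[OF XV module_tensor[OF YW] lin_comp[OF mod_hom_lin[OF TX(1)] mod_hom_lin[OF B(1)]]
 lin_comp[OF mod_hom_lin[OF A(1)] mod_hom_lin[OF TY(1)]] _ z])
 fix v assume v: "v:tensor_base ?n ?XV"
 have 1: "(tup ?n (%i. on_mor (X i) V W (\<psi> i) (v i))):tensor_base ?n ?XW"
 by (intro tensor_base_restrict lin_closed[OF linsD[OF lX]] tensor_baseD[OF v])
 have 2: "(tup ?n (%i. \<alpha> i (v i))):tensor_base ?n ?YV"
 by (intro tensor_base_restrict lin_closed[OF linsD[OF aV]] tensor_baseD[OF v])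
 have "(tup ?n (%i. \<beta> i ((tup ?n (%i. on_mor (X i) V W (\<psi> i) (v i))) i))) =
 (tup ?n (%i. on_mor (Y i) V W (\<psi> i) ((tup ?n (%i. \<alpha> i (v i))) i)))"
 by (intro restrict_ext) (simp add: nat[OF _ tensor_baseD[OF p] tensor_baseD[OF v]])
 thus "tensor_map R ?n ?XW ?YW \<beta> (tensor_map R ?n ?XV ?XW (%i. on_mor (X i) V W (\<psi> i)) (pure_tensor R ?n ?XV v)) =
 tensor_map R ?n ?YV ?YW (%i. on_mor (Y i) V W (\<psi> i)) (tensor_map R ?n ?XV ?YV \<alpha> (pure_tensor R ?n ?XV v))"
 unfolding TX(2)[OF v] A(2)[OF v] B(2)[OF 1] TY(2)[OF 2] by (rule arg_cong)
 qed
 qed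
qed

lemma reps_tpow: "reps l (%i. tpow_functor R (l ! i))"
 by (simp add: reps_def is_rep_tpow)

lemma young_act_tpow:
 assumes V: "V:fgp" and W: "W:fgp"
 and xi: "\<xi>:carrier (tensor R (length l) (%i. sp_hom R (l ! i) V W))" and t: "t:Tens (sum_list l) V"
 shows "young_act R l (%i. tpow_functor R (l ! i)) V W \<xi> (tsplit R l V t) = tsplit R l W (young_incl R l V W \<xi> t)"
proof -
 note MV = fgp_module[OF V] and MW = fgp_module[OF W]
 let ?n = "length l" and ?S = "%i. sp_hom R (l ! i) V W" and ?X = "%i. tpow_functor R (l ! i)"
 have obj: "on_obj (tpow_functor R e) = tpow R e" and mor: "on_mor (tpow_functor R e) = (%V W \<phi>. \<phi>)" for e
 by (simp_all add: tpow_functor_def)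
 note A = young_act[OF reps_tpow V W, unfolded obj mor] and I = young_incl[OF V W, where l = l]
 show ?thesis
 proof (rule tensor_lin_eqI[OF modules_sp_hom[OF V W] module_tensor[OF modules_tpow[OF MW]] _ _ _ xi])
 show "lin R (tensor R ?n ?S) (tensor R ?n (%i. tpow R (l ! i) W)) (%\<xi>. young_act R l ?X V W \<xi> (tsplit R l V t))"
 by (rule lin_hom_mod_apply[OF A(1) lin_closed[OF tsplit_lin[OF MV] t]])
 show "lin R (tensor R ?n ?S) (tensor R ?n (%i. tpow R (l ! i) W)) (%\<xi>. tsplit R l W (young_incl R l V W \<xi> t))"
 by (rule lin_comp[OF lin_hom_mod_apply[OF I(1) t] tsplit_lin[OF MW]])
 fix \<psi> assume p: "\<psi>:tensor_base ?n ?S"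
 show "young_act R l ?X V W (pure_tensor R ?n ?S \<psi>) (tsplit R l V t) =
 tsplit R l W (young_incl R l V W (pure_tensor R ?n ?S \<psi>) t)"
 unfolding A(2)[OF p] I(2)[OF p t] ..
 qed
qed

lemma tensor_functor_mor:
 assumes X: "reps l X" and V: "V:fgp" and W: "W:fgp" and f: "\<phi>:Homs (sum_list l) V W"
 obtains \<xi> where "\<xi>:carrier (tensor R (length l) (%i. sp_hom R (l ! i) V W))" "young_incl R l V W \<xi> = \<phi>"
 "on_mor (tensor_functor R l X) V W \<phi> = young_act R l X V W \<xi>"
 "on_mor (tensor_functor R l X) V W \<phi>:mod_hom R (on_obj (tensor_functor R l X) V) (on_obj (tensor_functor R l X) W)"
proof
 let ?xi = "inv_into (carrier (tensor R (length l) (%i. sp_hom R (l ! i) V W))) (young_incl R l V W) \<phi>"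
 show 1: "?xi:carrier (tensor R (length l) (%i. sp_hom R (l ! i) V W))"
 by (rule inv_into_into[OF young_incl_surj[OF V W f]])
 show "young_incl R l V W ?xi = \<phi>" by (rule f_inv_into_f[OF young_incl_surj[OF V W f]])
 show 2: "on_mor (tensor_functor R l X) V W \<phi> = young_act R l X V W ?xi" by (simp add: tensor_functor_def)
 show "on_mor (tensor_functor R l X) V W \<phi>:mod_hom R (on_obj (tensor_functor R l X) V) (on_obj (tensor_functor R l X) W)"
 unfolding 2 using lin_hom_mod_closed[OF young_act(1)[OF X V W] 1] by (simp add: tensor_functor_def)
qed

end

section \<open>Divided powers as representations\<close>

context cring
begin

text \<open>A family of modules that embeds naturally into tensor powers, or is a natural quotient of them,
 inherits the laws of a representation.\<close>

lemma is_rep_of_inj: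
 fixes X :: "('a, 'u, 'x) sp_functor"
 assumes mod: "!!V. V:fgp ==> module R (on_obj X V)"
 and mor: "!!V W \<phi>. V:fgp ==> W:fgp ==> \<phi>:Homs d V W ==>
 on_mor X V W \<phi>:mod_hom R (on_obj X V) (on_obj X W)"
 and D: "!!V. V:fgp ==> lin R (on_obj X V) (tpow R d V) (D V)"
 and inj: "!!V. V:fgp ==> inj_on (D V) (carrier (on_obj X V))"
 and nat: "!!V W \<phi> x. V:fgp ==> W:fgp ==> \<phi>:Homs d V W ==> x:carrier (on_obj X V) ==>
 D W (on_mor X V W \<phi> x) = \<phi> (D V x)"
 shows "is_rep R d X"
proof (rule is_repI)
 fix V W :: "('a, 'u) module" and \<phi> assume V: "V:fgp" and W: "W:fgp"
 note mcl = lin_closed[OF mod_hom_lin[OF mor[OF V W]]]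
 show "lin R (sp_hom R d V W) (on_obj X W) (%\<phi>. on_mor X V W \<phi> x)" if x: "x:carrier (on_obj X V)" for x
 proof (rule linI)
 interpret S: module R "sp_hom R d V W"
 by (rule module_sp_hom[OF fgp_module[OF V] fgp_module[OF W]])
 interpret XW: module R "on_obj X W" by (rule mod[OF W])
 note ap = lin_sp_hom_apply[OF lin_closed[OF D[OF V] x], of W]
 fix \<phi> assume f: "\<phi>:Homs d V W"
 show "on_mor X V W \<phi> x:carrier (on_obj X W)" by (rule mcl[OF f x])
 {
 fix \<psi> assume g: "\<psi>:Homs d V W"
 show "on_mor X V W (\<phi> +[sp_hom R d V W] \<psi>) x = on_mor X V W \<phi> x +[on_obj X W] on_mor X V W \<psi> x"
 by (rule inj_onD[OF inj[OF W] _ mcl[OF S.add.m_closed[OF f g] x] XW.add.m_closed[OF mcl[OF f x] mcl[OF g x]]])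
 (simp add: nat[OF V W _ x] S.add.m_closed f g lin_add[OF D[OF W]] mcl x lin_add[OF ap])
 }
 fix c assume c: "c:carrier R"
 show "on_mor X V W (c *[sp_hom R d V W] \<phi>) x = c *[on_obj X W] on_mor X V W \<phi> x"
 by (rule inj_onD[OF inj[OF W] _ mcl[OF S.smult_closed[OF c f] x] XW.smult_closed[OF c mcl[OF f x]]])
 (simp add: nat[OF V W _ x] S.smult_closed c f lin_smult[OF D[OF W]] mcl x lin_smult[OF ap])
 qed
next
 fix V :: "('a, 'u) module" and x assume V: "V:fgp" and x: "x:carrier (on_obj X V)"
 note i = sp_hom_id[OF fgp_module[OF V], of d]
 show "on_mor X V V (\<lambda>t\<in>Tens d V. t) x = x"
 by (rule inj_onD[OF inj[OF V] _ lin_closed[OF mod_hom_lin[OF mor[OF V V i]] x] x])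
 (simp only: nat[OF V V i x] restrict_apply'[OF lin_closed[OF D[OF V] x]])
next
 fix U V W :: "('a, 'u) module" and \<phi> \<psi> x
 assume U: "U:fgp" and V: "V:fgp" and W: "W:fgp" and f: "\<phi>:Homs d U V"
 and g: "\<psi>:Homs d V W" and x: "x:carrier (on_obj X U)"
 note gf = sp_hom_comp[OF f g fgp_module[OF U]]
 note fx = lin_closed[OF mod_hom_lin[OF mor[OF U V f]] x]
 show "on_mor X U W (compose (Tens d U) \<psi> \<phi>) x = on_mor X V W \<psi> (on_mor X U V \<phi> x)"
 by (rule inj_onD[OF inj[OF W] _ lin_closed[OF mod_hom_lin[OF mor[OF U W gf]] x]
 lin_closed[OF mod_hom_lin[OF mor[OF V W g]] fx]])
 (simp only: nat[OF U W gf x] nat[OF V W g fx] nat[OF U V f x] compose_eq[OF lin_closed[OF D[OF U] x]])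
qed (rule mod mor; assumption)+

lemma is_rep_of_surj:
 fixes X :: "('a, 'u, 'x) sp_functor"
 assumes mod: "!!V. V:fgp ==> module R (on_obj X V)"
 and mor: "!!V W \<phi>. V:fgp ==> W:fgp ==> \<phi>:Homs d V W ==>
 on_mor X V W \<phi>:mod_hom R (on_obj X V) (on_obj X W)"
 and P: "!!V. V:fgp ==> lin R (tpow R d V) (on_obj X V) (P V)"
 and surj: "!!V x. V:fgp ==> x:carrier (on_obj X V) ==> EX t:Tens d V. x = P V t"
 and nat: "!!V W \<phi> t. V:fgp ==> W:fgp ==> \<phi>:Homs d V W ==> t:Tens d V ==>
 on_mor X V W \<phi> (P V t) = P W (\<phi> t)"
 shows "is_rep R d X"
proof (rule is_repI)
 fix V W :: "('a, 'u) module" and x assume V: "V:fgp" and W: "W:fgp" and x: "x:carrier (on_obj X V)"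
 obtain t where t: "t:Tens d V" "x = P V t" using surj[OF V x] by (rule bexE)
 have L: "lin R (sp_hom R d V W) (on_obj X W) (%\<phi>. P W (\<phi> t))"
 by (rule lin_comp[OF lin_sp_hom_apply[OF t(1)] P[OF W]])
 show "lin R (sp_hom R d V W) (on_obj X W) (%\<phi>. on_mor X V W \<phi> x)"
 proof (rule lin_cong[OF L])
 show "module R (sp_hom R d V W)"
 by (rule module_sp_hom[OF fgp_module[OF V] fgp_module[OF W]])
 show "on_mor X V W \<phi> x = P W (\<phi> t)" if "\<phi>:Homs d V W" for \<phi>
 unfolding t(2) by (rule nat[OF V W that t(1)])
 qed
next
 fix V :: "('a, 'u) module" and x assume V: "V:fgp" and x: "x:carrier (on_obj X V)"
 obtain t where t: "t:Tens d V" "x = P V t" using surj[OF V x] by (rule bexE)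
 show "on_mor X V V (\<lambda>t\<in>Tens d V. t) x = x"
 unfolding t(2) nat[OF V V sp_hom_id[OF fgp_module[OF V]] t(1)] restrict_apply'[OF t(1)] ..
next
 fix U V W :: "('a, 'u) module" and \<phi> \<psi> x
 assume U: "U:fgp" and V: "V:fgp" and W: "W:fgp" and f: "\<phi>:Homs d U V"
 and g: "\<psi>:Homs d V W" and x: "x:carrier (on_obj X U)"
 obtain t where t: "t:Tens d U" "x = P U t" using surj[OF U x] by (rule bexE)
 show "on_mor X U W (compose (Tens d U) \<psi> \<phi>) x = on_mor X V W \<psi> (on_mor X U V \<phi> x)"
 unfolding t(2) nat[OF U W sp_hom_comp[OF f g fgp_module[OF U]] t(1)] nat[OF U V f t(1)]
 nat[OF V W g lin_closed[OF sp_hom_lin[OF f] t(1)]] compose_eq[OF t(1)] ..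
qed (rule mod mor; assumption)+

lemma subrep_sym: "subrep d (tpow_functor R d) (sym_tensors R d)"
proof (rule subrepI)
 fix V :: "('a, 'u) module" assume V: "V:fgp"
 interpret T: module R "tpow R d V" by (rule module_tpow[OF fgp_module[OF V]])
 have p: "lin R (tpow R d V) (tpow R d V) (tperm R d V \<sigma>)" if "\<sigma> permutes {..<d}" for \<sigma>
 by (rule tperm_lin[OF fgp_module[OF V] permutes_imp_bij[OF that]])
 have "submodule (sym_tensors R d V) R (tpow R d V)"
 proof (rule submoduleI'[OF T.module_axioms])
 show "\<zero>[tpow R d V]:sym_tensors R d V"
 using lin_zero[OF T.module_axioms T.module_axioms p] by (simp add: sym_tensors_def)
 qed (auto simp: sym_tensors_def lin_add[OF p] lin_smult[OF p])
 thus "submodule (sym_tensors R d V) R (on_obj (tpow_functor R d) V)" by (simp add: tpow_functor_def)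
next
 fix V W :: "('a, 'u) module" and \<phi> t
 assume "V:fgp" and f: "\<phi>:Homs d V W" and t: "t:sym_tensors R d V"
 have tt: "t:Tens d V" using t by (simp add: sym_tensors_def)
 have "tperm R d W \<sigma> (\<phi> t) = \<phi> t" if s: "\<sigma> permutes {..<d}" for \<sigma>
 using t s unfolding sp_hom_perm[OF f s tt, symmetric] by (simp add: sym_tensors_def)
 hence "\<phi> t:sym_tensors R d W" using lin_closed[OF sp_hom_lin[OF f] tt] by (simp add: sym_tensors_def)
 thus "on_mor (tpow_functor R d) V W \<phi> t:sym_tensors R d W" by (simp add: tpow_functor_def)
qed

lemma is_rep_div: "is_rep R d (div_power R d)"
 unfolding div_power_def by (rule is_rep_sub[OF is_rep_tpow subrep_sym])

lemma reps_div: "reps l (%i. div_power R (l ! i))"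
 by (simp add: reps_def is_rep_div)

abbreviation Gam :: "nat => ('a, 'u) module => ('a, ('a, 'u) tensor) module" where
 "Gam e V \<equiv> on_obj (div_power R e) V"

abbreviation Gams :: "nat list => ('a, 'u) module => ('a, ('a, ('a, 'u) tensor) tensor) module" where
 "Gams l V \<equiv> on_obj (div_powers R l) V"

lemma Gam_eq: "Gam e V = (tpow R e V)\<lparr>carrier := sym_tensors R e V\<rparr>"
 by (simp add: div_power_def sub_functor_def tpow_functor_def)

lemma Gams_eq: "Gams l V = tensor R (length l) (%i. Gam (l ! i) V)"
 by (simp add: div_powers_def tensor_functor_def)

lemma lin_Gam: "lin R (Gam e V) (tpow R e V) (%t. t)"
 by (rule linI) (simp_all add: Gam_eq sym_tensors_def)

lemma Gam_lin_restrict: "lin R (tpow R e V) N f ==> lin R (Gam e V) N f"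
 using lin_comp[OF lin_Gam] .

lemma lins_Gam: "lins R (length l) (%i. Gam (l ! i) V) (%i. tpow R (l ! i) V) (%i t. t)"
 by (intro linsI lin_Gam)

lemma modules_Gam: "V:fgp ==> modules R (length l) (%i. Gam (l ! i) V)"
 by (rule modules_reps[OF reps_div])

lemma module_Gams: "V:fgp ==> module R (Gams l V)"
 unfolding Gams_eq by (rule module_tensor[OF modules_Gam])

lemma div_incl:
 assumes V: "V:fgp"
 shows "lin R (Gams l V) (tpow R (sum_list l) V) (div_incl R l V)"
 and "!!z. z:carrier (Gams l V) ==> tsplit R l V (div_incl R l V z) =
 tensor_map R (length l) (%i. Gam (l ! i) V) (%i. tpow R (l ! i) V) (%i t. t) z"
proof -
 note MV = fgp_module[OF V]
 note T = tensor_map(1)[OF modules_Gam[OF V] modules_tpow[OF MV] lins_Gam]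
 show "lin R (Gams l V) (tpow R (sum_list l) V) (div_incl R l V)"
 unfolding Gams_eq div_incl_def by (rule lin_comp[OF mod_hom_lin[OF T] tjoin_lin[OF V]])
 show "tsplit R l V (div_incl R l V z) =
 tensor_map R (length l) (%i. Gam (l ! i) V) (%i. tpow R (l ! i) V) (%i t. t) z"
 if "z:carrier (Gams l V)" for z
 unfolding div_incl_def by (rule tjoin(3)[OF V lin_closed[OF mod_hom_lin[OF T] that[unfolded Gams_eq]]])
qed

lemma Gams_mor_hom:
 assumes V: "V:fgp" and W: "W:fgp" and f: "\<phi>:Homs (sum_list l) V W"
 shows "on_mor (div_powers R l) V W \<phi>:mod_hom R (Gams l V) (Gams l W)"
 unfolding div_powers_def by (rule tensor_functor_mor[OF reps_div V W f])

lemma div_incl_nat: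
 assumes V: "V:fgp" and W: "W:fgp" and f: "\<phi>:Homs (sum_list l) V W" and z: "z:carrier (Gams l V)"
 shows "div_incl R l W (on_mor (div_powers R l) V W \<phi> z) = \<phi> (div_incl R l V z)"
proof -
 note MV = fgp_module[OF V] and MW = fgp_module[OF W]
 obtain \<xi> where xi: "\<xi>:carrier (tensor R (length l) (%i. sp_hom R (l ! i) V W))" "young_incl R l V W \<xi> = \<phi>"
 "on_mor (div_powers R l) V W \<phi> = young_act R l (%i. div_power R (l ! i)) V W \<xi>"
 unfolding div_powers_def by (rule tensor_functor_mor[OF reps_div V W f])
 note oz = lin_closed[OF mod_hom_lin[OF Gams_mor_hom[OF V W f]] z]
 note Dz = lin_closed[OF div_incl(1)[OF V] z]
 have obj: "on_obj (tpow_functor R e) = tpow R e" and mor: "on_mor (tpow_functor R e) = (%V W \<phi>. \<phi>)" for e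
 by (simp_all add: tpow_functor_def)
 have "tsplit R l W (div_incl R l W (on_mor (div_powers R l) V W \<phi> z)) =
 tensor_map R (length l) (%i. Gam (l ! i) W) (%i. tpow R (l ! i) W) (%i t. t)
 (young_act R l (%i. div_power R (l ! i)) V W \<xi> z)"
 by (subst div_incl(2)[OF W oz]) (simp only: xi(3))
 also have "... = young_act R l (%i. tpow_functor R (l ! i)) V W \<xi>
 (tensor_map R (length l) (%i. Gam (l ! i) V) (%i. tpow R (l ! i) V) (%i t. t) z)"
 proof (rule young_act_nat[where Y = "%i. tpow_functor R (l ! i)", unfolded obj mor, OF reps_div reps_tpow V W lins_Gam lins_Gam _ xi(1)])
 show "on_mor (div_power R (l ! i)) V W \<phi> x = \<phi> x" if "x:carrier (Gam (l ! i) V)" for i \<phi> x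
 using that by (simp add: div_power_def sub_functor_def tpow_functor_def)
 show "z:carrier (tensor R (length l) (%i. Gam (l ! i) V))" using z by (simp only: Gams_eq)
 qed
 also have "... = tsplit R l W (\<phi> (div_incl R l V z))"
 unfolding div_incl(2)[OF V z, symmetric] young_act_tpow[OF V W xi(1) Dz] xi(2) ..
 finally show ?thesis
 by (rule inj_onD[OF tsplit_inj[OF W] _ lin_closed[OF div_incl(1)[OF W] oz] lin_closed[OF sp_hom_lin[OF f] Dz]])
qed

text \<open>Monomial symmetric tensors: orbit sums of basis tensors.\<close>

definition msum :: "nat => ('a, 'u) module => 'i set => ('i => 'u) => 'i multiset => ('a, 'u) tensor" where
 "msum d V B x a = finsum (tpow R d V) (tb d V x) {J\<in>Idx d B. ct d J = a}"

lemma msum_sym: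
 assumes V: "module R V" and x: "x:B \<rightarrow> carrier V"
 shows "msum d V B x a:sym_tensors R d V"
 unfolding sym_tensors_def
proof (intro CollectI conjI allI impI)
 let ?S = "{J\<in>Idx d B. ct d J = a}"
 interpret T: module R "tpow R d V" by (rule module_tpow[OF V])
 have S: "?S<=Idx d B" by blast
 have tbS: "tb d V x J:Tens d V" if "J:?S" for J
 by (rule tb_closed(2)[OF V x]) (use that in blast)
 show "msum d V B x a:Tens d V"
 unfolding msum_def by (rule T.finsum_closed) (intro Pi_I tbS)
 fix \<sigma> assume s: "\<sigma> permutes {..<d}"
 have inv: "(tup d (%r. L (\<tau> r))):?S" if "L:?S" "\<tau> permutes {..<d}" for L \<tau>
 proof -
 have "L:Idx d B" using that by blast
 from idx_perm[OF that(2) this] ct_perm[OF that(2), of L] that show ?thesis by simp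
 qed
 let ?f = "%L. \<lambda>r\<in>{..<d}. L (\<sigma> r)"
 have inj: "inj_on ?f ?S" by (rule perm_bij(1)[OF S s]) (rule inv)
 have im: "?f ` ?S = ?S" by (rule perm_bij(2)[OF S s]) (rule inv)
 have "tperm R d V \<sigma> (msum d V B x a) = finsum (tpow R d V) (%J. tperm R d V \<sigma> (tb d V x J)) ?S"
 unfolding msum_def
 by (rule lin_finsum[OF T.module_axioms T.module_axioms tperm_lin[OF V permutes_imp_bij[OF s]]]) (intro Pi_I tbS)
 also have "... = finsum (tpow R d V) (%J. tb d V x (?f J)) ?S"
 proof (rule T.finsum_cong'[OF refl])
 show "(%J. tb d V x (?f J)):?S \<rightarrow> Tens d V" by (intro Pi_I tbS inv s)
 show "tperm R d V \<sigma> (tb d V x J) = tb d V x (?f J)" if "J:?S" for J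
 by (rule tperm_tb[OF V x _ s]) (use that in blast)
 qed
 also have "... = finsum (tpow R d V) (tb d V x) (?f ` ?S)"
 by (rule T.finsum_reindex[OF _ inj, symmetric]) (unfold im, intro Pi_I tbS)
 finally show "tperm R d V \<sigma> (msum d V B x a) = msum d V B x a" unfolding im msum_def .
qed

abbreviation rp :: "nat => 'i set => 'i multiset => nat => 'i" where
 "rp d B a \<equiv> inv_into (Idx d B) (ct d) a"

lemma rp:
 assumes "a:ct d ` Idx d B"
 shows "rp d B a:Idx d B" and "ct d (rp d B a) = a"
 using inv_into_into[OF assms] f_inv_into_f[OF assms] by auto

lemma dual_basis_Gam:
 assumes V: "V:fgp" and D: "dual_basis V B x \<xi>"
 shows "dual_basis (Gam d V) (ct d ` Idx d B) (msum d V B x) (%a. tc d V \<xi> (rp d B a))"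
proof -
 note MV = fgp_module[OF V]
 let ?P = "Idx d B" and ?T = "tpow R d V"
 interpret T: module R ?T by (rule module_tpow[OF MV])
 interpret G: module R "Gam d V" by (rule rep_module[OF is_rep_div V])
 note x = dual_basis_mem[OF D]
 note DT = dual_basisD[OF dual_basis_tpow[OF MV D, of d]]
 have fin: "finite ?P" using dual_basisD(1)[OF D] by (simp add: finite_PiE)
 have ms: "msum d V B x a:carrier (Gam d V)" for a using msum_sym[OF MV x, of d a] by (simp add: Gam_eq)
 show ?thesis
 unfolding dual_basis_def
 proof (intro conjI ballI)
 show "finite (ct d ` ?P)" using fin by simp
 fix a assume a: "a:ct d ` ?P"
 show "lin R (Gam d V) (ring_as_mod R) (tc d V \<xi> (rp d B a))"
 by (rule Gam_lin_restrict[OF DT(3)[OF rp(1)[OF a]]])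
 next
 fix t assume t: "t:carrier (Gam d V)"
 have ts: "t:sym_tensors R d V" and tT: "t:carrier ?T" using t by (simp_all add: Gam_eq sym_tensors_def)
 have const: "tc d V \<xi> J t = tc d V \<xi> (rp d B (ct d J)) t" if J: "J:?P" for J
 proof -
 have a: "ct d J:ct d ` ?P" using J by (rule imageI)
 obtain \<sigma> where s: "\<sigma> permutes {..<d}" "J = (tup d (%r. rp d B (ct d J) (\<sigma> r)))"
 using ct_eq_perm[OF rp(2)[OF a, symmetric] J] .
 have "tc d V \<xi> J t = tc d V \<xi> (tup d (%r. rp d B (ct d J) (\<sigma> r))) (tperm R d V \<sigma> t)"
 using ts s by (simp add: sym_tensors_def)
 also have "... = tc d V \<xi> (rp d B (ct d J)) t"
 by (rule tc_tperm[OF MV D permutes_imp_bij[OF s(1)] rp(1)[OF a] tT])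
 finally show ?thesis .
 qed
 have cl: "tc d V \<xi> J t *[?T] tb d V x J:carrier ?T" if "J:?P" for J
 by (rule T.smult_closed[OF DT(5)[OF that tT] DT(2)[OF that]])
 have "t = finsum ?T (%J. tc d V \<xi> J t *[?T] tb d V x J) ?P" by (rule DT(4)[OF tT, symmetric])
 also have "... = finsum ?T (%a. finsum ?T (%J. tc d V \<xi> J t *[?T] tb d V x J) {J\<in>?P. ct d J = a}) (ct d ` ?P)"
 by (rule T.add.finprod_fibers[OF fin]) (intro Pi_I cl)
 also have "... = finsum ?T (%a. tc d V \<xi> (rp d B a) t *[?T] msum d V B x a) (ct d ` ?P)"
 proof (rule T.finsum_cong'[OF refl])
 fix a assume a: "a:ct d ` ?P"
 note ca = DT(5)[OF rp(1)[OF a] tT]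
 have m: "tb d V x J:carrier ?T" if "J:{J\<in>?P. ct d J = a}" for J using that DT(2)[of J] by simp
 have "finsum ?T (%J. tc d V \<xi> J t *[?T] tb d V x J) {J\<in>?P. ct d J = a} =
 finsum ?T (%J. tc d V \<xi> (rp d B a) t *[?T] tb d V x J) {J\<in>?P. ct d J = a}"
 proof (rule T.finsum_cong'[OF refl])
 show "(%J. tc d V \<xi> (rp d B a) t *[?T] tb d V x J):{J\<in>?P. ct d J = a} \<rightarrow> carrier ?T"
 by (intro Pi_I T.smult_closed ca m)
 show "tc d V \<xi> J t *[?T] tb d V x J = tc d V \<xi> (rp d B a) t *[?T] tb d V x J" if "J:{J\<in>?P. ct d J = a}" for J
 using const[of J] that by simp
 qed
 also have "... = tc d V \<xi> (rp d B a) t *[?T] msum d V B x a"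
 unfolding msum_def by (rule T.finsum_smult_ldistr[OF _ ca, symmetric]) (use fin m in auto)
 finally show "finsum ?T (%J. tc d V \<xi> J t *[?T] tb d V x J) {J\<in>?P. ct d J = a} =
 tc d V \<xi> (rp d B a) t *[?T] msum d V B x a" .
 next
 show "(%a. tc d V \<xi> (rp d B a) t *[?T] msum d V B x a):ct d ` ?P \<rightarrow> carrier ?T"
 by (intro Pi_I T.smult_closed DT(5)[OF rp(1) tT] lin_closed[OF lin_Gam ms])
 qed
 also have "... = finsum (Gam d V) (%a. tc d V \<xi> (rp d B a) t *[Gam d V] msum d V B x a) (ct d ` ?P)"
 proof -
 have "finsum (Gam d V) (%a. tc d V \<xi> (rp d B a) t *[Gam d V] msum d V B x a) (ct d ` ?P) =
 finsum ?T (%a. tc d V \<xi> (rp d B a) t *[Gam d V] msum d V B x a) (ct d ` ?P)"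
 by (rule lin_finsum[OF G.module_axioms T.module_axioms lin_Gam])
 (intro Pi_I G.smult_closed DT(5)[OF rp(1) tT] ms)
 thus ?thesis by (simp add: Gam_eq)
 qed
 finally show "t = finsum (Gam d V) (%a. tc d V \<xi> (rp d B a) t *[Gam d V] msum d V B x a) (ct d ` ?P)" .
 qed (rule ms)
qed

text \<open>Indices for the monomial basis of a tensor product of divided powers: row \<open>i\<close> is a multiset of
 size \<open>l ! i\<close>.\<close>

abbreviation Tabs :: "nat list => 'i set => (nat => 'i multiset) set" where
 "Tabs l B \<equiv> PiE {..<length l} (%i. ct (l ! i) ` Idx (l ! i) B)"

definition gam :: "nat list => ('a, 'u) module => 'i set => ('i => 'u) => (nat => 'i multiset) =>
 ('a, ('a, 'u) tensor) tensor" where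
 "gam l V B x T = pure_tensor R (length l) (%i. Gam (l ! i) V) (tup (length l) (%i. msum (l ! i) V B x (T i)))"

definition gcoef :: "nat list => ('a, 'u) module => 'i set => ('i => 'u => 'a) => (nat => 'i multiset) =>
 ('a, ('a, 'u) tensor) tensor => 'a" where
 "gcoef l V B \<xi> = tcoef (length l) (%i. Gam (l ! i) V) (%i a. tc (l ! i) V \<xi> (rp (l ! i) B a))"

lemma dual_basis_Gams:
 assumes V: "V:fgp" and D: "dual_basis V B x \<xi>"
 shows "dual_basis (Gams l V) (Tabs l B) (gam l V B x) (gcoef l V B \<xi>)"
 unfolding Gams_eq gcoef_def gam_def
 by (rule dual_basis_tensor[OF modules_Gam[OF V]]) (rule dual_basis_Gam[OF V D])

lemma gam_closed: "V:fgp ==> x:B \<rightarrow> carrier V ==> gam l V B x T:carrier (Gams l V)"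
 unfolding gam_def Gams_eq
proof (rule pure_closed[OF modules_Gam], assumption, rule tensor_base_restrict)
 fix i assume V: "V:fgp" and x: "x:B \<rightarrow> carrier V"
 show "msum (l ! i) V B x (T i):carrier (Gam (l ! i) V)"
 using msum_sym[OF fgp_module[OF V] x] by (simp add: Gam_eq)
qed

abbreviation rows :: "nat list => (nat => 'i) => nat => 'i multiset" where
 "rows l J \<equiv> (tup (length l) (%i. ct (l ! i) (blk l J i)))"

lemma div_incl_gam:
 assumes V: "V:fgp" and x: "x:B \<rightarrow> carrier V" and B: "finite B"
 shows "div_incl R l V (gam l V B x T) = finsum (tpow R (sum_list l) V) (tb (sum_list l) V x)
 {J\<in>Idx (sum_list l) B. ALL i<length l. ct (l ! i) (blk l J i) = T i}"
proof -
 note MV = fgp_module[OF V]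
 let ?n = "length l" and ?d = "sum_list l"
 let ?S = "%i. {J\<in>Idx (l ! i) B. ct (l ! i) J = T i}"
 let ?U = "{J\<in>Idx ?d B. ALL i<?n. ct (l ! i) (blk l J i) = T i}"
 interpret P: module R "tpow R ?d V" by (rule module_tpow[OF MV])
 have S: "?S i<=Idx (l ! i) B" for i by blast
 have g: "gam l V B x T:carrier (Gams l V)" by (rule gam_closed[OF V x])
 have v: "(tup ?n (%i. msum (l ! i) V B x (T i))):tensor_base ?n (%i. Gam (l ! i) V)"
 by (rule tensor_base_restrict) (use msum_sym[OF MV x] in "simp add: Gam_eq")
 have tbU: "tb ?d V x J:Tens ?d V" if "J:?U" for J
 by (rule tb_closed(2)[OF MV x]) (use that in blast)
 have ms: "msum (l ! i) V B x (T i) = finsum (tpow R (l ! i) V) (%L. \<one> *[tpow R (l ! i) V] tb (l ! i) V x L) (?S i)" for i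
 proof -
 interpret Q: module R "tpow R (l ! i) V" by (rule module_tpow[OF MV])
 have tbS: "tb (l ! i) V x J:Tens (l ! i) V" if "J:?S i" for J
 by (rule tb_closed(2)[OF MV x]) (use that in blast)
 show ?thesis unfolding msum_def
 proof (rule Q.finsum_cong'[OF refl])
 show "(%L. \<one> *[tpow R (l ! i) V] tb (l ! i) V x L):?S i \<rightarrow> Tens (l ! i) V"
 by (intro Pi_I Q.smult_closed one_closed tbS)
 qed (rule Q.smult_one[OF tbS, symmetric])
 qed
 have "tsplit R l V (div_incl R l V (gam l V B x T)) =
 pure_tensor R ?n (%i. tpow R (l ! i) V) (tup ?n (%i. (tup ?n (%i. msum (l ! i) V B x (T i))) i))"
 unfolding div_incl(2)[OF V g] unfolding gam_def
 by (rule tensor_map(2)[OF modules_Gam[OF V] modules_tpow[OF MV] lins_Gam v])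
 also have "(tup ?n (%i. (tup ?n (%i. msum (l ! i) V B x (T i))) i)) =
 (tup ?n (%i. finsum (tpow R (l ! i) V) (%L. \<one> *[tpow R (l ! i) V] tb (l ! i) V x L) (?S i)))"
 unfolding ms[symmetric] by (intro restrict_ext) simp
 also have "pure_tensor R ?n (%i. tpow R (l ! i) V) ... = tsplit R l V (finsum (tpow R ?d V)
 (%L. (\<Otimes>i\<in>{..<?n}. \<one>) *[tpow R ?d V] tb ?d V x L) {L\<in>Idx ?d B. ALL i<?n. blk l L i:?S i})"
 by (rule tsplit_sum[OF MV x B S]) simp
 also have "{L\<in>Idx ?d B. ALL i<?n. blk l L i:?S i} = ?U"
 using blk_PiE[where l = l and A = B] by blast
 also have "finsum (tpow R ?d V) (%L. (\<Otimes>i\<in>{..<?n}. \<one>) *[tpow R ?d V] tb ?d V x L) ?U =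
 finsum (tpow R ?d V) (tb ?d V x) ?U"
 proof (rule P.finsum_cong'[OF refl])
 show "tb ?d V x:?U \<rightarrow> Tens ?d V" by (intro Pi_I tbU)
 show "(\<Otimes>i\<in>{..<?n}. \<one>) *[tpow R ?d V] tb ?d V x L = tb ?d V x L" if "L:?U" for L
 by (simp only: finprod_one P.smult_one[OF tbU[OF that]])
 qed
 finally show ?thesis
 by (rule inj_onD[OF tsplit_inj[OF V] _ lin_closed[OF div_incl(1)[OF V] g]])
 (rule P.finsum_closed, intro Pi_I tbU)
qed

lemma gcoef_eq:
 assumes V: "V:fgp" and D: "dual_basis V B x \<xi>" and T: "T:Tabs l B" and z: "z:carrier (Gams l V)"
 shows "gcoef l V B \<xi> T z = tc (sum_list l) V \<xi> (glue l (%i. rp (l ! i) B (T i))) (div_incl R l V z)"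
proof -
 note MV = fgp_module[OF V]
 let ?n = "length l" and ?K = "%i. rp (l ! i) B (T i)"
 let ?J = "glue l ?K"
 have K: "?K i:Idx (l ! i) B" if "i < ?n" for i by (rule rp(1)[OF idxD[OF T that]])
 have J: "?J:Idx (sum_list l) B" by (rule glue_PiE) (rule K)
 have bJ: "blk l ?J i = ?K i" if "i < ?n" for i by (rule blk_glue[where K = ?K, OF that K[OF that]])
 have lG: "lins R ?n (%i. Gam (l ! i) V) (%_. ring_as_mod R) (%i. tc (l ! i) V \<xi> (?K i))"
 by (intro linsI Gam_lin_restrict dual_basisD(3)[OF dual_basis_tpow[OF MV D]] K)
 have lT: "lins R ?n (%i. tpow R (l ! i) V) (%_. ring_as_mod R) (%i. tc (l ! i) V \<xi> (blk l ?J i))"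
 by (intro linsI dual_basisD(3)[OF dual_basis_tpow[OF MV D]] blk_PiE[OF J])
 note G = tcoef[where c = "%i a. tc (l ! i) V \<xi> (rp (l ! i) B a)" and J = T, OF modules_Gam[OF V] lG]
 note TT = tcoef[where c = "%i. tc (l ! i) V \<xi>" and J = "blk l ?J", OF modules_tpow[OF MV] lT]
 note I = tensor_map[OF modules_Gam[OF V] modules_tpow[OF MV] lins_Gam]
 note z' = z[unfolded Gams_eq]
 have "gcoef l V B \<xi> T z = tcc l V \<xi> (blk l ?J)
 (tensor_map R ?n (%i. Gam (l ! i) V) (%i. tpow R (l ! i) V) (%i t. t) z)"
 unfolding gcoef_def
 proof (rule tensor_lin_eqI[OF modules_Gam[OF V] module_ring G(1) lin_comp[OF mod_hom_lin[OF I(1)] TT(1)] _ z'])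
 fix v assume v: "v:tensor_base ?n (%i. Gam (l ! i) V)"
 have v': "(tup ?n (%i. v i)):tensor_base ?n (%i. tpow R (l ! i) V)"
 by (intro tensor_base_restrict lin_closed[OF lin_Gam] tensor_baseD[OF v])
 show "tcoef ?n (%i. Gam (l ! i) V) (%i a. tc (l ! i) V \<xi> (rp (l ! i) B a)) T (pure_tensor R ?n (%i. Gam (l ! i) V) v) =
 tcc l V \<xi> (blk l ?J) (tensor_map R ?n (%i. Gam (l ! i) V) (%i. tpow R (l ! i) V) (%i t. t)
 (pure_tensor R ?n (%i. Gam (l ! i) V) v))"
 unfolding G(2)[OF v] I(2)[OF v] TT(2)[OF v']
 proof (rule finprod_cong'[OF refl])
 show "(%i. tc (l ! i) V \<xi> (blk l ?J i) ((tup ?n (%i. v i)) i)):{..<?n} \<rightarrow> carrier R"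
 using lin_closed[OF linsD[OF lT] tensor_baseD[OF v']] by (intro Pi_I) simp
 qed (simp add: bJ)
 qed
 also have "... = tc (sum_list l) V \<xi> ?J (div_incl R l V z)"
 unfolding div_incl(2)[OF V z, symmetric]
 by (rule tcc_tsplit[OF MV D J lin_closed[OF div_incl(1)[OF V] z]])
 finally show ?thesis .
qed

lemma div_incl_inj:
 assumes V: "V:fgp"
 shows "inj_on (div_incl R l V) (carrier (Gams l V))"
proof (rule inj_onI)
 obtain n :: nat and x \<xi> where D: "dual_basis V {..<n} x \<xi>" using fg_projective_dual_basis[OF V] .
 fix z z' assume z: "z:carrier (Gams l V)" and z': "z':carrier (Gams l V)"
 and eq: "div_incl R l V z = div_incl R l V z'"
 show "z = z'"
 by (rule dual_basis_eqI[OF dual_basis_Gams[OF V D] module_Gams[OF V] z z'])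
 (simp only: gcoef_eq[OF V D _ z] gcoef_eq[OF V D _ z'] eq)
qed

lemma is_rep_Gams: "is_rep R (sum_list l) (div_powers R l)"
 by (rule is_rep_of_inj[where D = "div_incl R l"])
 (rule module_Gams Gams_mor_hom div_incl(1) div_incl_inj div_incl_nat; assumption)+

end

section \<open>Exterior powers as representations\<close>

context cring
begin

lemma alt_gens_closed:
 "module R V ==> {tpure R d V v | v. v:tensor_base d (%_. V) & (EX i j. i < j & j < d & v i = v j)}<=Tens d V"
 using tpure_closed by blast

lemma submodule_alt: "module R V ==> submodule (alt_rels R d V) R (tpow R d V)"
 unfolding alt_rels_def by (rule submodule_mod_span[OF module_tpow alt_gens_closed])

lemma alt_repeat:
 assumes "v:tensor_base d (%_. V)" "i < d" "j < d" "i ~= j" "v i = v j"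
 shows "tpure R d V v:alt_rels R d V"
 unfolding alt_rels_def
proof (rule mod_span_superset, intro CollectI exI conjI)
 show "v:tensor_base d (%_. V)" by fact
 show "min i j < max i j" "max i j < d" using assms by auto
 show "v (min i j) = v (max i j)" using assms by (cases "i < j") (auto simp: min_def max_def)
qed (rule refl)

abbreviation Ext :: "nat => ('a, 'u) module => ('a, ('a, 'u) tensor set) module" where
 "Ext d V \<equiv> quot_mod (tpow R d V) (alt_rels R d V)"

abbreviation pr :: "nat => ('a, 'u) module => ('a, 'u) tensor => ('a, 'u) tensor set" where
 "pr d V \<equiv> quot_proj (tpow R d V) (alt_rels R d V)"

lemma module_Ext: "module R V ==> module R (Ext d V)"
 by (rule module_quot[OF module_tpow submodule_alt])

lemma pr_lin: "module R V ==> lin R (tpow R d V) (Ext d V) (pr d V)"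
 by (rule lin_quot_proj[OF module_tpow submodule_alt])

lemma pr_zero_iff: "module R V ==> t:Tens d V ==> pr d V t = \<zero>[Ext d V] \<longleftrightarrow> t:alt_rels R d V"
 by (rule quot_proj_zero_iff[OF module_tpow submodule_alt])

text \<open>Polarising the relation \<open>\<dots> \<otimes> x \<otimes> \<dots> \<otimes> x \<otimes> \<dots> = 0\<close> at \<open>x + y\<close>.\<close>

lemma pr_swap:
 assumes V: "module R V" and v: "v:tensor_base d (%_. V)" and ij: "i < d" "j < d" "i ~= j"
 shows "pr d V (tpure R d V v) +[Ext d V] pr d V (tpure R d V (tup d (%r. v (transpose i j r)))) = \<zero>[Ext d V]"
proof -
 interpret V: module R V by fact
 interpret E: module R "Ext d V" by (rule module_Ext[OF V])
 let ?f = "%a b. pr d V (tpure R d V (v(i := a, j := b)))"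
 note pm = multilin_lin[OF multilin_tpure[OF V] pr_lin[OF V], of d]
 have b: "v(i := a):tensor_base d (%_. V)" "v(i := a, j := b):tensor_base d (%_. V)"
 if "a:carrier V" "b:carrier V" for a b
 using tensor_base_upd[OF v ij(1)] tensor_base_upd[OF tensor_base_upd[OF v ij(1)] ij(2)] that by blast+
 have bj: "v(j := c):tensor_base d (%_. V)" if "c:carrier V" for c
 by (rule tensor_base_upd[OF v ij(2)]) (rule that)
 have fcl: "?f a b:carrier (Ext d V)" if "a:carrier V" "b:carrier V" for a b
 by (rule multilin_closed[OF pm b(2)[OF that]])
 have add2: "?f a (x +[V] y) = ?f a x +[Ext d V] ?f a y" if "a:carrier V" "x:carrier V" "y:carrier V" for a x y
 by (rule lin_add[OF multilin_slice[OF pm b(1)[OF that(1) that(1)] ij(2)] that(2,3)])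
 have add1: "?f (x +[V] y) c = ?f x c +[Ext d V] ?f y c" if "c:carrier V" "x:carrier V" "y:carrier V" for c x y
 using lin_add[OF multilin_slice[OF pm bj[OF that(1)] ij(1)] that(2,3)] by (simp only: fun_upd_twist[OF ij(3)])
 have rep: "?f a a = \<zero>[Ext d V]" if a: "a:carrier V" for a
 proof -
 have "tpure R d V (v(i := a, j := a)):alt_rels R d V"
 by (rule alt_repeat[OF b(2)[OF a a] ij]) (use ij in simp)
 thus ?thesis using pr_zero_iff[OF V tpure_closed[OF V b(2)[OF a a]]] by simp
 qed
 let ?x = "v i" and ?y = "v j"
 have x: "?x:carrier V" and y: "?y:carrier V" using tensor_baseD[OF v] ij by auto
 note xy = V.add.m_closed[OF x y]
 have "\<zero>[Ext d V] = ?f (?x +[V] ?y) (?x +[V] ?y)" using rep[OF xy] by simp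
 also have "... = (\<zero>[Ext d V] +[Ext d V] ?f ?x ?y) +[Ext d V] (?f ?y ?x +[Ext d V] \<zero>[Ext d V])"
 by (simp only: add1[OF xy x y] add2[OF x x y] add2[OF y x y] rep[OF x] rep[OF y])
 also have "... = ?f ?x ?y +[Ext d V] ?f ?y ?x" using fcl[OF x y] fcl[OF y x] by (simp only: E.l_zero E.r_zero)
 finally have eq: "\<zero>[Ext d V] = ?f ?x ?y +[Ext d V] ?f ?y ?x" .
 have 1: "v(i := ?x, j := ?y) = v" by simp
 have 2: "v(i := ?y, j := ?x) = (tup d (%r. v (transpose i j r)))"
 proof
 fix r
 have "v r = undefined" if "~ r < d" using v that by (simp add: tensor_base_def PiE_iff extensional_def)
 thus "(v(i := ?y, j := ?x)) r = (tup d (%r. v (transpose i j r))) r"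
 using ij by (simp add: transpose_def)
 qed
 show ?thesis using eq unfolding 1 2 by (rule sym)
qed

lemma transpose_permutes: "i < d ==> j < d ==> transpose i j permutes {..<d::nat}"
 by (rule permutes_swap_id) simp_all

lemma pr_perm_span:
 assumes V: "module R V" and s: "\<sigma> permutes {..<d}" and v: "v:tensor_base d (%_. V)"
 shows "pr d V (tpure R d V (tup d (%r. v (\<sigma> r)))):mod_span R (Ext d V) {pr d V (tpure R d V v)}"
proof -
 interpret E: module R "Ext d V" by (rule module_Ext[OF V])
 have pc: "pr d V (tpure R d V w):carrier (Ext d V)" if "w:tensor_base d (%_. V)" for w
 by (rule lin_closed[OF pr_lin[OF V] tpure_closed[OF V that]])
 have sub: "submodule (mod_span R (Ext d V) {pr d V (tpure R d V w)}) R (Ext d V)" if "w:tensor_base d (%_. V)" for w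
 by (rule submodule_mod_span[OF E.module_axioms]) (use pc[OF that] in simp)
 have "ALL v:tensor_base d (%_. V). pr d V (tpure R d V (tup d (%r. v (\<sigma> r)))):mod_span R (Ext d V) {pr d V (tpure R d V v)}"
 using s finite_lessThan[of d]
 proof (induction rule: permutes_induct)
 show "ALL v:tensor_base d (%_. V). pr d V (tpure R d V (tup d (%r. v (id r)))):mod_span R (Ext d V) {pr d V (tpure R d V v)}"
 proof
 fix v assume v: "v:tensor_base d (%_. V)"
 have "(tup d (%r. v (id r))) = v" using v unfolding id_def tensor_base_def by (rule PiE_restrict)
 thus "pr d V (tpure R d V (tup d (%r. v (id r)))):mod_span R (Ext d V) {pr d V (tpure R d V v)}"
 by (simp add: mod_span_superset)
 qed
 next
 fix a b p assume ab: "a:{..<d}" "b:{..<d}" "a ~= b" and p: "p permutes {..<d}"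
 and IH: "ALL v:tensor_base d (%_. V). pr d V (tpure R d V (tup d (%r. v (p r)))):mod_span R (Ext d V) {pr d V (tpure R d V v)}"
 show "ALL v:tensor_base d (%_. V). pr d V (tpure R d V (tup d (%r. v ((transpose a b\<circ>p) r)))):mod_span R (Ext d V) {pr d V (tpure R d V v)}"
 proof
 fix v assume v: "v:tensor_base d (%_. V)"
 have ab': "a < d" "b < d" using ab by auto
 let ?w = "\<lambda>r\<in>{..<d}. v (transpose a b r)"
 have w: "?w:tensor_base d (%_. V)"
 by (rule tperm_base[OF permutes_imp_bij[OF transpose_permutes[OF ab']] v]) (rule refl)
 have eq: "(tup d (%r. ?w (p r))) = (tup d (%r. v ((transpose a b\<circ>p) r)))"
 by (rule restrict_ext) (simp add: permutes_less[OF p])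
 note sv = submoduleD[OF sub[OF v] E.module_axioms]
 have "pr d V (tpure R d V ?w) = \<ominus>\<^bsub>Ext d V\<^esub> pr d V (tpure R d V v)"
 using E.minus_equality[OF _ pc[OF v] pc[OF w]] pr_swap[OF V v ab' ab(3)] pc[OF v] pc[OF w]
 by (simp add: E.a_comm)
 hence "pr d V (tpure R d V ?w):mod_span R (Ext d V) {pr d V (tpure R d V v)}"
 using sv(5)[OF mod_span_superset[of "pr d V (tpure R d V v)" "{pr d V (tpure R d V v)}"]] by simp
 hence "mod_span R (Ext d V) {pr d V (tpure R d V ?w)}<=mod_span R (Ext d V) {pr d V (tpure R d V v)}"
 by (intro mod_span_least[OF sub[OF v]]) simp
 moreover have "pr d V (tpure R d V (tup d (%r. ?w (p r)))):mod_span R (Ext d V) {pr d V (tpure R d V ?w)}"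
 using IH w by blast
 ultimately show "pr d V (tpure R d V (tup d (%r. v ((transpose a b\<circ>p) r)))):mod_span R (Ext d V) {pr d V (tpure R d V v)}"
 unfolding eq by (rule subsetD)
 qed
 qed
 thus ?thesis using v by (rule bspec)
qed

text \<open>In the expansion of \<open>\<phi> (\<dots> \<otimes> x \<otimes> \<dots> \<otimes> x \<otimes> \<dots>)\<close> by matrix coefficients, the transposition of the two
 places acts on the index functions. Its fixed points give tensors with a repeated entry, and the other
 terms cancel in pairs modulo the alternating relations; this works in every characteristic.\<close>

lemma alt_stable:
 assumes V: "V:fgp" and W: "W:fgp" and f: "\<phi>:Homs d V W" and t: "t:alt_rels R d V"
 shows "\<phi> t:alt_rels R d W"
proof -
 note MV = fgp_module[OF V] and MW = fgp_module[OF W]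
 obtain n :: nat and x \<xi> where DV: "dual_basis V {..<n} x \<xi>" using fg_projective_dual_basis[OF V] .
 obtain m :: nat and y \<eta> where DW: "dual_basis W {..<m} y \<eta>" using fg_projective_dual_basis[OF W] .
 let ?P = "Idx d ({..<n}\<times>{..<m})"
 interpret TW: module R "tpow R d W" by (rule module_tpow[OF MW])
 interpret E: module R "Ext d W" by (rule module_Ext[OF MW])
 have y': "(%p. y (snd p)):{..<n}\<times>{..<m} \<rightarrow> carrier W" using dual_basis_mem[OF DW] by auto
 have finP: "finite ?P" by (simp add: finite_PiE)
 have sub: "submodule {t\<in>Tens d V. \<phi> t:alt_rels R d W} R (tpow R d V)"
 by (rule submodule_preimage[OF module_tpow[OF MV] TW.module_axioms sp_hom_lin[OF f] submodule_alt[OF MW]])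
 have "alt_rels R d V<={t\<in>Tens d V. \<phi> t:alt_rels R d W}"
 unfolding alt_rels_def[of R d V]
 proof (rule mod_span_least[OF sub], rule subsetI)
 fix t assume "t:{tpure R d V v | v. v:tensor_base d (%_. V) & (EX i j. i < j & j < d & v i = v j)}"
 then obtain v i j where v: "v:tensor_base d (%_. V)" and ij: "i < j" "j < d" "v i = v j" and tv: "t = tpure R d V v"
 by blast
 have id: "i < d" "i ~= j" using ij by auto
 have t: "t:Tens d V" unfolding tv by (rule tpure_closed[OF MV v])
 let ?\<tau> = "transpose i j"
 have s: "?\<tau> permutes {..<d}" by (rule transpose_permutes[OF id(1) ij(2)])
 note b = permutes_imp_bij[OF s]
 have "(tup d (%r. v (?\<tau> r))) = v"
 proof
 fix r
 have "v r = undefined" if "~ r < d" using v that by (simp add: tensor_base_def PiE_iff extensional_def)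
 thus "(tup d (%r. v (?\<tau> r))) r = v r" using ij(3) by (simp add: transpose_def)
 qed
 hence tt: "tperm R d V ?\<tau> t = t" unfolding tv tperm(2)[OF MV b v] by simp
 let ?f = "%L::nat => nat\<times>nat. \<lambda>r\<in>{..<d}. L (?\<tau> r)"
 define c where "c L = mat_coef d V W x \<eta> \<phi> L\<otimes>tc d V \<xi> (tup d (%r. fst (L r))) t" for L
 let ?w = "%L. pr d W (tb d W (%p. y (snd p)) L)"
 have tcR: "tc d V \<xi> (tup d (%r. fst (L r))) t:carrier R" if "L:?P" for L
 by (rule dual_basisD(5)[OF dual_basis_tpow[OF MV DV] idx_fst[OF that] t])
 have mR: "mat_coef d V W x \<eta> \<phi> L:carrier R" if "L:?P" for L
 by (rule mat_coef_closed[OF MV DV MW DW sp_hom_lin[OF f] that])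
 have cR: "c L:carrier R" if "L:?P" for L unfolding c_def using mR[OF that] tcR[OF that] by simp
 have tbP: "tb d W (%p. y (snd p)) L:Tens d W" if "L:?P" for L
 by (rule tb_closed(2)[OF MW y' that])
 have w: "?w L:carrier (Ext d W)" if "L:?P" for L by (rule lin_closed[OF pr_lin[OF MW] tbP[OF that]])
 have fP: "?f L:?P" if "L:?P" for L by (rule idx_perm[OF s that])
 have ff: "?f (?f L) = L" if "L:?P" for L
 proof
 fix r show "?f (?f L) r = L r"
 using that permutes_less[OF s, of r] by (cases "r < d") (simp_all add: PiE_iff extensional_def)
 qed
 have cf: "c (?f L) = c L" if L: "L:?P" for L
 proof -
 have "(tup d (%r. fst (?f L r))) = (tup d (%r. (tup d (%r. fst (L r))) (?\<tau> r)))"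
 by (rule restrict_ext) (simp add: permutes_less[OF s])
 hence "tc d V \<xi> (tup d (%r. fst (?f L r))) t = tc d V \<xi> (tup d (%r. fst (L r))) t"
 using tc_tperm[OF MV DV b idx_fst[OF L] t] by (simp only: tt)
 thus ?thesis unfolding c_def mat_coef_perm[OF MV DV MW DW f L s] by simp
 qed
 have wf: "?w L +[Ext d W] ?w (?f L) = \<zero>[Ext d W]" if L: "L:?P" for L
 proof -
 have "(tup d (%r. (tup d (%r. y (snd (L r)))) (?\<tau> r))) = (tup d (%r. y (snd (?f L r))))"
 by (rule restrict_ext) (simp add: permutes_less[OF s])
 thus ?thesis using pr_swap[OF MW tb_closed(1)[OF MW y' L] id(1) ij(2) id(2)] by simp
 qed
 have wz: "?w L = \<zero>[Ext d W]" if L: "L:?P" and e: "L i = L j" for L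
 unfolding pr_zero_iff[OF MW tbP[OF L]]
 by (rule alt_repeat[OF tb_closed(1)[OF MW y' L] id(1) ij(2) id(2)]) (use e id ij in simp)
 let ?g = "%L. c L *[Ext d W] ?w L"
 have gc: "?g L:carrier (Ext d W)" if "L:?P" for L by (rule E.smult_closed[OF cR[OF that] w[OF that]])
 have "pr d W (\<phi> t) = pr d W (finsum (tpow R d W) (%L. mat_coef d V W x \<eta> \<phi> L *[tpow R d W]
 (tc d V \<xi> (tup d (%r. fst (L r))) t *[tpow R d W] tb d W (%p. y (snd p)) L)) ?P)"
 by (rule arg_cong[OF lin_expand[OF MV DV MW DW sp_hom_lin[OF f] t]])
 also have "... = finsum (Ext d W) (%L. pr d W (mat_coef d V W x \<eta> \<phi> L *[tpow R d W]
 (tc d V \<xi> (tup d (%r. fst (L r))) t *[tpow R d W] tb d W (%p. y (snd p)) L))) ?P"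
 by (rule lin_finsum[OF TW.module_axioms E.module_axioms pr_lin[OF MW]])
 (intro Pi_I TW.smult_closed mR tcR tbP; assumption)
 also have "... = finsum (Ext d W) ?g ?P"
 proof (rule E.finsum_cong'[OF refl])
 show "?g:?P \<rightarrow> carrier (Ext d W)" by (rule Pi_I) (rule gc)
 fix L assume L: "L:?P"
 show "pr d W (mat_coef d V W x \<eta> \<phi> L *[tpow R d W]
 (tc d V \<xi> (tup d (%r. fst (L r))) t *[tpow R d W] tb d W (%p. y (snd p)) L)) = ?g L"
 unfolding c_def TW.smult_assoc1[OF mR[OF L] tcR[OF L] tbP[OF L], symmetric]
 by (rule lin_smult[OF pr_lin[OF MW] m_closed[OF mR[OF L] tcR[OF L]] tbP[OF L]])
 qed
 also have "... = \<zero>[Ext d W]"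
 proof (rule E.add.finprod_involution[where h = ?f, OF finP])
 show "?g:?P \<rightarrow> carrier (Ext d W)" by (rule Pi_I) (rule gc)
 fix L assume L: "L:?P"
 show "?f L:?P" by (rule fP[OF L])
 show "?f (?f L) = L" by (rule ff[OF L])
 show "?g L +[Ext d W] ?g (?f L) = \<zero>[Ext d W]"
 unfolding cf[OF L] E.smult_r_distr[OF cR[OF L] w[OF L] w[OF fP[OF L]], symmetric] wf[OF L]
 by (rule E.smult_r_null[OF cR[OF L]])
 show "?g L = \<zero>[Ext d W]" if e: "?f L = L"
 proof -
 have "L i = L j" using fun_cong[OF e, of i] id(1) by simp
 hence wL: "?w L = \<zero>[Ext d W]" by (rule wz[OF L])
 show ?thesis unfolding wL by (rule E.smult_r_null[OF cR[OF L]])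
 qed
 qed
 finally have "pr d W (\<phi> t) = \<zero>[Ext d W]" .
 thus "t:{t\<in>Tens d V. \<phi> t:alt_rels R d W}"
 using t pr_zero_iff[OF MW lin_closed[OF sp_hom_lin[OF f] t]] by simp
 qed
 thus ?thesis using t by blast
qed

lemma subrep_alt: "subrep d (tpow_functor R d) (alt_rels R d)"
proof (rule subrepI)
 fix V :: "('a, 'u) module" assume V: "V:fgp"
 show "submodule (alt_rels R d V) R (on_obj (tpow_functor R d) V)"
 unfolding tpow_functor_def sp_functor.simps by (rule submodule_alt[OF fgp_module[OF V]])
 fix W :: "('a, 'u) module" and \<phi> t
 assume "W:fgp" "\<phi>:Homs d V W" "t:alt_rels R d V"
 thus "on_mor (tpow_functor R d) V W \<phi> t:alt_rels R d W"
 unfolding tpow_functor_def sp_functor.simps by (rule alt_stable[OF V])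
qed

lemma is_rep_ext: "is_rep R d (ext_power R d)"
 unfolding ext_power_def by (rule is_rep_quot[OF is_rep_tpow subrep_alt])

lemma reps_ext: "reps l (%i. ext_power R (l ! i))"
 by (simp add: reps_def is_rep_ext)

lemma Ext_eq: "on_obj (ext_power R e) V = Ext e V"
 by (simp add: ext_power_def quot_functor_def tpow_functor_def)

abbreviation Exts :: "nat list => ('a, 'u) module => ('a, ('a, ('a, 'u) tensor set) tensor) module" where
 "Exts l V \<equiv> on_obj (ext_powers R l) V"

lemma Exts_eq: "Exts l V = tensor R (length l) (%i. Ext (l ! i) V)"
 by (simp add: ext_powers_def tensor_functor_def Ext_eq)

lemma modules_Ext: "module R V ==> modules R (length l) (%i. Ext (l ! i) V)"
 by (intro modulesI module_Ext)

lemma module_Exts: "module R V ==> module R (Exts l V)"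
 unfolding Exts_eq by (rule module_tensor[OF modules_Ext])

lemma lins_pr: "module R V ==> lins R (length l) (%i. tpow R (l ! i) V) (%i. Ext (l ! i) V) (%i. pr (l ! i) V)"
 by (intro linsI pr_lin)

lemma ext_proj:
 assumes V: "module R V"
 shows "lin R (tpow R (sum_list l) V) (Exts l V) (ext_proj R l V)"
 and "!!v. v:tensor_base (sum_list l) (%_. V) ==> ext_proj R l V (tpure R (sum_list l) V v) =
 pure_tensor R (length l) (%i. Ext (l ! i) V) (tup (length l) (%i. pr (l ! i) V (tpure R (l ! i) V (blk l v i))))"
proof -
 note T = tensor_map[OF modules_tpow[OF V] modules_Ext[OF V] lins_pr[OF V]]
 show "lin R (tpow R (sum_list l) V) (Exts l V) (ext_proj R l V)"
 unfolding Exts_eq ext_proj_def Ext_eq by (rule lin_comp[OF tsplit_lin[OF V] mod_hom_lin[OF T(1)]])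
 fix v assume v: "v:tensor_base (sum_list l) (%_. V)"
 have b: "(tup (length l) (%i. tpure R (l ! i) V (blk l v i))):tensor_base (length l) (%i. tpow R (l ! i) V)"
 by (intro tensor_base_restrict tpure_closed[OF V] blk_base[OF v])
 have "(tup (length l) (%i. pr (l ! i) V ((tup (length l) (%i. tpure R (l ! i) V (blk l v i))) i))) =
 (tup (length l) (%i. pr (l ! i) V (tpure R (l ! i) V (blk l v i))))" by (rule restrict_ext) simp
 thus "ext_proj R l V (tpure R (sum_list l) V v) =
 pure_tensor R (length l) (%i. Ext (l ! i) V) (tup (length l) (%i. pr (l ! i) V (tpure R (l ! i) V (blk l v i))))"
 unfolding ext_proj_def Ext_eq tsplit(2)[OF V v] T(2)[OF b] by (rule arg_cong)
qed

lemma ext_proj_surj: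
 assumes V: "V:fgp" and z: "z:carrier (Exts l V)"
 shows "EX t:Tens (sum_list l) V. z = ext_proj R l V t"
proof -
 note MV = fgp_module[OF V]
 let ?n = "length l" and ?I = "ext_proj R l V ` Tens (sum_list l) V"
 note T = tensor_map[OF modules_tpow[OF MV] modules_Ext[OF MV] lins_pr[OF MV]]
 have sub: "submodule ?I R (Exts l V)"
 by (rule submodule_image[OF module_tpow[OF MV] module_Exts[OF MV] ext_proj(1)[OF MV]])
 have "pure_tensor R ?n (%i. Ext (l ! i) V) ` tensor_base ?n (%i. Ext (l ! i) V)<=?I"
 proof (rule image_subsetI)
 fix u assume u: "u:tensor_base ?n (%i. Ext (l ! i) V)"
 have "EX t. t:Tens (l ! i) V & u i = pr (l ! i) V t" if "i < ?n" for i
 using tensor_baseD[OF u that] unfolding quot_carrier by blast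
 then obtain w where w: "!!i. i < ?n ==> w i:Tens (l ! i) V" "!!i. i < ?n ==> u i = pr (l ! i) V (w i)"
 by metis
 have wb: "(tup ?n (%i. w i)):tensor_base ?n (%i. tpow R (l ! i) V)" by (rule tensor_base_restrict) (rule w)
 have uw: "u = (tup ?n (%i. pr (l ! i) V ((tup ?n (%i. w i)) i)))"
 proof
 fix i show "u i = (tup ?n (%i. pr (l ! i) V ((tup ?n (%i. w i)) i))) i"
 using w(2)[of i] u by (cases "i < ?n") (simp_all add: tensor_base_def PiE_iff extensional_def)
 qed
 note pw = pure_closed[OF modules_tpow[OF MV] wb]
 have eq: "ext_proj R l V (tjoin R l V (pure_tensor R ?n (%i. tpow R (l ! i) V) (tup ?n (%i. w i)))) =
 pure_tensor R ?n (%i. Ext (l ! i) V) u"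
 unfolding ext_proj_def Ext_eq tjoin(3)[OF V pw] T(2)[OF wb] using uw by simp
 show "pure_tensor R ?n (%i. Ext (l ! i) V) u:?I"
 by (rule image_eqI[where f = "ext_proj R l V", OF eq[symmetric] lin_closed[OF tjoin_lin[OF V] pw]])
 qed
 from mod_span_least[OF sub[unfolded Exts_eq] this]
 have "z:?I" by (rule subsetD) (rule tensor_span[OF modules_Ext[OF MV] z[unfolded Exts_eq]])
 thus ?thesis by (rule imageE) (rule bexI)
qed

lemma Exts_mor_hom:
 assumes V: "V:fgp" and W: "W:fgp" and f: "\<phi>:Homs (sum_list l) V W"
 shows "on_mor (ext_powers R l) V W \<phi>:mod_hom R (Exts l V) (Exts l W)"
 unfolding ext_powers_def by (rule tensor_functor_mor[OF reps_ext V W f])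

lemma ext_proj_nat:
 assumes V: "V:fgp" and W: "W:fgp" and f: "\<phi>:Homs (sum_list l) V W"
 and t: "t:Tens (sum_list l) V"
 shows "on_mor (ext_powers R l) V W \<phi> (ext_proj R l V t) = ext_proj R l W (\<phi> t)"
proof -
 note MV = fgp_module[OF V] and MW = fgp_module[OF W]
 obtain \<zeta> where xi: "\<zeta>:carrier (tensor R (length l) (%i. sp_hom R (l ! i) V W))" "young_incl R l V W \<zeta> = \<phi>"
 "on_mor (ext_powers R l) V W \<phi> = young_act R l (%i. ext_power R (l ! i)) V W \<zeta>"
 unfolding ext_powers_def by (rule tensor_functor_mor[OF reps_ext V W f])
 have obj: "on_obj (tpow_functor R e) = tpow R e" and mor: "on_mor (tpow_functor R e) = (%V W \<phi>. \<phi>)" for e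
 by (simp_all add: tpow_functor_def)
 have "tensor_map R (length l) (%i. tpow R (l ! i) W) (%i. Ext (l ! i) W) (%i. pr (l ! i) W)
 (young_act R l (%i. tpow_functor R (l ! i)) V W \<zeta> (tsplit R l V t)) =
 young_act R l (%i. ext_power R (l ! i)) V W \<zeta>
 (tensor_map R (length l) (%i. tpow R (l ! i) V) (%i. Ext (l ! i) V) (%i. pr (l ! i) V) (tsplit R l V t))"
 proof (rule young_act_nat[where X = "%i. tpow_functor R (l ! i)" and Y = "%i. ext_power R (l ! i)", unfolded obj mor Ext_eq,
 OF reps_tpow reps_ext V W lins_pr[OF MV] lins_pr[OF MW] _ xi(1) lin_closed[OF tsplit_lin[OF MV] t]])
 fix i \<phi> x assume "i < length l" and p: "\<phi>:Homs (l ! i) V W" and x: "x:Tens (l ! i) V"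
 show "pr (l ! i) W (\<phi> x) = on_mor (ext_power R (l ! i)) V W \<phi> (pr (l ! i) V x)"
 using quot_functor_mor[OF is_rep_tpow subrep_alt V W p, unfolded obj mor, OF x] by (simp add: ext_power_def)
 qed
 thus ?thesis unfolding xi(3) young_act_tpow[OF V W xi(1) t] xi(2) ext_proj_def Ext_eq by (rule sym)
qed

lemma is_rep_Exts: "is_rep R (sum_list l) (ext_powers R l)"
 by (rule is_rep_of_surj[where P = "ext_proj R l"])
 (rule module_Exts[OF fgp_module] Exts_mor_hom ext_proj(1)[OF fgp_module] ext_proj_surj ext_proj_nat; assumption)+

lemma ext_proj_repeat:
 assumes V: "module R V" and v: "v:tensor_base (sum_list l) (%_. V)"
 and i: "i < length l" and j: "j < l ! i" "j' < l ! i" "j ~= j'" "v (pos l i j) = v (pos l i j')"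
 shows "ext_proj R l V (tpure R (sum_list l) V v) = \<zero>[Exts l V]"
proof -
 have b: "(tup (length l) (%i. pr (l ! i) V (tpure R (l ! i) V (blk l v i)))):tensor_base (length l) (%i. Ext (l ! i) V)"
 by (intro tensor_base_restrict lin_closed[OF pr_lin[OF V]] tpure_closed[OF V] blk_base[OF v])
 have "tpure R (l ! i) V (blk l v i):alt_rels R (l ! i) V"
 by (rule alt_repeat[OF blk_base[OF v i] j(1-3)]) (use j in "simp add: blk_def")
 hence "pr (l ! i) V (tpure R (l ! i) V (blk l v i)) = \<zero>[Ext (l ! i) V]"
 using pr_zero_iff[OF V tpure_closed[OF V blk_base[OF v i]]] by simp
 hence z: "(tup (length l) (%i. pr (l ! i) V (tpure R (l ! i) V (blk l v i)))) i = \<zero>[Ext (l ! i) V]" using i by simp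
 show ?thesis unfolding ext_proj(2)[OF V v] Exts_eq
 by (rule multilin_zero_slot[where M = "%i. Ext (l ! i) V", OF module_Ext[OF V] module_tensor[OF modules_Ext[OF V]] multilin_pure[OF modules_Ext[OF V]] b i z])
qed

lemma ext_proj_perm_span:
 assumes V: "module R V" and v: "v:tensor_base (sum_list l) (%_. V)" and w: "w:tensor_base (sum_list l) (%_. V)"
 and s: "!!i. i < length l ==> EX \<sigma>. \<sigma> permutes {..<l ! i} & blk l w i = (tup (l ! i) (%r. blk l v i (\<sigma> r)))"
 shows "ext_proj R l V (tpure R (sum_list l) V w):mod_span R (Exts l V) {ext_proj R l V (tpure R (sum_list l) V v)}"
proof -
 let ?n = "length l" and ?M = "%i. Ext (l ! i) V"
 let ?p = "%v. \<lambda>i\<in>{..<?n}. pr (l ! i) V (tpure R (l ! i) V (blk l v i))"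
 let ?G = "%i. {pr (l ! i) V (tpure R (l ! i) V (blk l v i))}"
 have pc: "pr (l ! i) V (tpure R (l ! i) V (blk l u i)):carrier (?M i)" if "u:tensor_base (sum_list l) (%_. V)" "i < ?n" for u i
 by (intro lin_closed[OF pr_lin[OF V]] tpure_closed[OF V] blk_base that)
 have b: "?p w:tensor_base ?n ?M" by (intro tensor_base_restrict pc[OF w])
 have sp: "?p w i:mod_span R (?M i) (?G i)" if i: "i < ?n" for i
 proof -
 obtain \<sigma> where "\<sigma> permutes {..<l ! i}" "blk l w i = (tup (l ! i) (%r. blk l v i (\<sigma> r)))" using s[OF i] by blast
 thus ?thesis using pr_perm_span[OF V _ blk_base[OF v i], of \<sigma>] i by simp
 qed
 have "pure_tensor R ?n ?M (?p w):mod_span R (tensor R ?n ?M) (pure_tensor R ?n ?M ` PiE {..<?n} ?G)"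
 by (rule pure_in_span[OF modules_Ext[OF V] _ b sp]) (use pc[OF v] in simp)
 also have "PiE {..<?n} ?G = {?p v}"
 proof (intro equalityI subsetI)
 fix K assume K: "K:PiE {..<?n} ?G"
 have "K = ?p v"
 proof
 fix i show "K i = ?p v i"
 using idxD[OF K, of i] K by (cases "i < ?n") (simp_all add: PiE_iff extensional_def)
 qed
 thus "K:{?p v}" by simp
 qed (simp add: restrict_PiE_iff)
 finally show ?thesis
 unfolding ext_proj(2)[OF V v] ext_proj(2)[OF V w] Exts_eq by (simp only: image_insert image_empty)
qed

end

section \<open>Free objects and generators\<close>

context cring
begin

definition free_dual :: "('a, 'v) module => 'i set => ('i => 'v) => ('i => 'v => 'a) => bool" where
 "free_dual V B x \<xi> \<longleftrightarrow> dual_basis V B x \<xi> & (ALL p:B. ALL q:B. \<xi> p (x q) = (if p = q then \<one> else \<zero>))"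

text \<open>The free module of rank \<open>n\<close>, transported along an injection into the universe.\<close>

lemma free_object_exists:
 fixes f :: "(nat => 'a) => 'u"
 assumes inj: "inj_on f (carrier (free_mod R {..<n::nat}))"
 obtains F :: "('a, 'u) module" and b \<xi> where "F:fgp" "free_dual F {..<n} b \<xi>"
proof -
 let ?Fr = "free_mod R {..<n}"
 interpret Fr: module R ?Fr by (rule module_free)
 define g where "g = inv_into (carrier ?Fr) f"
 have gf: "g (f x) = x" if "x:carrier ?Fr" for x unfolding g_def by (rule inv_into_f_f[OF inj that])
 define F :: "('a, 'u) module" where "F = \<lparr>carrier = f ` carrier ?Fr, monoid.mult = undefined, one = undefined, zero = f \<zero>[?Fr],
 add = (%x y. f (g x +[?Fr] g y)), smult = (%c x. f (c *[?Fr] g x))\<rparr>"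
 have F: "carrier F = f ` carrier ?Fr" "\<zero>[F] = f \<zero>[?Fr]" "x +[F] y = f (g x +[?Fr] g y)"
 "c *[F] x = f (c *[?Fr] g x)" for c x y
 by (simp_all add: F_def)
 have fadd: "f x +[F] f y = f (x +[?Fr] y)" if "x:carrier ?Fr" "y:carrier ?Fr" for x y
 unfolding F gf[OF that(1)] gf[OF that(2)] ..
 have fsm: "c *[F] f x = f (c *[?Fr] x)" if "x:carrier ?Fr" for c x
 unfolding F gf[OF that] ..
 have M: "module R F"
 by (rule module_image[where h = f and M = ?Fr and Q = F, OF module_free F(1,2)]) (rule fadd fsm; assumption)+
 have fl: "lin R ?Fr F f"
 by (rule linI) (simp add: F(1), rule fadd[symmetric], assumption+, rule fsm[symmetric])
 have gl: "lin R F ?Fr g"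
 proof (rule linI)
 show "g x:carrier ?Fr" if "x:carrier F" for x using that gf unfolding F(1) by force
 show "g (x +[F] y) = g x +[?Fr] g y" if "x:carrier F" "y:carrier F" for x y
 using that gf unfolding F(1,3) by force
 show "g (c *[F] x) = c *[?Fr] g x" if "c:carrier R" "x:carrier F" for c x
 using that gf unfolding F(1,4) by force
 qed
 have p: "restrict f (carrier ?Fr):mod_hom R ?Fr F" by (rule lin_restrict[OF module_free fl])
 have i: "restrict g (carrier F):mod_hom R F ?Fr" by (rule lin_restrict[OF M gl])
 have pi: "restrict f (carrier ?Fr) (restrict g (carrier F) x) = x" if x: "x:carrier F" for x
 proof -
 obtain a where a: "a:carrier ?Fr" "x = f a" using x by (auto simp: F_def)
 show ?thesis using x gf[OF a(1)] a by simp
 qed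
 have "F:fgp" unfolding fg_proj_mods_def fg_projective_def using M i p pi by blast
 moreover have "free_dual F {..<n} (%j. restrict f (carrier ?Fr) (free_basis R j)) (%j x. restrict g (carrier F) x j)"
 unfolding free_dual_def
 proof (intro conjI ballI)
 show "dual_basis F {..<n} (%j. restrict f (carrier ?Fr) (free_basis R j)) (%j x. restrict g (carrier F) x j)"
 by (rule dual_basis_retract[OF M i p]) (rule pi)
 fix j k assume "j:{..<n}" "k:{..<n}"
 hence e: "free_basis R k:carrier ?Fr" by (intro free_basis_carrier)
 show "restrict g (carrier F) (restrict f (carrier ?Fr) (free_basis R k)) j = (if j = k then \<one> else \<zero>)"
 using e gf[OF e] lin_closed[OF fl e] by (simp add: free_basis_def)
 qed
 ultimately show thesis by (rule that)
qed

lemma tc_tb: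
 assumes V: "module R V" and F: "free_dual V B x \<xi>" and J: "J:Idx d B" and K: "K:Idx d B"
 shows "tc d V \<xi> J (tb d V x K) = (if J = K then \<one> else \<zero>)"
proof -
 have D: "dual_basis V B x \<xi>" and dl: "!!p q. p:B ==> q:B ==> \<xi> p (x q) = (if p = q then \<one> else \<zero>)"
 using F by (simp_all add: free_dual_def)
 have "tc d V \<xi> J (tb d V x K) = (\<Otimes>r\<in>{..<d}. \<xi> (J r) ((tup d (%r. x (K r))) r))"
 by (rule tc_pure[OF V D J tb_closed(1)[OF V dual_basis_mem[OF D] K]])
 also have "... = (\<Otimes>r\<in>{..<d}. if J r = K r then \<one> else \<zero>)"
 by (rule finprod_cong'[OF refl]) (simp_all add: dl idxD[OF J] idxD[OF K])
 also have "... = (if J = K then \<one> else \<zero>)"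
 proof (cases "J = K")
 case False
 then obtain r where r: "r < d" "J r ~= K r" using PiE_ext[OF J K] by blast
 have "(\<Otimes>s\<in>insert r ({..<d} - {r}). if J s = K s then \<one> else \<zero>) =
 (if J r = K r then \<one> else \<zero>)\<otimes>(\<Otimes>s\<in>{..<d} - {r}. if J s = K s then \<one> else \<zero>)"
 by (rule finprod_insert) auto
 also have "insert r ({..<d} - {r}) = {..<d}" using r by blast
 finally show ?thesis using r False by (simp add: Pi_iff)
 qed simp
 finally show ?thesis .
qed

text \<open>The standard generator of \<open>\<Gamma>\<^sup>\<mu>\<close>: its index function is constant with value \<open>i\<close> on block \<open>i\<close>.\<close>

abbreviation Ist :: "nat list => nat => nat" where
 "Ist l \<equiv> glue l (%i. \<lambda>j\<in>{..<l ! i}. i)"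

abbreviation gen :: "nat list => ('a, 'u) module => (nat => 'u) => ('a, ('a, 'u) tensor) tensor" where
 "gen l F b \<equiv> gam l F {..<length l} b (tup (length l) (%i. replicate_mset (l ! i) i))"

lemma Ist: "Ist l:Idx (sum_list l) {..<length l}" and blk_Ist: "i < length l ==> blk l (Ist l) i = (tup (l ! i) (%j. i))"
proof -
 have g: "(tup (l ! i) (%j. i)):Idx (l ! i) {..<length l}" if "i < length l" for i using that by simp
 show "Ist l:Idx (sum_list l) {..<length l}" by (rule glue_PiE) (rule g)
 show "blk l (Ist l) i = (tup (l ! i) (%j. i))" if "i < length l"
 by (rule blk_glue[where K = "%i. \<lambda>j\<in>{..<l ! i}. i", OF that g[OF that]])
qed

lemma ct_const: "ct d (tup d (%j. i)) = replicate_mset d i"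
proof -
 have "ct d (tup d (%j. i)) = ct d (%_. i)" by (rule ct_cong) simp
 thus ?thesis by (simp add: ct_def image_mset_const_eq)
qed

lemma ct_replicate:
 "J:Idx d A ==> ct d J = replicate_mset d i \<longleftrightarrow> J = (tup d (%j. i))"
proof
 assume J: "J:Idx d A" and "ct d J = replicate_mset d i"
 hence "set_mset (ct d J)<={i}" by simp
 hence "J j = i" if "j < d" for j using that by (auto simp: ct_def)
 thus "J = (tup d (%j. i))" using J by (auto simp: PiE_iff extensional_def fun_eq_iff)
next
 assume "J = (tup d (%j. i))"
 thus "ct d J = replicate_mset d i" by (simp only: ct_const)
qed

lemma finsum_one_term:
 assumes "module R M" "a:A" "f a:carrier M" "!!x. x:A ==> x ~= a ==> f x = \<zero>[M]" "finite A"
 shows "finsum M f A = f a"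
proof -
 interpret M: module R M by fact
 have "finsum M f A = finsum M (%x. if a = x then f a else \<zero>[M]) A"
 proof (rule M.finsum_cong'[OF refl])
 show "(%x. if a = x then f a else \<zero>[M]):A \<rightarrow> carrier M" using assms(3) by auto
 show "f x = (if a = x then f a else \<zero>[M])" if "x:A" for x using assms(4)[OF that] by metis
 qed
 also have "... = f a"
 by (rule M.add.finprod_singleton[OF assms(2,5), of "%_. f a"]) (use assms(3) in "intro Pi_I, simp")
 finally show ?thesis .
qed

lemma div_incl_gen:
 assumes F: "F:fgp" and D: "free_dual F {..<length l} b \<xi>"
 shows "gen l F b:carrier (Gams l F)" and "div_incl R l F (gen l F b) = tb (sum_list l) F b (Ist l)"
proof -
 have b: "b:{..<length l} \<rightarrow> carrier F"
 by (rule dual_basis_mem[of F _ b \<xi>]) (use D in "simp add: free_dual_def")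
 show "gen l F b:carrier (Gams l F)" by (rule gam_closed[OF F b])
 have S: "{J\<in>Idx (sum_list l) {..<length l}. ALL i<length l. ct (l ! i) (blk l J i) =
 (tup (length l) (%i. replicate_mset (l ! i) i)) i} = {Ist l}"
 proof (intro equalityI subsetI)
 fix J assume J: "J:{J\<in>Idx (sum_list l) {..<length l}. ALL i<length l. ct (l ! i) (blk l J i) =
 (tup (length l) (%i. replicate_mset (l ! i) i)) i}"
 hence JP: "J:Idx (sum_list l) {..<length l}" by blast
 have "blk l J i = blk l (Ist l) i" if i: "i < length l" for i
 using J i ct_replicate[OF blk_PiE[OF JP i], of i] blk_Ist[OF i] by simp
 hence "J = Ist l" by (rule blk_eqI[OF JP Ist])
 thus "J:{Ist l}" by simp
 next
 fix J assume "J:{Ist l}"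
 thus "J:{J\<in>Idx (sum_list l) {..<length l}. ALL i<length l. ct (l ! i) (blk l J i) =
 (tup (length l) (%i. replicate_mset (l ! i) i)) i}"
 using Ist[of l] blk_Ist[of _ l] by (simp add: ct_const)
 qed
 show "div_incl R l F (gen l F b) = tb (sum_list l) F b (Ist l)"
 unfolding div_incl_gam[OF F b finite_lessThan] S
 by (rule finsum_one_term[where f = "tb (sum_list l) F b" and a = "Ist l", OF module_tpow[OF fgp_module[OF F]] _
 tb_closed(2)[OF fgp_module[OF F] b Ist]]) simp_all
qed

lemma ct_pair_rows:
 assumes J: "J:Idx (sum_list l) B" and L: "L:Idx (sum_list l) ({..<length l}\<times>B)"
 and LI: "(tup (sum_list l) (%r. fst (L r))) = Ist l" "(tup (sum_list l) (%r. snd (L r))) = J"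
 shows "ct (sum_list l) L = (\<Sum>i<length l. image_mset (Pair i) (T i)) \<longleftrightarrow> (ALL i<length l. ct (l ! i) (blk l J i) = T i)"
proof -
 have row: "ct (l ! i) (blk l L i) = image_mset (Pair i) (ct (l ! i) (blk l J i))" if i: "i < length l" for i
 proof -
 have "blk l L i j = (i, blk l J i j)" if j: "j < l ! i" for j
 proof -
 have "fst (L (pos l i j)) = i" using fun_cong[OF LI(1), of "pos l i j"] pos_less[OF i j] glue_pos[OF i j, of "%i. \<lambda>j\<in>{..<l ! i}. i"] j by simp
 moreover have "snd (L (pos l i j)) = J (pos l i j)" using fun_cong[OF LI(2), of "pos l i j"] pos_less[OF i j] by simp
 ultimately show ?thesis using j by (simp add: blk_def prod_eq_iff)
 qed
 hence "ct (l ! i) (blk l L i) = ct (l ! i) (%j. (i, blk l J i j))" by (rule ct_cong)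
 thus ?thesis by (simp add: ct_comp[where f = "Pair i"])
 qed
 have eq: "ct (sum_list l) L = (\<Sum>i<length l. image_mset (Pair i) (ct (l ! i) (blk l J i)))"
 unfolding ct_blocks using row by simp
 have part: "image_mset snd (filter_mset (%p. fst p = k) (\<Sum>i<length l. image_mset (Pair i) (S i))) = S k"
 if k: "k < length l" for S :: "nat => 'c multiset" and k
 proof -
 have "filter_mset (%p. fst p = k) (\<Sum>i<n. image_mset (Pair i) (S i)) = (if k < n then image_mset (Pair k) (S k) else {#})" for n
 by (induction n) (auto simp: filter_mset_image_mset comp_def filter_mset_eq_conv less_Suc_eq)
 thus ?thesis using k by (simp add: multiset.map_comp comp_def)
 qed
 show ?thesis
 proof
 assume "ct (sum_list l) L = (\<Sum>i<length l. image_mset (Pair i) (T i))"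
 hence s: "(\<Sum>i<length l. image_mset (Pair i) (ct (l ! i) (blk l J i))) = (\<Sum>i<length l. image_mset (Pair i) (T i))"
 by (simp only: eq)
 show "ALL i<length l. ct (l ! i) (blk l J i) = T i"
 proof (intro allI impI)
 fix k assume k: "k < length l"
 show "ct (l ! k) (blk l J k) = T k"
 using arg_cong[OF s, of "%M. image_mset snd (filter_mset (%p. fst p = k) M)"]
 by (simp only: part[OF k])
 qed
 next
 assume "ALL i<length l. ct (l ! i) (blk l J i) = T i"
 thus "ct (sum_list l) L = (\<Sum>i<length l. image_mset (Pair i) (T i))" unfolding eq by simp
 qed
qed

text \<open>The orbit sum that maps the standard generator to a given monomial.\<close>

abbreviation row_orbit :: "nat list => 'i set => (nat => 'i multiset) => (nat => nat\<times>'i) set" where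
 "row_orbit l B T \<equiv> {L\<in>Idx (sum_list l) ({..<length l}\<times>B).
 ct (sum_list l) L = (\<Sum>i<length l. image_mset (Pair i) (T i))}"

lemma esum_orbit_sp_hom:
 assumes V: "module R V" and DV: "dual_basis V B x \<xi>" and W: "module R W" and y: "y:C \<rightarrow> carrier W"
 shows "esum d V W \<xi> y {L\<in>Idx d (B\<times>C). ct d L = M}:Homs d V W"
proof (rule esum_sp_hom[OF V DV W y])
 fix L \<sigma> assume L: "L:{L\<in>Idx d (B\<times>C). ct d L = M}" and s: "\<sigma> permutes {..<d}"
 have "L:Idx d (B\<times>C)" using L by blast
 from idx_perm[OF s this] ct_perm[OF s, of L] L
 show "(tup d (%r. L (\<sigma> r))):{L\<in>Idx d (B\<times>C). ct d L = M}" by simp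
qed blast

lemma gen_to_gam:
 assumes F: "F:fgp" and D: "free_dual F {..<length l} b \<zeta>" and V: "V:fgp" and x: "x:B \<rightarrow> carrier V" and B: "finite B"
 shows "esum (sum_list l) F V \<zeta> x (row_orbit l B T):Homs (sum_list l) F V"
 and "on_mor (div_powers R l) F V (esum (sum_list l) F V \<zeta> x (row_orbit l B T)) (gen l F b) = gam l V B x T"
proof -
 let ?g = "esum (sum_list l) F V \<zeta> x (row_orbit l B T)"
 note MF = fgp_module[OF F] and MV = fgp_module[OF V]
 have DB: "dual_basis F {..<length l} b \<zeta>" using D by (simp add: free_dual_def)
 let ?d = "sum_list l" and ?O = "row_orbit l B T"
 interpret TV: module R "tpow R ?d V" by (rule module_tpow[OF MV])
 show g: "?g:Homs ?d F V" by (rule esum_orbit_sp_hom[OF MF DB MV x])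
 note e = div_incl_gen[OF F D]
 have x': "(%p. x (snd p)):{..<length l}\<times>B \<rightarrow> carrier V" using x by auto
 let ?U = "{J\<in>Idx ?d B. ALL i<length l. ct (l ! i) (blk l J i) = T i}"
 let ?h = "%J. \<lambda>r\<in>{..<?d}. (Ist l r, J r)"
 let ?O' = "{L\<in>?O. (tup ?d (%r. fst (L r))) = Ist l}"
 have finO: "finite ?O" using B by (simp add: finite_PiE)
 have tbe: "tb ?d F b (Ist l):Tens ?d F" by (rule tb_closed(2)[OF MF dual_basis_mem[OF DB] Ist])
 have tbO: "tb ?d V (%p. x (snd p)) L:Tens ?d V" if "L:?O" for L
 by (rule tb_closed(2)[OF MV x']) (use that in blast)
 have h1: "(tup ?d (%r. fst (?h J r))) = Ist l" "(tup ?d (%r. snd (?h J r))) = J" "?h J:Idx ?d ({..<length l}\<times>B)"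
 if J: "J:Idx ?d B" for J
 proof -
 show "(tup ?d (%r. fst (?h J r))) = Ist l"
 by (rule PiE_ext[OF _ Ist]) (use Ist[of l] in "simp_all add: PiE_iff")
 show "(tup ?d (%r. snd (?h J r))) = J"
 by (rule PiE_ext[OF _ J]) (use J in "simp_all add: PiE_iff")
 show "?h J:Idx ?d ({..<length l}\<times>B)"
 by (rule idxI) (simp only: mem_Sigma_iff idxD[OF Ist] idxD[OF J])
 qed
 have im: "?h ` ?U = ?O'"
 proof (intro equalityI subsetI)
 fix L assume "L:?h ` ?U"
 then obtain J where J: "L = ?h J" "J:Idx ?d B" "ALL i<length l. ct (l ! i) (blk l J i) = T i" by blast
 show "L:?O'" unfolding J(1) using ct_pair_rows[OF J(2) h1(3)[OF J(2)] h1(1,2)[OF J(2)], of T] J(3) h1(1,3)[OF J(2)] by blast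
 next
 fix L assume "L:?O'"
 hence L: "L:Idx ?d ({..<length l}\<times>B)" "ct ?d L = (\<Sum>i<length l. image_mset (Pair i) (T i))"
 "(tup ?d (%r. fst (L r))) = Ist l" by blast+
 let ?J = "\<lambda>r\<in>{..<?d}. snd (L r)"
 have J: "?J:Idx ?d B" by (rule idx_snd[OF L(1)])
 have "?J:?U" using ct_pair_rows[OF J L(1,3) refl, of T] L(2) J by blast
 moreover have "?h ?J = L"
 proof (rule PiE_ext[OF h1(3)[OF J] L(1)])
 fix r assume "r:{..<?d}"
 thus "?h ?J r = L r" using fun_cong[OF L(3), of r] by (simp add: prod_eq_iff)
 qed
 ultimately show "L:?h ` ?U" by (intro image_eqI[where f = ?h]) (rule sym)
 qed
 have inj: "inj_on ?h ?U"
 proof (rule inj_onI)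
 fix J K assume "J:?U" "K:?U" "?h J = ?h K"
 thus "J = K" using h1(2)[of J] h1(2)[of K] by simp
 qed
 have tcO: "tc ?d F \<zeta> (tup ?d (%r. fst (L r))) (tb ?d F b (Ist l)) = (if (tup ?d (%r. fst (L r))) = Ist l then \<one> else \<zero>)"
 if "L:?O" for L
 proof -
 have "L:Idx ?d ({..<length l}\<times>B)" using that by blast
 from tc_tb[OF MF D idx_fst[OF this] Ist] show ?thesis .
 qed
 have "div_incl R l V (on_mor (div_powers R l) F V ?g (gen l F b)) = ?g (tb ?d F b (Ist l))"
 unfolding div_incl_nat[OF F V g e(1)] e(2) ..
 also have "... = finsum (tpow R ?d V) (%L. tc ?d F \<zeta> (tup ?d (%r. fst (L r))) (tb ?d F b (Ist l)) *[tpow R ?d V]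
 tb ?d V (%p. x (snd p)) L) ?O"
 unfolding esum_def by (rule restrict_apply'[OF tbe])
 also have "... = finsum (tpow R ?d V) (%L. tb ?d V (%p. x (snd p)) L) ?O'"
 proof (rule TV.add.finprod_mono_neutral_cong_right[OF finO])
 show "?O'<=?O" by blast
 fix L assume L: "L:?O - ?O'"
 hence "L:?O" "(tup ?d (%r. fst (L r))) ~= Ist l" by blast+
 thus "tc ?d F \<zeta> (tup ?d (%r. fst (L r))) (tb ?d F b (Ist l)) *[tpow R ?d V] tb ?d V (%p. x (snd p)) L = \<zero>[tpow R ?d V]"
 using tcO[of L] tbO[of L] by simp
 next
 fix L assume L: "L:?O'"
 hence LO: "L:?O" "(tup ?d (%r. fst (L r))) = Ist l" by blast+
 show "tc ?d F \<zeta> (tup ?d (%r. fst (L r))) (tb ?d F b (Ist l)) *[tpow R ?d V] tb ?d V (%p. x (snd p)) L =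
 tb ?d V (%p. x (snd p)) L"
 unfolding tcO[OF LO(1)] using LO(2) TV.smult_one[OF tbO[OF LO(1)]] by simp
 next
 show "(%L. tc ?d F \<zeta> (tup ?d (%r. fst (L r))) (tb ?d F b (Ist l)) *[tpow R ?d V] tb ?d V (%p. x (snd p)) L)
:?O \<rightarrow> Tens ?d V"
 proof (intro Pi_I TV.smult_closed)
 fix L assume L: "L:?O"
 show "tb ?d V (%p. x (snd p)) L:Tens ?d V" by (rule tbO[OF L])
 show "tc ?d F \<zeta> (tup ?d (%r. fst (L r))) (tb ?d F b (Ist l)):carrier R" unfolding tcO[OF L] by simp
 qed
 qed
 also have "... = finsum (tpow R ?d V) (%J. tb ?d V (%p. x (snd p)) (?h J)) ?U"
 unfolding im[symmetric] by (rule TV.finsum_reindex[OF _ inj]) (unfold im, intro Pi_I tbO, blast)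
 also have "... = finsum (tpow R ?d V) (tb ?d V x) ?U"
 proof (rule TV.finsum_cong'[OF refl])
 show "tb ?d V x:?U \<rightarrow> Tens ?d V" by (intro Pi_I tb_closed(2)[OF MV x]) blast
 fix J assume "J:?U"
 have "(tup ?d (%r. x (snd (?h J r)))) = (tup ?d (%r. x (J r)))" by (rule restrict_ext) simp
 thus "tb ?d V (%p. x (snd p)) (?h J) = tb ?d V x J" by (rule arg_cong)
 qed
 also have "... = div_incl R l V (gam l V B x T)" by (rule div_incl_gam[OF V x B, symmetric])
 finally show "on_mor (div_powers R l) F V ?g (gen l F b) = gam l V B x T"
 by (rule inj_onD[OF div_incl_inj[OF V] _ lin_closed[OF mod_hom_lin[OF Gams_mor_hom[OF F V g]] e(1)] gam_closed[OF V x]])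
qed

text \<open>Hence \<open>\<Gamma>\<^sup>\<mu>\<close> is generated by one element: it is a quotient of a representable functor.\<close>

lemma gen_generates:
 assumes F: "F:fgp" and D: "free_dual F {..<length l} b \<zeta>" and V: "V:fgp" and z: "z:carrier (Gams l V)"
 shows "EX g:Homs (sum_list l) F V. on_mor (div_powers R l) F V g (gen l F b) = z"
proof -
 obtain n :: nat and x \<xi> where DV: "dual_basis V {..<n} x \<xi>" using fg_projective_dual_basis[OF V] .
 let ?H = "(%g. on_mor (div_powers R l) F V g (gen l F b)) ` Homs (sum_list l) F V"
 have H: "submodule ?H R (Gams l V)"
 by (rule submodule_image[OF module_sp_hom[OF fgp_module[OF F] fgp_module[OF V]] module_Gams[OF V]
 rep_lin[OF is_rep_Gams F V div_incl_gen(1)[OF F D]]])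
 have "gam l V {..<n} x ` Tabs l {..<n}<=?H"
 proof (rule image_subsetI)
 fix T
 note g = gen_to_gam[OF F D V dual_basis_mem[OF DV] finite_lessThan, of T]
 show "gam l V {..<n} x T:?H"
 by (rule image_eqI[where f = "%g. on_mor (div_powers R l) F V g (gen l F b)", OF g(2)[symmetric] g(1)])
 qed
 from dual_basis_span[OF dual_basis_Gams[OF V DV] module_Gams[OF V] H this z] show ?thesis by blast
qed

lemma nat_transD:
 fixes X :: "('a, 'u, 'x) sp_functor" and Y :: "('a, 'u, 'y) sp_functor"
 assumes "\<eta>:nat_trans R d X Y"
 shows "!!V. V:fgp ==> \<eta> V:mod_hom R (on_obj X V) (on_obj Y V)"
 and "!!V W \<phi> x. V:fgp ==> W:fgp ==> \<phi>:Homs d V W ==> x:carrier (on_obj X V) ==>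
 \<eta> W (on_mor X V W \<phi> x) = on_mor Y V W \<phi> (\<eta> V x)"
 and "\<eta>:extensional fgp"
proof -
 note C = assms[unfolded nat_trans_def mem_Collect_eq]
 note P = conjunct1[OF C] and N = conjunct2[OF C]
 show "\<eta> V:mod_hom R (on_obj X V) (on_obj Y V)" if "V:fgp" for V by (rule PiE_mem[OF P that])
 show "\<eta>:extensional fgp" using P by (simp only: PiE_iff)
 show "\<eta> W (on_mor X V W \<phi> x) = on_mor Y V W \<phi> (\<eta> V x)"
 if "V:fgp" "W:fgp" "\<phi>:Homs d V W" "x:carrier (on_obj X V)" for V W \<phi> x
 using N that by blast
qed

lemma nat_trans_eqI:
 fixes X :: "('a, 'u, 'x) sp_functor" and Y :: "('a, 'u, 'y) sp_functor"
 assumes e: "\<eta>:nat_trans R d X Y" "\<theta>:nat_trans R d X Y"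
 and eq: "!!V x. V:fgp ==> x:carrier (on_obj X V) ==> \<eta> V x = \<theta> V x"
 shows "\<eta> = \<theta>"
proof (rule extensionalityI[OF nat_transD(3)[OF e(1)] nat_transD(3)[OF e(2)]])
 fix V :: "('a, 'u) module" assume V: "V:fgp"
 show "\<eta> V = \<theta> V" by (rule mod_hom_eqI[OF nat_transD(1)[OF e(1) V] nat_transD(1)[OF e(2) V] eq[OF V]])
qed

text \<open>A natural transformation out of \<open>\<Gamma>\<^sup>\<mu>\<close> is determined by its value at the generator.\<close>

lemma nat_trans_gen_eqI:
 assumes F: "F:fgp" and D: "free_dual F {..<length l} b \<zeta>"
 and e: "\<eta>:nat_trans R (sum_list l) (div_powers R l) X" "\<theta>:nat_trans R (sum_list l) (div_powers R l) X"
 and eq: "\<eta> F (gen l F b) = \<theta> F (gen l F b)" and V: "V:fgp" and z: "z:carrier (Gams l V)"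
 shows "\<eta> V z = \<theta> V z"
proof -
 obtain g where g: "g:Homs (sum_list l) F V" "z = on_mor (div_powers R l) F V g (gen l F b)"
 using gen_generates[OF F D V z] by blast
 show ?thesis
 unfolding g(2) nat_transD(2)[OF e(1) F V g(1) div_incl_gen(1)[OF F D]]
 nat_transD(2)[OF e(2) F V g(1) div_incl_gen(1)[OF F D]] eq ..
qed

end

section \<open>Conjugate partitions\<close>

lemma part_nth_mono:
 assumes "sorted_wrt (>=) (l :: nat list)" "i <= j" "j < length l"
 shows "l ! j <= l ! i"
 using sorted_wrt_nth_less[OF assms(1), of i j] assms(2,3) by (cases "i = j") auto

lemma conj_iff:
 assumes l: "sorted_wrt (>=) l"
 shows "j < length (conj_part l) & i < conj_part l ! j \<longleftrightarrow> i < length l & j < l ! i"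
proof -
 have len: "length (conj_part l) = (case l of [] => 0 | a # _ => a)" by (simp add: conj_part_def)
 have nth: "conj_part l ! j = card {i. i < length l & j < l ! i}" if "j < length (conj_part l)"
 using that by (simp add: conj_part_def)
 have len0: "length (conj_part l) = l ! 0" if "l ~= []" using that len by (cases l) auto
 \<comment> \<open>the rows that reach column \<open>j\<close> form an initial segment\<close>
 have seg: "{i. i < length l & j < l ! i} = {..<card {i. i < length l & j < l ! i}}"
 proof -
 have down: "i':{i. i < length l & j < l ! i}" if "i:{i. i < length l & j < l ! i}" "i' <= i" for i i'
 using that part_nth_mono[OF l, of i' i] by auto
 have fin: "finite {i. i < length l & j < l ! i}" by simp
 have ex: "EX k. S = {..<k}" if "finite S" "!!i i'. i:S ==> i' <= i ==> i':S" for S :: "nat set"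
 proof (cases "S = {}")
 case False
 have "S = {..<Suc (Max S)}"
 proof (intro equalityI subsetI)
 fix i assume "i:S" thus "i:{..<Suc (Max S)}" using Max_ge[OF that(1)] by (auto simp: less_Suc_eq_le)
 next
 fix i assume "i:{..<Suc (Max S)}"
 thus "i:S" using that(2)[OF Max_in[OF that(1) False], of i] by auto
 qed
 thus ?thesis by blast
 qed (auto intro: exI[of _ 0])
 have "EX k. {i. i < length l & j < l ! i} = {..<k}" by (rule ex[OF fin]) (rule down)
 then obtain k where "{i. i < length l & j < l ! i} = {..<k}" by (rule exE)
 thus ?thesis by simp
 qed
 show ?thesis
 proof
 assume a: "j < length (conj_part l) & i < conj_part l ! j"
 hence "i:{..<card {i. i < length l & j < l ! i}}" using nth by simp
 thus "i < length l & j < l ! i" using seg by blast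
 next
 assume a: "i < length l & j < l ! i"
 hence ne: "l ~= []" by auto
 have "l ! i <= l ! 0" using a part_nth_mono[OF l, of 0 i] by simp
 hence j: "j < length (conj_part l)" using a len0[OF ne] by simp
 have "i:{..<card {i. i < length l & j < l ! i}}" using a seg by blast
 thus "j < length (conj_part l) & i < conj_part l ! j" using nth[OF j] j by simp
 qed
qed

lemma conj_cells:
 assumes "sorted_wrt (>=) l"
 shows "(%(i, j). (j, i)) ` (SIGMA j:{..<length (conj_part l)}. {..<conj_part l ! j}) =
 (SIGMA i:{..<length l}. {..<l ! i})"
proof (intro equalityI subsetI)
 fix p assume "p:(SIGMA i:{..<length l}. {..<l ! i})"
 then obtain i j where "p = (i, j)" "i < length l" "j < l ! i" by auto
 thus "p:(%(i, j). (j, i)) ` (SIGMA j:{..<length (conj_part l)}. {..<conj_part l ! j})"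
 using conj_iff[OF assms, of j i] by (intro image_eqI[of _ _ "(j, i)"]) auto
qed (use conj_iff[OF assms] in auto)

lemma sum_conj_swap:
 fixes f :: "nat => nat => 'b::comm_monoid_add"
 assumes "sorted_wrt (>=) l"
 shows "(\<Sum>j<length (conj_part l). \<Sum>i<conj_part l ! j. f i j) = (\<Sum>i<length l. \<Sum>j<l ! i. f i j)"
proof -
 have inj: "inj_on (%(i, j). (j, i)) (SIGMA j:{..<length (conj_part l)}. {..<conj_part l ! j})"
 by (auto simp: inj_on_def)
 have "(\<Sum>i<length l. \<Sum>j<l ! i. f i j) = (\<Sum>(i, j)\<in>(SIGMA i:{..<length l}. {..<l ! i}). f i j)"
 by (simp add: sum.Sigma)
 also have "... = (\<Sum>(j, i)\<in>(SIGMA j:{..<length (conj_part l)}. {..<conj_part l ! j}). f i j)"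
 unfolding conj_cells[OF assms, symmetric] by (subst sum.reindex[OF inj]) (simp add: case_prod_unfold comp_def)
 also have "... = (\<Sum>j<length (conj_part l). \<Sum>i<conj_part l ! j. f i j)" by (simp add: sum.Sigma)
 finally show ?thesis by simp
qed

lemma sum_list_take: "sum_list (take r l) = (\<Sum>i<length l. if i < r then l ! i else (0::nat))"
proof -
 have "sum_list (take r l) = (\<Sum>i<min r (length l). l ! i)"
 by (simp add: sum_list_sum_nth atLeast0LessThan min.commute)
 also have "... = (\<Sum>i\<in>{i. i < length l & i < r}. l ! i)" by (rule sum.cong) auto
 also have "... = (\<Sum>i<length l. if i < r then l ! i else 0)"
 by (subst sum.inter_filter[symmetric]) (auto intro: sum.cong)
 finally show ?thesis .
qed

lemma sum_conj: "sorted_wrt (>=) l ==> sum_list (conj_part l) = sum_list l"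
 using sum_conj_swap[of l "%_ _. 1::nat"] by (simp add: sum_list_sum_nth atLeast0LessThan)

lemma sum_min_conj:
 assumes "sorted_wrt (>=) l"
 shows "(\<Sum>j<length (conj_part l). min r (conj_part l ! j)) = sum_list (take r l)"
proof -
 have m: "min r k = (\<Sum>i<k. if i < r then 1 else 0)" for k :: nat
 by (induction k) auto
 have "(\<Sum>j<length (conj_part l). min r (conj_part l ! j)) =
 (\<Sum>j<length (conj_part l). \<Sum>i<conj_part l ! j. if i < r then 1 else 0)" by (simp only: m)
 also have "... = (\<Sum>i<length l. \<Sum>j<l ! i. if i < r then 1 else 0)" by (rule sum_conj_swap[OF assms])
 also have "... = sum_list (take r l)" unfolding sum_list_take by (rule sum.cong) auto
 finally show ?thesis .
qed

lemma sorted_conj: "sorted_wrt (>=) (conj_part l)"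
 unfolding sorted_wrt_iff_nth_less conj_part_def
 by (auto intro!: card_mono)

lemma take_conj_conj:
 assumes l: "sorted_wrt (>=) l" and j: "j < length (conj_part l)" and i: "i < conj_part l ! j"
 shows "take i (conj_part (conj_part l)) = take i l"
proof -
 have il: "i < length l" using conj_iff[OF l, of j i] i j by blast
 have eqv: "i' < length (conj_part (conj_part l)) & j' < conj_part (conj_part l) ! i' \<longleftrightarrow> i' < length l & j' < l ! i'" for i' j'
 using conj_iff[OF sorted_conj, of i' l j'] conj_iff[OF l, of j' i'] by blast
 have ic: "i < length (conj_part (conj_part l))" using eqv[of i j] conj_iff[OF l, of j i] i j by blast
 show ?thesis
 proof (rule nth_equalityI)
 show "length (take i (conj_part (conj_part l))) = length (take i l)" using il ic by simp
 fix k assume "k < length (take i (conj_part (conj_part l)))"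
 hence k: "k < i" by simp
 have "j' < conj_part (conj_part l) ! k \<longleftrightarrow> j' < l ! k" for j' using eqv[of k j'] k il ic by auto
 hence "conj_part (conj_part l) ! k = l ! k" by (metis linorder_neqE_nat less_irrefl)
 thus "take i (conj_part (conj_part l)) ! k = take i l ! k" using k by simp
 qed
qed

lemma part_perm_conj:
 assumes l: "sorted_wrt (>=) l" and j: "j < length (conj_part l)" and i: "i < conj_part l ! j"
 shows "part_perm (conj_part l) (pos (conj_part l) j i) = pos l i j"
 unfolding part_perm_def
proof (rule the_equality)
 have t: "sum_list (take i (conj_part (conj_part l))) = sum_list (take i l)" by (simp only: take_conj_conj[OF assms])
 show "EX i' j'. i' < length (conj_part l) & j' < conj_part l ! i' &
 pos (conj_part l) j i = sum_list (take i' (conj_part l)) + j' &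
 pos l i j = sum_list (take j' (conj_part (conj_part l))) + i'"
 using i j t by (intro exI[of _ j] exI[of _ i]) (simp add: pos_def)
 fix s assume "EX i' j'. i' < length (conj_part l) & j' < conj_part l ! i' &
 pos (conj_part l) j i = sum_list (take i' (conj_part l)) + j' &
 s = sum_list (take j' (conj_part (conj_part l))) + i'"
 then obtain i' j' where ij: "i' < length (conj_part l)" "j' < conj_part l ! i'"
 "pos (conj_part l) j i = pos (conj_part l) i' j'" "s = sum_list (take j' (conj_part (conj_part l))) + i'"
 by (auto simp: pos_def)
 have "j = i'" "i = j'" using pos_inj[OF j i ij(1,2,3)] by auto
 thus "s = pos l i j" using ij(4) t by (simp add: pos_def)
qed

definition weyl_perm :: "nat list => nat => nat" where
 "weyl_perm l r = (if r < sum_list l then part_perm (conj_part l) r else r)"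

lemma weyl_perm_pos:
 "sorted_wrt (>=) l ==> j < length (conj_part l) ==> i < conj_part l ! j ==>
 weyl_perm l (pos (conj_part l) j i) = pos l i j"
 using pos_less[of j "conj_part l" i] by (simp add: weyl_perm_def sum_conj part_perm_conj)

lemma weyl_perm_permutes:
 assumes l: "sorted_wrt (>=) l"
 shows "weyl_perm l permutes {..<sum_list l}"
proof -
 have c: "EX j i. j < length (conj_part l) & i < conj_part l ! j & r = pos (conj_part l) j i" if "r < sum_list l" for r
 using pos_cases[of r "conj_part l"] that by (metis sum_conj[OF l])
 have im: "weyl_perm l r < sum_list l" if r: "r < sum_list l" for r
 proof -
 obtain j i where ji: "j < length (conj_part l)" "i < conj_part l ! j" "r = pos (conj_part l) j i" using c[OF r] by blast
 thus ?thesis using weyl_perm_pos[OF l ji(1,2)] conj_iff[OF l, of j i] pos_less[of i l j] by simp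
 qed
 have inj: "inj_on (weyl_perm l) {..<sum_list l}"
 proof (rule inj_onI)
 fix r r' assume "r:{..<sum_list l}" "r':{..<sum_list l}" and eq: "weyl_perm l r = weyl_perm l r'"
 then obtain j i j' i' where ji: "j < length (conj_part l)" "i < conj_part l ! j" "r = pos (conj_part l) j i"
 "j' < length (conj_part l)" "i' < conj_part l ! j'" "r' = pos (conj_part l) j' i'"
 using c[of r] c[of r'] by auto
 have "pos l i j = pos l i' j'" using eq weyl_perm_pos[OF l ji(1,2)] weyl_perm_pos[OF l ji(4,5)] ji by simp
 hence "i = i'" "j = j'" using pos_inj[of i l j i' j'] conj_iff[OF l, of j i] conj_iff[OF l, of j' i'] ji by blast+
 thus "r = r'" using ji by simp
 qed
 have "weyl_perm l ` {..<sum_list l} = {..<sum_list l}"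
 by (rule endo_inj_surj[OF finite_lessThan _ inj]) (use im in auto)
 thus ?thesis using inj by (intro bij_imp_permutes) (auto simp: bij_betw_def weyl_perm_def)
qed

section \<open>Fillings with distinct entries in the columns\<close>

abbreviation ctl :: "nat list => nat multiset" where
 "ctl m \<equiv> (\<Sum>i<length m. replicate_mset (m ! i) i)"

lemma card_less_ct: "card {r. r < d & I r < k} = size (filter_mset (%i. i < k) (ct d I))"
proof -
 have "size (filter_mset (%i. i < k) (ct d I)) = size (filter_mset (%r. I r < k) (mset_set {..<d}))"
 by (simp add: ct_def filter_mset_image_mset)
 also have "filter_mset (%r. I r < k) (mset_set {..<d}) = mset_set {r. r < d & I r < k}"
 by (simp add: filter_mset_mset_set)
 finally show ?thesis by simp
qed

lemma size_less_ctl: "size (filter_mset (%i. i < k) (ctl m)) = sum_list (take k m)"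
proof -
 have r: "filter_mset P (replicate_mset n x) = (if P x then replicate_mset n x else {#})" for P n and x :: nat
 by (induction n) auto
 have "filter_mset (%i. i < k) (\<Sum>i<n. replicate_mset (f i) i) = (\<Sum>i<n. if i < k then replicate_mset (f i) i else {#})"
 for n and f :: "nat => nat"
 by (induction n) (simp_all add: r)
 moreover have "size (\<Sum>i<n. if i < k then replicate_mset (f i) i else {#}) = (\<Sum>i<n. if i < k then f i else 0)"
 for n and f :: "nat => nat"
 by (induction n) simp_all
 ultimately show ?thesis by (simp add: sum_list_take)
qed

lemma columns_count:
 assumes l: "sorted_wrt (>=) l" and I: "ct (sum_list l) I = ctl m"
 and inj: "!!j. j < length (conj_part l) ==> inj_on (%i. I (pos (conj_part l) j i)) {..<conj_part l ! j}"
 shows "sum_list (take k m) = (\<Sum>j<length (conj_part l). card {i. i < conj_part l ! j & I (pos (conj_part l) j i) < k})"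
 and "j < length (conj_part l) ==> card {i. i < conj_part l ! j & I (pos (conj_part l) j i) < k} <= min k (conj_part l ! j)"
proof -
 let ?c = "conj_part l"
 have "sum_list (take k m) = card {r. r < sum_list ?c & I r < k}"
 unfolding card_less_ct sum_conj[OF l] I size_less_ctl ..
 also have "... = (\<Sum>r<sum_list ?c. if I r < k then 1 else 0)" by (simp add: sum.If_cases Int_def)
 also have "... = (\<Sum>j<length ?c. \<Sum>i<?c ! j. if I (pos ?c j i) < k then 1 else 0)" by (rule sum_blocks)
 also have "... = (\<Sum>j<length ?c. card {i. i < ?c ! j & I (pos ?c j i) < k})" by (simp add: sum.If_cases Int_def)
 finally show "sum_list (take k m) = (\<Sum>j<length ?c. card {i. i < ?c ! j & I (pos ?c j i) < k})" .
 assume j: "j < length ?c"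
 have "card {i. i < ?c ! j & I (pos ?c j i) < k} <= card {..<k}"
 by (rule card_inj_on_le[of "%i. I (pos ?c j i)"]) (use inj[OF j] in "auto simp: inj_on_def")
 moreover have "card {i. i < ?c ! j & I (pos ?c j i) < k} <= card {..<?c ! j}" by (rule card_mono) auto
 ultimately show "card {i. i < ?c ! j & I (pos ?c j i) < k} <= min k (?c ! j)" by simp
qed

text \<open>The easy half of the theorem of Gale and Ryser: the entries below \<open>k\<close> occupy at most \<open>min k \<lambda>'\<^sub>j\<close>
 places in column \<open>j\<close>.\<close>

lemma columns_dominated:
 assumes l: "sorted_wrt (>=) l" and I: "ct (sum_list l) I = ctl m"
 and inj: "!!j. j < length (conj_part l) ==> inj_on (%i. I (pos (conj_part l) j i)) {..<conj_part l ! j}"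
 shows "dominated m l"
 unfolding dominated_def
proof (intro allI impI)
 fix k :: nat
 have c1: "sum_list (take k m) = (\<Sum>j<length (conj_part l). card {i. i < conj_part l ! j & I (pos (conj_part l) j i) < k})"
 by (rule columns_count(1)[OF l I]) (rule inj)
 have c2: "card {i. i < conj_part l ! j & I (pos (conj_part l) j i) < k} <= min k (conj_part l ! j)"
 if "j < length (conj_part l)" for j
 by (rule columns_count(2)[OF l I _ that]) (rule inj)
 have "sum_list (take k m) <= (\<Sum>j<length (conj_part l). min k (conj_part l ! j))"
 unfolding c1 by (rule sum_mono) (rule c2, simp)
 thus "sum_list (take k m) <= sum_list (take k l)" unfolding sum_min_conj[OF l] .
qed

text \<open>If the content is \<open>\<lambda>\<close> itself, all the inequalities in this count are equalities, and a column of height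
 \<open>k\<close> consists of the entries \<open>0, \<dots>, k - 1\<close>.\<close>

lemma columns_extremal:
 assumes l: "sorted_wrt (>=) l" and I: "ct (sum_list l) I = ctl l"
 and inj: "!!j. j < length (conj_part l) ==> inj_on (%i. I (pos (conj_part l) j i)) {..<conj_part l ! j}"
 and j: "j < length (conj_part l)"
 shows "EX \<tau>. \<tau> permutes {..<conj_part l ! j} & blk (conj_part l) I j = (tup (conj_part l ! j) (%i. \<tau> i))"
proof -
 let ?c = "conj_part l"
 have c1: "sum_list (take k l) = (\<Sum>j<length ?c. card {i. i < ?c ! j & I (pos ?c j i) < k})" for k
 by (rule columns_count(1)[OF l I]) (rule inj)
 have c2: "card {i. i < ?c ! j & I (pos ?c j i) < k} <= min k (?c ! j)" if "j < length ?c" for j k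
 by (rule columns_count(2)[OF l I _ that]) (rule inj)
 let ?f = "%i. I (pos ?c j i)" and ?k = "?c ! j"
 have eq: "(\<Sum>j<length ?c. card {i. i < ?c ! j & I (pos ?c j i) < ?k}) = (\<Sum>j<length ?c. min ?k (?c ! j))"
 unfolding c1[symmetric] sum_min_conj[OF l] ..
 have "card {i. i < ?k & ?f i < ?k} = min ?k ?k"
 proof (rule ccontr)
 assume "card {i. i < ?k & ?f i < ?k} ~= min ?k ?k"
 hence "card {i. i < ?k & ?f i < ?k} < min ?k ?k" using c2[OF j, of ?k] by linarith
 hence "(\<Sum>j<length ?c. card {i. i < ?c ! j & I (pos ?c j i) < ?k}) < (\<Sum>j<length ?c. min ?k (?c ! j))"
 using j c2 by (intro sum_strict_mono_ex1) auto
 thus False using eq by simp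
 qed
 hence "{i. i < ?k & ?f i < ?k} = {..<?k}" by (intro card_subset_eq) auto
 hence im: "?f ` {..<?k}<={..<?k}" by blast
 have bij: "bij_betw ?f {..<?k} {..<?k}"
 using endo_inj_surj[OF finite_lessThan im inj[OF j]] inj[OF j] by (simp add: bij_betw_def)
 define \<tau> where "\<tau> i = (if i < ?k then ?f i else i)" for i
 have "bij_betw \<tau> {..<?k} {..<?k} \<longleftrightarrow> bij_betw ?f {..<?k} {..<?k}" by (rule bij_betw_cong) (simp add: \<tau>_def)
 hence "\<tau> permutes {..<?k}" using bij by (intro bij_imp_permutes) (auto simp: \<tau>_def)
 moreover have "blk ?c I j = (tup ?k (%i. \<tau> i))" by (auto simp: blk_def \<tau>_def fun_eq_iff)
 ultimately show ?thesis by blast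
qed

section \<open>Inequalities for straightening\<close>

text \<open>The rearrangement inequality, with its case of equality.\<close>

lemma rearrangement:
 fixes u :: "nat => nat"
 assumes "!!a b. a < b ==> b < k ==> u a < u b" "\<tau> permutes {..<k}"
 shows "(\<Sum>i<k. i * u (\<tau> i)) <= (\<Sum>i<k. i * u i) & ((\<Sum>i<k. i * u (\<tau> i)) = (\<Sum>i<k. i * u i) --> \<tau> = id)"
 using assms
proof (induction k arbitrary: \<tau>)
 case 0 thus ?case by (simp add: permutes_empty)
next
 case (Suc k)
 note IH = Suc.IH[OF Suc.prems(1)[OF _ less_SucI]]
 show ?case
 proof (cases "\<tau> k = k")
 case True
 have "\<tau> permutes {..<k}"
 by (rule permutes_superset[OF Suc.prems(2)]) (use True in "auto simp: less_Suc_eq")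
 from IH[OF _ _ this] show ?thesis using True by simp
 next
 case False
 define a where "a = inv_into UNIV \<tau> k"
 have ta: "\<tau> a = k" unfolding a_def by (rule permutes_inverses(1)[OF Suc.prems(2)])
 have ak: "a < k" using ta False permutes_in_image[OF Suc.prems(2), of a] by (cases "a = k") auto
 have tk: "\<tau> k < k" using False permutes_in_image[OF Suc.prems(2), of k] by (auto simp: less_Suc_eq)
 define \<rho> where "\<rho> = \<tau>\<circ>transpose a k"
 have r: "\<rho> permutes {..<Suc k}" unfolding \<rho>_def
 by (rule permutes_compose[OF _ Suc.prems(2)]) (use ak in "auto intro!: permutes_swap_id")
 have rk: "\<rho> k = k" "\<rho> a = \<tau> k" using ta by (simp_all add: \<rho>_def)
 have ro: "\<rho> i = \<tau> i" if "i ~= a" "i ~= k" for i using that by (simp add: \<rho>_def)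
 have "\<rho> permutes {..<k}"
 by (rule permutes_superset[OF r]) (use rk in "auto simp: less_Suc_eq")
 from IH[OF _ _ this] have 1: "(\<Sum>i<k. i * u (\<rho> i)) <= (\<Sum>i<k. i * u i)" by simp
 have s1: "(\<Sum>i<k. i * u (\<rho> i)) = a * u (\<tau> k) + (\<Sum>i\<in>{..<k} - {a}. i * u (\<tau> i))"
 using ak rk ro by (subst sum.remove[of _ a]) (auto intro!: sum.cong)
 have s2: "(\<Sum>i<k. i * u (\<tau> i)) = a * u k + (\<Sum>i\<in>{..<k} - {a}. i * u (\<tau> i))"
 using ak ta by (subst sum.remove[of _ a]) auto
 have uk: "u (\<tau> k) < u k" using Suc.prems(1)[OF tk] by simp
 obtain e where e: "u k = u (\<tau> k) + Suc e" using less_imp_Suc_add[OF uk] by auto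
 obtain f where f: "k = a + Suc f" using less_imp_Suc_add[OF ak] by auto
 have "a * (x + Suc e) + (a + Suc f) * x < a * x + (a + Suc f) * (x + Suc e)" for x
 by (simp add: algebra_simps)
 from this[of "u (\<tau> k)"] have "a * u k + k * u (\<tau> k) < a * u (\<tau> k) + k * u k"
 unfolding e[symmetric] f[symmetric] .
 hence "(\<Sum>i<Suc k. i * u (\<tau> i)) < (\<Sum>i<Suc k. i * u i)" using 1 unfolding s1 by (simp add: s2)
 thus ?thesis by simp
 qed
qed

lemma exchange_sum:
 fixes A B U U' :: "nat multiset"
 assumes eq: "U + U' = A + B" and sz: "size U = size A"
 and A: "!!a. a \<in># A ==> c <= a" and B: "!!b. b \<in># B ==> b <= c"
 shows "sum_mset U <= sum_mset A" and "sum_mset U = sum_mset A ==> U = A"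
proof -
 let ?X = "A - U" and ?Y = "U - A"
 have AX: "A = (A \<inter># U) + ?X" and UY: "U = (A \<inter># U) + ?Y"
 by (auto simp: multiset_eq_iff)
 have sXY: "size ?X = size ?Y"
 using sz arg_cong[OF AX, of size] arg_cong[OF UY, of size] by simp
 have YB: "?Y \<subseteq># B"
 proof -
 have "U \<subseteq># A + B" unfolding eq[symmetric] by simp
 thus ?thesis by (simp add: subset_eq_diff_conv add.commute)
 qed
 have X: "c * size M <= sum_mset M" if "!!a. a \<in># M ==> c <= a" for M :: "nat multiset"
 using that by (induction M) (simp_all add: add_mono)
 have Y: "sum_mset M <= c * size M" if "!!a. a \<in># M ==> a <= c" for M :: "nat multiset"
 using that by (induction M) (simp_all add: add_mono)
 have X1: "c * size ?X <= sum_mset ?X" by (rule X) (use A in_diffD in fastforce)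
 have Y1: "sum_mset ?Y <= c * size ?Y" by (rule Y) (use B mset_subset_eqD[OF YB] in blast)
 have sums: "sum_mset A = sum_mset (A \<inter># U) + sum_mset ?X" "sum_mset U = sum_mset (A \<inter># U) + sum_mset ?Y"
 using arg_cong[OF AX, of sum_mset] arg_cong[OF UY, of sum_mset] by simp_all
 show "sum_mset U <= sum_mset A" using X1 Y1 sXY sums by simp
 assume "sum_mset U = sum_mset A"
 hence e: "sum_mset ?X = c * size ?X" "sum_mset ?Y = c * size ?Y" using X1 Y1 sXY sums by simp_all
 have allX: "a = c" if "sum_mset M = c * size M" "!!a. a \<in># M ==> c <= a" "a \<in># M" for M :: "nat multiset" and a
 proof -
 from multi_member_split[OF that(3)] obtain N where N: "M = add_mset a N" ..
 have "c * size N <= sum_mset N" by (rule X) (use that(2) N in auto)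
 moreover have "c <= a" using that(2,3) by blast
 ultimately show ?thesis using that(1) N by simp
 qed
 have allY: "a = c" if "sum_mset M = c * size M" "!!a. a \<in># M ==> a <= c" "a \<in># M" for M :: "nat multiset" and a
 proof -
 from multi_member_split[OF that(3)] obtain N where N: "M = add_mset a N" ..
 have "sum_mset N <= c * size N" by (rule Y) (use that(2) N in auto)
 moreover have "a <= c" using that(2,3) by blast
 ultimately show ?thesis using that(1) N by simp
 qed
 have "?X = {#}"
 proof (rule ccontr)
 assume ne: "?X ~= {#}"
 then obtain a where a: "a \<in># ?X" by blast
 have "?Y ~= {#}" using ne sXY by auto
 then obtain b where b: "b \<in># ?Y" by blast
 have "a = c" by (rule allX[OF e(1) _ a]) (use A in_diffD in fastforce)
 moreover have "b = c" by (rule allY[OF e(2) _ b]) (use B mset_subset_eqD[OF YB] in blast)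
 ultimately have "c \<in># ?X" "c \<in># ?Y" using a b by auto
 thus False by (simp add: in_diff_count)
 qed
 moreover from this have "?Y = {#}" using sXY by simp
 ultimately show "U = A" using AX UY by simp
qed

lemma sort_desc:
 fixes \<nu> :: "nat => nat"
 obtains \<beta> where "\<beta> permutes {..<m}" "sorted_wrt (>=) (map (%q. \<nu> (\<beta> q)) [0..<m])"
proof -
 let ?ys = "map \<nu> [0..<m]" let ?xs = "rev (sort ?ys)"
 have "mset ?xs = mset ?ys" by simp
 then obtain \<beta> where b: "\<beta> permutes {..<length ?ys}" "permute_list \<beta> ?ys = ?xs"
 by (rule mset_eq_permutation)
 have bm: "\<beta> permutes {..<m}" using b(1) by simp
 have "?xs = map (%q. \<nu> (\<beta> q)) [0..<m]"
 proof (rule nth_equalityI)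
 fix k assume "k < length ?xs"
 hence k: "k < m" by simp
 have "?xs ! k = ?ys ! \<beta> k" unfolding b(2)[symmetric] by (rule permute_list_nth[OF b(1)]) (simp add: k)
 thus "?xs ! k = map (%q. \<nu> (\<beta> q)) [0..<m] ! k" using k permutes_in_image[OF bm, of k] by simp
 qed simp
 moreover have "sorted_wrt (>=) ?xs" using sorted_sort[of ?ys] by (simp add: sorted_wrt_rev)
 ultimately show thesis using that[OF bm] by simp
qed

lemma sum_le_take:
 assumes m: "sorted_wrt (>=) (m :: nat list)" and Q: "Q<={..<length m}"
 shows "(\<Sum>q\<in>Q. m ! q) <= sum_list (take (card Q) m)"
proof -
 let ?k = "card Q"
 have fin: "finite Q" using Q by (rule finite_subset) simp
 have kl: "?k <= length m" using card_mono[OF _ Q] by simp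
 let ?A = "Q - {..<?k}" and ?B = "{..<?k} - Q"
 have c: "card ?A = card ?B"
 proof -
 have "card Q = card (Q\<inter>{..<?k}) + card ?A" using fin by (subst card_Int_Diff[symmetric]) auto
 moreover have "?k = card ({..<?k}\<inter>Q) + card ?B"
 using card_Int_Diff[of "{..<?k}" Q] by simp
 ultimately show ?thesis by (simp add: Int_commute)
 qed
 have le: "m ! a <= m ! b" if "a:?A" "b:?B" for a b
 using that Q by (intro part_nth_mono[OF m]) auto
 have AB: "(\<Sum>q\<in>?A. m ! q) <= (\<Sum>q\<in>?B. m ! q)"
 proof (cases "?B = {}")
 case True
 hence "card ?A = 0" using c by (metis card.empty)
 hence e: "?A = {}" using fin by simp
 show ?thesis unfolding e True by simp
 next
 case False
 define z where "z = Min ((!) m ` ?B)"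
 have zin: "z:(!) m ` ?B" unfolding z_def by (rule Min_in) (use False in auto)
 then obtain b0 where b0: "b0:?B" "z = m ! b0" by blast
 have "(\<Sum>q\<in>?A. m ! q) <= (\<Sum>q\<in>?A. z)" by (rule sum_mono) (use le[OF _ b0(1)] b0(2) in auto)
 also have "... = (\<Sum>q\<in>?B. z)" using c by simp
 also have "... <= (\<Sum>q\<in>?B. m ! q)" by (rule sum_mono) (simp add: z_def)
 finally show ?thesis .
 qed
 have "(\<Sum>q\<in>Q. m ! q) = (\<Sum>q\<in>Q\<inter>{..<?k}. m ! q) + (\<Sum>q\<in>?A. m ! q)"
 using fin by (rule sum.Int_Diff)
 also have "... <= (\<Sum>q\<in>{..<?k}\<inter>Q. m ! q) + (\<Sum>q\<in>?B. m ! q)" using AB by (simp add: Int_commute)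
 also have "... = (\<Sum>q<?k. m ! q)" by (rule sum.Int_Diff[symmetric]) simp
 also have "... = sum_list (take ?k m)" using kl by (simp add: sum_list_sum_nth atLeast0LessThan min_def)
 finally show ?thesis .
qed

section \<open>Semistandard tableaux\<close>

text \<open>In terms of row contents: the entries up to \<open>c\<close> of a row fit strictly below entries less than \<open>c\<close> of
 the row above.\<close>

definition semistandard :: "nat list => (nat => nat multiset) => bool" where
 "semistandard l T \<longleftrightarrow> (ALL i c. Suc i < length l -->
 size (filter_mset (%x. x <= c) (T (Suc i))) <= size (filter_mset (%x. x < c) (T i)))"

abbreviation row_list :: "nat multiset => nat list" where
 "row_list \<equiv> sorted_list_of_multiset"

lemma semistandard_columns:
 assumes T: "semistandard l T" and i: "Suc i < length l" and j: "j < size (T (Suc i))" "j < size (T i)"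
 shows "row_list (T i) ! j < row_list (T (Suc i)) ! j"
proof -
 let ?xs = "row_list (T i)" and ?ys = "row_list (T (Suc i))"
 have lx: "length ?xs = size (T i)" and ly: "length ?ys = size (T (Suc i))"
 using size_mset[of ?xs] size_mset[of ?ys] by simp_all
 let ?c = "?ys ! j"
 have "{..j}<={k. k < length ?ys & ?ys ! k <= ?c}"
 using sorted_nth_mono[OF sorted_sorted_list_of_multiset[of "T (Suc i)"]] j ly by auto
 hence "card {..j} <= card {k. k < length ?ys & ?ys ! k <= ?c}" by (intro card_mono) simp_all
 hence "Suc j <= card {k. k < length ?ys & ?ys ! k <= ?c}" by simp
 also have "... = size (filter_mset (%x. x <= ?c) (T (Suc i)))"
 using size_mset[of "filter (%x. x <= ?c) ?ys"] by (simp add: length_filter_conv_card)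
 also have "... <= size (filter_mset (%x. x < ?c) (T i))" using T i unfolding semistandard_def by blast
 also have "... = card {k. k < length ?xs & ?xs ! k < ?c}"
 using size_mset[of "filter (%x. x < ?c) ?xs"] by (simp add: length_filter_conv_card)
 finally have le: "Suc j <= card {k. k < length ?xs & ?xs ! k < ?c}" .
 show ?thesis
 proof (rule ccontr)
 assume "~ ?xs ! j < ?c"
 hence "?c <= ?xs ! k" if "j <= k" "k < length ?xs" for k
 using sorted_nth_mono[OF sorted_sorted_list_of_multiset[of "T i"] that] by simp
 hence "{k. k < length ?xs & ?xs ! k < ?c}<={..<j}" by (metis (no_types, lifting) lessThan_iff linorder_not_le mem_Collect_eq subsetI)
 hence "card {k. k < length ?xs & ?xs ! k < ?c} <= card {..<j}" by (rule card_mono[OF finite_lessThan])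
 thus False using le by simp
 qed
qed

section \<open>Elements of the trace\<close>

context cring
begin

lemma ct_Ist: "ct (sum_list l) (Ist l) = ctl l"
 unfolding ct_blocks by (rule sum.cong) (simp_all add: blk_Ist ct_const)

lemma tc_gam:
 assumes F: "F:fgp" and D: "free_dual F B b \<zeta>" and K: "K:Idx (sum_list l) B"
 shows "tc (sum_list l) F \<zeta> K (div_incl R l F (gam l F B b T)) =
 (if ALL i<length l. ct (l ! i) (blk l K i) = T i then \<one> else \<zero>)"
proof -
 let ?d = "sum_list l" and ?S = "{J\<in>Idx (sum_list l) B. ALL i<length l. ct (l ! i) (blk l J i) = T i}"
 note M = fgp_module[OF F]
 have DB: "dual_basis F B b \<zeta>" using D by (simp add: free_dual_def)
 have fin: "finite ?S" using dual_basisD(1)[OF dual_basis_tpow[OF M DB], of ?d] by simp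
 have l: "lin R (tpow R ?d F) (ring_as_mod R) (tc ?d F \<zeta> K)" by (rule dual_basisD(3)[OF dual_basis_tpow[OF M DB] K])
 have "tc ?d F \<zeta> K (div_incl R l F (gam l F B b T)) = finsum (ring_as_mod R) (%J. tc ?d F \<zeta> K (tb ?d F b J)) ?S"
 unfolding div_incl_gam[OF F dual_basis_mem[OF DB] dual_basisD(1)[OF DB]]
 by (rule lin_finsum[OF module_tpow[OF M] module_ring l])
 (use tb_closed(2)[OF M dual_basis_mem[OF DB]] in blast)
 also have "... = (if ALL i<length l. ct (l ! i) (blk l K i) = T i then \<one> else \<zero>)"
 proof (cases "ALL i<length l. ct (l ! i) (blk l K i) = T i")
 case True
 hence KS: "K:?S" using K by blast
 have "finsum (ring_as_mod R) (%J. tc ?d F \<zeta> K (tb ?d F b J)) ?S = tc ?d F \<zeta> K (tb ?d F b K)"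
 by (rule finsum_one_term[OF module_ring KS _ _ fin]) (simp_all add: tc_tb[OF M D K] K)
 thus ?thesis using True by (simp add: tc_tb[OF M D K K])
 next
 case False
 have "finsum (ring_as_mod R) (%J. tc ?d F \<zeta> K (tb ?d F b J)) ?S = \<zero>"
 unfolding finsum_ring by (rule add.finprod_one_eqI) (use False in "auto simp: tc_tb[OF M D K]")
 thus ?thesis by (simp only: False if_False)
 qed
 finally show ?thesis .
qed

lemma free_dual_permute:
 assumes V: "module R V" and D: "free_dual V {..<m} b \<zeta>" and p: "\<beta> permutes {..<m::nat}"
 shows "free_dual V {..<m} (%q. b (\<beta> q)) (%q. \<zeta> (\<beta> q))"
proof -
 interpret V: module R V by fact
 have DB: "dual_basis V {..<m} b \<zeta>" using D by (simp add: free_dual_def)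
 have im: "\<beta> ` {..<m} = {..<m}" by (rule permutes_image[OF p])
 have m: "\<beta> q:{..<m}" if "q:{..<m}" for q using permutes_in_image[OF p] that by blast
 have "x = finsum V (%q. \<zeta> (\<beta> q) x *[V] b (\<beta> q)) {..<m}" if x: "x:carrier V" for x
 proof -
 have "x = finsum V (%q. \<zeta> q x *[V] b q) (\<beta> ` {..<m})" unfolding im by (rule dual_basisD(4)[OF DB x, symmetric])
 also have "... = finsum V (%q. \<zeta> (\<beta> q) x *[V] b (\<beta> q)) {..<m}"
 proof (rule V.finsum_reindex)
 show "(%q. \<zeta> q x *[V] b q):\<beta> ` {..<m} \<rightarrow> carrier V" unfolding im
 by (intro Pi_I V.smult_closed dual_basisD(5)[OF DB _ x] dual_basisD(2)[OF DB])
 show "inj_on \<beta> {..<m}" by (rule permutes_inj_on[OF p])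
 qed
 finally show ?thesis .
 qed
 hence "dual_basis V {..<m} (%q. b (\<beta> q)) (%q. \<zeta> (\<beta> q))"
 unfolding dual_basis_def using dual_basisD(2,3)[OF DB m] by blast
 moreover have "\<zeta> (\<beta> p) (b (\<beta> q)) = (if p = q then \<one> else \<zero>)" if pq: "p:{..<m}" "q:{..<m}" for p q
 using D m[OF pq(1)] m[OF pq(2)] inj_eq[OF permutes_inj[OF p], of p q] by (simp add: free_dual_def)
 ultimately show ?thesis unfolding free_dual_def by blast
qed

text \<open>
 An element \<open>y\<close> of \<open>\<Gamma>\<^sup>\<lambda>(F)\<close> whose tensors all have content \<open>\<mu>\<close> defines a morphism
 \<open>\<Gamma>\<^sup>\<mu> \<rightarrow> \<Gamma>\<^sup>\<lambda>\<close>: it sends \<open>g(e)\<close>, for the generator \<open>e\<close> of \<open>\<Gamma>\<^sup>\<mu>(F)\<close>, to \<open>g(y)\<close>. This is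
 well defined because \<open>g(e)\<close> determines \<open>g\<close> on the tensors of content \<open>\<mu>\<close>, which are
 permutations of the one underlying \<open>e\<close>.
\<close>

lemma trace_mem:
 fixes F V :: "('a, 'u) module"
 assumes F: "F:fgp" and D: "free_dual F {..<length m} b \<zeta>" and m: "sum_list m = sum_list l"
 and y: "y:carrier (Gams l F)"
 and supp: "!!K. K:Idx (sum_list l) {..<length m} ==> ct (sum_list l) K ~= ctl m ==>
 tc (sum_list l) F \<zeta> K (div_incl R l F y) = \<zero>"
 and V: "V:fgp" and g: "g:Homs (sum_list l) F V"
 shows "on_mor (div_powers R l) F V g y:trace_sub R m (div_powers R l) V"
proof -
 let ?d = "sum_list l" and ?e = "gen m F b"
 let ?X = "div_powers R m :: ('a, 'u, ('a, ('a, 'u) tensor) tensor) sp_functor"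
 and ?Y = "div_powers R l :: ('a, 'u, ('a, ('a, 'u) tensor) tensor) sp_functor"
 have DB: "dual_basis F {..<length m} b \<zeta>" using D by (simp add: free_dual_def)
 note MF = fgp_module[OF F]
 have e: "?e:carrier (Gams m F)" and De: "div_incl R m F ?e = tb ?d F b (Ist m)"
 using div_incl_gen[OF F D] unfolding m by blast+
 have X: "is_rep R ?d ?X" using is_rep_Gams[of m] unfolding m .
 have Y: "is_rep R ?d ?Y" by (rule is_rep_Gams)
 have well: "on_mor ?Y F U g y = on_mor ?Y F U h y"
 if U: "U:fgp" and g: "g:Homs ?d F U" and h: "h:Homs ?d F U"
 and eq: "on_mor ?X F U g ?e = on_mor ?X F U h ?e" for U g h
 proof -
 note MU = fgp_module[OF U]
 have g': "g:Homs (sum_list m) F U" "h:Homs (sum_list m) F U" using g h unfolding m .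
 have "g (tb ?d F b (Ist m)) = h (tb ?d F b (Ist m))"
 using arg_cong[OF eq, of "div_incl R m U"] unfolding div_incl_nat[OF F U g'(1) e] div_incl_nat[OF F U g'(2) e] De .
 have I: "Ist m:Idx ?d {..<length m}" using Ist[of m] unfolding m .
 have tK: "g (tb ?d F b K) = h (tb ?d F b K)" if K: "K:Idx ?d {..<length m}" and c: "ct ?d K = ctl m" for K
 proof -
 have "ct ?d K = ct ?d (Ist m)" using c ct_Ist[of m] unfolding m by simp
 then obtain \<sigma> where s: "\<sigma> permutes {..<?d}" "K = (tup ?d (%r. Ist m (\<sigma> r)))" by (rule ct_eq_perm[OF _ K])
 have t: "tb ?d F b K = tperm R ?d F \<sigma> (tb ?d F b (Ist m))"
 unfolding s(2) by (rule tperm_tb[OF MF dual_basis_mem[OF DB] I s(1), symmetric])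
 show ?thesis unfolding t sp_hom_perm[OF g s(1) tb_closed(2)[OF MF dual_basis_mem[OF DB] I]]
 sp_hom_perm[OF h s(1) tb_closed(2)[OF MF dual_basis_mem[OF DB] I]]
 by (rule arg_cong) fact
 qed
 interpret TF: module R "tpow R ?d F" by (rule module_tpow[OF MF])
 interpret TU: module R "tpow R ?d U" by (rule module_tpow[OF MU])
 note DT = dual_basis_tpow[OF MF DB, of ?d]
 have Dy: "div_incl R l F y:Tens ?d F" by (rule lin_closed[OF div_incl(1)[OF F] y])
 let ?f = "%K. tc ?d F \<zeta> K (div_incl R l F y) *[tpow R ?d F] tb ?d F b K"
 let ?P = "Idx ?d {..<length m}"
 have fc: "?f:?P \<rightarrow> Tens ?d F"
 by (rule Pi_I) (rule TF.smult_closed[OF dual_basisD(5)[OF DT _ Dy] dual_basisD(2)[OF DT]])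
 have fK: "g (?f K) = h (?f K)" if K: "K:?P" for K
 proof (cases "ct ?d K = ctl m")
 case True
 show ?thesis unfolding lin_smult[OF sp_hom_lin[OF g] dual_basisD(5)[OF DT K Dy] dual_basisD(2)[OF DT K]]
 lin_smult[OF sp_hom_lin[OF h] dual_basisD(5)[OF DT K Dy] dual_basisD(2)[OF DT K]] tK[OF K True] ..
 next
 case False
 have "?f K = \<zero>[tpow R ?d F]" unfolding supp[OF K False] by (rule TF.smult_l_null[OF dual_basisD(2)[OF DT K]])
 thus ?thesis using lin_zero[OF TF.module_axioms TU.module_axioms sp_hom_lin[OF g]]
 lin_zero[OF TF.module_axioms TU.module_axioms sp_hom_lin[OF h]] by simp
 qed
 have "g (div_incl R l F y) = g (finsum (tpow R ?d F) ?f ?P)" by (simp only: dual_basisD(4)[OF DT Dy])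
 also have "... = finsum (tpow R ?d U) (%K. g (?f K)) ?P" by (rule lin_finsum[OF TF.module_axioms TU.module_axioms sp_hom_lin[OF g] fc])
 also have "... = finsum (tpow R ?d U) (%K. h (?f K)) ?P"
 proof (rule TU.finsum_cong'[OF refl])
 show "(%K. h (?f K)):?P \<rightarrow> Tens ?d U" by (rule Pi_I) (rule lin_closed[OF sp_hom_lin[OF h] funcset_mem[OF fc]])
 qed (rule fK)
 also have "... = h (finsum (tpow R ?d F) ?f ?P)" by (rule lin_finsum[OF TF.module_axioms TU.module_axioms sp_hom_lin[OF h] fc, symmetric])
 also have "... = h (div_incl R l F y)" by (simp only: dual_basisD(4)[OF DT Dy])
 finally have "div_incl R l U (on_mor ?Y F U g y) = div_incl R l U (on_mor ?Y F U h y)"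
 unfolding div_incl_nat[OF F U g y] div_incl_nat[OF F U h y] .
 thus ?thesis by (rule inj_onD[OF div_incl_inj[OF U] _ rep_mor_closed[OF Y F U g y] rep_mor_closed[OF Y F U h y]])
 qed
 define p where "p U z = (SOME g. g:Homs ?d F U & on_mor ?X F U g ?e = z)" for U z
 define \<eta> where "\<eta> = (\<lambda>U\<in>fgp. \<lambda>z\<in>carrier (Gams m U). on_mor ?Y F U (p U z) y)"
 have ex: "EX g. g:Homs ?d F U & on_mor ?X F U g ?e = z" if U: "U:fgp" and z: "z:carrier (Gams m U)" for U z
 using gen_generates[OF F D U z] unfolding m by blast
 have eta: "\<eta> U (on_mor ?X F U g ?e) = on_mor ?Y F U g y" if U: "U:fgp" and g: "g:Homs ?d F U" for U g
 proof -
 have z: "on_mor ?X F U g ?e:carrier (Gams m U)" by (rule rep_mor_closed[OF X F U g e])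
 have pz: "p U (on_mor ?X F U g ?e):Homs ?d F U &
 on_mor ?X F U (p U (on_mor ?X F U g ?e)) ?e = on_mor ?X F U g ?e"
 unfolding p_def by (rule someI_ex[OF ex[OF U z]])
 have "\<eta> U (on_mor ?X F U g ?e) = on_mor ?Y F U (p U (on_mor ?X F U g ?e)) y" using U z by (simp add: \<eta>_def)
 also have "... = on_mor ?Y F U g y" by (rule well[OF U conjunct1[OF pz] g conjunct2[OF pz]])
 finally show ?thesis .
 qed
 have "\<eta>:nat_trans R ?d ?X ?Y"
 unfolding nat_trans_def
 proof (intro CollectI conjI ballI)
 show "\<eta>:(\<Pi>\<^sub>E U\<in>fgp. mod_hom R (Gams m U) (Gams l U))"
 proof (rule PiE_I)
 fix U :: "('a, 'u) module" assume U: "U:fgp"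
 note MU = fgp_module[OF U]
 interpret H: module R "sp_hom R ?d F U" by (rule module_sp_hom[OF MF MU])
 have ext: "\<eta> U:extensional (carrier (Gams m U))" using U by (simp add: \<eta>_def)
 have "lin R (Gams m U) (Gams l U) (\<eta> U)"
 proof (rule linI)
 fix z assume z: "z:carrier (Gams m U)"
 obtain g where g: "g:Homs ?d F U" "on_mor ?X F U g ?e = z" using ex[OF U z] by blast
 show "\<eta> U z:carrier (Gams l U)" unfolding g(2)[symmetric] eta[OF U g(1)] by (rule rep_mor_closed[OF Y F U g(1) y])
 fix c assume c: "c:carrier R"
 show "\<eta> U (c *[Gams m U] z) = c *[Gams l U] \<eta> U z"
 unfolding g(2)[symmetric] lin_smult[OF rep_lin[OF X F U e] c g(1), symmetric]
 eta[OF U g(1)] eta[OF U H.smult_closed[OF c g(1)]] lin_smult[OF rep_lin[OF Y F U y] c g(1)] ..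
 next
 fix z z' assume z: "z:carrier (Gams m U)" "z':carrier (Gams m U)"
 obtain g where g: "g:Homs ?d F U" "on_mor ?X F U g ?e = z" using ex[OF U z(1)] by blast
 obtain h where h: "h:Homs ?d F U" "on_mor ?X F U h ?e = z'" using ex[OF U z(2)] by blast
 show "\<eta> U (z +[Gams m U] z') = \<eta> U z +[Gams l U] \<eta> U z'"
 unfolding g(2)[symmetric] h(2)[symmetric] lin_add[OF rep_lin[OF X F U e] g(1) h(1), symmetric]
 eta[OF U g(1)] eta[OF U h(1)] eta[OF U H.a_closed[OF g(1) h(1)]] lin_add[OF rep_lin[OF Y F U y] g(1) h(1)] ..
 qed
 thus "\<eta> U:mod_hom R (Gams m U) (Gams l U)" unfolding mod_hom_iff using ext by (rule conjI)
 qed (simp add: \<eta>_def)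
 fix U W :: "('a, 'u) module" and \<phi> z
 assume U: "U:fgp" and W: "W:fgp" and f: "\<phi>:Homs ?d U W" and z: "z:carrier (Gams m U)"
 obtain g where g: "g:Homs ?d F U" "on_mor ?X F U g ?e = z" using ex[OF U z] by blast
 show "\<eta> W (on_mor ?X U W \<phi> z) = on_mor ?Y U W \<phi> (\<eta> U z)"
 unfolding g(2)[symmetric] rep_comp_mor[OF X F U W g(1) f e, symmetric] eta[OF U g(1)]
 eta[OF W sp_hom_comp[OF g(1) f MF]] rep_comp_mor[OF Y F U W g(1) f y] ..
 qed
 hence n: "\<eta>:nat_trans R (sum_list m) ?X ?Y" unfolding m .
 have "on_mor ?Y F V g y:\<eta> V ` carrier (Gams m V)"
 unfolding eta[OF V g, symmetric] by (rule imageI[OF rep_mor_closed[OF X F V g e]])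
 thus ?thesis unfolding trace_sub_def by (intro mod_span_superset UN_I[OF n])
qed

text \<open>
 The relations used for straightening. A filling \<open>J\<close> of \<open>\<lambda>\<close> is labelled by letters \<open>I\<close> of content
 \<open>\<mu>\<close>; the relation is the sum over all pairs \<open>L\<close> of a labelling and a filling that arise from
 \<open>(I, J)\<close> by a permutation and whose labelling has the same rows as \<open>I\<close>.
\<close>

lemma exchange_relation:
 fixes F V :: "('a, 'u) module"
 assumes F: "F:fgp" and D: "free_dual F {..<length m} b \<zeta>" and m: "sum_list m = sum_list l"
 and p: "\<beta> permutes {..<length m}"
 and I: "I:Idx (sum_list l) {..<length m}" and cI: "ct (sum_list l) I = image_mset \<beta> (ctl m)"
 and V: "V:fgp" and x: "x:C \<rightarrow> carrier V" and C: "finite C"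
 obtains z where "z:trace_sub R m (div_powers R l) V" "z:carrier (Gams l V)"
 "div_incl R l V z = finsum (tpow R (sum_list l) V) (tb (sum_list l) V (%p. x (snd p)))
 {L\<in>Idx (sum_list l) ({..<length m}\<times>C). ct (sum_list l) L = M &
 (ALL i<length l. ct (l ! i) (blk l (tup (sum_list l) (%r. fst (L r))) i) = ct (l ! i) (blk l I i))}"
proof -
 let ?d = "sum_list l" and ?Y = "div_powers R l :: ('a, 'u, ('a, ('a, 'u) tensor) tensor) sp_functor"
 let ?B = "{..<length m}" and ?b = "%q. b (\<beta> q)" and ?z = "%q. \<zeta> (\<beta> q)"
 note MF = fgp_module[OF F] and MV = fgp_module[OF V]
 have DB: "dual_basis F ?B b \<zeta>" using D by (simp add: free_dual_def)
 let ?y = "gam l F ?B b (rows l I)"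
 have y: "?y:carrier (Gams l F)" by (rule gam_closed[OF F dual_basis_mem[OF DB]])
 let ?O = "{L\<in>Idx ?d (?B\<times>C). ct ?d L = M}"
 let ?g = "esum ?d F V \<zeta> x ?O"
 have g: "?g:Homs ?d F V" by (rule esum_orbit_sp_hom[OF MF DB MV x])
 let ?z' = "on_mor ?Y F V ?g ?y"
 have supp: "tc ?d F ?z K (div_incl R l F ?y) = \<zero>" if K: "K:Idx ?d ?B" and c: "ct ?d K ~= ctl m" for K
 proof -
 have bK: "(tup ?d (%r. \<beta> (K r))):Idx ?d ?B"
 by (rule idxI) (use idxD[OF K] permutes_in_image[OF p] in blast)
 have DB': "dual_basis F ?B ?b ?z" using free_dual_permute[OF MF D p] by (simp add: free_dual_def)
 have e: "tc ?d F ?z K t = tc ?d F \<zeta> (tup ?d (%r. \<beta> (K r))) t" if t: "t:Tens ?d F" for t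
 proof (rule tpow_lin_eqI[OF MF module_ring dual_basisD(3)[OF dual_basis_tpow[OF MF DB'] K]
 dual_basisD(3)[OF dual_basis_tpow[OF MF DB] bK] _ t])
 fix v assume v: "v:tensor_base ?d (%_. F)"
 show "tc ?d F ?z K (tpure R ?d F v) = tc ?d F \<zeta> (tup ?d (%r. \<beta> (K r))) (tpure R ?d F v)"
 unfolding tc_pure[OF MF DB' K v] tc_pure[OF MF DB bK v]
 by (rule finprod_cong'[OF refl]) (use dual_basisD(5)[OF DB' idxD[OF K] tensor_baseD[OF v]] in simp_all)
 qed
 have Dy: "div_incl R l F ?y:Tens ?d F" by (rule lin_closed[OF div_incl(1)[OF F] y])
 have "~ (ALL i<length l. ct (l ! i) (blk l (tup ?d (%r. \<beta> (K r))) i) = rows l I i)"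
 proof
 assume "ALL i<length l. ct (l ! i) (blk l (tup ?d (%r. \<beta> (K r))) i) = rows l I i"
 hence "ct ?d (tup ?d (%r. \<beta> (K r))) = ct ?d I" unfolding ct_blocks by (intro sum.cong) simp_all
 moreover have "ct ?d (tup ?d (%r. \<beta> (K r))) = image_mset \<beta> (ct ?d K)"
 unfolding ct_comp[symmetric] by (rule ct_cong) simp
 ultimately have "image_mset \<beta> (ct ?d K) = image_mset \<beta> (ctl m)" using cI by simp
 hence "ct ?d K = ctl m" by (rule injD[OF multiset.inj_map[OF permutes_inj[OF p]]])
 thus False using c by simp
 qed
 thus ?thesis unfolding e[OF Dy] tc_gam[OF F D bK] by (rule if_not_P)
 qed
 have "?z':trace_sub R m ?Y V"
 by (rule trace_mem[OF F free_dual_permute[OF MF D p] m y _ V g]) (rule supp)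
 moreover have "?z':carrier (Gams l V)" by (rule rep_mor_closed[OF is_rep_Gams F V g y])
 moreover have "div_incl R l V ?z' = finsum (tpow R ?d V) (tb ?d V (%p. x (snd p)))
 {L\<in>Idx ?d (?B\<times>C). ct ?d L = M &
 (ALL i<length l. ct (l ! i) (blk l (tup ?d (%r. fst (L r))) i) = ct (l ! i) (blk l I i))}"
 proof -
 interpret TV: module R "tpow R ?d V" by (rule module_tpow[OF MV])
 have x': "(%p. x (snd p)):?B\<times>C \<rightarrow> carrier V" using x by auto
 have "finite (Idx ?d (?B\<times>C))" by (rule finite_PiE) (simp_all add: C)
 hence fin: "finite ?O" by simp
 have Dy: "div_incl R l F ?y:Tens ?d F" by (rule lin_closed[OF div_incl(1)[OF F] y])
 have tcL: "tc ?d F \<zeta> (tup ?d (%r. fst (L r))) (div_incl R l F ?y) =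
 (if ALL i<length l. ct (l ! i) (blk l (tup ?d (%r. fst (L r))) i) = rows l I i then \<one> else \<zero>)" if "L:?O" for L
 by (rule tc_gam[OF F D idx_fst]) (use that in blast)
 have tbL: "tb ?d V (%p. x (snd p)) L:Tens ?d V" if "L:?O" for L
 by (rule tb_closed(2)[OF MV x']) (use that in blast)
 have "div_incl R l V ?z' = ?g (div_incl R l F ?y)" by (rule div_incl_nat[OF F V g y])
 also have "... = finsum (tpow R ?d V) (%L. tc ?d F \<zeta> (tup ?d (%r. fst (L r))) (div_incl R l F ?y) *[tpow R ?d V]
 tb ?d V (%p. x (snd p)) L) ?O" unfolding esum_def using Dy by (rule restrict_apply')
 also have "... = finsum (tpow R ?d V) (tb ?d V (%p. x (snd p)))
 {L\<in>Idx ?d (?B\<times>C). ct ?d L = M &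
 (ALL i<length l. ct (l ! i) (blk l (tup ?d (%r. fst (L r))) i) = ct (l ! i) (blk l I i))}" (is "_ = finsum _ _ ?S")
 proof (rule TV.add.finprod_mono_neutral_cong_right[OF fin])
 show "?S<=?O" by blast
 show "(%L. tc ?d F \<zeta> (tup ?d (%r. fst (L r))) (div_incl R l F ?y) *[tpow R ?d V]
 tb ?d V (%p. x (snd p)) L):?O \<rightarrow> Tens ?d V"
 by (rule Pi_I) (rule TV.smult_closed[OF _ tbL], simp add: tcL, assumption)
 fix L
 show "tc ?d F \<zeta> (tup ?d (%r. fst (L r))) (div_incl R l F ?y) *[tpow R ?d V] tb ?d V (%p. x (snd p)) L = \<zero>[tpow R ?d V]"
 if L: "L:?O - ?S"
 proof -
 have LO: "L:?O" using L by blast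
 have n: "~ (ALL i<length l. ct (l ! i) (blk l (tup ?d (%r. fst (L r))) i) = rows l I i)" using L by simp
 show ?thesis unfolding tcL[OF LO] if_not_P[OF n] by (rule TV.smult_l_null[OF tbL[OF LO]])
 qed
 show "tc ?d F \<zeta> (tup ?d (%r. fst (L r))) (div_incl R l F ?y) *[tpow R ?d V] tb ?d V (%p. x (snd p)) L = tb ?d V (%p. x (snd p)) L"
 if L: "L:?S"
 proof -
 have LO: "L:?O" using L by blast
 have n: "ALL i<length l. ct (l ! i) (blk l (tup ?d (%r. fst (L r))) i) = rows l I i" using L by simp
 show ?thesis unfolding tcL[OF LO] if_P[OF n] by (rule TV.smult_one[OF tbL[OF LO]])
 qed
 qed
 finally show ?thesis .
 qed
 ultimately show thesis by (rule that)
qed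

end

section \<open>Straightening\<close>

text \<open>
 The labelling of a filling that violates semistandardness at row \<open>i\<close> and entry \<open>c\<close>: entries
 of row \<open>i\<close> from \<open>c\<close> on and entries of the next row up to \<open>c\<close> receive the new letter \<open>n\<close>, and are
 thereby free to change places; all other entries are labelled by their row.
\<close>

definition lt :: "nat => nat => nat => nat => nat => nat" where
 "lt n i c k v = (if k = i then if v < c then i else n else if k = Suc i then if v <= c then n else Suc i else k)"

definition wt :: "nat => (nat => nat multiset) => nat" where
 "wt n T = (\<Sum>k<n. k * sum_mset (T k))"

lemma filter_mset_sum: "filter_mset P (\<Sum>k<n::nat. A k) = (\<Sum>k<n. filter_mset P (A k))"
 by (induction n) simp_all

text \<open>The entries that change places get larger from above to below, so the weight increases unless
 nothing has changed.\<close>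

lemma exchange_msets:
 fixes A :: "nat => (nat\<times>nat) multiset" and R :: "nat => nat multiset"
 assumes i: "Suc i < n"
 and letters: "!!k. k < n ==> image_mset fst (A k) = image_mset (lt n i c k) (R k)"
 and tot: "(\<Sum>k<n. A k) = (\<Sum>k<n. image_mset (%v. (lt n i c k v, v)) (R k))"
 shows "wt n R <= wt n (%k. image_mset snd (A k))"
 and "wt n R = wt n (%k. image_mset snd (A k)) ==> k < n ==> A k = image_mset (%v. (lt n i c k v, v)) (R k)"
proof -
 let ?lt = "lt n i c" and ?B = "%k. image_mset (%v. (lt n i c k v, v)) (R k)"
 let ?F = "%q. filter_mset (%p::nat\<times>nat. fst p = q)"
 have fB: "image_mset fst (?B k) = image_mset (?lt k) (R k)" for k by (simp add: multiset.map_comp comp_def)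
 have mA: "fst p:?lt k ` set_mset (R k)" if "k < n" "p \<in># A k" for k p
 proof -
 have "fst p \<in># image_mset fst (A k)" using that(2) by simp
 thus ?thesis unfolding letters[OF that(1)] by simp
 qed
 have lt: "?lt k v = k \<or> ?lt k v = n & (k = i \<or> k = Suc i)" for k v by (simp add: lt_def)
 have AF: "fst p = k \<or> fst p = n & (k = i \<or> k = Suc i)" if "k < n" "p \<in># A k" for k p
 using mA[OF that] lt by fastforce
 have BF: "fst p = k \<or> fst p = n & (k = i \<or> k = Suc i)" if "p \<in># ?B k" for k p
 using that lt by fastforce
 have split: "M = ?F k M + ?F n M" if "k < n" "!!p. p \<in># M ==> fst p = k \<or> fst p = n" for k M
 proof -
 have "?F n M = filter_mset (%p. ~ fst p = k) M" by (rule filter_mset_cong) (use that in auto)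
 thus ?thesis by (simp add: multiset_partition[symmetric])
 qed
 have one: "(\<Sum>k<n. ?F q (M k)) = ?F q (M q)"
 if q: "q < n" and M: "!!k p. k < n ==> p \<in># M k ==> fst p = k \<or> fst p = n" for M q
 proof -
 have "?F q (M k) = {#}" if k: "k < n" "k ~= q" for k
 unfolding filter_mset_eq_mempty_iff using M[OF k(1)] k(2) q by (metis less_irrefl)
 hence "(\<Sum>k<n. ?F q (M k)) = (\<Sum>k\<in>{q}. ?F q (M k))"
 using q by (intro sum.mono_neutral_right) auto
 thus ?thesis by simp
 qed
 have own: "?F q (A q) = ?F q (?B q)" if q: "q < n" for q
 proof -
 have "?F q (A q) = (\<Sum>k<n. ?F q (A k))" by (rule one[OF q, symmetric]) (use AF in blast)
 also have "... = (\<Sum>k<n. ?F q (?B k))" unfolding filter_mset_sum[symmetric] tot ..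
 also have "... = ?F q (?B q)" by (rule one[OF q]) (use BF in blast)
 finally show ?thesis .
 qed
 have two: "(\<Sum>k<n. ?F n (M k)) = ?F n (M i) + ?F n (M (Suc i))"
 if M: "!!k p. k < n ==> p \<in># M k ==> fst p = k \<or> fst p = n & (k = i \<or> k = Suc i)" for M
 proof -
 have "?F n (M k) = {#}" if k: "k < n" "k ~= i" "k ~= Suc i" for k
 unfolding filter_mset_eq_mempty_iff using M[OF k(1)] k by (metis less_irrefl)
 hence "(\<Sum>k<n. ?F n (M k)) = (\<Sum>k\<in>{i, Suc i}. ?F n (M k))"
 using i by (intro sum.mono_neutral_right) auto
 thus ?thesis by simp
 qed
 have Z: "?F n (A i) + ?F n (A (Suc i)) = ?F n (?B i) + ?F n (?B (Suc i))"
 using two[of A] two[of ?B] AF BF unfolding filter_mset_sum[symmetric] tot by simp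
 have rowA: "A k = ?F k (?B k) + ?F n (A k)" if "k < n" for k
 using split[OF that, of "A k"] AF[OF that] own[OF that] by metis
 have rowB: "?B k = ?F k (?B k) + ?F n (?B k)" if "k < n" for k
 by (rule split[OF that]) (use BF in blast)
 have same: "A k = ?B k" if "k < n" "k ~= i" "k ~= Suc i" for k
 proof -
 have "?F n (A k) = {#}" unfolding filter_mset_eq_mempty_iff using AF[OF that(1)] that by (metis less_irrefl)
 moreover have "?F n (?B k) = {#}" unfolding filter_mset_eq_mempty_iff using BF[of _ k] that by (metis less_irrefl)

 show ?thesis using rowA[OF that(1)] rowB[OF that(1)] by (metis \<open>?F n (A k) = {#}\<close> \<open>?F n (?B k) = {#}\<close>)
 qed
 let ?s = "%M. image_mset snd (M :: (nat\<times>nat) multiset)"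
 have sz: "size (?s (?F n (A i))) = size (?s (?F n (?B i)))"
 proof -
 have "size (A i) = size (?B i)" using letters[of i] i by (metis Suc_lessD size_image_mset)
 thus ?thesis using arg_cong[OF rowA[of i], of size] arg_cong[OF rowB[of i], of size] i by simp
 qed
 have U: "?s (?F n (A i)) + ?s (?F n (A (Suc i))) = ?s (?F n (?B i)) + ?s (?F n (?B (Suc i)))"
 using arg_cong[OF Z, of ?s] by simp
 have a: "c <= v" if "v \<in># ?s (?F n (?B i))" for v using that i by (auto simp: lt_def split: if_splits)
 have b: "v <= c" if "v \<in># ?s (?F n (?B (Suc i)))" for v using that i by (auto simp: lt_def split: if_splits)
 have ex: "sum_mset (?s (?F n (A i))) <= sum_mset (?s (?F n (?B i)))"
 by (rule exchange_sum(1)[OF U sz]) (rule a, assumption, rule b, assumption)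
 have sU: "sum_mset (?s (?F n (A i))) + sum_mset (?s (?F n (A (Suc i)))) =
 sum_mset (?s (?F n (?B i))) + sum_mset (?s (?F n (?B (Suc i))))"
 using arg_cong[OF U, of sum_mset] by simp
 have sB: "?s (?B k) = R k" for k by (simp add: multiset.map_comp comp_def)
 have wtM: "wt n M = (\<Sum>k\<in>{..<n} - {i, Suc i}. k * sum_mset (M k)) + (i * sum_mset (M i) + Suc i * sum_mset (M (Suc i)))" for M
 unfolding wt_def using i by (subst sum.subset_diff[of "{i, Suc i}"]) auto
 have rest: "(\<Sum>k\<in>{..<n} - {i, Suc i}. k * sum_mset (?s (A k))) = (\<Sum>k\<in>{..<n} - {i, Suc i}. k * sum_mset (R k))"
 proof (rule sum.cong[OF refl])
 fix k assume "k:{..<n} - {i, Suc i}"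
 hence "A k = ?B k" by (intro same) auto
 thus "k * sum_mset (?s (A k)) = k * sum_mset (R k)" by (simp only: sB)
 qed
 have sA: "sum_mset (?s (A k)) = sum_mset (?s (?F k (?B k))) + sum_mset (?s (?F n (A k)))"
 and sR: "sum_mset (R k) = sum_mset (?s (?F k (?B k))) + sum_mset (?s (?F n (?B k)))" if "k < n" for k
 using arg_cong[OF rowA[OF that], of "%M. sum_mset (?s M)"] arg_cong[OF rowB[OF that], of "%M. sum_mset (?s M)"]
 unfolding sB by simp_all
 have ii: "i < n" using i by simp
 have wts: "wt n (%k. ?s (A k)) + sum_mset (?s (?F n (A i))) = wt n R + sum_mset (?s (?F n (?B i)))"
 proof -
 define a1 b1 u u' v v' where "a1 = sum_mset (?s (?F i (?B i)))" and "b1 = sum_mset (?s (?F (Suc i) (?B (Suc i))))"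
 and "u = sum_mset (?s (?F n (A i)))" and "u' = sum_mset (?s (?F n (A (Suc i))))"
 and "v = sum_mset (?s (?F n (?B i)))" and "v' = sum_mset (?s (?F n (?B (Suc i))))"
 note defs = a1_def[symmetric] b1_def[symmetric] u_def[symmetric] u'_def[symmetric] v_def[symmetric] v'_def[symmetric]
 have uv: "u + u' = v + v'" using sU unfolding defs .
 have "i * (u + u') = i * (v + v')" by (simp only: uv)
 hence "i * (a1 + u) + Suc i * (b1 + u') + u = i * (a1 + v) + Suc i * (b1 + v') + v" using uv by (simp add: algebra_simps)
 thus ?thesis unfolding wtM rest sA[OF ii] sA[OF i] sR[OF ii] sR[OF i] defs by simp
 qed
 show "wt n R <= wt n (%k. ?s (A k))" using wts ex by linarith
 assume e: "wt n R = wt n (%k. ?s (A k))" and k: "k < n"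
 have UA: "?s (?F n (A i)) = ?s (?F n (?B i))"     by (rule exchange_sum(2)[OF U sz]) (rule a, assumption, rule b, assumption, rule add_left_imp_eq[OF wts[folded e]])
 hence UB: "?s (?F n (A (Suc i))) = ?s (?F n (?B (Suc i)))" using U by simp
 have pair: "?F n M = image_mset (Pair n) (?s (?F n M))" for M
 proof -
 have "image_mset (Pair n) (?s (?F n M)) = image_mset (%p. p) (?F n M)"
 unfolding multiset.map_comp by (rule image_mset_cong) auto
 thus ?thesis by simp
 qed
 have "A i = ?B i" using rowA[OF ii] rowB[OF ii] pair[of "A i"] pair[of "?B i"] UA by metis
 moreover have "A (Suc i) = ?B (Suc i)" using rowA[OF i] rowB[OF i] pair[of "A (Suc i)"] pair[of "?B (Suc i)"] UB by metis
 ultimately show "A k = ?B k" using same[OF k] by blast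
qed

lemma multiset_eq_ctl:
 assumes "set_mset M<={..<m::nat}"
 shows "M = (\<Sum>k<m. replicate_mset (count M k) k)"
proof (rule multiset_eqI)
 fix x
 have "count (\<Sum>k<m. replicate_mset (count M k) k) x = (\<Sum>k<m. if k = x then count M k else 0)"
 unfolding count_sum by (rule sum.cong) auto
 thus "count M x = count (\<Sum>k<m. replicate_mset (count M k) k) x"
 using assms by (auto simp: sum.delta not_in_iff)
qed

lemma count_image_size: "count (image_mset f M) y = size (filter_mset (%v. f v = y) M)"
 by (induction M) auto

context cring
begin

text \<open>
 A violation of semistandardness at \<open>(i, c)\<close> gives a labelling in which the new letter and the
 letters of the rows above \<open>i\<close> occur more than \<open>\<lambda>\<^sub>0 + \<dots> + \<lambda>\<^sub>i\<close> times, so that its content, sorted,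
 is not dominated by \<open>\<lambda>\<close>.
\<close>

lemma violation_content:
 fixes T :: "nat => nat multiset"
 assumes i: "Suc i < length l" and T: "!!k. k < length l ==> size (T k) = l ! k"
 and v: "size (filter_mset (%x. x < c) (T i)) < size (filter_mset (%x. x <= c) (T (Suc i)))"
 and cI: "!!k. k < length l ==> ct (l ! k) (blk l I k) = image_mset (lt (length l) i c k) (T k)"
 and I: "I:Idx (sum_list l) {..<Suc (length l)}"
 obtains \<beta> m where "\<beta> permutes {..<length m}" "length m = Suc (length l)"
 "ct (sum_list l) I = image_mset \<beta> (ctl m)" "is_partition (sum_list l) m" "~ dominated m l"
proof -
 let ?n = "length l" and ?d = "sum_list l"
 define \<nu> where "\<nu> = count (ct ?d I)"
 obtain \<beta> where b: "\<beta> permutes {..<Suc ?n}" "sorted_wrt (>=) (map (%q. \<nu> (\<beta> q)) [0..<Suc ?n])"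
 by (rule sort_desc)
 define m where "m = map (%q. \<nu> (\<beta> q)) [0..<Suc ?n]"
 have len: "length m = Suc ?n" by (simp add: m_def)
 have mq: "m ! q = \<nu> (\<beta> q)" if "q < Suc ?n" for q unfolding m_def using that by (simp del: upt_Suc)
 have "set_mset (ct ?d I)<={..<Suc ?n}" using idxD[OF I] by (auto simp: ct_def)
 note M = multiset_eq_ctl[OF this]
 have ims: "image_mset \<beta> (\<Sum>k<N. A k) = (\<Sum>k<N. image_mset \<beta> (A k))" for N :: nat and A by (induction N) simp_all
 have "image_mset \<beta> (ctl m) = (\<Sum>q<Suc ?n. image_mset \<beta> (replicate_mset (\<nu> (\<beta> q)) q))"
 unfolding ims len by (rule sum.cong) (simp_all add: mq)
 also have "... = (\<Sum>q<Suc ?n. replicate_mset (\<nu> (\<beta> q)) (\<beta> q))" by (simp only: image_replicate_mset)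
 also have "... = (\<Sum>k<Suc ?n. replicate_mset (\<nu> k) k)"
 by (rule sum.reindex_bij_betw[OF permutes_imp_bij[OF b(1)]])
 finally have ct: "ct ?d I = image_mset \<beta> (ctl m)" using M unfolding \<nu>_def by simp
 have sz: "size (\<Sum>k<N. replicate_mset (f k) k) = (\<Sum>k<N. f k)" for N and f :: "nat => nat" by (induction N) auto
 have "sum_list m = size (ctl m)" unfolding sz by (simp add: sum_list_sum_nth atLeast0LessThan)
 also have "... = ?d" using arg_cong[OF ct, of size] by simp
 finally have part: "is_partition ?d m" using b(2) unfolding is_partition_def m_def by blast
 let ?P = "{..<i}\<union>{?n}" and ?Q = "{q\<in>{..<Suc ?n}. \<beta> q < i \<or> \<beta> q = ?n}"
 have im: "\<beta> ` ?Q = ?P"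
 proof (intro equalityI subsetI)
 fix k assume k: "k:?P"
 hence "k:\<beta> ` {..<Suc ?n}" unfolding permutes_image[OF b(1)] using i by auto
 thus "k:\<beta> ` ?Q" using k by auto
 qed auto
 have inj: "inj_on \<beta> ?Q" using permutes_inj[OF b(1)] by (rule inj_on_subset) simp
 have cardQ: "card ?Q = Suc i"
 proof -
 have "card ?Q = card ?P" unfolding im[symmetric] by (rule card_image[OF inj, symmetric])
 thus ?thesis using i by simp
 qed
 have "(\<Sum>q\<in>?Q. m ! q) = (\<Sum>q\<in>?Q. \<nu> (\<beta> q))" by (rule sum.cong) (simp_all add: mq)
 also have "... = (\<Sum>k\<in>?P. \<nu> k)" unfolding im[symmetric] by (rule sum.reindex[OF inj, symmetric, unfolded comp_def])
 also have "... = (\<Sum>k<i. \<nu> k) + \<nu> ?n" using i by simp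
 finally have sQ: "(\<Sum>q\<in>?Q. m ! q) = (\<Sum>k<i. \<nu> k) + \<nu> ?n" .
 have nu: "\<nu> q = (\<Sum>k<?n. size (filter_mset (%v. lt ?n i c k v = q) (T k)))" for q
 unfolding \<nu>_def ct_blocks count_sum by (rule sum.cong) (simp_all add: cI count_image_size)
 have nuk: "l ! q <= \<nu> q" if q: "q < i" for q
 proof -
 have "filter_mset (%v. lt ?n i c q v = q) (T q) = T q" using q by (simp add: lt_def)
 hence "l ! q = size (filter_mset (%v. lt ?n i c q v = q) (T q))" using T[of q] q i by simp
 also have "... <= \<nu> q" unfolding nu by (rule member_le_sum) (use q i in auto)
 finally show ?thesis .
 qed
 have "l ! i < \<nu> ?n"
 proof -
 have li: "l ! i = size (filter_mset (%x. x < c) (T i)) + size (filter_mset (%x. ~ x < c) (T i))"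
 unfolding size_union[symmetric] multiset_partition[symmetric] using T[of i] i by simp
 have fi: "filter_mset (%v. lt ?n i c i v = ?n) (T i) = filter_mset (%x. ~ x < c) (T i)"
 "filter_mset (%v. lt ?n i c (Suc i) v = ?n) (T (Suc i)) = filter_mset (%x. x <= c) (T (Suc i))"
 using i by (auto simp: lt_def intro!: filter_mset_cong)
 have "(\<Sum>k\<in>{i, Suc i}. size (filter_mset (%v. lt ?n i c k v = ?n) (T k))) <= \<nu> ?n"
 unfolding nu by (rule sum_mono2) (use i in auto)
 thus ?thesis using li v fi by simp
 qed
 moreover have "(\<Sum>k<i. l ! k) <= (\<Sum>k<i. \<nu> k)" by (rule sum_mono) (simp add: nuk)
 moreover have "(\<Sum>k<Suc i. l ! k) = sum_list (take (Suc i) l)"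
 using i by (simp add: sum_list_sum_nth atLeast0LessThan min_def del: sum.lessThan_Suc)
 moreover have "(\<Sum>q\<in>?Q. m ! q) <= sum_list (take (Suc i) m)"
 unfolding cardQ[symmetric] by (rule sum_le_take) (use part in "auto simp: is_partition_def len")
 ultimately have "sum_list (take (Suc i) l) < sum_list (take (Suc i) m)" unfolding sQ by simp
 hence "~ dominated m l" unfolding dominated_def by (metis One_nat_def Suc_le_mono le0 not_less)
 thus thesis using that[OF _ len ct part] b(1) unfolding len by blast
qed

lemma Tabs_filling:
 assumes T: "T:Tabs l B"
 shows "glue l (%k. rp (l ! k) B (T k)):Idx (sum_list l) B"
 and "k < length l ==> ct (l ! k) (blk l (glue l (%k. rp (l ! k) B (T k))) k) = T k"
proof -
 have r: "rp (l ! k) B (T k):Idx (l ! k) B" "ct (l ! k) (rp (l ! k) B (T k)) = T k" if "k < length l" for k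
 using rp[OF idxD[OF T that]] by blast+
 show "glue l (%k. rp (l ! k) B (T k)):Idx (sum_list l) B" by (rule glue_PiE) (rule r(1))
 show "ct (l ! k) (blk l (glue l (%k. rp (l ! k) B (T k))) k) = T k" if k: "k < length l"
 using blk_glue[where K = "%k. rp (l ! k) B (T k)", OF k r(1)[OF k]] r(2)[OF k] by simp
qed

lemma straightening_step:
 fixes F V :: "('a, 'u) module" and T :: "nat => nat multiset"
 assumes F: "F:fgp" and D: "free_dual F {..<Suc (length l)} b \<zeta>"
 and V: "V:fgp" and DV: "free_dual V B x \<xi>"
 and T: "T:Tabs l B" and ns: "~ semistandard l T"
 obtains z where "z:std_rels R l V" "z:carrier (Gams l V)" "gcoef l V B \<xi> T z = \<one>"
 "ALL T':Tabs l B - {T}. gcoef l V B \<xi> T' z ~= \<zero> --> wt (length l) T < wt (length l) T'"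
proof -
 let ?n = "length l" and ?d = "sum_list l"
 note MV = fgp_module[OF V]
 have DB: "dual_basis V B x \<xi>" using DV by (simp add: free_dual_def)
 obtain i c where i: "Suc i < ?n" and v: "size (filter_mset (%x. x < c) (T i)) < size (filter_mset (%x. x <= c) (T (Suc i)))"
 using ns unfolding semistandard_def by (auto simp: not_le)
 define fill where "fill T = glue l (%k. rp (l ! k) B (T k))" for T :: "nat => nat multiset"
 have fillP: "fill T:Idx ?d B" and fillT: "k < ?n ==> ct (l ! k) (blk l (fill T) k) = T k"
 if "T:Tabs l B" for T k
 unfolding fill_def using Tabs_filling[OF that] by blast+
 let ?lt = "lt ?n i c" and ?J = "fill T"
 define I where "I = glue l (%k. \<lambda>j\<in>{..<l ! k}. ?lt k (?J (pos l k j)))"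
 have Ipos: "I (pos l k j) = ?lt k (?J (pos l k j))" if "k < ?n" "j < l ! k" for k j
 unfolding I_def using that by (simp add: glue_pos)
 have IP: "I:Idx ?d {..<Suc ?n}"
 unfolding I_def by (rule glue_PiE, rule idxI) (use i in "auto simp: lt_def")
 define L0 where "L0 = (tup ?d (%r. (I r, ?J r)))"
 have rowI: "ct (l ! k) (blk l I k) = image_mset (?lt k) (T k)" if k: "k < ?n" for k
 proof -
 have "ct (l ! k) (blk l I k) = ct (l ! k) (%j. ?lt k (blk l ?J k j))"
 by (rule ct_cong) (simp add: blk_def Ipos[OF k])
 thus ?thesis by (simp add: ct_comp[where f = "?lt k"] fillT[OF T k])
 qed
 have rowL0: "ct (l ! k) (blk l L0 k) = image_mset (%v. (?lt k v, v)) (T k)" if k: "k < ?n" for k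
 proof -
 have "ct (l ! k) (blk l L0 k) = ct (l ! k) (%j. (?lt k (blk l ?J k j), blk l ?J k j))"
 by (rule ct_cong) (simp add: blk_def L0_def Ipos[OF k] pos_less[OF k])
 thus ?thesis by (simp add: ct_comp[where f = "%v. (?lt k v, v)"] fillT[OF T k])
 qed
 have szT: "size (T k) = l ! k" if "k < ?n" for k using fillT[OF T that] by (metis size_ct)
 obtain \<beta> m where m: "\<beta> permutes {..<length m}" "length m = Suc ?n" "ct ?d I = image_mset \<beta> (ctl m)"
 "is_partition ?d m" "~ dominated m l"
 by (rule violation_content[OF i _ v _ IP]) (rule szT, assumption, rule rowI, assumption)
 have sm: "sum_list m = ?d" using m(4) by (simp add: is_partition_def)
 have D': "free_dual F {..<length m} b \<zeta>" and IP': "I:Idx ?d {..<length m}" using D IP unfolding m(2) .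
 let ?S = "{L\<in>Idx ?d ({..<length m}\<times>B). ct ?d L = ct ?d L0 &
 (ALL i<length l. ct (l ! i) (blk l (tup ?d (%r. fst (L r))) i) = ct (l ! i) (blk l I i))}"
 obtain z where z: "z:trace_sub R m (div_powers R l) V" "z:carrier (Gams l V)"
 "div_incl R l V z = finsum (tpow R ?d V) (tb ?d V (%p. x (snd p))) ?S"
 by (rule exchange_relation[OF F D' sm m(1) IP' m(3) V dual_basis_mem[OF DB] dual_basisD(1)[OF DB]])
 let ?s = "%L. \<lambda>r\<in>{..<?d}. snd (L r :: nat\<times>nat)"
 have finS: "finite ?S"
 proof -
 have "finite (Idx ?d ({..<length m}\<times>B))" by (rule finite_PiE) (simp_all add: dual_basisD(1)[OF DB])
 thus ?thesis by simp
 qed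
 have sP: "?s L:Idx ?d B" if "L:?S" for L by (rule idx_snd) (use that in blast)
 have coef: "gcoef l V B \<xi> T' z = finsum (ring_as_mod R) (%L. if fill T' = ?s L then \<one> else \<zero>) ?S" if T': "T':Tabs l B" for T'
 proof -
 note lin = dual_basisD(3)[OF dual_basis_tpow[OF MV DB] fillP[OF T']]
 have e: "tb ?d V (%p. x (snd p)) L = tb ?d V x (?s L)" for L
 by (rule arg_cong[where f = "tpure R ?d V"], rule restrict_ext) simp
 have tcl: "tb ?d V x (?s L):Tens ?d V" if "L:?S" for L
 by (rule tb_closed(2)[OF MV dual_basis_mem[OF DB] sP[OF that]])
 have "gcoef l V B \<xi> T' z = tc ?d V \<xi> (fill T') (div_incl R l V z)" unfolding fill_def by (rule gcoef_eq[OF V DB T' z(2)])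
 also have "... = finsum (ring_as_mod R) (%L. tc ?d V \<xi> (fill T') (tb ?d V (%p. x (snd p)) L)) ?S"
 unfolding z(3) by (rule lin_finsum[OF module_tpow[OF MV] module_ring lin], rule Pi_I) (unfold e, rule tcl)
 also have "... = finsum (ring_as_mod R) (%L. if fill T' = ?s L then \<one> else \<zero>) ?S"
 unfolding e finsum_ring by (rule finsum_cong'[OF refl]) (simp, rule tc_tb[OF MV DV fillP[OF T'] sP])
 finally show ?thesis .
 qed
 \<comment> \<open>the weight comparison for one term of the relation\<close>
 have key: "wt ?n T <= wt ?n T' & (wt ?n T = wt ?n T' --> T' = T & L = L0)"
 if T': "T':Tabs l B" and L: "L:?S" and s: "fill T' = ?s L" for T' L
 proof -
 let ?A = "%k. ct (l ! k) (blk l L k)"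
 have LP: "L:Idx ?d ({..<length m}\<times>B)" and Lc: "ct ?d L = ct ?d L0"
 and Lr: "!!k. k < ?n ==> ct (l ! k) (blk l (tup ?d (%r. fst (L r))) k) = ct (l ! k) (blk l I k)" using L by blast+
 have f: "image_mset fst (?A k) = image_mset (?lt k) (T k)" if k: "k < ?n" for k
 proof -
 have "image_mset fst (?A k) = ct (l ! k) (blk l (tup ?d (%r. fst (L r))) k)"
 unfolding ct_comp[symmetric] blk_restrict_comp[OF k, where f = fst] by (rule ct_cong) simp
 thus ?thesis by (simp only: Lr[OF k] rowI[OF k])
 qed
 have tot: "(\<Sum>k<?n. ?A k) = (\<Sum>k<?n. image_mset (%v. (?lt k v, v)) (T k))"
 using Lc unfolding ct_blocks by (simp add: rowL0)
 have T'k: "image_mset snd (?A k) = T' k" if k: "k < ?n" for k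
 proof -
 have "image_mset snd (?A k) = ct (l ! k) (blk l (?s L) k)"
 unfolding ct_comp[symmetric] blk_restrict_comp[OF k, where f = snd] by (rule ct_cong) simp
 thus ?thesis unfolding s[symmetric] by (simp only: fillT[OF T' k])
 qed
 have w: "wt ?n (%k. image_mset snd (?A k)) = wt ?n T'" unfolding wt_def by (rule sum.cong) (simp_all add: T'k)
 have "wt ?n T <= wt ?n T'" unfolding w[symmetric] by (rule exchange_msets(1)[OF i _ tot]) (rule f)
 moreover have "T' = T & L = L0" if e: "wt ?n T = wt ?n T'"
 proof -
 have A: "?A k = image_mset (%v. (?lt k v, v)) (T k)" if k: "k < ?n" for k
 by (rule exchange_msets(2)[OF i _ tot _ k]) (erule f, unfold w, rule e)
 have "T' k = T k" if k: "k < ?n" for k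
 unfolding T'k[OF k, symmetric] A[OF k] by (simp add: multiset.map_comp comp_def)
 hence TT: "T' = T" by (intro PiE_ext[OF T' T]) simp
 have "L r = L0 r" if r: "r < ?d" for r
 proof -
 obtain k j where kj: "k < ?n" "j < l ! k" "r = pos l k j" using pos_cases[OF r] by blast
 have "blk l L k j \<in># ?A k" using kj(2) by (simp add: ct_def)
 hence "fst (L r) = ?lt k (snd (L r))" unfolding A[OF kj(1)] using kj by (auto simp: blk_def)
 moreover have "snd (L r) = ?J r" using fun_cong[OF s, of r] r unfolding TT by simp
 ultimately show ?thesis using r Ipos[OF kj(1,2)] kj(3) by (simp add: L0_def prod_eq_iff)
 qed
 hence "L = L0" using LP unfolding L0_def by (auto simp: PiE_iff extensional_def fun_eq_iff)
 thus ?thesis using TT by blast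
 qed
 ultimately show ?thesis by blast
 qed
 have L0S: "L0:?S"
 proof -
 have "L0:Idx ?d ({..<length m}\<times>B)" unfolding L0_def
 by (rule idxI) (use idxD[OF IP'] idxD[OF fillP[OF T]] in blast)
 moreover have "(tup ?d (%r. fst (L0 r))) = I"
 using IP by (auto simp: L0_def fun_eq_iff PiE_iff extensional_def)
 ultimately show ?thesis by simp
 qed
 have sL0: "fill T = ?s L0" using fillP[OF T] by (auto simp: L0_def fun_eq_iff PiE_iff extensional_def)
 show thesis
 proof (rule that[OF _ z(2)])
 show "z:std_rels R l V" unfolding std_rels_def
 by (rule mod_span_superset, rule UN_I[where a = m]) (use m(4,5) z(1) in simp_all)
 have "gcoef l V B \<xi> T z = (if fill T = ?s L0 then \<one> else \<zero>)"
 unfolding coef[OF T] by (rule finsum_one_term[OF module_ring L0S _ _ finS]) (use key[OF T] in auto)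
 thus "gcoef l V B \<xi> T z = \<one>" by (simp only: if_P[OF sL0])
 show "ALL T':Tabs l B - {T}. gcoef l V B \<xi> T' z ~= \<zero> --> wt ?n T < wt ?n T'"
 proof (intro ballI impI)
 fix T' assume TT: "T':Tabs l B - {T}" and nz: "gcoef l V B \<xi> T' z ~= \<zero>"
 have T': "T':Tabs l B" "T' ~= T" using TT by blast+
 have "EX L:?S. fill T' = ?s L"
 proof (rule ccontr)
 assume no: "~ (EX L:?S. fill T' = ?s L)"
 have "gcoef l V B \<xi> T' z = \<zero>" unfolding coef[OF T'(1)] finsum_ring
 by (rule add.finprod_one_eqI) (use no in auto)
 thus False using nz by simp
 qed
 then obtain L where L: "L:?S" "fill T' = ?s L" by blast
 show "wt ?n T < wt ?n T'" using key[OF T'(1) L] T'(2) by linarith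
 qed
 qed
qed

text \<open>Modulo the relations, semistandard monomials span.\<close>

lemma straightening:
 fixes F V :: "('a, 'u) module" and H :: "('a, ('a, 'u) tensor) tensor set"
 assumes F: "F:fgp" and D: "free_dual F {..<Suc (length l)} b \<zeta>"
 and V: "V:fgp" and DV: "free_dual V (B :: nat set) x \<xi>"
 and H: "submodule H R (Gams l V)" and N: "std_rels R l V<=H"
 and S: "!!S. S:Tabs l B ==> semistandard l S ==> gam l V B x S:H"
 and y: "y:carrier (Gams l V)"
 shows "y:H"
proof -
 interpret G: module R "Gams l V" by (rule module_Gams[OF V])
 have DB: "dual_basis V B x \<xi>" using DV by (simp add: free_dual_def)
 note DG = dual_basis_Gams[OF V DB, of l] and HD = submoduleD[OF H G.module_axioms]
 let ?w = "wt (length l)" and ?\<T> = "Tabs l B"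
 have fin: "finite ?\<T>" by (rule dual_basisD(1)[OF DG])
 have "gam l V B x T:H" if "T:?\<T>" for T
 using that
 proof (induction "Max (?w ` ?\<T>) - ?w T" arbitrary: T rule: less_induct)
 case (less T)
 note T = less.prems
 show ?case
 proof (cases "semistandard l T")
 case False
 obtain z where z: "z:std_rels R l V" "z:carrier (Gams l V)" "gcoef l V B \<xi> T z = \<one>"
 "ALL T':?\<T> - {T}. gcoef l V B \<xi> T' z ~= \<zero> --> ?w T < ?w T'"
 by (rule straightening_step[OF F D V DV T False])
 let ?f = "%T'. gcoef l V B \<xi> T' z *[Gams l V] gam l V B x T'"
 have fc: "?f T':carrier (Gams l V)" if "T':?\<T>" for T'
 by (rule G.smult_closed[OF dual_basisD(5)[OF DG that z(2)] dual_basisD(2)[OF DG that]])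
 have "?f T':H" if T': "T':?\<T> - {T}" for T'
 proof (cases "gcoef l V B \<xi> T' z = \<zero>")
 case True
 have "?f T' = \<zero>[Gams l V]" unfolding True by (rule G.smult_l_null[OF dual_basisD(2)[OF DG]]) (use T' in blast)
 thus ?thesis using HD(2) by simp
 next
 case False
 have w: "?w T < ?w T'" using z(4) T' False by blast
 have "?w T' <= Max (?w ` ?\<T>)" using fin T' by (intro Max_ge) auto
 hence "gam l V B x T':H" by (intro less.hyps) (use w T' in auto)
 thus ?thesis by (rule HD(4)[rotated]) (use T' dual_basisD(5)[OF DG _ z(2)] in blast)
 qed
 hence s: "finsum (Gams l V) ?f (?\<T> - {T}):H" by (intro submodule_finsum[OF H G.module_axioms] Pi_I)
 have "z = finsum (Gams l V) ?f (insert T (?\<T> - {T}))"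
 unfolding insert_Diff[OF T] by (rule dual_basisD(4)[OF DG z(2), symmetric])
 also have "... = ?f T +[Gams l V] finsum (Gams l V) ?f (?\<T> - {T})"
 by (rule G.finsum_insert) (use fin fc T in auto)
 also have "?f T = gam l V B x T" unfolding z(3) by (rule G.smult_one[OF dual_basisD(2)[OF DG T]])
 finally have ze: "z = gam l V B x T +[Gams l V] finsum (Gams l V) ?f (?\<T> - {T})" .
 have ab: "a = (a +[Gams l V] c) \<ominus>\<^bsub>Gams l V\<^esub> c" if "a:carrier (Gams l V)" "c:carrier (Gams l V)" for a c
 using that by (simp add: G.minus_eq G.a_assoc G.r_neg)
 have "gam l V B x T = z \<ominus>\<^bsub>Gams l V\<^esub> finsum (Gams l V) ?f (?\<T> - {T})"
 using ab[OF dual_basisD(2)[OF DG T] subsetD[OF HD(1) s]] by (simp only: ze[symmetric])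
 also have "...:H" unfolding G.minus_eq by (rule HD(3)[OF _ HD(5)[OF s]]) (use z(1) N in blast)
 finally show ?thesis .
 qed (rule S[OF T])
 qed
 hence "gam l V B x ` ?\<T><=H" by (intro image_subsetI)
 from dual_basis_span[OF DG G.module_axioms H this y] show ?thesis .
qed

end

section \<open>Determinants on exterior powers\<close>

context cring
begin

lemma finprod_zero_factor:
 assumes "finite A" "a:A" "f:A \<rightarrow> carrier R" "f a = \<zero>"
 shows "finprod R f A = \<zero>"
proof -
 have "finprod R f (insert a (A - {a})) = f a\<otimes>finprod R f (A - {a})"
 by (rule finprod_insert) (use assms in auto)
 moreover have "finprod R f (A - {a}):carrier R" by (rule finprod_closed) (use assms(3) in auto)
 ultimately show ?thesis using assms(4) by (simp add: insert_absorb[OF assms(2)])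
qed

text \<open>The minor of the coordinates \<open>s 0, \<dots>, s (e - 1)\<close>.\<close>

lemma ext_functional:
 fixes V :: "('a, 'u) module"
 assumes V: "module R V" and D: "free_dual V B x \<xi>" and s: "s:Idx e B" and inj: "inj_on s {..<e}"
 obtains \<delta> where "lin R (Ext e V) (ring_as_mod R) \<delta>" "\<delta> (pr e V (tb e V x s)) = \<one>"
 "ALL J:Idx e B. (ALL \<sigma>. \<sigma> permutes {..<e} --> J ~= (tup e (%r. s (\<sigma> r)))) --> \<delta> (pr e V (tb e V x J)) = \<zero>"
proof -
 have DB: "dual_basis V B x \<xi>" using D by (simp add: free_dual_def)
 let ?P = "{\<sigma>. \<sigma> permutes {..<e}}"
 define sg where "sg \<sigma> = (if evenperm \<sigma> then \<one> else \<ominus> \<one>)" for \<sigma> :: "nat => nat"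
 define a where "a t \<sigma> = tc e V \<xi> (tup e (%r. s (\<sigma> r))) t" for t \<sigma>
 define f where "f t = finsum R (%\<sigma>. a t \<sigma>\<otimes>sg \<sigma>) ?P" for t
 have sgc: "sg \<sigma>:carrier R" for \<sigma> by (simp add: sg_def)
 have fin: "finite ?P" by (rule finite_permutations) simp
 have sP: "(tup e (%r. s (\<sigma> r))):Idx e B" if "\<sigma>:?P" for \<sigma> by (rule idx_perm[OF _ s]) (use that in simp)
 have al: "lin R (tpow R e V) (ring_as_mod R) (%t. a t \<sigma>)" if "\<sigma>:?P" for \<sigma>
 unfolding a_def by (rule dual_basisD(3)[OF dual_basis_tpow[OF V DB] sP[OF that]])
 have ac: "a t \<sigma>:carrier R" if "\<sigma>:?P" "t:Tens e V" for t \<sigma> using lin_closed[OF al[OF that(1)] that(2)] by simp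
 have fe: "f = (%t. finsum (ring_as_mod R) (%\<sigma>. a t \<sigma> *[ring_as_mod R] sg \<sigma>) ?P)"
 by (rule ext) (simp add: f_def)
 have fl: "lin R (tpow R e V) (ring_as_mod R) f"
 unfolding fe by (rule lin_sum[OF module_tpow[OF V] module_ring]) (rule al, assumption, use sgc in simp)
 \<comment> \<open>a repeated entry makes the terms of \<open>\<sigma>\<close> and \<open>\<sigma>\<circ>(i j)\<close> cancel\<close>
 have kill: "f (tpure R e V v) = \<zero>" if v: "v:tensor_base e (%_. V)" and ij: "i < j" "j < e" "v i = v j" for v i j
 proof -
 let ?\<tau> = "transpose i j" and ?t = "tpure R e V v"
 have tp: "?\<tau> permutes {..<e}" using ij by (intro transpose_permutes) auto
 have t: "?t:Tens e V" by (rule tpure_closed[OF V v])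
 have "(tup e (%r. v (?\<tau> r))) = v"
 using v ij by (auto simp: fun_eq_iff tensor_base_def PiE_iff extensional_def transpose_def)
 hence tt: "tperm R e V ?\<tau> ?t = ?t" using tperm(2)[OF V permutes_imp_bij[OF tp] v] by simp
 have acomp: "a ?t (\<sigma>\<circ>?\<tau>) = a ?t \<sigma>" if \<sigma>: "\<sigma>:?P" for \<sigma>
 proof -
 have "(tup e (%r. s ((\<sigma>\<circ>?\<tau>) r))) = (tup e (%r. (tup e (%r. s (\<sigma> r))) (?\<tau> r)))"
 by (rule restrict_ext) (use permutes_less[OF tp] in simp)
 hence "a ?t (\<sigma>\<circ>?\<tau>) = tc e V \<xi> (tup e (%r. (tup e (%r. s (\<sigma> r))) (?\<tau> r))) (tperm R e V ?\<tau> ?t)"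
 unfolding a_def tt by (rule arg_cong)
 also have "... = a ?t \<sigma>" unfolding a_def by (rule tc_tperm[OF V DB permutes_imp_bij[OF tp] sP[OF \<sigma>] t])
 finally show ?thesis .
 qed
 have perm: "permutation \<sigma>" if "\<sigma>:?P" for \<sigma> using that by (auto simp: permutation_permutes)
 have ev: "evenperm (\<sigma>\<circ>?\<tau>) \<longleftrightarrow> ~ evenperm \<sigma>" if "\<sigma>:?P" for \<sigma>
 using evenperm_comp[OF perm[OF that] perm[of ?\<tau>]] tp ij by (simp add: evenperm_swap)
 have comp: "\<sigma>\<circ>?\<tau>:?P" if "\<sigma>:?P" for \<sigma> using permutes_compose[OF tp] that by simp
 have undo: "(\<sigma>\<circ>?\<tau>)\<circ>?\<tau> = \<sigma>" for \<sigma> :: "nat => nat" by (simp add: fun_eq_iff)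
 show ?thesis unfolding f_def
 proof (rule add.finprod_involution[where h = "%\<sigma>. \<sigma>\<circ>?\<tau>", OF fin])
 show "(%\<sigma>. a ?t \<sigma>\<otimes>sg \<sigma>):?P \<rightarrow> carrier R" using sgc ac t by simp
 fix \<sigma> assume s: "\<sigma>:?P"
 show "\<sigma>\<circ>?\<tau>:?P" by (rule comp[OF s])
 show "\<sigma>\<circ>?\<tau>\<circ>?\<tau> = \<sigma>" by (rule undo)
 show "a ?t \<sigma>\<otimes>sg \<sigma> \<oplus> a ?t (\<sigma>\<circ>?\<tau>)\<otimes>sg (\<sigma>\<circ>?\<tau>) = \<zero>"
 unfolding acomp[OF s] using ev[OF s] ac[OF s t] by (simp add: sg_def r_minus r_neg l_neg)
 show "a ?t \<sigma>\<otimes>sg \<sigma> = \<zero>" if e: "\<sigma>\<circ>?\<tau> = \<sigma>" using ev[OF s] unfolding e by blast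
 qed
 qed
 have alt: "f t = \<zero>[ring_as_mod R]" if t: "t:alt_rels R e V" for t
 proof -
 have "alt_rels R e V<={t\<in>Tens e V. f t:{\<zero>[ring_as_mod R]}}"
 unfolding alt_rels_def
 by (rule mod_span_least[OF submodule_preimage[OF module_tpow[OF V] module_ring fl submodule_zero[OF module_ring]]])
 (use kill tpure_closed[OF V] in auto)
 thus ?thesis using t by blast
 qed
 obtain \<delta> where d: "lin R (Ext e V) (ring_as_mod R) \<delta>" "!!t. t:Tens e V ==> \<delta> (pr e V t) = f t"
 using quot_lift[OF module_tpow[OF V] submodule_alt[OF V] module_ring fl alt] by blast
 have tbc: "tb e V x J:Tens e V" if "J:Idx e B" for J
 by (rule tb_closed(2)[OF V dual_basis_mem[OF DB] that])
 have atb: "a (tb e V x J) \<sigma> = (if (tup e (%r. s (\<sigma> r))) = J then \<one> else \<zero>)"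
 if "\<sigma>:?P" "J:Idx e B" for J \<sigma>
 unfolding a_def by (rule tc_tb[OF V D sP[OF that(1)] that(2)])
 show thesis
 proof (rule that[OF d(1)])
 have one: "\<sigma> = id" if "\<sigma>:?P" "(tup e (%r. s (\<sigma> r))) = s" for \<sigma>
 proof (rule ext)
 fix r show "\<sigma> r = id r"
 proof (cases "r < e")
 case True
 have "s (\<sigma> r) = s r" using fun_cong[OF that(2), of r] True by simp
 thus ?thesis using inj_onD[OF inj, of "\<sigma> r" r] permutes_less[of \<sigma> e r] that(1) True by simp
 qed (use that(1) permutes_not_in[of \<sigma> "{..<e}" r] in simp)
 qed
 have idP: "id:?P" by (simp add: permutes_id)
 have si: "(tup e (%r. s (id r))) = s" using s by (auto simp: fun_eq_iff PiE_iff extensional_def)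
 have "\<delta> (pr e V (tb e V x s)) = finsum (ring_as_mod R) (%\<sigma>. a (tb e V x s) \<sigma>\<otimes>sg \<sigma>) ?P"
 unfolding d(2)[OF tbc[OF s]] f_def finsum_ring ..
 also have "... = a (tb e V x s) id\<otimes>sg id"
 proof (rule finsum_one_term[OF module_ring idP _ _ fin])
 show "a (tb e V x s) id\<otimes>sg id:carrier (ring_as_mod R)" using sgc ac[OF idP tbc[OF s]] by simp
 fix \<sigma> assume P: "\<sigma>:?P" and ne: "\<sigma> ~= id"
 have "(tup e (%r. s (\<sigma> r))) ~= s" using one[OF P] ne by blast
 thus "a (tb e V x s) \<sigma>\<otimes>sg \<sigma> = \<zero>[ring_as_mod R]" using atb[OF P s] sgc by simp
 qed
 also have "... = \<one>" unfolding atb[OF idP s] if_P[OF si] by (simp add: sg_def evenperm_id)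
 finally show "\<delta> (pr e V (tb e V x s)) = \<one>" .
 show "ALL J:Idx e B. (ALL \<sigma>. \<sigma> permutes {..<e} --> J ~= (tup e (%r. s (\<sigma> r)))) --> \<delta> (pr e V (tb e V x J)) = \<zero>"
 proof (intro ballI impI)
 fix J assume J: "J:Idx e B" and no: "ALL \<sigma>. \<sigma> permutes {..<e} --> J ~= (tup e (%r. s (\<sigma> r)))"
 show "\<delta> (pr e V (tb e V x J)) = \<zero>"
 unfolding d(2)[OF tbc[OF J]] f_def
 proof (rule add.finprod_one_eqI)
 fix \<sigma> assume P: "\<sigma>:?P"
 have "(tup e (%r. s (\<sigma> r))) ~= J" using no P by blast
 thus "a (tb e V x J) \<sigma>\<otimes>sg \<sigma> = \<zero>" using atb[OF P J] sgc by simp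
 qed
 qed
 qed
qed

lemma Exts_functional:
 fixes V :: "('a, 'u) module"
 assumes V: "module R V" and D: "free_dual V B x \<xi>" and K: "K:Idx (sum_list l) B"
 and inj: "!!i. i < length l ==> inj_on (blk l K i) {..<l ! i}"
 obtains \<delta> where "lin R (Exts l V) (ring_as_mod R) \<delta>" "\<delta> (ext_proj R l V (tb (sum_list l) V x K)) = \<one>"
 "ALL J:Idx (sum_list l) B. ALL i<length l.
 (ALL \<sigma>. \<sigma> permutes {..<l ! i} --> blk l J i ~= (tup (l ! i) (%r. blk l K i (\<sigma> r)))) -->
 \<delta> (ext_proj R l V (tb (sum_list l) V x J)) = \<zero>"
proof -
 let ?d = "sum_list l"
 have DB: "dual_basis V B x \<xi>" using D by (simp add: free_dual_def)
 have "EX \<delta>. lin R (Ext (l ! i) V) (ring_as_mod R) \<delta> & \<delta> (pr (l ! i) V (tb (l ! i) V x (blk l K i))) = \<one> &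
 (ALL J:Idx (l ! i) B. (ALL \<sigma>. \<sigma> permutes {..<l ! i} --> J ~= (tup (l ! i) (%r. blk l K i (\<sigma> r)))) -->
 \<delta> (pr (l ! i) V (tb (l ! i) V x J)) = \<zero>)" if i: "i < length l" for i
 by (rule ext_functional[OF V D blk_PiE[OF K i] inj[OF i]]) blast
 then obtain \<delta> where d: "!!i. i < length l ==> lin R (Ext (l ! i) V) (ring_as_mod R) (\<delta> i)"
 "!!i. i < length l ==> \<delta> i (pr (l ! i) V (tb (l ! i) V x (blk l K i))) = \<one>"
 "!!i J \<sigma>. i < length l ==> J:Idx (l ! i) B ==> ALL \<sigma>. \<sigma> permutes {..<l ! i} --> J ~= (tup (l ! i) (%r. blk l K i (\<sigma> r))) ==>
 \<delta> i (pr (l ! i) V (tb (l ! i) V x J)) = \<zero>"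
 by metis
 let ?\<delta> = "tcoef (length l) (%i. Ext (l ! i) V) (%i (_::nat). \<delta> i) (%_. 0)"
 have ls: "lins R (length l) (%i. Ext (l ! i) V) (%_. ring_as_mod R) (%i. (%i (_::nat). \<delta> i) i ((%_. 0) i))"
 by (rule linsI) (rule d(1))
 note tl = tcoef[where J = "%_. 0 :: nat" and c = "%i _. \<delta> i", OF modules_Ext[OF V] ls]
 have val: "?\<delta> (ext_proj R l V (tb ?d V x J)) = (\<Otimes>i\<in>{..<length l}. \<delta> i (pr (l ! i) V (tb (l ! i) V x (blk l J i))))"
 and cl: "(%i. \<delta> i (pr (l ! i) V (tb (l ! i) V x (blk l J i)))):{..<length l} \<rightarrow> carrier R"
 if J: "J:Idx ?d B" for J
 proof -
 have c: "pr (l ! i) V (tb (l ! i) V x (blk l J i)):carrier (Ext (l ! i) V)" if i: "i < length l" for i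
 by (rule lin_closed[OF pr_lin[OF V] tb_closed(2)[OF V dual_basis_mem[OF DB] blk_PiE[OF J i]]])
 show cl: "(%i. \<delta> i (pr (l ! i) V (tb (l ! i) V x (blk l J i)))):{..<length l} \<rightarrow> carrier R"
 using lin_closed[OF d(1) c] by auto
 have e: "ext_proj R l V (tb ?d V x J) = pure_tensor R (length l) (%i. Ext (l ! i) V)
 (tup (length l) (%i. pr (l ! i) V (tb (l ! i) V x (blk l J i))))"
 unfolding ext_proj(2)[OF V tb_closed(1)[OF V dual_basis_mem[OF DB] J]]
 by (rule arg_cong[where f = "pure_tensor R _ _"], rule restrict_ext) (simp only: lessThan_iff blk_restrict_comp)
 have "?\<delta> (ext_proj R l V (tb ?d V x J)) = (\<Otimes>i\<in>{..<length l}. \<delta> i ((tup (length l) (%i. pr (l ! i) V (tb (l ! i) V x (blk l J i)))) i))"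
 unfolding e by (rule tl(2)) (unfold tensor_base_def, rule idxI, rule c)
 also have "... = (\<Otimes>i\<in>{..<length l}. \<delta> i (pr (l ! i) V (tb (l ! i) V x (blk l J i))))"
 by (rule finprod_cong'[OF refl cl]) simp
 finally show "?\<delta> (ext_proj R l V (tb ?d V x J)) = (\<Otimes>i\<in>{..<length l}. \<delta> i (pr (l ! i) V (tb (l ! i) V x (blk l J i))))" .
 qed
 show thesis
 proof (rule that)
 show "lin R (Exts l V) (ring_as_mod R) ?\<delta>" unfolding Exts_eq by (rule tl(1))
 show "?\<delta> (ext_proj R l V (tb ?d V x K)) = \<one>" unfolding val[OF K]
 by (rule finprod_one_eqI) (simp add: d(2))
 show "ALL J:Idx ?d B. ALL i<length l.
 (ALL \<sigma>. \<sigma> permutes {..<l ! i} --> blk l J i ~= (tup (l ! i) (%r. blk l K i (\<sigma> r)))) -->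
 ?\<delta> (ext_proj R l V (tb ?d V x J)) = \<zero>"
 proof (intro ballI allI impI)
 fix J i assume J: "J:Idx ?d B" and i: "i < length l"
 and no: "ALL \<sigma>. \<sigma> permutes {..<l ! i} --> blk l J i ~= (tup (l ! i) (%r. blk l K i (\<sigma> r)))"
 show "?\<delta> (ext_proj R l V (tb ?d V x J)) = \<zero>" unfolding val[OF J]
 by (rule finprod_zero_factor[OF _ _ cl[OF J], of i]) (use i d(3)[OF i blk_PiE[OF J i] no] in simp_all)
 qed
 qed
qed

end

section \<open>The kernel of the Weyl map\<close>

context cring
begin

lemma weyl_map_eq:
 "weyl_map R l V y = ext_proj R (conj_part l) V (tperm R (sum_list l) V (weyl_perm l) (div_incl R l V y))"
proof -
 have "tperm R (sum_list l) V (weyl_perm l) = tperm R (sum_list l) V (part_perm (conj_part l))"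
 by (rule tperm_cong) (simp add: weyl_perm_def)
 thus ?thesis by (simp only: weyl_map_def)
qed

lemma weyl_map_lin:
 assumes l: "sorted_wrt (>=) l" and V: "V:fgp"
 shows "lin R (Gams l V) (Exts (conj_part l) V) (weyl_map R l V)"
proof -
 note MV = fgp_module[OF V]
 show ?thesis unfolding weyl_map_eq
 by (rule lin_comp[OF lin_comp[OF div_incl(1)[OF V] tperm_lin[OF MV permutes_imp_bij[OF weyl_perm_permutes[OF l]]]]
 ext_proj(1)[OF MV, of "conj_part l", unfolded sum_conj[OF l]]])
qed

lemma weyl_map_nat:
 assumes l: "sorted_wrt (>=) l" and V: "V:fgp" and W: "W:fgp"
 and f: "\<phi>:Homs (sum_list l) V W" and y: "y:carrier (Gams l V)"
 shows "weyl_map R l W (on_mor (div_powers R l) V W \<phi> y) = on_mor (ext_powers R (conj_part l)) V W \<phi> (weyl_map R l V y)"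
proof -
 note MV = fgp_module[OF V] and p = weyl_perm_permutes[OF l]
 have Dy: "div_incl R l V y:Tens (sum_list l) V" by (rule lin_closed[OF div_incl(1)[OF V] y])
 show ?thesis unfolding weyl_map_eq div_incl_nat[OF V W f y] sp_hom_perm[OF f p Dy, symmetric]
 by (rule ext_proj_nat[of _ _ _ "conj_part l", unfolded sum_conj[OF l], OF V W f
 lin_closed[OF tperm_lin[OF MV permutes_imp_bij[OF p]] Dy], symmetric])
qed

text \<open>The column reading of a filling.\<close>

abbreviation colread :: "nat list => (nat => 'i) => nat => 'i" where
 "colread l J \<equiv> \<lambda>r\<in>{..<sum_list l}. J (weyl_perm l r)"

lemma blk_colread:
 assumes l: "sorted_wrt (>=) l" and j: "j < length (conj_part l)"
 shows "blk (conj_part l) (colread l J) j = (tup (conj_part l ! j) (%i. J (pos l i j)))"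
 unfolding blk_def
proof (rule restrict_ext)
 fix i assume "i:{..<conj_part l ! j}"
 hence i: "i < conj_part l ! j" by simp
 show "colread l J (pos (conj_part l) j i) = J (pos l i j)"
 using pos_less[OF j i] by (simp add: sum_conj[OF l] weyl_perm_pos[OF l j i])
qed

lemma weyl_map_gam:
 assumes l: "sorted_wrt (>=) l" and V: "V:fgp" and x: "x:B \<rightarrow> carrier V" and B: "finite B"
 shows "weyl_map R l V (gam l V B x T) = finsum (Exts (conj_part l) V)
 (%J. ext_proj R (conj_part l) V (tb (sum_list l) V x (colread l J)))
 {J\<in>Idx (sum_list l) B. ALL i<length l. ct (l ! i) (blk l J i) = T i}" (is "_ = finsum _ _ ?S")
proof -
 note MV = fgp_module[OF V] and p = weyl_perm_permutes[OF l]
 note tl = tperm_lin[OF MV permutes_imp_bij[OF p]] and el = ext_proj(1)[OF MV, of "conj_part l", unfolded sum_conj[OF l]]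
 note lc = lin_comp[OF tl el]
 have tbc: "tb (sum_list l) V x:?S \<rightarrow> Tens (sum_list l) V"
 by (rule Pi_I) (use tb_closed(2)[OF MV x] in blast)
 interpret E: module R "Exts (conj_part l) V" by (rule module_Exts[OF MV])
 have e: "ext_proj R (conj_part l) V (tperm R (sum_list l) V (weyl_perm l) (tb (sum_list l) V x J)) =
 ext_proj R (conj_part l) V (tb (sum_list l) V x (colread l J))" if "J:?S" for J
 by (rule arg_cong[where f = "ext_proj R (conj_part l) V"], rule tperm_tb[OF MV x _ p]) (use that in blast)
 have "weyl_map R l V (gam l V B x T) = finsum (Exts (conj_part l) V)
 (%J. ext_proj R (conj_part l) V (tperm R (sum_list l) V (weyl_perm l) (tb (sum_list l) V x J))) ?S"
 unfolding weyl_map_eq div_incl_gam[OF V x B]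
 by (rule lin_finsum[OF module_tpow[OF MV] E.module_axioms lc tbc])
 also have "... = finsum (Exts (conj_part l) V) (%J. ext_proj R (conj_part l) V (tb (sum_list l) V x (colread l J))) ?S"
 proof (rule E.finsum_cong'[OF refl])
 show "(%J. ext_proj R (conj_part l) V (tb (sum_list l) V x (colread l J))):?S \<rightarrow> carrier (Exts (conj_part l) V)"
 by (rule Pi_I, rule lin_closed[OF el], rule tb_closed(2)[OF MV x], rule idx_perm[OF p]) blast
 qed (rule e)
 finally show ?thesis .
qed

lemma filling_weight:
 assumes l: "sorted_wrt (>=) l" and T: "!!i. i < length l ==> ct (l ! i) (blk l J i) = T i"
 shows "wt (length l) T = (\<Sum>j<length (conj_part l). \<Sum>i<conj_part l ! j. i * J (pos l i j))"
proof -
 have "sum_mset (T i) = (\<Sum>j<l ! i. J (pos l i j))" if i: "i < length l" for i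
 unfolding T[OF i, symmetric] ct_def sum_unfold_sum_mset[symmetric] by (rule sum.cong) (simp_all add: blk_def)
 hence "wt (length l) T = (\<Sum>i<length l. \<Sum>j<l ! i. i * J (pos l i j))"
 unfolding wt_def by (simp add: sum_distrib_left)
 thus ?thesis unfolding sum_conj_swap[OF l] .
qed

lemma mono_steps:
 fixes f :: "nat => nat"
 assumes "!!i. Suc i < k ==> f i < f (Suc i)" "a < b" "b < k"
 shows "f a < f b"
 using assms(2,3)
proof (induction b)
 case (Suc b)
 thus ?case using assms(1)[of b] by (cases "a = b") force+
qed simp

text \<open>
 Fill the rows of a semistandard \<open>S\<close> in increasing order; then the columns increase strictly. The
 product of the minors of these columns detects \<open>S\<close>: by the rearrangement inequality, any other
 filling with the same column contents has smaller weight.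
\<close>

lemma weyl_functional:
 fixes V :: "('a, 'u) module"
 assumes l: "sorted_wrt (>=) l" and V: "V:fgp" and D: "free_dual V (B :: nat set) x \<xi>"
 and S: "S:Tabs l B" and ss: "semistandard l S"
 obtains \<delta> where "lin R (Exts (conj_part l) V) (ring_as_mod R) \<delta>" "\<delta> (weyl_map R l V (gam l V B x S)) = \<one>"
 "ALL T:Tabs l B - {S}. \<delta> (weyl_map R l V (gam l V B x T)) ~= \<zero> --> wt (length l) T < wt (length l) S"
proof -
 let ?d = "sum_list l" and ?c = "conj_part l" and ?n = "length l"
 note MV = fgp_module[OF V] and p = weyl_perm_permutes[OF l]
 have DB: "dual_basis V B x \<xi>" using D by (simp add: free_dual_def)
 have Sk: "size (S i) = l ! i" "set_mset (S i)<=B" if i: "i < ?n" for i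
 proof -
 obtain K where K: "K:Idx (l ! i) B" "S i = ct (l ! i) K" using idxD[OF S i] by blast
 show "size (S i) = l ! i" "set_mset (S i)<=B" unfolding K(2) using idxD[OF K(1)] by (auto simp: ct_def)
 qed
 have len: "length (row_list (S i)) = l ! i" if "i < ?n" for i
 using size_mset[of "row_list (S i)"] Sk(1)[OF that] by simp
 define J where "J = glue l (%i. \<lambda>j\<in>{..<l ! i}. row_list (S i) ! j)"
 have Jr: "(tup (l ! i) (%j. row_list (S i) ! j)):Idx (l ! i) B" if i: "i < ?n" for i
 proof (rule idxI)
 fix j assume "j < l ! i"
 hence "row_list (S i) ! j:set (row_list (S i))" using len[OF i] by (intro nth_mem) simp
 thus "row_list (S i) ! j:B" using Sk(2)[OF i] by auto
 qed
 have JP: "J:Idx ?d B" unfolding J_def by (rule glue_PiE) (rule Jr)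
 have Jpos: "J (pos l i j) = row_list (S i) ! j" if "i < ?n" "j < l ! i" for i j
 unfolding J_def using that by (simp add: glue_pos)
 have JS: "ct (l ! i) (blk l J i) = S i" if i: "i < ?n" for i
 proof -
 have "ct (l ! i) (blk l J i) = ct (l ! i) ((!) (row_list (S i)))" by (rule ct_cong) (simp add: blk_def Jpos[OF i])
 also have "... = mset (map ((!) (row_list (S i))) [0..<length (row_list (S i))])"
 unfolding ct_def len[OF i] mset_set_upto_eq_mset_upto by simp
 finally have "ct (l ! i) (blk l J i) = mset (map ((!) (row_list (S i))) [0..<length (row_list (S i))])" .
 thus ?thesis by (simp only: map_nth mset_sorted_list_of_multiset)
 qed
 have cell: "i < ?n" "j < l ! i" if "j < length ?c" "i < ?c ! j" for i j using conj_iff[OF l, of j i] that by blast+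
 have col: "J (pos l a j) < J (pos l b j)" if j: "j < length ?c" and ab: "a < b" "b < ?c ! j" for a b j
 proof (rule mono_steps[where f = "%i. J (pos l i j)", OF _ ab])
 fix i assume i: "Suc i < ?c ! j"
 note c1 = cell[OF j i] and c0 = cell[OF j Suc_lessD[OF i]]
 show "J (pos l i j) < J (pos l (Suc i) j)" unfolding Jpos[OF c0] Jpos[OF c1]
 by (rule semistandard_columns[OF ss c1(1)]) (simp_all add: Sk(1)[OF c1(1)] Sk(1)[OF c0(1)] c1 c0)
 qed
 let ?K = "colread l J"
 have KP: "colread l I:Idx ?d B" if "I:Idx ?d B" for I by (rule idx_perm[OF p that])
 have inj: "inj_on (blk ?c ?K j) {..<?c ! j}" if j: "j < length ?c" for j
 unfolding blk_colread[OF l j]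
 proof (rule inj_onI)
 fix a b assume ab: "a:{..<?c ! j}" "b:{..<?c ! j}"
 "(tup (?c ! j) (%i. J (pos l i j))) a = (tup (?c ! j) (%i. J (pos l i j))) b"
 show "a = b"
 proof (rule ccontr)
 assume "a ~= b"
 hence "a < b \<or> b < a" by arith
 thus False using col[OF j, of a b] col[OF j, of b a] ab by auto
 qed
 qed
 obtain \<delta> where d: "lin R (Exts ?c V) (ring_as_mod R) \<delta>" "\<delta> (ext_proj R ?c V (tb ?d V x ?K)) = \<one>"
 "ALL I:Idx ?d B. ALL j<length ?c.
 (ALL \<sigma>. \<sigma> permutes {..<?c ! j} --> blk ?c I j ~= (tup (?c ! j) (%r. blk ?c ?K j (\<sigma> r)))) -->
 \<delta> (ext_proj R ?c V (tb ?d V x I)) = \<zero>"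
 by (rule Exts_functional[OF MV D, of ?K ?c, unfolded sum_conj[OF l], OF KP[OF JP] inj])
 let ?e = "%I. ext_proj R ?c V (tb ?d V x (colread l I))"
 have el: "?e I:carrier (Exts ?c V)" if "I:Idx ?d B" for I
 by (rule lin_closed[OF ext_proj(1)[OF MV, of ?c, unfolded sum_conj[OF l]] tb_closed(2)[OF MV dual_basis_mem[OF DB] KP[OF that]]])
 have key: "wt ?n T <= wt ?n S & (wt ?n T = wt ?n S --> I = J)"
 if I: "I:Idx ?d B" and T: "!!i. i < ?n ==> ct (l ! i) (blk l I i) = T i" and nz: "\<delta> (?e I) ~= \<zero>" for I T
 proof -
 have "EX \<sigma>. \<sigma> permutes {..<?c ! j} & blk ?c (colread l I) j = (tup (?c ! j) (%r. blk ?c ?K j (\<sigma> r)))" if j: "j < length ?c" for j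
 using d(3) KP[OF I] j nz by blast
 then obtain \<sigma> where s: "!!j. j < length ?c ==> \<sigma> j permutes {..<?c ! j}"
 "!!j. j < length ?c ==> blk ?c (colread l I) j = (tup (?c ! j) (%r. blk ?c ?K j (\<sigma> j r)))" by metis
 have Ij: "I (pos l i j) = J (pos l (\<sigma> j i) j)" if j: "j < length ?c" and i: "i < ?c ! j" for i j
 using fun_cong[OF s(2)[OF j], of i] i permutes_less[OF s(1)[OF j] i] unfolding blk_colread[OF l j] by simp
 let ?a = "%j. \<Sum>i<?c ! j. i * J (pos l (\<sigma> j i) j)" and ?b = "%j. \<Sum>i<?c ! j. i * J (pos l i j)"
 have r: "?a j <= ?b j & (?a j = ?b j --> \<sigma> j = id)" if j: "j < length ?c" for j
 by (rule rearrangement[where u = "%i. J (pos l i j)", OF _ s(1)[OF j]]) (rule col[OF j])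
 have "wt ?n T = (\<Sum>j<length ?c. \<Sum>i<?c ! j. i * I (pos l i j))" by (rule filling_weight[OF l]) (rule T)
 also have "... = (\<Sum>j<length ?c. ?a j)" by (intro sum.cong refl) (simp add: Ij)
 finally have wT: "wt ?n T = (\<Sum>j<length ?c. ?a j)" .
 have wS: "wt ?n S = (\<Sum>j<length ?c. ?b j)" by (rule filling_weight[OF l]) (rule JS)
 have "wt ?n T <= wt ?n S" unfolding wT wS by (rule sum_mono) (use r in simp)
 moreover have "I = J" if eq: "wt ?n T = wt ?n S"
 proof (rule PiE_ext[OF I JP])
 fix r assume "r:{..<?d}"
 then obtain i j where ij: "i < ?n" "j < l ! i" "r = pos l i j" using pos_cases by blast
 hence j: "j < length ?c" "i < ?c ! j" using conj_iff[OF l, of j i] by blast+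
 have "?a j = ?b j"
 proof (rule ccontr)
 assume "?a j ~= ?b j"
 hence "?a j < ?b j" using r[OF j(1)] by simp
 hence "(\<Sum>j<length ?c. ?a j) < (\<Sum>j<length ?c. ?b j)" by (intro sum_strict_mono_ex1) (use r j in auto)
 thus False using eq wT wS by simp
 qed
 hence "\<sigma> j = id" using r[OF j(1)] by blast
 thus "I r = J r" unfolding ij(3) Ij[OF j] by simp
 qed
 ultimately show ?thesis by blast
 qed
 let ?\<S> = "%T. {I\<in>Idx ?d B. ALL i<?n. ct (l ! i) (blk l I i) = T i}"
 have dw: "\<delta> (weyl_map R l V (gam l V B x T)) = finsum (ring_as_mod R) (%I. \<delta> (?e I)) (?\<S> T)" for T
 unfolding weyl_map_gam[OF l V dual_basis_mem[OF DB] dual_basisD(1)[OF DB]]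
 by (rule lin_finsum[OF module_Exts[OF MV] module_ring d(1)]) (use el in blast)
 have fin: "finite (?\<S> T)" for T
 using dual_basisD(1)[OF dual_basis_tpow[OF MV DB], of ?d] by simp
 show thesis
 proof (rule that[OF d(1)])
 have "\<delta> (weyl_map R l V (gam l V B x S)) = \<delta> (?e J)" unfolding dw
 proof (rule finsum_one_term[OF module_ring _ _ _ fin])
 show "J:?\<S> S" using JP JS by blast
 show "\<delta> (?e J):carrier (ring_as_mod R)" by (rule lin_closed[OF d(1) el[OF JP]])
 fix I assume I: "I:?\<S> S" and ne: "I ~= J"
 show "\<delta> (?e I) = \<zero>[ring_as_mod R]" using key[of I S] I ne by auto
 qed
 thus "\<delta> (weyl_map R l V (gam l V B x S)) = \<one>" using d(2) by simp
 show "ALL T:Tabs l B - {S}. \<delta> (weyl_map R l V (gam l V B x T)) ~= \<zero> --> wt ?n T < wt ?n S"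
 proof (intro ballI impI)
 fix T assume T: "T:Tabs l B - {S}" and nz: "\<delta> (weyl_map R l V (gam l V B x T)) ~= \<zero>"
 have "EX I:?\<S> T. \<delta> (?e I) ~= \<zero>"
 proof (rule ccontr)
 assume no: "~ (EX I:?\<S> T. \<delta> (?e I) ~= \<zero>)"
 have "\<delta> (weyl_map R l V (gam l V B x T)) = \<zero>" unfolding dw finsum_ring
 by (rule add.finprod_one_eqI) (use no in blast)
 thus False using nz by simp
 qed
 then obtain I where I: "I:Idx ?d B" "!!i. i < ?n ==> ct (l ! i) (blk l I i) = T i" "\<delta> (?e I) ~= \<zero>" by blast
 have k: "wt ?n T <= wt ?n S & (wt ?n T = wt ?n S --> I = J)" by (rule key[OF I(1) _ I(3)]) (rule I(2))
 have "I ~= J"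
 proof
 assume "I = J"
 hence "T i = S i" if "i < ?n" for i using I(2)[OF that] JS[OF that] by simp
 moreover have TT: "T:Tabs l B" using T by blast
 ultimately have "T = S" by (intro PiE_ext[OF TT S]) simp
 thus False using T by blast
 qed
 thus "wt ?n T < wt ?n S" using k by linarith
 qed
 qed
qed

lemma std_rels_gens_closed:
 assumes V: "V:fgp"
 shows "trace_sub R m (div_powers R l) V<=carrier (Gams l V)"
 unfolding trace_sub_def
proof (rule mod_span_carrier[OF module_Gams[OF V]], rule subsetI)
 fix y assume "y:(\<Union>\<phi>\<in>nat_trans R (sum_list m) (div_powers R m) (div_powers R l). \<phi> V ` carrier (Gams m V))"
 then obtain \<phi> z where p: "\<phi>:nat_trans R (sum_list m) (div_powers R m) (div_powers R l)" "z:carrier (Gams m V)" "y = \<phi> V z"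
 by blast
 show "y:carrier (Gams l V)" unfolding p(3) by (rule lin_closed[OF mod_hom_lin[OF nat_transD(1)[OF p(1) V]] p(2)])
qed

lemma submodule_std_rels:
 assumes V: "V:fgp"
 shows "submodule (std_rels R l V) R (Gams l V)"
 unfolding std_rels_def
 by (rule submodule_mod_span[OF module_Gams[OF V]], rule UN_least, rule std_rels_gens_closed[OF V])

lemma std_rels_least:
 assumes H: "submodule H R (Gams l V)"
 and g: "!!m \<phi> z. is_partition (sum_list l) m ==> ~ dominated m l ==>
 \<phi>:nat_trans R (sum_list l) (div_powers R m) (div_powers R l) ==> z:carrier (Gams m V) ==> \<phi> V z:H"
 shows "std_rels R l V<=H"
 unfolding std_rels_def
proof (rule mod_span_least[OF H], rule UN_least)
 fix m assume m: "m:{m. is_partition (sum_list l) m & ~ dominated m l}"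
 hence s: "sum_list m = sum_list l" by (simp add: is_partition_def)
 show "trace_sub R m (div_powers R l) V<=H"
 unfolding trace_sub_def s by (rule mod_span_least[OF H], rule UN_least, rule image_subsetI, rule g) (use m in simp_all)
qed

lemma subrep_std_rels: "subrep (sum_list l) (div_powers R l) (std_rels R l)"
proof (rule subrepI)
 fix V W :: "('a, 'u) module" and \<phi> y
 assume V: "V:fgp" and W: "W:fgp" and f: "\<phi>:Homs (sum_list l) V W" and y: "y:std_rels R l V"
 note ml = rep_mor_lin[OF is_rep_Gams V W f]
 let ?H = "{y\<in>carrier (Gams l V). on_mor (div_powers R l) V W \<phi> y:std_rels R l W}"
 have "std_rels R l V<=?H"
 proof (rule std_rels_least[OF submodule_preimage[OF module_Gams[OF V] module_Gams[OF W] ml submodule_std_rels[OF W]]])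
 fix m z and \<theta> :: "('a, 'u) module => ('a, ('a, 'u) tensor) tensor => ('a, ('a, 'u) tensor) tensor" assume m: "is_partition (sum_list l) m" "~ dominated m l"
 and t: "\<theta>:nat_trans R (sum_list l) (div_powers R m) (div_powers R l)" and z: "z:carrier (Gams m V)"
 have s: "sum_list m = sum_list l" using m by (simp add: is_partition_def)
 have z': "on_mor (div_powers R m) V W \<phi> z:carrier (Gams m W)"
 by (rule lin_closed[OF mod_hom_lin[OF Gams_mor_hom[of _ _ _ m, unfolded s, OF V W f]] z])
 have "\<theta> W (on_mor (div_powers R m) V W \<phi> z):trace_sub R m (div_powers R l) W"
 unfolding trace_sub_def s by (rule mod_span_superset, rule UN_I[where a = \<theta>, OF t]) (rule imageI[OF z'])
 hence "\<theta> W (on_mor (div_powers R m) V W \<phi> z):std_rels R l W"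
 unfolding std_rels_def by (intro mod_span_superset UN_I[where a = m]) (use m in simp_all)
 thus "\<theta> V z:?H"
 unfolding nat_transD(2)[OF t V W f z] using lin_closed[OF mod_hom_lin[OF nat_transD(1)[OF t V]] z] by (intro CollectI conjI)
 qed
 thus "on_mor (div_powers R l) V W \<phi> y:std_rels R l W" using y by blast
qed (rule submodule_std_rels)

text \<open>
 A vector of an exterior functor that behaves like the generator of \<open>\<Gamma>\<^sup>\<mu>\<close> has weight \<open>\<mu>\<close>: it is fixed
 by the idempotent that projects to the tensors of content \<open>\<mu>\<close>.
\<close>

lemma weight_span:
 fixes F :: "('a, 'u) module"
 assumes F: "F:fgp" and D: "free_dual F {..<length m} b \<zeta>" and m: "sum_list m = sum_list k"
 and w: "w:carrier (Exts k F)"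
 and fix_w: "!!\<phi>. \<phi>:Homs (sum_list k) F F ==> on_mor (div_powers R m) F F \<phi> (gen m F b) = gen m F b ==>
 on_mor (ext_powers R k) F F \<phi> w = w"
 and H: "submodule H R (Exts k F)"
 and I: "!!I. I:Idx (sum_list k) {..<length m} ==> ct (sum_list k) I = ctl m ==>
 ext_proj R k F (tb (sum_list k) F b I):H"
 shows "w:H"
proof -
 let ?d = "sum_list k" and ?T = "\<lambda>i\<in>{..<length m}. replicate_mset (m ! i) i"
 note MF = fgp_module[OF F]
 have DB: "dual_basis F {..<length m} b \<zeta>" using D by (simp add: free_dual_def)
 let ?O = "row_orbit m {..<length m} ?T" and ?g = "esum (sum_list m) F F \<zeta> b (row_orbit m {..<length m} ?T)"
 note gg = gen_to_gam[OF F D F dual_basis_mem[OF DB] finite_lessThan, of ?T]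
 have g: "?g:Homs ?d F F" using gg(1) unfolding m .
 obtain t where t: "t:Tens ?d F" "w = ext_proj R k F t" using ext_proj_surj[OF F w] by blast
 have gt: "?g t = finsum (tpow R ?d F) (%L. tc ?d F \<zeta> (tup ?d (%r. fst (L r))) t *[tpow R ?d F] tb ?d F (%p. b (snd p)) L) ?O"
 unfolding esum_def m using t(1) by (rule restrict_apply')
 have b': "(%p. b (snd p)):{..<length m}\<times>{..<length m} \<rightarrow> carrier F" using dual_basis_mem[OF DB] by auto
 have LP: "L:Idx ?d ({..<length m}\<times>{..<length m})" if "L:?O" for L using that unfolding m by blast
 have tcl: "tc ?d F \<zeta> (tup ?d (%r. fst (L r))) t:carrier R" if "L:?O" for L
 by (rule dual_basisD(5)[OF dual_basis_tpow[OF MF DB] idx_fst[OF LP[OF that]] t(1)])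
 have tbl: "tb ?d F (%p. b (snd p)) L:Tens ?d F" if "L:?O" for L by (rule tb_closed(2)[OF MF b' LP[OF that]])
 note el = ext_proj(1)[OF MF, of k]
 interpret TF: module R "tpow R ?d F" by (rule module_tpow[OF MF])
 have "w = on_mor (ext_powers R k) F F ?g w" by (rule fix_w[OF g gg(2), symmetric])
 also have "... = ext_proj R k F (?g t)" unfolding t(2) by (rule ext_proj_nat[OF F F g t(1)])
 also have "... = finsum (Exts k F) (%L. ext_proj R k F (tc ?d F \<zeta> (tup ?d (%r. fst (L r))) t *[tpow R ?d F] tb ?d F (%p. b (snd p)) L)) ?O"
 unfolding gt by (rule lin_finsum[OF TF.module_axioms module_Exts[OF MF] el], rule Pi_I, rule TF.smult_closed[OF tcl tbl])
 also have "...:H"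
 proof (rule submodule_finsum[OF H module_Exts[OF MF]], rule Pi_I)
 fix L assume L: "L:?O"
 let ?s = "\<lambda>r\<in>{..<?d}. snd (L r)"
 have e: "tb ?d F (%p. b (snd p)) L = tb ?d F b ?s" by (rule arg_cong[where f = "tpure R ?d F"], rule restrict_ext) simp
 have im: "image_mset f (\<Sum>i<n::nat. A i) = (\<Sum>i<n. image_mset f (A i))" for f :: "nat\<times>nat => nat" and A n by (induction n) simp_all
 have "ct ?d ?s = image_mset snd (ct ?d L)" unfolding ct_comp[symmetric] by (rule ct_cong) simp
 also have "ct ?d L = (\<Sum>i<length m. image_mset (Pair i) (?T i))" using L unfolding m by blast
 also have "image_mset snd ... = ctl m" unfolding im by (rule sum.cong) (simp_all add: multiset.map_comp comp_def)
 finally have "ext_proj R k F (tb ?d F b ?s):H" by (intro I idx_snd[OF LP[OF L]])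
 thus "ext_proj R k F (tc ?d F \<zeta> (tup ?d (%r. fst (L r))) t *[tpow R ?d F] tb ?d F (%p. b (snd p)) L):H"
 unfolding lin_smult[OF el tcl[OF L] tbl[OF L]] unfolding e by (rule submoduleD(4)[OF H module_Exts[OF MF] tcl[OF L]])
 qed
 finally show ?thesis .
qed

lemma ext_proj_not_dominated:
 assumes l: "sorted_wrt (>=) l" and V: "module R V" and b: "b:B \<rightarrow> carrier V"
 and I: "I:Idx (sum_list l) B" and c: "ct (sum_list l) I = ctl m" and nd: "~ dominated m l"
 shows "ext_proj R (conj_part l) V (tb (sum_list l) V b I) = \<zero>[Exts (conj_part l) V]"
proof -
 let ?c = "conj_part l"
 have "~ (ALL j<length ?c. inj_on (%i. I (pos ?c j i)) {..<?c ! j})" using columns_dominated[OF l c] nd by blast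
 then obtain j i i' where j: "j < length ?c" and i: "i < ?c ! j" "i' < ?c ! j" "i ~= i'" "I (pos ?c j i) = I (pos ?c j i')"
 unfolding inj_on_def by blast
 show ?thesis
 by (rule ext_proj_repeat[of _ _ ?c, unfolded sum_conj[OF l], OF V tb_closed(1)[OF V b I] j i(1,2,3)])
 (use i(4) pos_less[OF j i(1)] pos_less[OF j i(2)] in "simp add: sum_conj[OF l]")
qed

text \<open>The generator of \<open>\<Gamma>\<^sup>\<mu>\<close> goes to a vector of weight \<open>\<mu>\<close>, and if \<open>\<mu>\<close> is not dominated by \<open>\<lambda>\<close>, every
 product of wedges of content \<open>\<mu>\<close> has a repeated entry in some factor.\<close>

lemma weyl_map_std_rels:
 fixes V :: "('a, 'u) module"
 assumes l: "sorted_wrt (>=) l"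
 and U: "!!n::nat. EX F b \<zeta>. (F :: ('a, 'u) module):fgp & free_dual F {..<n} b \<zeta>"
 and V: "V:fgp" and y: "y:std_rels R l V"
 shows "weyl_map R l V y = \<zero>[Exts (conj_part l) V]"
proof -
 let ?c = "conj_part l" and ?d = "sum_list l"
 note MV = fgp_module[OF V]
 note wl = weyl_map_lin[OF l V]
 let ?H = "{y\<in>carrier (Gams l V). weyl_map R l V y:{\<zero>[Exts ?c V]}}"
 have "std_rels R l V<=?H"
 proof (rule std_rels_least[OF submodule_preimage[OF module_Gams[OF V] module_Exts[OF MV] wl submodule_zero[OF module_Exts[OF MV]]]])
 fix m z and \<eta> :: "('a, 'u) module => ('a, ('a, 'u) tensor) tensor => ('a, ('a, 'u) tensor) tensor" assume m: "is_partition ?d m" "~ dominated m l"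
 and t: "\<eta>:nat_trans R ?d (div_powers R m) (div_powers R l)" and z: "z:carrier (Gams m V)"
 have s: "sum_list m = ?d" using m by (simp add: is_partition_def)
 have sm: "sum_list m = sum_list ?c" unfolding s sum_conj[OF l] ..
 obtain F :: "('a, 'u) module" and b \<zeta> where F: "F:fgp" and D: "free_dual F {..<length m} b \<zeta>" using U by blast
 note MF = fgp_module[OF F]
 have DB: "dual_basis F {..<length m} b \<zeta>" using D by (simp add: free_dual_def)
 let ?e = "gen m F b"
 note e = div_incl_gen(1)[OF F D]
 obtain g where g: "g:Homs ?d F V" "on_mor (div_powers R m) F V g ?e = z"
 using gen_generates[OF F D V z] unfolding s by blast
 have te: "\<eta> F ?e:carrier (Gams l F)" by (rule lin_closed[OF mod_hom_lin[OF nat_transD(1)[OF t F]] e])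
 have "weyl_map R l F (\<eta> F ?e):{\<zero>[Exts ?c F]}"
 proof (rule weight_span[OF F D sm lin_closed[OF weyl_map_lin[OF l F] te] _ submodule_zero[OF module_Exts[OF MF]]])
 fix \<phi> assume f: "\<phi>:Homs (sum_list ?c) F F" and fe: "on_mor (div_powers R m) F F \<phi> ?e = ?e"
 have f': "\<phi>:Homs ?d F F" using f unfolding sum_conj[OF l] .
 show "on_mor (ext_powers R ?c) F F \<phi> (weyl_map R l F (\<eta> F ?e)) = weyl_map R l F (\<eta> F ?e)"
 unfolding weyl_map_nat[OF l F F f' te, symmetric] nat_transD(2)[OF t F F f' e, symmetric] fe ..
 next
 fix I assume I: "I:Idx (sum_list ?c) {..<length m}" and c: "ct (sum_list ?c) I = ctl m"
 show "ext_proj R ?c F (tb (sum_list ?c) F b I):{\<zero>[Exts ?c F]}"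
 unfolding singleton_iff sum_conj[OF l]
 by (rule ext_proj_not_dominated[OF l MF dual_basis_mem[OF DB] I[unfolded sum_conj[OF l]] c[unfolded sum_conj[OF l]] m(2)])
 qed
 hence 0: "weyl_map R l F (\<eta> F ?e) = \<zero>[Exts ?c F]" by (rule singletonD)
 have f: "g:Homs (sum_list ?c) F V" using g(1) unfolding sum_conj[OF l] .
 have "weyl_map R l V (\<eta> V z) = on_mor (ext_powers R ?c) F V g (weyl_map R l F (\<eta> F ?e))"
 unfolding g(2)[symmetric] nat_transD(2)[OF t F V g(1) e] by (rule weyl_map_nat[OF l F V g(1) te])
 also have "... = \<zero>[Exts ?c V]"
 unfolding 0 by (rule lin_zero[OF module_Exts[OF MF] module_Exts[OF MV] mod_hom_lin[OF Exts_mor_hom[OF F V f]]])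
 finally have w: "weyl_map R l V (\<eta> V z) = \<zero>[Exts ?c V]" .
 show "\<eta> V z:?H" unfolding mem_Collect_eq singleton_iff
 by (rule conjI[OF lin_closed[OF mod_hom_lin[OF nat_transD(1)[OF t V]] z] w])
 qed
 thus ?thesis using y by blast
qed

text \<open>Semistandard monomials are independent modulo the kernel, by triangularity of their images under
 the functionals above.\<close>

lemma weyl_kernel_free:
 fixes V :: "('a, 'u) module"
 assumes l: "sorted_wrt (>=) l"
 and U: "!!n::nat. EX F b \<zeta>. (F :: ('a, 'u) module):fgp & free_dual F {..<n} b \<zeta>"
 and V: "V:fgp" and D: "free_dual V (B :: nat set) x \<xi>" and y: "y:carrier (Gams l V)"
 and y0: "weyl_map R l V y = \<zero>[Exts (conj_part l) V]"
 shows "y:std_rels R l V"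
proof -
 let ?E = "Exts (conj_part l) V" and ?N = "std_rels R l V" and ?S = "{S\<in>Tabs l B. semistandard l S}"
 note MV = fgp_module[OF V]
 interpret G: module R "Gams l V" by (rule module_Gams[OF V])
 interpret E: module R ?E by (rule module_Exts[OF MV])
 note wl = weyl_map_lin[OF l V]
 have DB: "dual_basis V B x \<xi>" using D by (simp add: free_dual_def)
 note DG = dual_basis_Gams[OF V DB, of l]
 let ?m = "gam l V B x" let ?s = "%c. finsum (Gams l V) (%S. c S *[Gams l V] ?m S) ?S"
 note N = submoduleD[OF submodule_std_rels[OF V, of l] G.module_axioms]
 have fin: "finite ?S" using dual_basisD(1)[OF DG] by simp
 have mc: "?m S:carrier (Gams l V)" for S by (rule gam_closed[OF V dual_basis_mem[OF DB]])
 have cmc: "(%S. c S *[Gams l V] ?m S):?S \<rightarrow> carrier (Gams l V)" if "c:?S \<rightarrow> carrier R" for c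
 by (rule Pi_I, rule G.smult_closed[OF funcset_mem[OF that] mc])
 have sc: "?s c:carrier (Gams l V)" if "c:?S \<rightarrow> carrier R" for c by (rule G.finsum_closed[OF cmc[OF that]])
 let ?H = "{y\<in>carrier (Gams l V). EX n:?N. EX c:?S \<rightarrow> carrier R. y = n +[Gams l V] ?s c}"
 have mem: "n +[Gams l V] ?s c:?H" if "n:?N" "c:?S \<rightarrow> carrier R" for n c
 using that sc[OF that(2)] N(1) by blast
 have s0: "?s (%_. \<zero>) = \<zero>[Gams l V]"
 by (rule G.add.finprod_one_eqI) (rule G.smult_l_null[OF mc])
 have H: "submodule ?H R (Gams l V)"
 proof (rule submoduleI'[OF G.module_axioms])
 show "?H<=carrier (Gams l V)" by blast
 show "\<zero>[Gams l V]:?H" using mem[OF N(2), of "%_. \<zero>"] unfolding s0 by simp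
 next
 fix a a' assume "a:?H" "a':?H"
 then obtain n c n' c' where a: "n:?N" "c:?S \<rightarrow> carrier R" "a = n +[Gams l V] ?s c"
 "n':?N" "c':?S \<rightarrow> carrier R" "a' = n' +[Gams l V] ?s c'" by blast
 have cc: "(%S. c S \<oplus> c' S):?S \<rightarrow> carrier R"       by (rule Pi_I, rule a_closed[OF funcset_mem[OF a(2)] funcset_mem[OF a(5)]])
 have "?s (%S. c S \<oplus> c' S) = finsum (Gams l V) (%S. c S *[Gams l V] ?m S +[Gams l V] c' S *[Gams l V] ?m S) ?S"
 by (rule G.finsum_cong'[OF refl])
 (rule Pi_I, rule G.a_closed[OF funcset_mem[OF cmc[OF a(2)]] funcset_mem[OF cmc[OF a(5)]]], assumption+,
 rule G.smult_l_distr[OF funcset_mem[OF a(2)] funcset_mem[OF a(5)] mc])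
 also have "... = ?s c +[Gams l V] ?s c'" by (rule G.finsum_addf[OF cmc[OF a(2)] cmc[OF a(5)]])
 finally have e: "?s (%S. c S \<oplus> c' S) = ?s c +[Gams l V] ?s c'" .
 have "a +[Gams l V] a' = (n +[Gams l V] n') +[Gams l V] ?s (%S. c S \<oplus> c' S)"
 unfolding e a(3,6) using subsetD[OF N(1) a(1)] subsetD[OF N(1) a(4)] sc[OF a(2)] sc[OF a(5)] by (simp only: G.a_ac G.a_closed)
 thus "a +[Gams l V] a':?H" using mem[OF N(3)[OF a(1,4)] cc] by (simp only:)
 next
 fix k a assume k: "k:carrier R" and "a:?H"
 then obtain n c where a: "n:?N" "c:?S \<rightarrow> carrier R" "a = n +[Gams l V] ?s c" by blast
 have cc: "(%S. k\<otimes>c S):?S \<rightarrow> carrier R" by (rule Pi_I, rule m_closed[OF k funcset_mem[OF a(2)]])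
 have "?s (%S. k\<otimes>c S) = finsum (Gams l V) (%S. k *[Gams l V] (c S *[Gams l V] ?m S)) ?S"
 by (rule G.finsum_cong'[OF refl])
 (rule Pi_I, rule G.smult_closed[OF k funcset_mem[OF cmc[OF a(2)]]], assumption,
 rule G.smult_assoc1[OF k funcset_mem[OF a(2)] mc])
 also have "... = k *[Gams l V] ?s c" by (rule G.finsum_smult_ldistr[symmetric, OF fin k cmc[OF a(2)]])
 finally have e: "?s (%S. k\<otimes>c S) = k *[Gams l V] ?s c" .
 have "k *[Gams l V] a = (k *[Gams l V] n) +[Gams l V] ?s (%S. k\<otimes>c S)"
 unfolding e a(3) by (rule G.smult_r_distr[OF k subsetD[OF N(1) a(1)] sc[OF a(2)]])
 thus "k *[Gams l V] a:?H" using mem[OF N(4)[OF k a(1)] cc] by (simp only:)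
 qed
 have NH: "?N<=?H"
 proof (rule subsetI)
 fix n assume n: "n:?N"
 have "n = n +[Gams l V] ?s (%_. \<zero>)" unfolding s0 using subsetD[OF N(1) n] by simp
 thus "n:?H" using mem[OF n, of "%_. \<zero>"] by simp
 qed
 have SH: "?m S:?H" if S: "S:Tabs l B" "semistandard l S" for S
 proof -
 let ?i = "%S'. if S' = S then \<one> else \<zero>"
 have SS: "S:?S" using S by blast
 have "?s ?i = ?i S *[Gams l V] ?m S"
 by (rule finsum_one_term[OF G.module_axioms SS _ _ fin]) (simp_all add: mc G.smult_l_null)
 also have "... = ?m S" using mc[of S] by simp
 finally have e: "\<zero>[Gams l V] +[Gams l V] ?s ?i = ?m S" using mc[of S] by simp
 show ?thesis using mem[OF N(2), of ?i] unfolding e by simp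
 qed
 obtain F :: "('a, 'u) module" and b \<zeta> where F: "F:fgp" "free_dual F {..<Suc (length l)} b \<zeta>" using U by blast
 have "y:?H" by (rule straightening[OF F V D H NH SH y])
 then obtain n c where c: "n:?N" "c:?S \<rightarrow> carrier R" "y = n +[Gams l V] ?s c" by blast
 have w0: "weyl_map R l V (?s c) = \<zero>[?E]"
 using y0 unfolding c(3) lin_add[OF wl subsetD[OF N(1) c(1)] sc[OF c(2)]] weyl_map_std_rels[OF l U V c(1)]
 using lin_closed[OF wl sc[OF c(2)]] by simp
 have cz: "c S = \<zero>" if "S:?S" for S
 using that
 proof (induction "wt (length l) S" arbitrary: S rule: less_induct)
 case (less S)
 have S: "S:Tabs l B" "semistandard l S" using less.prems by blast+
 obtain \<delta> where d: "lin R ?E (ring_as_mod R) \<delta>" "\<delta> (weyl_map R l V (?m S)) = \<one>"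
 "ALL T:Tabs l B - {S}. \<delta> (weyl_map R l V (?m T)) ~= \<zero> --> wt (length l) T < wt (length l) S"
 by (rule weyl_functional[OF l V D S])
 note dl = lin_comp[OF wl d(1)]
 have dc: "\<delta> (weyl_map R l V (?m T)):carrier R" for T using lin_closed[OF dl mc[of T]] by simp
 have dT: "\<delta> (weyl_map R l V (c T *[Gams l V] ?m T)) = c T\<otimes>\<delta> (weyl_map R l V (?m T))" if "T:?S" for T
 using lin_smult[OF dl funcset_mem[OF c(2) that] mc[of T]] by simp
 have "\<zero> = \<delta> (weyl_map R l V (?s c))" unfolding w0 using lin_zero[OF E.module_axioms module_ring d(1)] by simp
 also have "... = finsum (ring_as_mod R) (%T. \<delta> (weyl_map R l V (c T *[Gams l V] ?m T))) ?S"
 by (rule lin_finsum[OF G.module_axioms module_ring dl cmc[OF c(2)]])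
 also have "... = \<delta> (weyl_map R l V (c S *[Gams l V] ?m S))"
 proof (rule finsum_one_term[OF module_ring less.prems _ _ fin])
 show "\<delta> (weyl_map R l V (c S *[Gams l V] ?m S)):carrier (ring_as_mod R)"
 unfolding dT[OF less.prems] using funcset_mem[OF c(2) less.prems] dc by simp
 fix T assume T: "T:?S" and ne: "T ~= S"
 show "\<delta> (weyl_map R l V (c T *[Gams l V] ?m T)) = \<zero>[ring_as_mod R]"
 proof (cases "\<delta> (weyl_map R l V (?m T)) = \<zero>")
 case True thus ?thesis unfolding dT[OF T] using funcset_mem[OF c(2) T] by simp
 next
 case False
 have "wt (length l) T < wt (length l) S" using d(3) T ne False by blast
 from less.hyps[OF this T] show ?thesis unfolding dT[OF T] using dc by simp
 qed
 qed
 also have "... = c S" unfolding dT[OF less.prems] d(2) using funcset_mem[OF c(2) less.prems] by simp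
 finally show ?case ..
 qed
 have "?s c = \<zero>[Gams l V]" by (rule G.add.finprod_one_eqI) (simp only: cz G.smult_l_null[OF mc])
 hence "y = n" unfolding c(3) using subsetD[OF N(1) c(1)] by simp
 thus ?thesis using c(1) by simp
qed

end

lemma (in abelian_group) minus_zero_iff:
 assumes "x:carrier G" "y:carrier G"
 shows "x \<ominus> y = \<zero> \<longleftrightarrow> x = y"
proof
 assume "x \<ominus> y = \<zero>"
 hence "(x \<oplus> \<ominus> y) \<oplus> y = y" using assms by (simp add: minus_eq)
 thus "x = y" using assms by (simp add: a_assoc l_neg)
qed (use assms in "simp add: minus_eq r_neg")

context cring
begin

text \<open>An arbitrary object is a retract of a free one.\<close>

lemma weyl_kernel:
 fixes V :: "('a, 'u) module"
 assumes l: "sorted_wrt (>=) l"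
 and U: "!!n::nat. EX F b \<zeta>. (F :: ('a, 'u) module):fgp & free_dual F {..<n} b \<zeta>"
 and V: "V:fgp" and y: "y:carrier (Gams l V)"
 shows "weyl_map R l V y = \<zero>[Exts (conj_part l) V] \<longleftrightarrow> y:std_rels R l V"
proof
 assume y0: "weyl_map R l V y = \<zero>[Exts (conj_part l) V]"
 let ?d = "sum_list l" and ?c = "conj_part l" and ?G = "div_powers R l :: ('a, 'u, ('a, ('a, 'u) tensor) tensor) sp_functor"
 note MV = fgp_module[OF V]
 obtain n :: nat and x \<xi> where DV: "dual_basis V {..<n} x \<xi>" using fg_projective_dual_basis[OF V] .
 obtain F :: "('a, 'u) module" and b \<zeta> where F: "F:fgp" and D: "free_dual F {..<n} b \<zeta>" using U by blast
 note MF = fgp_module[OF F]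
 interpret MV: module R V by (rule MV)
 interpret MF: module R F by (rule MF)
 have DF: "dual_basis F {..<n} b \<zeta>" using D by (simp add: free_dual_def)
 define i where "i v = finsum F (%q. \<xi> q v *[F] b q) {..<n}" for v
 define p where "p w = finsum V (%q. \<zeta> q w *[V] x q) {..<n}" for w
 have il: "lin R V F i" unfolding i_def by (rule lin_sum[OF MV MF _ dual_basis_mem[OF DF]]) (rule dual_basisD(3)[OF DV])
 have pl: "lin R F V p" unfolding p_def by (rule lin_sum[OF MF MV _ dual_basis_mem[OF DV]]) (rule dual_basisD(3)[OF DF])
 have pb: "p (b q) = x q" if q: "q:{..<n}" for q
 proof -
 have "p (b q) = \<zeta> q (b q) *[V] x q" unfolding p_def
 by (rule finsum_one_term[OF MV q]) (use D q dual_basisD(2)[OF DV] in "simp_all add: free_dual_def")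
 thus ?thesis using D q dual_basisD(2)[OF DV q] by (simp add: free_dual_def)
 qed
 have pi: "p (i v) = v" if v: "v:carrier V" for v
 proof -
 have "p (i v) = finsum V (%q. p (\<xi> q v *[F] b q)) {..<n}" unfolding i_def
 by (rule lin_finsum[OF MF MV pl], rule Pi_I, rule MF.smult_closed[OF dual_basisD(5)[OF DV _ v] dual_basisD(2)[OF DF]])
 also have "... = finsum V (%q. \<xi> q v *[V] x q) {..<n}"
 proof (rule MV.finsum_cong'[OF refl])
 show "(%q. \<xi> q v *[V] x q):{..<n} \<rightarrow> carrier V"
 by (rule Pi_I, rule MV.smult_closed[OF dual_basisD(5)[OF DV _ v] dual_basisD(2)[OF DV]])
 fix q assume q: "q:{..<n}"
 show "p (\<xi> q v *[F] b q) = \<xi> q v *[V] x q"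
 unfolding lin_smult[OF pl dual_basisD(5)[OF DV q v] dual_basisD(2)[OF DF q]] pb[OF q] ..
 qed
 also have "... = v" by (rule dual_basisD(4)[OF DV v])
 finally show ?thesis .
 qed
 let ?i = "tensor_map R ?d (%_. V) (%_. F) (%_. i)" and ?p = "tensor_map R ?d (%_. F) (%_. V) (%_. p)"
 note i = sp_hom_of_lin[OF MV MF il] and p = sp_hom_of_lin[OF MF MV pl]
 have id: "compose (Tens ?d V) ?p ?i = (\<lambda>t\<in>Tens ?d V. t)"
 proof (rule sp_hom_eqI[OF sp_hom_comp[OF i(1) p(1) MV] sp_hom_id[OF MV]])
 fix t assume t: "t:Tens ?d V"
 have "?p (?i t) = t"
 proof (rule tpow_lin_eqI[OF MV module_tpow[OF MV] lin_comp[OF sp_hom_lin[OF i(1)] sp_hom_lin[OF p(1)]] lin_id _ t])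
 fix v assume v: "v:tensor_base ?d (%_. V)"
 have iv: "(tup ?d (%r. i (v r))):tensor_base ?d (%_. F)"
 unfolding tensor_base_def by (rule idxI) (rule lin_closed[OF il tensor_baseD[OF v]])
 have e: "(tup ?d (%r. p ((tup ?d (%r. i (v r))) r))) = v"
 by (rule tensor_base_eqI[OF _ v]) (simp_all add: tensor_base_def pi tensor_baseD[OF v])
 show "?p (?i (tpure R ?d V v)) = tpure R ?d V v" unfolding i(2)[OF v] p(2)[OF iv] e ..
 qed
 thus "compose (Tens ?d V) ?p ?i t = (\<lambda>t\<in>Tens ?d V. t) t" using t by (simp add: compose_def)
 qed
 let ?y = "on_mor ?G V F ?i y"
 have G: "is_rep R ?d ?G" by (rule is_rep_Gams)
 have yc: "?y:carrier (Gams l F)" by (rule rep_mor_closed[OF G V F i(1) y])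
 have i': "?i:Homs (sum_list ?c) V F" using i(1) unfolding sum_conj[OF l] .
 have "weyl_map R l F ?y = \<zero>[Exts ?c F]"
 unfolding weyl_map_nat[OF l V F i(1) y] y0
 by (rule lin_zero[OF module_Exts[OF MV] module_Exts[OF MF] mod_hom_lin[OF Exts_mor_hom[OF V F i']]])
 hence "?y:std_rels R l F" by (rule weyl_kernel_free[OF l U F D yc])
 hence "on_mor ?G F V ?p ?y:std_rels R l V" by (rule subrep_mor[OF subrep_std_rels F V p(1)])
 moreover have "on_mor ?G F V ?p ?y = y"
 unfolding rep_comp_mor[OF G V F V i(1) p(1) y, symmetric] id by (rule rep_id_mor[OF G V y])
 ultimately show "y:std_rels R l V" by simp
qed (rule weyl_map_std_rels[OF l U V])

section \<open>Natural transformations\<close>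

lemma nat_transI:
 fixes X :: "('a, 'u, 'x) sp_functor" and Y :: "('a, 'u, 'y) sp_functor"
 assumes X: "is_rep R d X"
 and lin: "!!V. V:fgp ==> lin R (on_obj X V) (on_obj Y V) (h V)"
 and nat: "!!V W \<phi> x. V:fgp ==> W:fgp ==> \<phi>:Homs d V W ==> x:carrier (on_obj X V) ==>
 h W (on_mor X V W \<phi> x) = on_mor Y V W \<phi> (h V x)"
 shows "(\<lambda>V\<in>fgp. \<lambda>x\<in>carrier (on_obj X V). h V x):nat_trans R d X Y"
 unfolding nat_trans_def
proof (intro CollectI conjI ballI)
 show "(\<lambda>V\<in>fgp. \<lambda>x\<in>carrier (on_obj X V). h V x):(\<Pi>\<^sub>E V\<in>fgp. mod_hom R (on_obj X V) (on_obj Y V))"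
 by (rule restrict_PiE_iff[THEN iffD2], rule ballI, rule lin_restrict[OF rep_module[OF X] lin])
 fix V W :: "('a, 'u) module" and \<phi> x
 assume a: "V:fgp" "W:fgp" "\<phi>:Homs d V W" "x:carrier (on_obj X V)"
 show "(\<lambda>V\<in>fgp. \<lambda>x\<in>carrier (on_obj X V). h V x) W (on_mor X V W \<phi> x) =
 on_mor Y V W \<phi> ((\<lambda>V\<in>fgp. \<lambda>x\<in>carrier (on_obj X V). h V x) V x)"
 using nat[OF a] rep_mor_closed[OF X a] a by simp
qed

lemmas nat_trans_lin = mod_hom_lin[OF nat_transD(1)]
lemmas nat_trans_closed = lin_closed[OF nat_trans_lin]

text \<open>The universal property of a quotient functor.\<close>

lemma nat_trans_factor:
 fixes X :: "('a, 'u, 'x) sp_functor" and Y :: "('a, 'u, 'y) sp_functor" and Z :: "('a, 'u, 'z) sp_functor"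
 assumes X: "is_rep R d X" and Y: "is_rep R d Y" and Z: "is_rep R d Z"
 and p: "p:nat_trans R d X Y" and q: "q:nat_trans R d X Z"
 and surj: "!!V w. V:fgp ==> w:carrier (on_obj Y V) ==> EX x:carrier (on_obj X V). p V x = w"
 and ker: "!!V x. V:fgp ==> x:carrier (on_obj X V) ==> p V x = \<zero>[on_obj Y V] ==> q V x = \<zero>[on_obj Z V]"
 obtains \<theta> where "\<theta>:nat_trans R d Y Z" "ALL V:fgp. ALL x:carrier (on_obj X V). \<theta> V (p V x) = q V x"
proof -
 define h where "h V w = q V (SOME x. x:carrier (on_obj X V) & p V x = w)" for V w
 have h: "h V (p V x) = q V x" if V: "V:fgp" and x: "x:carrier (on_obj X V)" for V x
 proof -
 interpret XV: module R "on_obj X V" by (rule rep_module[OF X V])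
 interpret YV: module R "on_obj Y V" by (rule rep_module[OF Y V])
 interpret ZV: module R "on_obj Z V" by (rule rep_module[OF Z V])
 note pl = nat_trans_lin[OF p V] and ql = nat_trans_lin[OF q V]
 define x' where "x' = (SOME x'. x':carrier (on_obj X V) & p V x' = p V x)"
 have "EX x'. x':carrier (on_obj X V) & p V x' = p V x" using x by blast
 from someI_ex[OF this] have x': "x':carrier (on_obj X V)" "p V x' = p V x" unfolding x'_def by blast+
 have "p V (x' \<ominus>\<^bsub>on_obj X V\<^esub> x) = \<zero>[on_obj Y V]"
 unfolding lin_minus[OF XV.module_axioms YV.module_axioms pl x'(1) x] x'(2) using lin_closed[OF pl x] by (simp add: YV.minus_eq YV.r_neg)
 hence "q V (x' \<ominus>\<^bsub>on_obj X V\<^esub> x) = \<zero>[on_obj Z V]" by (rule ker[OF V XV.minus_closed[OF x'(1) x]])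
 hence "q V x' = q V x"
 unfolding lin_minus[OF XV.module_axioms ZV.module_axioms ql x'(1) x]
 ZV.minus_zero_iff[OF lin_closed[OF ql x'(1)] lin_closed[OF ql x]] .
 thus ?thesis unfolding h_def x'_def[symmetric] .
 qed
 have "(\<lambda>V\<in>fgp. \<lambda>w\<in>carrier (on_obj Y V). h V w):nat_trans R d Y Z"
 proof (rule nat_transI[OF Y])
 fix V :: "('a, 'u) module" assume V: "V:fgp"
 interpret XV: module R "on_obj X V" by (rule rep_module[OF X V])
 note pl = nat_trans_lin[OF p V] and ql = nat_trans_lin[OF q V]
 show "lin R (on_obj Y V) (on_obj Z V) (h V)"
 proof (rule linI)
 fix w assume w: "w:carrier (on_obj Y V)"
 obtain x where x: "x:carrier (on_obj X V)" "p V x = w" using surj[OF V w] by blast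
 show "h V w:carrier (on_obj Z V)" unfolding x(2)[symmetric] h[OF V x(1)] by (rule lin_closed[OF ql x(1)])
 fix c assume c: "c:carrier R"
 show "h V (c *[on_obj Y V] w) = c *[on_obj Z V] h V w"
 unfolding x(2)[symmetric] lin_smult[OF pl c x(1), symmetric] h[OF V x(1)] h[OF V XV.smult_closed[OF c x(1)]]
 by (rule lin_smult[OF ql c x(1)])
 next
 fix w w' assume w: "w:carrier (on_obj Y V)" "w':carrier (on_obj Y V)"
 obtain x where x: "x:carrier (on_obj X V)" "p V x = w" using surj[OF V w(1)] by blast
 obtain x' where x': "x':carrier (on_obj X V)" "p V x' = w'" using surj[OF V w(2)] by blast
 show "h V (w +[on_obj Y V] w') = h V w +[on_obj Z V] h V w'"
 unfolding x(2)[symmetric] x'(2)[symmetric] lin_add[OF pl x(1) x'(1), symmetric] h[OF V x(1)] h[OF V x'(1)]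
 h[OF V XV.a_closed[OF x(1) x'(1)]]
 by (rule lin_add[OF ql x(1) x'(1)])
 qed
 next
 fix V W :: "('a, 'u) module" and \<phi> w
 assume V: "V:fgp" and W: "W:fgp" and f: "\<phi>:Homs d V W" and w: "w:carrier (on_obj Y V)"
 obtain x where x: "x:carrier (on_obj X V)" "p V x = w" using surj[OF V w] by blast
 show "h W (on_mor Y V W \<phi> w) = on_mor Z V W \<phi> (h V w)"
 unfolding x(2)[symmetric] nat_transD(2)[OF p V W f x(1), symmetric] h[OF V x(1)] h[OF W rep_mor_closed[OF X V W f x(1)]]
 by (rule nat_transD(2)[OF q V W f x(1)])
 qed
 moreover have "ALL V:fgp. ALL x:carrier (on_obj X V). (\<lambda>V\<in>fgp. \<lambda>w\<in>carrier (on_obj Y V). h V w) V (p V x) = q V x"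
 using h nat_trans_closed[OF p] by simp
 ultimately show thesis by (rule that)
qed

lemma rep_comp_apply: "V:fgp ==> x:carrier (on_obj X V) ==> rep_comp R X \<theta> \<eta> V x = \<theta> V (\<eta> V x)"
 by (simp add: rep_comp_def compose_def)

lemma nat_trans_comp:
 fixes X :: "('a, 'u, 'x) sp_functor" and Y :: "('a, 'u, 'y) sp_functor" and Z :: "('a, 'u, 'z) sp_functor"
 assumes X: "is_rep R d X" and e: "\<eta>:nat_trans R d X Y" and t: "\<theta>:nat_trans R d Y Z"
 shows "rep_comp R X \<theta> \<eta>:nat_trans R d X Z"
 unfolding rep_comp_def compose_def
proof (rule nat_transI[OF X])
 show "lin R (on_obj X V) (on_obj Z V) (%x. \<theta> V (\<eta> V x))" if V: "V:fgp" for V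
 by (rule lin_comp[OF nat_trans_lin[OF e V] nat_trans_lin[OF t V]])
 show "\<theta> W (\<eta> W (on_mor X V W \<phi> x)) = on_mor Z V W \<phi> (\<theta> V (\<eta> V x))"
 if "V:fgp" "W:fgp" "\<phi>:Homs d V W" "x:carrier (on_obj X V)" for V W \<phi> x
 unfolding nat_transD(2)[OF e that] by (rule nat_transD(2)[OF t that(1-3) nat_trans_closed[OF e that(1,4)]])
qed

lemma nat_trans_id: "is_rep R d X ==> rep_id R X:nat_trans R d X X"
 unfolding rep_id_def by (rule nat_transI) (rule lin_id refl | assumption)+

lemma rep_hom_ops:
 fixes X :: "('a, 'u, 'x) sp_functor" and Y :: "('a, 'u, 'y) sp_functor"
 assumes X: "is_rep R d X" and Y: "is_rep R d Y" and e: "\<eta>:nat_trans R d X Y"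
 shows "\<theta>:nat_trans R d X Y ==> \<eta> +[rep_hom R d X Y] \<theta>:nat_trans R d X Y"
 and "c:carrier R ==> c *[rep_hom R d X Y] \<eta>:nat_trans R d X Y"
proof -
 assume t: "\<theta>:nat_trans R d X Y"
 have "(\<lambda>V\<in>fgp. \<lambda>x\<in>carrier (on_obj X V). \<eta> V x +[on_obj Y V] \<theta> V x):nat_trans R d X Y"
 proof (rule nat_transI[OF X])
 fix V :: "('a, 'u) module" assume V: "V:fgp"
 interpret YV: module R "on_obj Y V" by (rule rep_module[OF Y V])
 note l = nat_trans_lin[OF e V] nat_trans_lin[OF t V]
 show "lin R (on_obj X V) (on_obj Y V) (%x. \<eta> V x +[on_obj Y V] \<theta> V x)"
 by (rule linI) (simp_all add: lin_closed[OF l(1)] lin_closed[OF l(2)] lin_add[OF l(1)] lin_add[OF l(2)]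
 lin_smult[OF l(1)] lin_smult[OF l(2)] YV.smult_r_distr YV.a_ac)
 fix W :: "('a, 'u) module" and \<phi> x
 assume W: "W:fgp" and f: "\<phi>:Homs d V W" and x: "x:carrier (on_obj X V)"
 show "\<eta> W (on_mor X V W \<phi> x) +[on_obj Y W] \<theta> W (on_mor X V W \<phi> x) =
 on_mor Y V W \<phi> (\<eta> V x +[on_obj Y V] \<theta> V x)"
 unfolding nat_transD(2)[OF e V W f x] nat_transD(2)[OF t V W f x]
 by (rule lin_add[OF rep_mor_lin[OF Y V W f] lin_closed[OF l(1) x] lin_closed[OF l(2) x], symmetric])
 qed
 thus "\<eta> +[rep_hom R d X Y] \<theta>:nat_trans R d X Y" by (simp add: rep_hom_def)
next
 assume c: "c:carrier R"
 have "(\<lambda>V\<in>fgp. \<lambda>x\<in>carrier (on_obj X V). c *[on_obj Y V] \<eta> V x):nat_trans R d X Y"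
 proof (rule nat_transI[OF X])
 fix V :: "('a, 'u) module" assume V: "V:fgp"
 interpret YV: module R "on_obj Y V" by (rule rep_module[OF Y V])
 note l = nat_trans_lin[OF e V]
 have cc: "c *[on_obj Y V] (k *[on_obj Y V] y) = k *[on_obj Y V] (c *[on_obj Y V] y)"
 if "k:carrier R" "y:carrier (on_obj Y V)" for k y
 using that c by (simp add: YV.smult_assoc1[symmetric] m_comm)
 show "lin R (on_obj X V) (on_obj Y V) (%x. c *[on_obj Y V] \<eta> V x)"
 by (rule linI) (simp_all add: c lin_closed[OF l] lin_add[OF l] lin_smult[OF l] YV.smult_r_distr cc)
 fix W :: "('a, 'u) module" and \<phi> x
 assume W: "W:fgp" and f: "\<phi>:Homs d V W" and x: "x:carrier (on_obj X V)"
 show "c *[on_obj Y W] \<eta> W (on_mor X V W \<phi> x) = on_mor Y V W \<phi> (c *[on_obj Y V] \<eta> V x)"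
 unfolding nat_transD(2)[OF e V W f x]
 by (rule lin_smult[OF rep_mor_lin[OF Y V W f] c lin_closed[OF l x], symmetric])
 qed
 thus "c *[rep_hom R d X Y] \<eta>:nat_trans R d X Y" by (simp add: rep_hom_def)
qed

section \<open>Weyl functors and standard objects\<close>

abbreviation weyl_sub :: "nat list => ('a, 'u) module => ('a, ('a, 'u) tensor set) tensor set" where
 "weyl_sub l V \<equiv> weyl_map R l V ` carrier (Gams l V)"

lemma subrep_weyl:
 assumes l: "sorted_wrt (>=) l"
 shows "subrep (sum_list l) (ext_powers R (conj_part l)) (weyl_sub l)"
proof (rule subrepI)
 show "submodule (weyl_sub l V) R (Exts (conj_part l) V)" if V: "V:fgp" for V
 by (rule submodule_image[OF module_Gams[OF V] module_Exts[OF fgp_module[OF V]] weyl_map_lin[OF l V]])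
 fix V W :: "('a, 'u) module" and \<phi> w
 assume V: "V:fgp" and W: "W:fgp" and f: "\<phi>:Homs (sum_list l) V W" and w: "w:weyl_sub l V"
 then obtain y where y: "y:carrier (Gams l V)" "w = weyl_map R l V y" by blast
 show "on_mor (ext_powers R (conj_part l)) V W \<phi> w:weyl_sub l W"
 unfolding y(2) weyl_map_nat[OF l V W f y(1), symmetric] by (rule imageI[OF rep_mor_closed[OF is_rep_Gams V W f y(1)]])
qed

lemma is_rep_weyl:
 assumes l: "sorted_wrt (>=) l"
 shows "is_rep R (sum_list l) (weyl R l)"
 unfolding weyl_def by (rule is_rep_sub[OF is_rep_Exts[of "conj_part l", unfolded sum_conj[OF l]] subrep_weyl[OF l]])

lemma is_rep_std_obj: "is_rep R (sum_list l) (std_obj R l)"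
 unfolding std_obj_def by (rule is_rep_quot[OF is_rep_Gams subrep_std_rels])

lemma std_obj_eq: "on_obj (std_obj R l) V = quot_mod (Gams l V) (std_rels R l V)"
 by (simp add: std_obj_def quot_functor_def)

lemma weyl_epi:
 fixes l :: "nat list"
 assumes l: "sorted_wrt (>=) l"
 shows "(weyl_epi R l :: ('a, 'u) module => _):nat_trans R (sum_list l) (div_powers R l) (weyl R l)"
 unfolding weyl_epi_def
proof (rule nat_transI[OF is_rep_Gams])
 fix V :: "('a, 'u) module" assume V: "V:fgp"
 note wl = weyl_map_lin[OF l V]
 show "lin R (Gams l V) (on_obj (weyl R l) V) (weyl_map R l V)"
 by (rule linI) (simp_all add: weyl_def sub_functor_def lin_add[OF wl] lin_smult[OF wl])
 fix W :: "('a, 'u) module" and \<phi> x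
 assume W: "W:fgp" and f: "\<phi>:Homs (sum_list l) V W" and x: "x:carrier (Gams l V)"
 show "weyl_map R l W (on_mor (div_powers R l) V W \<phi> x) = on_mor (weyl R l) V W \<phi> (weyl_map R l V x)"
 unfolding weyl_map_nat[OF l V W f x] using x by (simp add: weyl_def sub_functor_def)
qed

lemma std_epi: "(std_epi R l :: ('a, 'u) module => _):nat_trans R (sum_list l) (div_powers R l) (std_obj R l)"
proof -
 have "(\<lambda>V\<in>fgp. \<lambda>x\<in>carrier (Gams l V). quot_proj (Gams l V) (std_rels R l V) x) :
 nat_trans R (sum_list l) (div_powers R l) (std_obj R l :: ('a, 'u, _) sp_functor)"
 proof (rule nat_transI[OF is_rep_Gams])
 fix V :: "('a, 'u) module" assume V: "V:fgp"
 show "lin R (Gams l V) (on_obj (std_obj R l) V) (quot_proj (Gams l V) (std_rels R l V))"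
 unfolding std_obj_eq by (rule lin_quot_proj[OF module_Gams[OF V] submodule_std_rels[OF V]])
 fix W :: "('a, 'u) module" and \<phi> x
 assume W: "W:fgp" and f: "\<phi>:Homs (sum_list l) V W" and x: "x:carrier (Gams l V)"
 show "quot_proj (Gams l W) (std_rels R l W) (on_mor (div_powers R l) V W \<phi> x) =
 on_mor (std_obj R l) V W \<phi> (quot_proj (Gams l V) (std_rels R l V) x)"
 unfolding std_obj_def by (rule quot_functor_mor[OF is_rep_Gams subrep_std_rels V W f x, symmetric])
 qed
 moreover have "(\<lambda>x\<in>carrier (Gams l V). quot_proj (Gams l V) (std_rels R l V) x) = quot_proj (Gams l V) (std_rels R l V)"
 for V :: "('a, 'u) module"
 unfolding quot_proj_def by (rule restrict_ext) simp
 ultimately show ?thesis unfolding std_epi_def by simp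
qed

end

section \<open>Weyl functors are standard objects\<close>

context cring
begin

lemma weyl_epi_apply: "V:fgp ==> y:carrier (Gams l V) ==> weyl_epi R l V y = weyl_map R l V y"
 by (simp add: weyl_epi_def)

lemma std_epi_apply: "V:fgp ==> std_epi R l V y = quot_proj (Gams l V) (std_rels R l V) y"
 by (simp add: std_epi_def)

lemma std_epi_surj: "V:fgp ==> w:carrier (on_obj (std_obj R l) V) ==> EX y:carrier (Gams l V). std_epi R l V y = w"
 unfolding std_obj_eq quot_carrier std_epi_apply by blast

lemma std_epi_zero_iff:
 "V:fgp ==> y:carrier (Gams l V) ==> std_epi R l V y = \<zero>[on_obj (std_obj R l) V] \<longleftrightarrow> y:std_rels R l V"
 unfolding std_obj_eq std_epi_apply by (rule quot_proj_zero_iff[OF module_Gams submodule_std_rels])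

lemma weyl_iso_std:
 fixes l :: "nat list"
 assumes l: "sorted_wrt (>=) l"
 and U: "!!n::nat. EX F b \<zeta>. (F :: ('a, 'u) module):fgp & free_dual F {..<n} b \<zeta>"
 shows "EX \<theta>. rep_iso R (sum_list l) (weyl R l :: ('a, 'u, ('a, ('a, 'u) tensor set) tensor) sp_functor)
 (std_obj R l :: ('a, 'u, ('a, ('a, 'u) tensor) tensor set) sp_functor) \<theta> &
 rep_comp R (div_powers R l) \<theta> (weyl_epi R l) = std_epi R l"
proof -
 let ?d = "sum_list l" and ?G = "div_powers R l :: ('a, 'u, ('a, ('a, 'u) tensor) tensor) sp_functor"
 let ?W = "weyl R l :: ('a, 'u, ('a, ('a, 'u) tensor set) tensor) sp_functor"
 let ?D = "std_obj R l :: ('a, 'u, ('a, ('a, 'u) tensor) tensor set) sp_functor"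
 note G = is_rep_Gams[of l] and W = is_rep_weyl[OF l] and D = is_rep_std_obj[of l]
 have Wc: "EX y:carrier (Gams l V). weyl_epi R l V y = w" if V: "V:fgp" and w: "w:carrier (on_obj ?W V)" for V w
 proof -
 have "w:weyl_sub l V" using w by (simp add: weyl_def sub_functor_def)
 then obtain y where "y:carrier (Gams l V)" "w = weyl_map R l V y" by blast
 thus ?thesis using weyl_epi_apply[OF V] by metis
 qed
 have ker: "weyl_epi R l V y = \<zero>[on_obj ?W V] \<longleftrightarrow> std_epi R l V y = \<zero>[on_obj ?D V]"
 if V: "V:fgp" and y: "y:carrier (Gams l V)" for V :: "('a, 'u) module" and y
 proof -
 have "\<zero>[on_obj ?W V] = \<zero>[Exts (conj_part l) V]" by (simp add: weyl_def sub_functor_def)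
 thus ?thesis unfolding weyl_epi_apply[OF V y] std_epi_zero_iff[OF V y] by (simp only: weyl_kernel[OF l U V y])
 qed
 obtain \<theta> where t: "\<theta>:nat_trans R ?d ?W ?D" "ALL V:fgp. ALL y:carrier (Gams l V). \<theta> V (weyl_epi R l V y) = std_epi R l V y"
 by (rule nat_trans_factor[OF G W D weyl_epi[OF l] std_epi Wc]) (use ker in blast)+
 obtain \<theta>' where t': "\<theta>':nat_trans R ?d ?D ?W" "ALL V:fgp. ALL y:carrier (Gams l V). \<theta>' V (std_epi R l V y) = weyl_epi R l V y"
 by (rule nat_trans_factor[OF G D W std_epi weyl_epi[OF l] std_epi_surj]) (use ker in blast)+
 have "rep_comp R ?W \<theta>' \<theta> = rep_id R ?W"
 proof (rule nat_trans_eqI[OF nat_trans_comp[OF W t(1) t'(1)] nat_trans_id[OF W]])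
 fix V w assume V: "V:fgp" and w: "w:carrier (on_obj ?W V)"
 obtain y where y: "y:carrier (Gams l V)" "weyl_epi R l V y = w" using Wc[OF V w] by blast
 show "rep_comp R ?W \<theta>' \<theta> V w = rep_id R ?W V w"
 unfolding rep_comp_apply[OF V w] using t(2) t'(2) V y w by (auto simp: rep_id_def)
 qed
 moreover have "rep_comp R ?D \<theta> \<theta>' = rep_id R ?D"
 proof (rule nat_trans_eqI[OF nat_trans_comp[OF D t'(1) t(1)] nat_trans_id[OF D]])
 fix V w assume V: "V:fgp" and w: "w:carrier (on_obj ?D V)"
 obtain y where y: "y:carrier (Gams l V)" "std_epi R l V y = w" using std_epi_surj[OF V w] by blast
 show "rep_comp R ?D \<theta> \<theta>' V w = rep_id R ?D V w"
 unfolding rep_comp_apply[OF V w] using t(2) t'(2) V y w by (auto simp: rep_id_def)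
 qed
 ultimately have iso: "rep_iso R ?d ?W ?D \<theta>" unfolding rep_iso_def using W D t(1) t'(1) by blast
 have "rep_comp R ?G \<theta> (weyl_epi R l) = std_epi R l"
 proof (rule nat_trans_eqI[OF nat_trans_comp[OF G weyl_epi[OF l] t(1)] std_epi])
 fix V :: "('a, 'u) module" and y assume V: "V:fgp" and y: "y:carrier (Gams l V)"
 show "rep_comp R ?G \<theta> (weyl_epi R l) V y = std_epi R l V y" unfolding rep_comp_apply[OF V y] using t(2) V y by blast
 qed
 thus ?thesis using iso by blast
qed

lemma mod_span_singleton:
 assumes M: "module R M" and w: "w:carrier M" and x: "x:mod_span R M {w}"
 shows "EX c:carrier R. x = c *[M] w"
proof -
 interpret M: module R M by (rule M)
 have l: "lin R (ring_as_mod R) M (%c. c *[M] w)"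
 by (rule linI) (simp_all add: w M.smult_l_distr M.smult_assoc1)
 have "mod_span R M {w}<=(%c. c *[M] w) ` carrier (ring_as_mod R)"
 by (rule mod_span_least[OF submodule_image[OF module_ring M l]])
 (use M.smult_one[OF w] in "auto intro!: image_eqI[where x = \<one>]")
 thus ?thesis using x by auto
qed

text \<open>The generator of \<open>\<Gamma>\<^sup>\<lambda>\<close> maps to the product of the standard wedges \<open>x\<^sub>0 \<and> x\<^sub>1 \<and> \<dots>\<close>; these span the
 vectors of weight \<open>\<lambda>\<close>.\<close>

lemma weyl_gen:
 fixes F :: "('a, 'u) module"
 assumes l: "sorted_wrt (>=) l" and F: "F:fgp" and D: "free_dual F {..<length l} b \<zeta>"
 shows "EX \<delta>. lin R (Exts (conj_part l) F) (ring_as_mod R) \<delta> & \<delta> (weyl_map R l F (gen l F b)) = \<one>"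
 and "I:Idx (sum_list l) {..<length l} ==> ct (sum_list l) I = ctl l ==>
 ext_proj R (conj_part l) F (tb (sum_list l) F b I):mod_span R (Exts (conj_part l) F) {weyl_map R l F (gen l F b)}"
proof -
 let ?c = "conj_part l" and ?d = "sum_list l" and ?K = "colread l (Ist l)"
 note MF = fgp_module[OF F] and p = weyl_perm_permutes[OF l]
 have DB: "dual_basis F {..<length l} b \<zeta>" using D by (simp add: free_dual_def)
 note bm = dual_basis_mem[OF DB]
 have w: "weyl_map R l F (gen l F b) = ext_proj R ?c F (tb ?d F b ?K)"
 unfolding weyl_map_eq div_incl_gen(2)[OF F D] tperm_tb[OF MF bm Ist p] ..
 have K: "?K:Idx ?d {..<length l}" by (rule idx_perm[OF p Ist])
 have bK: "blk ?c ?K j = (tup (?c ! j) (%i. i))" if j: "j < length ?c" for j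
 unfolding blk_colread[OF l j]
 proof (rule restrict_ext)
 fix i assume "i:{..<?c ! j}"
 thus "Ist l (pos l i j) = i" using conj_iff[OF l, of j i] j by (simp add: glue_pos)
 qed
 have "inj_on (blk ?c ?K j) {..<?c ! j}" if j: "j < length ?c" for j unfolding bK[OF j] by (simp add: inj_on_def)
 from Exts_functional[OF MF D, of ?K ?c, unfolded sum_conj[OF l], OF K this]
 show "EX \<delta>. lin R (Exts ?c F) (ring_as_mod R) \<delta> & \<delta> (weyl_map R l F (gen l F b)) = \<one>" unfolding w by blast
 assume I: "I:Idx ?d {..<length l}" and cI: "ct ?d I = ctl l"
 have tI: "(tup ?d (%r. b (I r))):tensor_base ?d (%_. F)" "(tup ?d (%r. b (?K r))):tensor_base ?d (%_. F)"
 by (rule tb_closed(1)[OF MF bm I], rule tb_closed(1)[OF MF bm K])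
 show "ext_proj R ?c F (tb ?d F b I):mod_span R (Exts ?c F) {weyl_map R l F (gen l F b)}"
 proof (cases "ALL j<length ?c. inj_on (%i. I (pos ?c j i)) {..<?c ! j}")
 case True
 show ?thesis unfolding w
 proof (rule ext_proj_perm_span[of _ _ ?c, unfolded sum_conj[OF l], OF MF tI(2) tI(1)])
 fix j assume j: "j < length ?c"
 obtain \<tau> where t: "\<tau> permutes {..<?c ! j}" "blk ?c I j = (tup (?c ! j) (%i. \<tau> i))"
 using columns_extremal[OF l cI _ j] True by blast
 have bb: "blk ?c (tup ?d (%r. b (J r))) j = (tup (?c ! j) (%i. b (blk ?c J j i)))" for J
 using blk_restrict_comp[OF j, of b J] unfolding sum_conj[OF l] .
 have "blk ?c (tup ?d (%r. b (I r))) j = (tup (?c ! j) (%r. blk ?c (tup ?d (%r. b (?K r))) j (\<tau> r)))"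
 unfolding bb[of I] bb[of ?K] t(2) bK[OF j] by (rule restrict_ext) (use permutes_less[OF t(1)] in simp)
 thus "EX \<sigma>. \<sigma> permutes {..<?c ! j} &
 blk ?c (tup ?d (%r. b (I r))) j = (tup (?c ! j) (%r. blk ?c (tup ?d (%r. b (?K r))) j (\<sigma> r)))"
 using t(1) by blast
 qed
 next
 case False
 then obtain j i i' where j: "j < length ?c" and i: "i < ?c ! j" "i' < ?c ! j" "i ~= i'" "I (pos ?c j i) = I (pos ?c j i')"
 unfolding inj_on_def by blast
 have "ext_proj R ?c F (tb ?d F b I) = \<zero>[Exts ?c F]"
 by (rule ext_proj_repeat[of _ _ ?c, unfolded sum_conj[OF l], OF MF tI(1) j i(1,2,3)])
 (use i(4) pos_less[OF j i(1)] pos_less[OF j i(2)] in "simp add: sum_conj[OF l]")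
 moreover have "submodule (mod_span R (Exts ?c F) {weyl_map R l F (gen l F b)}) R (Exts ?c F)"
 by (rule submodule_mod_span[OF module_Exts[OF MF]])
 (use lin_closed[OF weyl_map_lin[OF l F] div_incl_gen(1)[OF F D]] in simp)
 ultimately show ?thesis using submoduleD(2)[OF _ module_Exts[OF MF]] by simp
 qed
qed

text \<open>Hence a morphism \<open>\<Gamma>\<^sup>\<lambda> \<rightarrow> \<Delta>(\<lambda>)\<close> is a multiple of the canonical one, and the multiple is unique.\<close>

lemma hom_to_std:
 fixes \<eta> :: "('a, 'u) module => ('a, ('a, 'u) tensor) tensor => ('a, ('a, 'u) tensor) tensor set"
 assumes l: "sorted_wrt (>=) l"
 and U: "!!n::nat. EX F b \<zeta>. (F :: ('a, 'u) module):fgp & free_dual F {..<n} b \<zeta>"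
 and e: "\<eta>:nat_trans R (sum_list l) (div_powers R l) (std_obj R l)"
 shows "EX c:carrier R. \<eta> = c *[rep_hom R (sum_list l) (div_powers R l) (std_obj R l)] std_epi R l"
proof -
 let ?d = "sum_list l" and ?c = "conj_part l" and ?G = "div_powers R l :: ('a, 'u, ('a, ('a, 'u) tensor) tensor) sp_functor"
 let ?D = "std_obj R l :: ('a, 'u, ('a, ('a, 'u) tensor) tensor set) sp_functor"
 obtain F :: "('a, 'u) module" and b \<zeta> where F: "F:fgp" and D: "free_dual F {..<length l} b \<zeta>" using U by blast
 note MF = fgp_module[OF F]
 interpret GF: module R "Gams l F" by (rule module_Gams[OF F])
 interpret DF: module R "on_obj ?D F" by (rule rep_module[OF is_rep_std_obj F])
 interpret EF: module R "Exts ?c F" by (rule module_Exts[OF MF])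
 note wl = weyl_map_lin[OF l F] and sl = nat_trans_lin[OF std_epi F]
 let ?e = "gen l F b" note g = div_incl_gen(1)[OF F D]
 obtain y where y: "y:carrier (Gams l F)" "std_epi R l F y = \<eta> F ?e"
 using std_epi_surj[OF F nat_trans_closed[OF e F g]] by blast
 have eq: "weyl_map R l F u = weyl_map R l F v \<longleftrightarrow> std_epi R l F u = std_epi R l F v"
 if u: "u:carrier (Gams l F)" and v: "v:carrier (Gams l F)" for u v
 proof -
 have uv: "u \<ominus>\<^bsub>Gams l F\<^esub> v:carrier (Gams l F)" by (rule GF.minus_closed[OF u v])
 have "weyl_map R l F (u \<ominus>\<^bsub>Gams l F\<^esub> v) = \<zero>[Exts ?c F] \<longleftrightarrow> std_epi R l F (u \<ominus>\<^bsub>Gams l F\<^esub> v) = \<zero>[on_obj ?D F]"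
 unfolding weyl_kernel[OF l U F uv] std_epi_zero_iff[OF F uv] ..
 thus ?thesis
 unfolding lin_minus[OF GF.module_axioms EF.module_axioms wl u v] lin_minus[OF GF.module_axioms DF.module_axioms sl u v]
 EF.minus_zero_iff[OF lin_closed[OF wl u] lin_closed[OF wl v]] DF.minus_zero_iff[OF lin_closed[OF sl u] lin_closed[OF sl v]] .
 qed
 have "weyl_map R l F y:mod_span R (Exts ?c F) {weyl_map R l F ?e}"
 proof (rule weight_span[OF F D sum_conj[OF l, symmetric] lin_closed[OF wl y(1)]])
 fix \<phi> assume f: "\<phi>:Homs (sum_list ?c) F F" and fe: "on_mor ?G F F \<phi> ?e = ?e"
 have f': "\<phi>:Homs ?d F F" using f unfolding sum_conj[OF l] .
 have fy: "on_mor ?G F F \<phi> y:carrier (Gams l F)" by (rule rep_mor_closed[OF is_rep_Gams F F f' y(1)])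
 have "std_epi R l F (on_mor ?G F F \<phi> y) = on_mor ?D F F \<phi> (\<eta> F ?e)"
 unfolding nat_transD(2)[OF std_epi F F f' y(1)] y(2) ..
 also have "... = std_epi R l F y" unfolding nat_transD(2)[OF e F F f' g, symmetric] fe y(2) ..
 finally show "on_mor (ext_powers R ?c) F F \<phi> (weyl_map R l F y) = weyl_map R l F y"
 unfolding weyl_map_nat[OF l F F f' y(1), symmetric] eq[OF fy y(1)] .
 next
 show "submodule (mod_span R (Exts ?c F) {weyl_map R l F ?e}) R (Exts ?c F)"
 by (rule submodule_mod_span[OF EF.module_axioms]) (use lin_closed[OF wl g] in simp)
 qed (unfold sum_conj[OF l], rule weyl_gen(2)[OF l F D])
 then obtain c where c: "c:carrier R" "weyl_map R l F y = c *[Exts ?c F] weyl_map R l F ?e"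
 using mod_span_singleton[OF EF.module_axioms lin_closed[OF wl g]] by blast
 have "std_epi R l F y = std_epi R l F (c *[Gams l F] ?e)"
 using c(2) unfolding lin_smult[OF wl c(1) g, symmetric] eq[OF y(1) GF.smult_closed[OF c(1) g]] .
 hence ye: "\<eta> F ?e = c *[on_obj ?D F] std_epi R l F ?e" unfolding y(2) lin_smult[OF sl c(1) g] .
 let ?s = "c *[rep_hom R ?d ?G ?D] std_epi R l"
 have s: "?s:nat_trans R ?d ?G ?D" by (rule rep_hom_ops(2)[OF is_rep_Gams is_rep_std_obj std_epi c(1)])
 have "\<eta> F ?e = ?s F ?e" unfolding ye using F g by (simp add: rep_hom_def)
 note eqs = nat_trans_gen_eqI[OF F D e s this]
 have "\<eta> = ?s" by (rule nat_trans_eqI[OF e s]) (rule eqs)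
 thus ?thesis using c(1) by blast
qed

lemma hom_to_std_unique:
 assumes l: "sorted_wrt (>=) l"
 and U: "!!n::nat. EX F b \<zeta>. (F :: ('a, 'u) module):fgp & free_dual F {..<n} b \<zeta>"
 and c: "c:carrier R" "c':carrier R"
 and eq: "!!(V :: ('a, 'u) module) y. V:fgp ==> y:carrier (Gams l V) ==>
 c *[on_obj (std_obj R l) V] std_epi R l V y = c' *[on_obj (std_obj R l) V] std_epi R l V y"
 shows "c = c'"
proof -
 obtain F :: "('a, 'u) module" and b \<zeta> where F: "F:fgp" and D: "free_dual F {..<length l} b \<zeta>" using U by blast
 note MF = fgp_module[OF F]
 interpret GF: module R "Gams l F" by (rule module_Gams[OF F])
 interpret DF: module R "on_obj (std_obj R l) F" by (rule rep_module[OF is_rep_std_obj F])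
 note wl = weyl_map_lin[OF l F] and sl = nat_trans_lin[OF std_epi F]
 let ?e = "gen l F b" note g = div_incl_gen(1)[OF F D]
 let ?u = "(c \<ominus> c') *[Gams l F] ?e"
 have cc: "c \<ominus> c':carrier R" using c by simp
 have u: "?u:carrier (Gams l F)" by (rule GF.smult_closed[OF cc g])
 have sg: "std_epi R l F ?e:carrier (on_obj (std_obj R l) F)" by (rule lin_closed[OF sl g])
 have "std_epi R l F ?u = \<zero>[on_obj (std_obj R l) F]"
 unfolding lin_smult[OF sl cc g] using eq[OF F g] c sg
 by (simp add: minus_eq DF.smult_l_distr DF.smult_l_minus DF.r_neg)
 hence "weyl_map R l F ?u = \<zero>[Exts (conj_part l) F]"
 unfolding std_epi_zero_iff[OF F u] weyl_kernel[OF l U F u] .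
 moreover obtain \<delta> where d: "lin R (Exts (conj_part l) F) (ring_as_mod R) \<delta>" "\<delta> (weyl_map R l F ?e) = \<one>"
 using weyl_gen(1)[OF l F D] by blast
 ultimately have "\<delta> ((c \<ominus> c') *[Exts (conj_part l) F] weyl_map R l F ?e) = \<zero>"
 unfolding lin_smult[OF wl cc g] using lin_zero[OF module_Exts[OF MF] module_ring d(1)] by simp
 hence "c \<ominus> c' = \<zero>" unfolding lin_smult[OF d(1) cc lin_closed[OF wl g]] using d(2) cc by simp
 thus "c = c'" using minus_zero_iff[OF c] by blast
qed

lemma restrict_mod_hom:
 assumes "!!x. x:carrier M ==> f x:carrier N"
 and "!!x y. x:carrier M ==> y:carrier M ==> x +[M] y:carrier M"
 and "!!c x. c:carrier R ==> x:carrier M ==> c *[M] x:carrier M"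
 and "!!x y. x:carrier M ==> y:carrier M ==> f (x +[M] y) = f x +[N] f y"
 and "!!c x. c:carrier R ==> x:carrier M ==> f (c *[M] x) = c *[N] f x"
 shows "restrict f (carrier M):mod_hom R M N"
 unfolding mod_hom_iff by (intro conjI linI) (simp_all add: assms)

text \<open>A module that is free of rank one on \<open>e\<close>.\<close>

lemma rank_one_iso:
 assumes smc: "!!c. c:carrier R ==> c *[M] e:carrier M"
 and ex: "!!x. x:carrier M ==> EX c:carrier R. x = c *[M] e"
 and uniq: "!!c c'. c:carrier R ==> c':carrier R ==> c *[M] e = c' *[M] e ==> c = c'"
 and add: "!!c c'. c:carrier R ==> c':carrier R ==> (c \<oplus> c') *[M] e = c *[M] e +[M] c' *[M] e"
 and mult: "!!c c'. c:carrier R ==> c':carrier R ==> (c\<otimes>c') *[M] e = c *[M] (c' *[M] e)"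
 and one: "\<one> *[M] e = e"
 shows "EX \<psi>:mod_iso R M (ring_as_mod R). \<psi> e = \<one>"
proof -
 define f where "f x = (THE c. c:carrier R & x = c *[M] e)" for x
 have f: "f (c *[M] e) = c" if c: "c:carrier R" for c
 unfolding f_def by (rule the_equality) (use c uniq in auto)
 have hom: "restrict f (carrier M):mod_hom R M (ring_as_mod R)"
 proof (rule restrict_mod_hom)
 fix x assume "x:carrier M"
 then obtain c where c: "c:carrier R" "x = c *[M] e" using ex by blast
 show "f x:carrier (ring_as_mod R)" unfolding c(2) f[OF c(1)] using c(1) by simp
 fix k assume k: "k:carrier R"
 have kx: "k *[M] x = (k\<otimes>c) *[M] e" unfolding c(2) mult[OF k c(1)] ..
 show "k *[M] x:carrier M" unfolding kx by (rule smc[OF m_closed[OF k c(1)]])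
 show "f (k *[M] x) = k *[ring_as_mod R] f x"
 unfolding kx f[OF m_closed[OF k c(1)]] unfolding c(2) f[OF c(1)] by simp
 next
 fix x y assume "x:carrier M" "y:carrier M"
 then obtain c c' where c: "c:carrier R" "x = c *[M] e" "c':carrier R" "y = c' *[M] e" using ex by metis
 have xy: "x +[M] y = (c \<oplus> c') *[M] e" unfolding c(2,4) add[OF c(1,3)] ..
 show "x +[M] y:carrier M" unfolding xy by (rule smc[OF a_closed[OF c(1,3)]])
 show "f (x +[M] y) = f x +[ring_as_mod R] f y"
 unfolding xy f[OF a_closed[OF c(1,3)]] unfolding c(2,4) f[OF c(1)] f[OF c(3)] by simp
 qed
 have "bij_betw (restrict f (carrier M)) (carrier M) (carrier (ring_as_mod R))"
 proof (rule bij_betw_byWitness[where f' = "%c. c *[M] e"])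
 show "ALL x:carrier M. restrict f (carrier M) x *[M] e = x"
 proof
 fix x assume x: "x:carrier M"
 then obtain c where c: "c:carrier R" "x = c *[M] e" using ex by blast
 show "restrict f (carrier M) x *[M] e = x" unfolding restrict_apply'[OF x] unfolding c(2) f[OF c(1)] ..
 qed
 show "ALL c:carrier (ring_as_mod R). restrict f (carrier M) (c *[M] e) = c" using f smc by simp
 show "restrict f (carrier M) ` carrier M<=carrier (ring_as_mod R)"
 using lin_closed[OF mod_hom_lin[OF hom]] by blast
 show "(%c. c *[M] e) ` carrier (ring_as_mod R)<=carrier M" using smc by auto
 qed
 moreover have "restrict f (carrier M) e = \<one>" using f[OF one_closed] smc[OF one_closed] unfolding one by simp
 ultimately show ?thesis unfolding mod_iso_def using hom by blast
qed

lemma rep_hom_apply: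
 "V:fgp ==> x:carrier (on_obj X V) ==> (\<eta> +[rep_hom R d X Y] \<theta>) V x = \<eta> V x +[on_obj Y V] \<theta> V x"
 "V:fgp ==> x:carrier (on_obj X V) ==> (c *[rep_hom R d X Y] \<eta>) V x = c *[on_obj Y V] \<eta> V x"
 by (simp_all add: rep_hom_def)

lemma rep_hom_carrier: "carrier (rep_hom R d X Y) = nat_trans R d X Y"
 by (simp add: rep_hom_def)

lemma hom_std_iso:
 fixes l :: "nat list"
 assumes l: "sorted_wrt (>=) l"
 and U: "!!n::nat. EX F b \<zeta>. (F :: ('a, 'u) module):fgp & free_dual F {..<n} b \<zeta>"
 defines "\<Gamma> \<equiv> div_powers R l :: ('a, 'u, ('a, ('a, 'u) tensor) tensor) sp_functor"
 and "\<Delta> \<equiv> std_obj R l :: ('a, 'u, ('a, ('a, 'u) tensor) tensor set) sp_functor"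
 shows "(\<lambda>\<eta>\<in>carrier (rep_hom R (sum_list l) \<Delta> \<Delta>). rep_comp R \<Gamma> \<eta> (std_epi R l))
:mod_iso R (rep_hom R (sum_list l) \<Delta> \<Delta>) (rep_hom R (sum_list l) \<Gamma> \<Delta>)"
 and "EX \<psi>:mod_iso R (rep_hom R (sum_list l) \<Gamma> \<Delta>) (ring_as_mod R). \<psi> (std_epi R l) = \<one>"
proof -
 let ?d = "sum_list l"
 let ?M = "rep_hom R ?d \<Delta> \<Delta>" and ?N = "rep_hom R ?d \<Gamma> \<Delta>" and ?p = "std_epi R l :: ('a, 'u) module => _"
 have G: "is_rep R ?d \<Gamma>" and D: "is_rep R ?d \<Delta>" unfolding \<Gamma>_def \<Delta>_def by (rule is_rep_Gams is_rep_std_obj)+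
 have p: "?p:nat_trans R ?d \<Gamma> \<Delta>" unfolding \<Gamma>_def \<Delta>_def by (rule std_epi)
 have surj: "EX y:carrier (on_obj \<Gamma> V). ?p V y = w" if "V:fgp" "w:carrier (on_obj \<Delta> V)" for V w
 using std_epi_surj[OF that(1)] that(2) unfolding \<Gamma>_def \<Delta>_def by blast
 have mult: "EX c:carrier R. \<eta> = c *[?N] ?p" if "\<eta>:nat_trans R ?d \<Gamma> \<Delta>" for \<eta>
 using hom_to_std[OF l U] that unfolding \<Gamma>_def \<Delta>_def by blast
 note MN = rep_hom_carrier[of ?d]
 let ?T = "%\<eta>. rep_comp R \<Gamma> \<eta> ?p"
 have Tc: "?T \<eta>:nat_trans R ?d \<Gamma> \<Delta>" if "\<eta>:nat_trans R ?d \<Delta> \<Delta>" for \<eta> by (rule nat_trans_comp[OF G p that])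
 have hom: "restrict ?T (carrier ?M):mod_hom R ?M ?N"
 proof (rule restrict_mod_hom, unfold MN)
 fix \<eta> assume e: "\<eta>:nat_trans R ?d \<Delta> \<Delta>"
 show "?T \<eta>:nat_trans R ?d \<Gamma> \<Delta>" by (rule Tc[OF e])
 fix c assume c: "c:carrier R"
 show ce: "c *[?M] \<eta>:nat_trans R ?d \<Delta> \<Delta>" by (rule rep_hom_ops(2)[OF D D e c])
 show "?T (c *[?M] \<eta>) = c *[?N] ?T \<eta>"
 proof (rule nat_trans_eqI[OF Tc[OF ce] rep_hom_ops(2)[OF G D Tc[OF e] c]])
 fix V x assume a: "V:fgp" "x:carrier (on_obj \<Gamma> V)"
 show "?T (c *[?M] \<eta>) V x = (c *[?N] ?T \<eta>) V x"
 unfolding rep_hom_apply(2)[OF a] rep_comp_apply[OF a] by (rule rep_hom_apply(2)[OF a(1) nat_trans_closed[OF p a]])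
 qed
 next
 fix \<eta> \<theta> assume e: "\<eta>:nat_trans R ?d \<Delta> \<Delta>" and t: "\<theta>:nat_trans R ?d \<Delta> \<Delta>"
 show et: "\<eta> +[?M] \<theta>:nat_trans R ?d \<Delta> \<Delta>" by (rule rep_hom_ops(1)[OF D D e t])
 show "?T (\<eta> +[?M] \<theta>) = ?T \<eta> +[?N] ?T \<theta>"
 proof (rule nat_trans_eqI[OF Tc[OF et] rep_hom_ops(1)[OF G D Tc[OF e] Tc[OF t]]])
 fix V x assume a: "V:fgp" "x:carrier (on_obj \<Gamma> V)"
 show "?T (\<eta> +[?M] \<theta>) V x = (?T \<eta> +[?N] ?T \<theta>) V x"
 unfolding rep_hom_apply(1)[OF a] rep_comp_apply[OF a] by (rule rep_hom_apply(1)[OF a(1) nat_trans_closed[OF p a]])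
 qed
 qed
 have inj: "inj_on ?T (nat_trans R ?d \<Delta> \<Delta>)"
 proof (rule inj_onI)
 fix \<eta> \<theta> assume e: "\<eta>:nat_trans R ?d \<Delta> \<Delta>" and t: "\<theta>:nat_trans R ?d \<Delta> \<Delta>" and eq: "?T \<eta> = ?T \<theta>"
 show "\<eta> = \<theta>"
 proof (rule nat_trans_eqI[OF e t])
 fix V w assume V: "V:fgp" and "w:carrier (on_obj \<Delta> V)"
 then obtain y where y: "y:carrier (on_obj \<Gamma> V)" "?p V y = w" using surj by blast
 have "?T \<eta> V y = ?T \<theta> V y" by (simp only: eq)
 thus "\<eta> V w = \<theta> V w" unfolding rep_comp_apply[OF V y(1)] y(2) .
 qed
 qed
 have "?T ` nat_trans R ?d \<Delta> \<Delta> = nat_trans R ?d \<Gamma> \<Delta>"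
 proof (intro equalityI subsetI)
 fix \<eta> assume e: "\<eta>:nat_trans R ?d \<Gamma> \<Delta>"
 obtain c where c: "c:carrier R" "\<eta> = c *[?N] ?p" using mult[OF e] by blast
 have ci: "c *[?M] rep_id R \<Delta>:nat_trans R ?d \<Delta> \<Delta>" by (rule rep_hom_ops(2)[OF D D nat_trans_id[OF D] c(1)])
 have "?T (c *[?M] rep_id R \<Delta>) = \<eta>"
 proof (rule nat_trans_eqI[OF Tc[OF ci] e])
 fix V x assume a: "V:fgp" "x:carrier (on_obj \<Gamma> V)"
 note px = nat_trans_closed[OF p a]
 show "?T (c *[?M] rep_id R \<Delta>) V x = \<eta> V x"
 unfolding c(2) rep_hom_apply(2)[OF a] rep_comp_apply[OF a] rep_hom_apply(2)[OF a(1) px]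
 using a(1) px by (simp add: rep_id_def)
 qed
 thus "\<eta>:?T ` nat_trans R ?d \<Delta> \<Delta>" using ci by blast
 qed (use Tc in blast)
 hence "bij_betw (restrict ?T (carrier ?M)) (carrier ?M) (carrier ?N)"
 unfolding MN bij_betw_def using inj by (simp add: inj_on_restrict_eq image_restrict_eq)
 thus "(\<lambda>\<eta>\<in>carrier ?M. ?T \<eta>):mod_iso R ?M ?N" unfolding mod_iso_def using hom by blast
 show "EX \<psi>:mod_iso R ?N (ring_as_mod R). \<psi> ?p = \<one>"
 proof (rule rank_one_iso, unfold MN)
 note pm = rep_hom_ops(2)[OF G D p]
 show "c *[?N] ?p:nat_trans R ?d \<Gamma> \<Delta>" if "c:carrier R" for c by (rule pm[OF that])
 show "EX c:carrier R. \<eta> = c *[?N] ?p" if "\<eta>:nat_trans R ?d \<Gamma> \<Delta>" for \<eta> by (rule mult[OF that])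
 show "c = c'" if c: "c:carrier R" "c':carrier R" and eq: "c *[?N] ?p = c' *[?N] ?p" for c c'
 proof (rule hom_to_std_unique[OF l U c])
 fix V :: "('a, 'u) module" and y assume V: "V:fgp" and y: "y:carrier (Gams l V)"
 have "(c *[?N] ?p) V y = (c' *[?N] ?p) V y" by (simp only: eq)
 thus "c *[on_obj (std_obj R l) V] ?p V y = c' *[on_obj (std_obj R l) V] ?p V y"
 unfolding \<Gamma>_def \<Delta>_def rep_hom_apply(2)[OF V y] .
 qed
 show "(c \<oplus> c') *[?N] ?p = c *[?N] ?p +[?N] c' *[?N] ?p" if c: "c:carrier R" "c':carrier R" for c c'
 proof (rule nat_trans_eqI[OF pm[OF a_closed[OF c]] rep_hom_ops(1)[OF G D pm[OF c(1)] pm[OF c(2)]]])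
 fix V x assume a: "V:fgp" "x:carrier (on_obj \<Gamma> V)"
 interpret DV: module R "on_obj \<Delta> V" by (rule rep_module[OF D a(1)])
 show "((c \<oplus> c') *[?N] ?p) V x = (c *[?N] ?p +[?N] c' *[?N] ?p) V x"
 unfolding rep_hom_apply[OF a] by (rule DV.smult_l_distr[OF c nat_trans_closed[OF p a]])
 qed
 show "(c\<otimes>c') *[?N] ?p = c *[?N] (c' *[?N] ?p)" if c: "c:carrier R" "c':carrier R" for c c'
 proof (rule nat_trans_eqI[OF pm[OF m_closed[OF c]] rep_hom_ops(2)[OF G D pm[OF c(2)] c(1)]])
 fix V x assume a: "V:fgp" "x:carrier (on_obj \<Gamma> V)"
 interpret DV: module R "on_obj \<Delta> V" by (rule rep_module[OF D a(1)])
 show "((c\<otimes>c') *[?N] ?p) V x = (c *[?N] (c' *[?N] ?p)) V x"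
 unfolding rep_hom_apply[OF a] by (rule DV.smult_assoc1[OF c nat_trans_closed[OF p a]])
 qed
 show "\<one> *[?N] ?p = ?p"
 proof (rule nat_trans_eqI[OF pm[OF one_closed] p])
 fix V x assume a: "V:fgp" "x:carrier (on_obj \<Gamma> V)"
 interpret DV: module R "on_obj \<Delta> V" by (rule rep_module[OF D a(1)])
 show "(\<one> *[?N] ?p) V x = ?p V x"
 unfolding rep_hom_apply[OF a] by (rule DV.smult_one[OF nat_trans_closed[OF p a]])
 qed
 qed
qed

end

theorem theorem5p8:
  fixes R :: "('a, 'm) ring_scheme" and d :: nat and lam :: "nat list"
  assumes "cring R"
    and universe: "\<And>n::nat. \<exists>f :: (nat \<Rightarrow> 'a) \<Rightarrow> 'u. inj_on f (carrier (free_mod R {..<n}))"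
    and "d > 0" and "is_partition d lam"
  shows "let \<Gamma> = (div_powers R lam :: ('a, 'u, ('a, ('a, 'u) tensor) tensor) sp_functor);
             W = (weyl R lam :: ('a, 'u, ('a, ('a, 'u) tensor set) tensor) sp_functor);
             \<Delta> = (std_obj R lam :: ('a, 'u, ('a, ('a, 'u) tensor) tensor set) sp_functor)
         in (\<exists>\<theta>. rep_iso R d W \<Delta> \<theta> \<and> rep_comp R \<Gamma> \<theta> (weyl_epi R lam) = std_epi R lam) \<and>
            (\<lambda>\<eta>\<in>carrier (rep_hom R d \<Delta> \<Delta>). rep_comp R \<Gamma> \<eta> (std_epi R lam))
              \<in> mod_iso R (rep_hom R d \<Delta> \<Delta>) (rep_hom R d \<Gamma> \<Delta>) \<and>
            (\<exists>\<psi>\<in>mod_iso R (rep_hom R d \<Gamma> \<Delta>) (ring_as_mod R). \<psi> (std_epi R lam) = \<one>\<^bsub>R\<^esub>)"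
proof -
  interpret cring R by fact
  have l: "sorted_wrt (\<ge>) lam" and d: "d = sum_list lam" using assms(4) by (simp_all add: is_partition_def)
  have U: "\<exists>F b \<zeta>. (F :: ('a, 'u) module) \<in> fg_proj_mods R \<and> free_dual F {..<n} b \<zeta>" for n :: nat
  proof -
    obtain f :: "(nat \<Rightarrow> 'a) \<Rightarrow> 'u" where "inj_on f (carrier (free_mod R {..<n}))" using universe by blast
    from free_object_exists[OF this] show ?thesis by metis
  qed
  show ?thesis unfolding Let_def d by (intro conjI weyl_iso_std[OF l U] hom_std_iso[OF l U])
qed

end
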